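(* Let $b$ be a prime, let $m,s,\alpha,d\in\mathbb{N}$ with $\alpha\ge2$, let $N=b^m$, and consider product weights $\gamma_u=\prod_{j\in u}\gamma_j$ for all $u\subseteq I_s=\{1,\ldots,s\}$, with non-negative $\gamma_1,\ldots,\gamma_s$. Then the fast component-by-component construction using the fast Fourier transform (described in the context), which carries out the component-by-component algorithm for finding polynomials $p$ and $\boldsymbol{q}=(q_1,\ldots,q_{ds})$, requires in total a construction cost of $O(dsmb^m)=O(dsN\log N)$ operations using $O(b^m)=O(N)$ memory.
   Context: Notation: $\mathbb{N}=\{1,2,\ldots\}$, $\mathbb{N}_0=\mathbb{N}\cup\{0\}$, $I_n=\{1,\ldots,n\}$, $\mathbb{F}_b=\{0,\ldots,b-1\}$ the field with $b$ elements, $R_{b,m}=\{q\in\mathbb{F}_b[x]:\deg(q)<m,\ q\ne0\}$. A non-negative integer $n=\nu_0+\nu_1b+\cdots$ is identified with the polynomial $n(x)=\nu_0+\nu_1x+\cdots$. The map $v_m$ sends a formal Laurent series $\sum_{l\ge w}t_lx^{-l}$ over $\mathbb{F}_b$ to $\sum_{l=\max(1,w)}^{m}t_lb^{-l}\in[0,1)$. Dual net: for $k=\kappa_0+\kappa_1b+\cdots\in\mathbb{N}_0$ let $\mathrm{tr}_m(k)(x)=\kappa_0+\kappa_1x+\cdots+\kappa_{m-1}x^{m-1}$; for $\boldsymbol{q}_r=(q_1,\ldots,q_r)\in(\mathbb{F}_b[x])^r$, $D^{\perp}(\boldsymbol{q}_r,p)=\{\boldsymbol{k}\in\mathbb{N}_0^r:\sum_{j=1}^{r}\mathrm{tr}_m(k_j)q_j\equiv0\pmod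 p\}$. Criterion: for $1\le r\le ds$, $$B_{\alpha,d,\boldsymbol{\gamma}}(\boldsymbol{q}_r,p)=\sum_{\emptyset\ne w\subseteq I_r}\gamma_{\phi(w)}\tilde{D}_{\alpha,b,d}^{|\phi(w)|}\sum_{\substack{\boldsymbol{l}_w\in\mathbb{N}^{|w|}\\(\boldsymbol{l}_w,\boldsymbol{0})\in D^{\perp}(\boldsymbol{q}_r,p)}}\ \prod_{j\in w}r_{\alpha,d}(l_j),$$ where $(\boldsymbol{l}_w,\boldsymbol{0})$ is the $r$-dimensional vector with $j$-th component $l_j$ if $j\in w$ and $0$ otherwise; $\phi(w)=\{1\le j\le s:w\cap\{d(j-1)+1,\ldots,dj\}\ne\emptyset\}$; $r_{\alpha,d}(l)=b^{-2\min(\alpha,d)\mu_1(l)-\alpha}$ for $l\ge1$, with $\mu_1(l)=a$ if $b^{a-1}\le l<b^a$. Constants: $\tilde{D}_{\alpha,b,d}=b^{(2d-1)\alpha}D_{\alpha,b}$, $D_{\alpha,b}=\max_{1\le\nu\le\alpha}\big(C'_{\alpha,b,\nu}+\tilde{C}_{2\alpha,b}b^{-2(\alpha-\nu)}\big)$, $C'_{\alpha,b,\nu}=\sum_{\tau=\nu}^{\alpha}C_{\tau,b}^2b^{-2(\tau-\nu)}$, $C_{1,b}=(2\sin(\pi/b))^{-1}$, $C_{\tau,b}=(1+1/b+1/(b(b+1)))^{\tau-2}/(2\sin(\pi/b))^{\tau}$ for $\tau\ge2$, $\tilde{C}_{2\alpha,b}=2(1+1/b+1/(b(b+1)))^{2\alpha-2}/(2\sin(\pi/b))^{2\alpha}$.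 Component-by-component algorithm: (1) choose an irreducible polynomial $p\in\mathbb{F}_b[x]$ with $\deg(p)=m$; (2) set $q_1=1$; (3) for $r=2,\ldots,ds$, with $\boldsymbol{q}_{r-1}=(q_1,\ldots,q_{r-1})$ already found, let $q_r$ be a minimizer of $q_r^*\mapsto B_{\alpha,d,\boldsymbol{\gamma}}((\boldsymbol{q}_{r-1},q_r^* ),p)$ over $q_r^*\in R_{b,m}$. Fast construction for product weights: for $y\in[0,1)$ let $$\chi_{\alpha,d}(y)=\frac{b-1-b^{(2\min(\alpha,d)-1)\lfloor\log_b y\rfloor}(b^{2\min(\alpha,d)}-1)}{b^{\alpha}(b^{2\min(\alpha,d)}-b)},$$ with $b^{(2\min(\alpha,d)-1)\lfloor\log_b 0\rfloor}:=0$, and let $y_{n,j}=v_m(n(x)q_j(x)/p(x))$ for $0\le n<b^m$. Write $r=d(j_1-1)+d_1$ with $j_1\in\mathbb{N}$, $d_1\in\{1,\ldots,d\}$, and set $\eta^{(1)}_{n,r-1}=\prod_{j=1}^{j_1-1}\big[1-\gamma_j\tilde{D}_{\alpha,b,d}+\gamma_j\tilde{D}_{\alpha,b,d}\prod_{l=1}^{d}(1+\chi_{\alpha,d}(y_{n,d(j-1)+l}))\big]$, $\eta^{(2)}_{n,r-1}=\prod_{l=1}^{d_1-1}(1+\chi_{\alpha,d}(y_{n,d(j_1-1)+l}))$ (empty products equal $1$) and $\eta_{n,r-1}=\eta^{(1)}_{n,r-1}\eta^{(2)}_{n,r-1}$. Step (3) then amounts to minimizing $\sum_{n=1}^{b^m-1}\eta_{n,r-1}\chi_{\alpha,d}(v_m(n(x)q_r^*(x)/p(x)))$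 over $q_r^*\in R_{b,m}$. Since $p$ is irreducible there is a primitive element $g\in R_{b,m}$, i.e. $\{g^0\bmod p,\ldots,g^{b^m-2}\bmod p\}=R_{b,m}$. Writing $q_r^*=g^i\bmod p$ and enumerating the non-zero polynomials $n(x)$ as $g^{-n}\bmod p$, $1\le n<b^m$ (with the entries $\eta_{n,r-1}$ ordered accordingly), the values to be compared are the entries of $\boldsymbol{c}=\Omega_p\boldsymbol{\eta}_{r-1}$, where $\Omega_p=\big[\chi_{\alpha,d}(v_m((g^{i-n}\bmod p)(x)/p(x)))\big]_{1\le i,n<b^m}$ is circulant. This matrix-vector product is computed by the fast Fourier transform; one sets $q_r=g^{i_0}\bmod p$ with $c_{i_0}$ minimal, and then updates $\eta^{(1)}_{n,r-1},\eta^{(2)}_{n,r-1}$ to $\eta^{(1)}_{n,r},\eta^{(2)}_{n,r}$, which are the quantities that need to be stored. *)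

theory Defs
  imports "HOL-Analysis.Analysis"
    "HOL-Computational_Algebra.Formal_Laurent_Series"
    "Berlekamp_Zassenhaus.Finite_Field"
begin

section \<open>Polynomials over the prime field and the dual net\<close>

text \<open>The prime \<open>b\<close> is \<open>CARD('b)\<close> for a type \<open>'b\<close> of class \<^class>\<open>prime_card\<close>, and the field with
  \<open>b\<close> elements is \<open>'b mod_ring\<close>.  All vectors are indexed from 1, as functions on \<^typ>\<open>nat\<close>.\<close>

definition tr :: "nat \<Rightarrow> nat \<Rightarrow> 'b::prime_card mod_ring poly" where
  "tr m k = (\<Sum>i<m. Polynomial.monom (of_nat (k div CARD('b) ^ i mod CARD('b))) i)"

text \<open>Base-\<open>b\<close> digits of \<open>n\<close> at positions \<open>> n\<close> vanish, so this is the full digit expansion.\<close>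

definition nat_poly :: "nat \<Rightarrow> 'b::prime_card mod_ring poly" where
  "nat_poly n = tr (Suc n) n"

definition R_set :: "nat \<Rightarrow> 'b::prime_card mod_ring poly set" where
  "R_set m = {q. Polynomial.degree q < m \<and> q \<noteq> 0}"

definition dual_net ::
    "nat \<Rightarrow> nat \<Rightarrow> (nat \<Rightarrow> 'b::prime_card mod_ring poly) \<Rightarrow> 'b mod_ring poly \<Rightarrow> (nat \<Rightarrow> nat) set" where
  "dual_net m r q p =
     {k. (\<forall>j. j \<notin> {1..r} \<longrightarrow> k j = 0) \<and> [(\<Sum>j=1..r. tr m (k j) * q j) = 0] (mod p)}"

section \<open>The quality criterion\<close>

definition C_const :: "nat \<Rightarrow> nat \<Rightarrow> real" where
  "C_const b \<tau> =
     (if \<tau> = 1 then 1 / (2 * sin (pi / b))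
      else (1 + 1 / b + 1 / (b * (b + 1))) ^ (\<tau> - 2) / (2 * sin (pi / b)) ^ \<tau>)"

definition C_tilde :: "nat \<Rightarrow> nat \<Rightarrow> real" where
  "C_tilde b \<alpha> =
     2 * (1 + 1 / b + 1 / (b * (b + 1))) ^ (2 * \<alpha> - 2) / (2 * sin (pi / b)) ^ (2 * \<alpha>)"

definition C_prime :: "nat \<Rightarrow> nat \<Rightarrow> nat \<Rightarrow> real" where
  "C_prime b \<alpha> \<nu> = (\<Sum>\<tau>=\<nu>..\<alpha>. (C_const b \<tau>)\<^sup>2 / real b ^ (2 * (\<tau> - \<nu>)))"

definition D_const :: "nat \<Rightarrow> nat \<Rightarrow> real" where
  "D_const b \<alpha> =
     Max ((\<lambda>\<nu>. C_prime b \<alpha> \<nu> + C_tilde b \<alpha> / real b ^ (2 * (\<alpha> - \<nu>))) ` {1..\<alpha>})"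

definition D_tilde :: "nat \<Rightarrow> nat \<Rightarrow> nat \<Rightarrow> real" where
  "D_tilde b \<alpha> d = real b ^ ((2 * d - 1) * \<alpha>) * D_const b \<alpha>"

definition mu1 :: "nat \<Rightarrow> nat \<Rightarrow> nat" where
  "mu1 b l = (THE a. 1 \<le> a \<and> b ^ (a - 1) \<le> l \<and> l < b ^ a)"

definition r_coeff :: "nat \<Rightarrow> nat \<Rightarrow> nat \<Rightarrow> nat \<Rightarrow> real" where
  "r_coeff b \<alpha> d l = 1 / real b ^ (2 * min \<alpha> d * mu1 b l + \<alpha>)"

definition phi_set :: "nat \<Rightarrow> nat \<Rightarrow> nat set \<Rightarrow> nat set" where
  "phi_set s d w = {j \<in> {1..s}. w \<inter> {d * (j - 1) + 1..d * j} \<noteq> {}}"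

definition B_crit ::
    "nat \<Rightarrow> nat \<Rightarrow> nat \<Rightarrow> nat \<Rightarrow> (nat set \<Rightarrow> real) \<Rightarrow> nat
      \<Rightarrow> (nat \<Rightarrow> 'b::prime_card mod_ring poly) \<Rightarrow> 'b mod_ring poly \<Rightarrow> real" where
  "B_crit m s \<alpha> d \<gamma> r q p =
     (\<Sum>w \<in> Pow {1..r} - {{}}.
        \<gamma> (phi_set s d w) * D_tilde CARD('b) \<alpha> d ^ card (phi_set s d w) *
        infsum (\<lambda>l. \<Prod>j\<in>w. r_coeff CARD('b) \<alpha> d (l j))
          {l \<in> w \<rightarrow>\<^sub>E {1..}. (\<lambda>j. if j \<in> w then l j else 0) \<in> dual_net m r q p})"

definition product_weights :: "(nat \<Rightarrow> real) \<Rightarrow> nat set \<Rightarrow> real" where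
  "product_weights \<gamma> u = (\<Prod>j\<in>u. \<gamma> j)"

text \<open>The possible results of the component-by-component algorithm (the choice of \<open>p\<close> and of the
  minimizers is free).\<close>

definition cbc_result ::
    "nat \<Rightarrow> nat \<Rightarrow> nat \<Rightarrow> nat \<Rightarrow> (nat set \<Rightarrow> real)
      \<Rightarrow> 'b::prime_card mod_ring poly \<Rightarrow> (nat \<Rightarrow> 'b mod_ring poly) \<Rightarrow> bool" where
  "cbc_result m s \<alpha> d \<gamma> p q \<longleftrightarrow>
     Factorial_Ring.irreducible p \<and> Polynomial.degree p = m \<and> q 1 = 1 \<and>
     (\<forall>r\<in>{2..d * s}.
        is_arg_min (\<lambda>q'. B_crit m s \<alpha> d \<gamma> r (q(r := q')) p) (\<lambda>q'. q' \<in> R_set m) (q r))"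

section \<open>The quantities of the fast construction\<close>

text \<open>Laurent series in \<open>x\<^sup>-\<^sup>1\<close>: the variable \<^const>\<open>fls_X\<close> stands for \<open>1/x\<close>, so the coefficient
  of \<open>x\<^sup>-\<^sup>l\<close> is the \<open>l\<close>-th one.\<close>

definition poly_fls :: "'b::prime_card mod_ring poly \<Rightarrow> 'b mod_ring fls" where
  "poly_fls q = (\<Sum>i\<le>Polynomial.degree q. fls_const (Polynomial.coeff q i) * fls_X_intpow (- int i))"

definition v_map :: "nat \<Rightarrow> 'b::prime_card mod_ring fls \<Rightarrow> real" where
  "v_map m f = (\<Sum>l=1..m. of_int (to_int_mod_ring (fls_nth f (int l))) / real CARD('b) ^ l)"

definition v_quot ::
    "nat \<Rightarrow> 'b::prime_card mod_ring poly \<Rightarrow> 'b mod_ring poly \<Rightarrow> real" where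
  "v_quot m h p = v_map m (poly_fls h / poly_fls p)"

definition chi :: "nat \<Rightarrow> nat \<Rightarrow> nat \<Rightarrow> real \<Rightarrow> real" where
  "chi b \<alpha> d y =
     (real b - 1
       - (if y = 0 then 0 else real b powi ((2 * int (min \<alpha> d) - 1) * \<lfloor>log b y\<rfloor>))
         * (real b ^ (2 * min \<alpha> d) - 1))
     / (real b ^ \<alpha> * (real b ^ (2 * min \<alpha> d) - real b))"

text \<open>\<open>eta m \<alpha> d \<gamma> p q r n\<close> is the entry with index \<open>(n, r - 1)\<close> of the construction, where \<open>n\<close> is
  given as a polynomial.  Here \<open>r = d * (j1 - 1) + d1\<close> with \<open>1 \<le> d1 \<le> d\<close>.\<close>

definition eta ::
    "nat \<Rightarrow> nat \<Rightarrow> nat \<Rightarrow> (nat \<Rightarrow> real) \<Rightarrow> 'b::prime_card mod_ring poly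
      \<Rightarrow> (nat \<Rightarrow> 'b mod_ring poly) \<Rightarrow> nat \<Rightarrow> 'b mod_ring poly \<Rightarrow> real" where
  "eta m \<alpha> d \<gamma> p q r n =
     (let j1 = (r - 1) div d + 1; d1 = (r - 1) mod d + 1; b = CARD('b);
          x = (\<lambda>i. chi b \<alpha> d (v_quot m (n * q i) p))
      in (\<Prod>j=1..j1 - 1. 1 - \<gamma> j * D_tilde b \<alpha> d
             + \<gamma> j * D_tilde b \<alpha> d * (\<Prod>l=1..d. 1 + x (d * (j - 1) + l)))
         * (\<Prod>l=1..d1 - 1. 1 + x (d * (j1 - 1) + l)))"

definition primitive_mod ::
    "nat \<Rightarrow> 'b::prime_card mod_ring poly \<Rightarrow> 'b mod_ring poly \<Rightarrow> bool" where
  "primitive_mod m p g \<longleftrightarrow>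
     g \<in> R_set m \<and> (\<lambda>i. g ^ i mod p) ` {0..CARD('b) ^ m - 2} = R_set m"

text \<open>\<open>g\<^sup>i mod p\<close> for an integer exponent, using \<open>g\<^sup>M = 1\<close> modulo \<open>p\<close> for \<open>M = b\<^sup>m - 1\<close>.\<close>

definition pow_mod ::
    "nat \<Rightarrow> 'b::prime_card mod_ring poly \<Rightarrow> 'b mod_ring poly \<Rightarrow> int \<Rightarrow> 'b mod_ring poly" where
  "pow_mod m p g i = g ^ nat (i mod int (CARD('b) ^ m - 1)) mod p"

definition c_vec ::
    "nat \<Rightarrow> nat \<Rightarrow> nat \<Rightarrow> (nat \<Rightarrow> real) \<Rightarrow> 'b::prime_card mod_ring poly \<Rightarrow> 'b mod_ring poly
      \<Rightarrow> (nat \<Rightarrow> 'b mod_ring poly) \<Rightarrow> nat \<Rightarrow> nat \<Rightarrow> real" where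
  "c_vec m \<alpha> d \<gamma> p g q r i =
     (\<Sum>n=1..CARD('b) ^ m - 1.
        chi CARD('b) \<alpha> d (v_quot m (pow_mod m p g (int i - int n)) p)
        * eta m \<alpha> d \<gamma> p q r (pow_mod m p g (- int n)))"

definition fast_choice ::
    "nat \<Rightarrow> nat \<Rightarrow> nat \<Rightarrow> nat \<Rightarrow> (nat \<Rightarrow> real) \<Rightarrow> 'b::prime_card mod_ring poly
      \<Rightarrow> (nat \<Rightarrow> 'b mod_ring poly) \<Rightarrow> bool" where
  "fast_choice m s \<alpha> d \<gamma> p q \<longleftrightarrow>
     (\<exists>g. primitive_mod m p g \<and>
        (\<forall>r\<in>{2..d * s}. \<exists>i0.
           is_arg_min (c_vec m \<alpha> d \<gamma> p g q r) (\<lambda>i. i \<in> {1..CARD('b) ^ m - 1}) i0 \<and>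
           q r = pow_mod m p g (int i0)))"

section \<open>A random access machine over the integers and the complex numbers\<close>

text \<open>Memory consists of arrays of naturals and arrays of complex numbers, addressed by a name and an
  index and initially 0; scalars are stored at index 0.  The weights are on a read-only input,
  results go to a write-only output.  All naturals occurring in the program below are
  array indices, loop counters or polynomials of degree at most \<open>m\<close>, i.e. of polynomial size, so that
  unit cost for arithmetic on naturals does not hide any work or storage.\<close>

datatype nexp =
    Num nat
  | NCell string nexp
  | NPlus nexp nexp (infixl "\<^bold>+" 65)
  | NMinus nexp nexp (infixl "\<^bold>-" 65)
  | NTimes nexp nexp (infixl "\<^bold>*" 70)
  | NDiv nexp nexp (infixl "\<^bold>'/" 70)
  | NMod nexp nexp (infixl "\<^bold>%" 70)

text \<open>\<open>Root k n\<close> is the root of unity \<open>exp (2 \<pi> i k / n)\<close>.\<close>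

datatype cexp =
    OfN nexp
  | Weight nexp
  | Root nexp nexp
  | CCell string nexp
  | CPlus cexp cexp (infixl "\<boxplus>" 65)
  | CMinus cexp cexp (infixl "\<boxminus>" 65)
  | CTimes cexp cexp (infixl "\<boxtimes>" 70)
  | CDiv cexp cexp (infixl "\<div>" 70)

text \<open>\<open>CLess\<close> compares real parts.\<close>

datatype bexp = TT | NLess nexp nexp (infix "\<^bold><" 50) | CLess cexp cexp

text \<open>\<open>For x e g c\<close> runs \<open>c\<close> for \<open>x = 0, \<dots>, e - 1\<close> and is left early as soon as the guard \<open>g\<close>
  is false; \<open>e\<close> is evaluated once.\<close>

datatype com =
    NSet string nexp nexp
  | CSet string nexp cexp
  | Out nexp
  | Seq com com (infixr ";;" 60)
  | Cond bexp com com
  | For string nexp bexp com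

record state =
  nmem :: "string \<Rightarrow> nat \<Rightarrow> nat"
  cmem :: "string \<Rightarrow> nat \<Rightarrow> complex"
  weights :: "nat \<Rightarrow> real"
  results :: "nat list"
  ticks :: nat
  nused :: "(string \<times> nat) set"
  cused :: "(string \<times> nat) set"

primrec neval :: "nexp \<Rightarrow> state \<Rightarrow> nat" where
  "neval (Num n) \<sigma> = n"
| "neval (NCell x e) \<sigma> = nmem \<sigma> x (neval e \<sigma>)"
| "neval (e \<^bold>+ f) \<sigma> = neval e \<sigma> + neval f \<sigma>"
| "neval (e \<^bold>- f) \<sigma> = neval e \<sigma> - neval f \<sigma>"
| "neval (e \<^bold>* f) \<sigma> = neval e \<sigma> * neval f \<sigma>"
| "neval (e \<^bold>/ f) \<sigma> = neval e \<sigma> div neval f \<sigma>"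
| "neval (e \<^bold>% f) \<sigma> = neval e \<sigma> mod neval f \<sigma>"

primrec ceval :: "cexp \<Rightarrow> state \<Rightarrow> complex" where
  "ceval (OfN e) \<sigma> = of_nat (neval e \<sigma>)"
| "ceval (Weight e) \<sigma> = of_real (weights \<sigma> (neval e \<sigma>))"
| "ceval (Root k n) \<sigma> = cis (2 * pi * real (neval k \<sigma>) / real (neval n \<sigma>))"
| "ceval (CCell x e) \<sigma> = cmem \<sigma> x (neval e \<sigma>)"
| "ceval (e \<boxplus> f) \<sigma> = ceval e \<sigma> + ceval f \<sigma>"
| "ceval (e \<boxminus> f) \<sigma> = ceval e \<sigma> - ceval f \<sigma>"
| "ceval (e \<boxtimes> f) \<sigma> = ceval e \<sigma> * ceval f \<sigma>"
| "ceval (e \<div> f) \<sigma> = ceval e \<sigma> / ceval f \<sigma>"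

primrec beval :: "bexp \<Rightarrow> state \<Rightarrow> bool" where
  "beval TT \<sigma> = True"
| "beval (e \<^bold>< f) \<sigma> = (neval e \<sigma> < neval f \<sigma>)"
| "beval (CLess e f) \<sigma> = (Re (ceval e \<sigma>) < Re (ceval f \<sigma>))"

text \<open>Evaluating an expression costs one operation for each of its nodes.\<close>

primrec ncost :: "nexp \<Rightarrow> nat" where
  "ncost (Num n) = 1"
| "ncost (NCell x e) = ncost e + 1"
| "ncost (e \<^bold>+ f) = ncost e + ncost f + 1"
| "ncost (e \<^bold>- f) = ncost e + ncost f + 1"
| "ncost (e \<^bold>* f) = ncost e + ncost f + 1"
| "ncost (e \<^bold>/ f) = ncost e + ncost f + 1"
| "ncost (e \<^bold>% f) = ncost e + ncost f + 1"

primrec ccost :: "cexp \<Rightarrow> nat" where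
  "ccost (OfN e) = ncost e + 1"
| "ccost (Weight e) = ncost e + 1"
| "ccost (Root k n) = ncost k + ncost n + 1"
| "ccost (CCell x e) = ncost e + 1"
| "ccost (e \<boxplus> f) = ccost e + ccost f + 1"
| "ccost (e \<boxminus> f) = ccost e + ccost f + 1"
| "ccost (e \<boxtimes> f) = ccost e + ccost f + 1"
| "ccost (e \<div> f) = ccost e + ccost f + 1"

primrec bcost :: "bexp \<Rightarrow> nat" where
  "bcost TT = 1"
| "bcost (e \<^bold>< f) = ncost e + ncost f + 1"
| "bcost (CLess e f) = ccost e + ccost f + 1"

definition tick :: "nat \<Rightarrow> state \<Rightarrow> state" where
  "tick k \<sigma> = \<sigma>\<lparr>ticks := ticks \<sigma> + k\<rparr>"

definition nwrite :: "string \<Rightarrow> nat \<Rightarrow> nat \<Rightarrow> state \<Rightarrow> state" where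
  "nwrite x i v \<sigma> =
     \<sigma>\<lparr>nmem := (nmem \<sigma>)(x := (nmem \<sigma> x)(i := v)), nused := insert (x, i) (nused \<sigma>)\<rparr>"

definition cwrite :: "string \<Rightarrow> nat \<Rightarrow> complex \<Rightarrow> state \<Rightarrow> state" where
  "cwrite x i v \<sigma> =
     \<sigma>\<lparr>cmem := (cmem \<sigma>)(x := (cmem \<sigma> x)(i := v)), cused := insert (x, i) (cused \<sigma>)\<rparr>"

text \<open>\<open>for_loop x g f k i\<close> performs the at most \<open>k\<close> remaining rounds of a loop, from \<open>x = i\<close> on.\<close>

primrec for_loop ::
    "string \<Rightarrow> bexp \<Rightarrow> (state \<Rightarrow> state) \<Rightarrow> nat \<Rightarrow> nat \<Rightarrow> state \<Rightarrow> state" where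
  "for_loop x g f 0 i \<sigma> = \<sigma>"
| "for_loop x g f (Suc k) i \<sigma> =
     (let \<sigma>' = tick (1 + bcost g) (nwrite x 0 i \<sigma>)
      in if beval g \<sigma>' then for_loop x g f k (Suc i) (f \<sigma>') else \<sigma>')"

primrec run :: "com \<Rightarrow> state \<Rightarrow> state" where
  "run (NSet x i e) = (\<lambda>\<sigma>. tick (1 + ncost i + ncost e) (nwrite x (neval i \<sigma>) (neval e \<sigma>) \<sigma>))"
| "run (CSet x i e) = (\<lambda>\<sigma>. tick (1 + ncost i + ccost e) (cwrite x (neval i \<sigma>) (ceval e \<sigma>) \<sigma>))"
| "run (Out e) = (\<lambda>\<sigma>. tick (1 + ncost e) (\<sigma>\<lparr>results := results \<sigma> @ [neval e \<sigma>]\<rparr>))"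
| "run (c ;; c') = (\<lambda>\<sigma>. run c' (run c \<sigma>))"
| "run (Cond g c c') = (\<lambda>\<sigma>. tick (1 + bcost g) (if beval g \<sigma> then run c \<sigma> else run c' \<sigma>))"
| "run (For x e g c) =
     (\<lambda>\<sigma>. for_loop x g (run c) (neval e \<sigma>) 0 (tick (1 + ncost e) \<sigma>))"

text \<open>Memory requirement: the number of cells ever written (other cells still hold their initial
  contents: one of the five parameters, or 0).  The input of weights and the output are not counted.\<close>

definition cells_used :: "state \<Rightarrow> nat" where
  "cells_used \<sigma> = card (nused \<sigma>) + card (cused \<sigma>)"

definition start :: "nat \<Rightarrow> nat \<Rightarrow> nat \<Rightarrow> nat \<Rightarrow> nat \<Rightarrow> (nat \<Rightarrow> real) \<Rightarrow> state" where
  "start b m s \<alpha> d \<gamma> =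
     \<lparr>nmem = (\<lambda>_ _. 0)(''b'' := (\<lambda>_. 0)(0 := b), ''m'' := (\<lambda>_. 0)(0 := m), ''s'' := (\<lambda>_. 0)(0 := s),
        ''alpha'' := (\<lambda>_. 0)(0 := \<alpha>), ''d'' := (\<lambda>_. 0)(0 := d)),
      cmem = (\<lambda>_ _. 0), weights = \<gamma>, results = [], ticks = 0, nused = {}, cused = {}\<rparr>"

text \<open>The sets counted by \<^const>\<open>cells_used\<close> are always finite.\<close>

lemma finite_used:
  assumes "finite (nused \<sigma>)" "finite (cused \<sigma>)"
  shows "finite (nused (run c \<sigma>)) \<and> finite (cused (run c \<sigma>))"
  using assms
proof (induction c arbitrary: \<sigma>)
  case (For x e g c)
  have "finite (nused (for_loop x g (run c) k i \<sigma>)) \<and> finite (cused (for_loop x g (run c) k i \<sigma>))"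
    if "finite (nused \<sigma>)" "finite (cused \<sigma>)" for k i \<sigma>
    using that
    by (induction k arbitrary: i \<sigma>) (simp_all add: Let_def tick_def nwrite_def For.IH)
  then show ?case
    using For.prems by (simp add: tick_def)
qed (simp_all add: tick_def nwrite_def cwrite_def)

section \<open>The fast component-by-component construction as a program\<close>

abbreviation nv :: "string \<Rightarrow> nexp" where "nv x \<equiv> NCell x (Num 0)"
abbreviation cv :: "string \<Rightarrow> cexp" where "cv x \<equiv> CCell x (Num 0)"
abbreviation nlet :: "string \<Rightarrow> nexp \<Rightarrow> com" where "nlet x e \<equiv> NSet x (Num 0) e"
abbreviation clet :: "string \<Rightarrow> cexp \<Rightarrow> com" where "clet x e \<equiv> CSet x (Num 0) e"
abbreviation for_all :: "string \<Rightarrow> nexp \<Rightarrow> com \<Rightarrow> com" where "for_all x e c \<equiv> For x e TT c"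
abbreviation skip :: com where "skip \<equiv> nlet ''tmp'' (Num 0)"

subsection \<open>Arithmetic of polynomials over the prime field\<close>

text \<open>Polynomials are stored as the naturals they are identified with.  With \<open>H = b\<^sup>h\<close>, \<open>h = \<lfloor>m/2\<rfloor> + 1\<close>,
  polynomials of degree at most \<open>m\<close> consist of two halves below \<open>H\<close>; a table of all sums of halves,
  of size \<open>H\<^sup>2 \<le> b\<^sup>m\<^sup>+\<^sup>2\<close>, then gives their sum in constantly many operations.\<close>

definition init_tables :: com where
  "init_tables =
     nlet ''N'' (Num 1) ;;
     for_all ''i'' (nv ''m'') (nlet ''N'' (nv ''N'' \<^bold>* nv ''b'')) ;;
     nlet ''M'' (nv ''N'' \<^bold>- Num 1) ;;
     nlet ''h'' (nv ''m'' \<^bold>/ Num 2 \<^bold>+ Num 1) ;;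
     nlet ''H'' (Num 1) ;;
     for_all ''i'' (nv ''h'') (nlet ''H'' (nv ''H'' \<^bold>* nv ''b'')) ;;
     NSet ''Add'' (Num 0) (Num 0) ;;
     for_all ''i'' (nv ''H'') (for_all ''k'' (nv ''H'')
       (NSet ''Add'' (nv ''i'' \<^bold>* nv ''H'' \<^bold>+ nv ''k'')
         (NCell ''Add'' (nv ''i'' \<^bold>/ nv ''b'' \<^bold>* nv ''H'' \<^bold>+ nv ''k'' \<^bold>/ nv ''b'') \<^bold>* nv ''b''
          \<^bold>+ (nv ''i'' \<^bold>+ nv ''k'') \<^bold>% nv ''b'')))"

definition padd :: "nexp \<Rightarrow> nexp \<Rightarrow> nexp" where
  "padd e f =
     NCell ''Add'' (e \<^bold>/ nv ''H'' \<^bold>* nv ''H'' \<^bold>+ f \<^bold>/ nv ''H'') \<^bold>* nv ''H''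
     \<^bold>+ NCell ''Add'' (e \<^bold>% nv ''H'' \<^bold>* nv ''H'' \<^bold>+ f \<^bold>% nv ''H'')"

text \<open>The multiples of \<open>e\<close> by the \<open>b\<close> constants.\<close>

definition scalar_multiples :: "string \<Rightarrow> nexp \<Rightarrow> com" where
  "scalar_multiples S e =
     NSet S (Num 0) (Num 0) ;;
     for_all ''k'' (nv ''b'' \<^bold>- Num 1) (NSet S (nv ''k'' \<^bold>+ Num 1) (padd (NCell S (nv ''k'')) e))"

text \<open>\<open>x * e\<close> modulo the monic polynomial \<open>p\<close>, whose constant multiples are in \<open>''P''\<close>.\<close>

definition xtimes :: "nexp \<Rightarrow> nexp" where
  "xtimes e =
     padd (e \<^bold>* nv ''b'') (NCell ''P'' ((nv ''b'' \<^bold>- e \<^bold>* nv ''b'' \<^bold>/ nv ''N'') \<^bold>% nv ''b''))"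

text \<open>Sieve: for all \<open>1 \<le> e < m\<close>, mark all products of a polynomial \<open>u\<close> of degree \<open>e\<close> and one of
  degree at most \<open>m - e\<close>; then \<open>p\<close> is the first polynomial of degree \<open>m\<close> that is not marked.
  It is monic.\<close>

definition find_p :: com where
  "find_p =
     nlet ''lo'' (nv ''b'') ;;
     nlet ''hi'' (nv ''N'') ;;
     for_all ''e'' (nv ''m'' \<^bold>- Num 1)
      (for_all ''i'' (nv ''lo'' \<^bold>* nv ''b'' \<^bold>- nv ''lo'')
        (nlet ''u'' (nv ''lo'' \<^bold>+ nv ''i'') ;;
         scalar_multiples ''S'' (nv ''u'') ;;
         NSet ''T'' (Num 0) (Num 0) ;;
         for_all ''j'' (nv ''hi'')
          (NSet ''T'' (nv ''j'') (padd (NCell ''T'' (nv ''j'' \<^bold>/ nv ''b'') \<^bold>* nv ''b'')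
                                     (NCell ''S'' (nv ''j'' \<^bold>% nv ''b''))) ;;
           NSet ''Mark'' (NCell ''T'' (nv ''j'')) (Num 1))) ;;
       nlet ''lo'' (nv ''lo'' \<^bold>* nv ''b'') ;;
       nlet ''hi'' (nv ''hi'' \<^bold>/ nv ''b'')) ;;
     nlet ''p'' (nv ''N'') ;;
     For ''i'' (nv ''N'') (Num 0 \<^bold>< NCell ''Mark'' (nv ''p''))
      (nlet ''p'' (nv ''p'' \<^bold>+ Num 1)) ;;
     scalar_multiples ''P'' (nv ''p'')"

text \<open>\<open>T[y] = y * e mod p\<close> for the polynomials \<open>y\<close> below \<open>H\<close>.\<close>

definition mult_table :: "string \<Rightarrow> nexp \<Rightarrow> com" where
  "mult_table T e =
     scalar_multiples ''S'' e ;;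
     NSet T (Num 0) (Num 0) ;;
     for_all ''j'' (nv ''H'')
      (NSet T (nv ''j'') (padd (xtimes (NCell T (nv ''j'' \<^bold>/ nv ''b'')))
                              (NCell ''S'' (nv ''j'' \<^bold>% nv ''b''))))"

text \<open>Primitive element: run through the powers of elements \<open>a\<close> not seen before until one of order
  \<open>M = b\<^sup>m - 1\<close> is found; \<open>''G''\<close> then holds \<open>g\<^sup>i mod p\<close> for \<open>i < M\<close>.  Multiplication by \<open>a\<close> uses the
  tables of the multiples of \<open>a\<close> and \<open>x\<^sup>h a\<close>.\<close>

definition find_g :: com where
  "find_g =
     nlet ''ord'' (Num 0) ;;
     For ''i'' (nv ''M'') (nv ''ord'' \<^bold>< nv ''M'')
      (nlet ''a'' (nv ''i'' \<^bold>+ Num 1) ;;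
       Cond (NCell ''Seen'' (nv ''a'') \<^bold>< Num 1)
        (mult_table ''L'' (nv ''a'') ;;
         nlet ''z'' (nv ''a'') ;;
         for_all ''j'' (nv ''h'') (nlet ''z'' (xtimes (nv ''z''))) ;;
         mult_table ''U'' (nv ''z'') ;;
         NSet ''G'' (Num 0) (Num 1) ;;
         nlet ''ord'' (Num 1) ;;
         nlet ''z'' (nv ''a'') ;;
         For ''j'' (nv ''M'') (Num 1 \<^bold>< nv ''z'')
          (NSet ''G'' (nv ''ord'') (nv ''z'') ;;
           NSet ''Seen'' (nv ''z'') (Num 1) ;;
           nlet ''ord'' (nv ''ord'' \<^bold>+ Num 1) ;;
           nlet ''z'' (padd (NCell ''L'' (nv ''z'' \<^bold>% nv ''H'')) (NCell ''U'' (nv ''z'' \<^bold>/ nv ''H'')))))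
        skip)"

subsection \<open>Constants and the first column of the circulant matrix\<close>

text \<open>\<open>''rho'' = 1 + 1/b + 1/(b(b+1))\<close>, \<open>''sg'' = 2 sin (\<pi>/b)\<close>; in the last but one loop,
  \<open>\<nu> = \<alpha> - k\<close>, \<open>''c'' = C_const b \<nu>\<close>, \<open>''E'' = C_prime b \<alpha> \<nu>\<close>, \<open>''t'' = b\<^sup>-\<^sup>2\<^sup>(\<^sup>\<alpha>\<^sup>-\<^sup>\<nu>\<^sup>)\<close> and \<open>''Dt''\<close> is the
  maximum so far.  Finally \<open>''Dt'' = D_tilde b \<alpha> d\<close>.\<close>

definition comp_D :: com where
  "comp_D =
     clet ''b'' (OfN (nv ''b'')) ;;
     clet ''rho'' (OfN (Num 1) \<boxplus> OfN (Num 1) \<div> cv ''b''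
                  \<boxplus> OfN (Num 1) \<div> (cv ''b'' \<boxtimes> (cv ''b'' \<boxplus> OfN (Num 1)))) ;;
     clet ''sg'' ((Root (Num 1) (Num 2 \<^bold>* nv ''b'')
                   \<boxminus> Root (Num 2 \<^bold>* nv ''b'' \<^bold>- Num 1) (Num 2 \<^bold>* nv ''b'')) \<div> Root (Num 1) (Num 4)) ;;
     clet ''c'' (OfN (Num 1) \<div> (cv ''sg'' \<boxtimes> cv ''sg'')) ;;
     for_all ''k'' (nv ''alpha'' \<^bold>- Num 2) (clet ''c'' (cv ''c'' \<boxtimes> cv ''rho'' \<div> cv ''sg'')) ;;
     clet ''Ct'' (OfN (Num 2) \<boxtimes> cv ''c'' \<boxtimes> cv ''c'' \<boxtimes> cv ''rho'' \<boxtimes> cv ''rho'') ;;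
     clet ''E'' (OfN (Num 0)) ;;
     clet ''t'' (OfN (Num 1)) ;;
     clet ''Dt'' (OfN (Num 0)) ;;
     for_all ''k'' (nv ''alpha'')
      (clet ''E'' (cv ''c'' \<boxtimes> cv ''c'' \<boxplus> cv ''E'' \<div> (cv ''b'' \<boxtimes> cv ''b'')) ;;
       clet ''val'' (cv ''E'' \<boxplus> cv ''Ct'' \<boxtimes> cv ''t'') ;;
       Cond (CLess (cv ''Dt'') (cv ''val'')) (clet ''Dt'' (cv ''val'')) skip ;;
       clet ''t'' (cv ''t'' \<div> (cv ''b'' \<boxtimes> cv ''b'')) ;;
       Cond (nv ''k'' \<^bold>+ Num 2 \<^bold>< nv ''alpha'')
         (clet ''c'' (cv ''c'' \<boxtimes> cv ''sg'' \<div> cv ''rho''))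
         (clet ''c'' (cv ''c'' \<boxtimes> cv ''sg''))) ;;
     for_all ''k'' ((Num 2 \<^bold>* nv ''d'' \<^bold>- Num 1) \<^bold>* nv ''alpha'')
      (clet ''Dt'' (cv ''Dt'' \<boxtimes> cv ''b''))"

text \<open>For \<open>0 \<noteq> h\<close> of degree less than \<open>m = deg p\<close> the Laurent series of \<open>h/p\<close> starts at
  \<open>x\<^sup>d\<^sup>e\<^sup>g\<^sup>(\<^sup>h\<^sup>)\<^sup>-\<^sup>m\<close>, so \<open>\<lfloor>log\<^sub>b (v\<^sub>m (h/p))\<rfloor> = deg h - m\<close> and \<open>\<chi> (v\<^sub>m (h/p))\<close> depends on \<open>m - deg h\<close>
  only; \<open>''chi''\<close> is indexed by this number and \<open>''om''\<close> is the list of the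
  \<open>\<chi> (v\<^sub>m ((g\<^sup>i mod p)/p))\<close>, \<open>i < M\<close>.\<close>

definition comp_omega :: com where
  "comp_omega =
     Cond (nv ''alpha'' \<^bold>< nv ''d'') (nlet ''mn'' (nv ''alpha'')) (nlet ''mn'' (nv ''d'')) ;;
     clet ''B2'' (OfN (Num 1)) ;;
     for_all ''k'' (Num 2 \<^bold>* nv ''mn'') (clet ''B2'' (cv ''B2'' \<boxtimes> cv ''b'')) ;;
     clet ''B1'' (cv ''B2'' \<div> cv ''b'') ;;
     clet ''den'' (cv ''B2'' \<boxminus> cv ''b'') ;;
     for_all ''k'' (nv ''alpha'') (clet ''den'' (cv ''den'' \<boxtimes> cv ''b'')) ;;
     clet ''t'' (OfN (Num 1)) ;;
     for_all ''k'' (nv ''m'')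
      (clet ''t'' (cv ''t'' \<div> cv ''B1'') ;;
       CSet ''chi'' (nv ''k'' \<^bold>+ Num 1)
        ((cv ''b'' \<boxminus> OfN (Num 1) \<boxminus> cv ''t'' \<boxtimes> (cv ''B2'' \<boxminus> OfN (Num 1))) \<div> cv ''den'')) ;;
     for_all ''i'' (nv ''N'')
      (Cond (nv ''i'' \<^bold>< nv ''b'')
        (NSet ''Deg'' (nv ''i'') (Num 0))
        (NSet ''Deg'' (nv ''i'') (NCell ''Deg'' (nv ''i'' \<^bold>/ nv ''b'') \<^bold>+ Num 1))) ;;
     for_all ''i'' (nv ''M'')
      (CSet ''om'' (nv ''i'') (CCell ''chi'' (nv ''m'' \<^bold>- NCell ''Deg'' (NCell ''G'' (nv ''i'')))))"

subsection \<open>Fast Fourier transform\<close>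

text \<open>Radix-2 transform (Stockham's form) of the array \<open>''X''\<close> of length \<open>''Len''\<close>, a power of two.  After
  each stage, \<open>X[q + st * k]\<close>, \<open>k < n\<close>, is for each \<open>q < st\<close> a sequence whose transform of length \<open>n\<close>
  gives the values of the full transform at the indices congruent to \<open>q\<close> modulo \<open>st\<close>.
  The argument \<open>tw\<close> is the twiddle factor, depending on \<open>''k''\<close> and \<open>''n''\<close>.\<close>

definition fft :: "cexp \<Rightarrow> com" where
  "fft tw =
     nlet ''n'' (nv ''Len'') ;;
     nlet ''st'' (Num 1) ;;
     For ''r'' (nv ''Len'') (Num 1 \<^bold>< nv ''n'')
      (nlet ''half'' (nv ''n'' \<^bold>/ Num 2) ;;
       for_all ''k'' (nv ''half'')
        (clet ''w'' tw ;;
         for_all ''q'' (nv ''st'')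
          (clet ''x'' (CCell ''X'' (nv ''q'' \<^bold>+ nv ''st'' \<^bold>* nv ''k'')) ;;
           clet ''y'' (CCell ''X'' (nv ''q'' \<^bold>+ nv ''st'' \<^bold>* (nv ''k'' \<^bold>+ nv ''half''))) ;;
           CSet ''Y'' (nv ''q'' \<^bold>+ nv ''st'' \<^bold>* (Num 2 \<^bold>* nv ''k'')) (cv ''x'' \<boxplus> cv ''y'') ;;
           CSet ''Y'' (nv ''q'' \<^bold>+ nv ''st'' \<^bold>* (Num 2 \<^bold>* nv ''k'' \<^bold>+ Num 1))
             ((cv ''x'' \<boxminus> cv ''y'') \<boxtimes> cv ''w''))) ;;
       for_all ''q'' (nv ''Len'') (CSet ''X'' (nv ''q'') (CCell ''Y'' (nv ''q''))) ;;
       nlet ''n'' (nv ''half'') ;;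
       nlet ''st'' (Num 2 \<^bold>* nv ''st''))"

definition forward_fft :: com where
  "forward_fft = fft (Root (nv ''k'') (nv ''n''))"

definition inverse_fft :: com where
  "inverse_fft =
     fft (Root (nv ''n'' \<^bold>- nv ''k'') (nv ''n'')) ;;
     for_all ''q'' (nv ''Len'')
      (CSet ''X'' (nv ''q'') (CCell ''X'' (nv ''q'') \<div> OfN (nv ''Len'')))"

text \<open>The transform of the zero-padded first column, computed once.\<close>

definition prepare_fft :: com where
  "prepare_fft =
     nlet ''Len'' (Num 1) ;;
     For ''i'' (Num 2 \<^bold>* nv ''M'') (nv ''Len'' \<^bold>< Num 2 \<^bold>* nv ''M'')
      (nlet ''Len'' (Num 2 \<^bold>* nv ''Len'')) ;;
     for_all ''i'' (nv ''Len'') (CSet ''X'' (nv ''i'') (OfN (Num 0))) ;;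
     for_all ''i'' (nv ''M'') (CSet ''X'' (nv ''i'') (CCell ''om'' (nv ''i''))) ;;
     forward_fft ;;
     for_all ''i'' (nv ''Len'') (CSet ''F'' (nv ''i'') (CCell ''X'' (nv ''i'')))"

subsection \<open>The construction\<close>

text \<open>The circulant matrix-vector product \<open>c = \<Omega>\<^sub>p \<eta>\<close>: a linear convolution, by transforms of length
  \<open>Len \<ge> 2 M\<close>, folded modulo \<open>M\<close>.  Indices \<open>i, n \<in> {1..M}\<close> of the matrix are stored modulo \<open>M\<close>.
  Afterwards \<open>''i0''\<close> is the index of a minimal entry of \<open>c\<close>.\<close>

definition choose_next :: com where
  "choose_next =
     for_all ''i'' (nv ''Len'') (CSet ''X'' (nv ''i'') (OfN (Num 0))) ;;
     for_all ''i'' (nv ''M'')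
      (CSet ''X'' (nv ''i'') (CCell ''eta1'' (nv ''i'') \<boxtimes> CCell ''eta2'' (nv ''i''))) ;;
     forward_fft ;;
     for_all ''i'' (nv ''Len'')
      (CSet ''X'' (nv ''i'') (CCell ''X'' (nv ''i'') \<boxtimes> CCell ''F'' (nv ''i''))) ;;
     inverse_fft ;;
     for_all ''i'' (nv ''M'')
      (CSet ''X'' (nv ''i'') (CCell ''X'' (nv ''i'') \<boxplus> CCell ''X'' (nv ''i'' \<^bold>+ nv ''M''))) ;;
     nlet ''i0'' (Num 0) ;;
     for_all ''i'' (nv ''M'')
      (Cond (CLess (CCell ''X'' (nv ''i'')) (CCell ''X'' (nv ''i0''))) (nlet ''i0'' (nv ''i'')) skip)"

text \<open>Entry \<open>n\<close> of \<open>''eta1''\<close> and \<open>''eta2''\<close> belongs to the polynomial \<open>g\<^sup>-\<^sup>n mod p\<close>.\<close>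

definition main_loop :: com where
  "main_loop =
     for_all ''n'' (nv ''M'') (CSet ''eta1'' (nv ''n'') (OfN (Num 1))) ;;
     for_all ''j'' (nv ''s'')
      (for_all ''n'' (nv ''M'') (CSet ''eta2'' (nv ''n'') (OfN (Num 1))) ;;
       for_all ''l'' (nv ''d'')
        (Cond (Num 0 \<^bold>< nv ''j'' \<^bold>+ nv ''l'') choose_next (nlet ''i0'' (Num 0)) ;;
         Out (NCell ''G'' (nv ''i0'')) ;;
         for_all ''n'' (nv ''M'')
          (CSet ''eta2'' (nv ''n'')
            (CCell ''eta2'' (nv ''n'') \<boxtimes>
             (OfN (Num 1) \<boxplus> CCell ''om'' ((nv ''i0'' \<^bold>+ (nv ''M'' \<^bold>- nv ''n'')) \<^bold>% nv ''M''))))) ;;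
       clet ''t'' (Weight (nv ''j'' \<^bold>+ Num 1) \<boxtimes> cv ''Dt'') ;;
       for_all ''n'' (nv ''M'')
        (CSet ''eta1'' (nv ''n'')
          (CCell ''eta1'' (nv ''n'') \<boxtimes>
           (OfN (Num 1) \<boxminus> cv ''t'' \<boxplus> cv ''t'' \<boxtimes> CCell ''eta2'' (nv ''n'')))))"

text \<open>Output: \<open>p\<close>, followed by \<open>q\<^sub>1, \<dots>, q\<^sub>d\<^sub>s\<close>.\<close>

definition fast_cbc :: com where
  "fast_cbc =
     init_tables ;; find_p ;; Out (nv ''p'') ;; find_g ;; comp_D ;; comp_omega ;; prepare_fft ;;
     main_loop"

end

theory Submission
  imports Defs "Berlekamp_Zassenhaus.Distinct_Degree_Factorization"
begin

text \<open>Correctness.  The value \<open>\<chi> (v\<^sub>m (h/p))\<close> is the sum over \<open>l \<ge> 1\<close> of \<open>r\<^sub>\<alpha>\<^sub>,\<^sub>d (l)\<close> times an additive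
  character at \<open>tr\<^sub>m (l) h/p\<close>.  Averaging products of these series over all \<open>h\<close> of degree less than \<open>m\<close> leaves
  exactly the terms of the dual net.  For product weights the sum over all sets \<open>w\<close> factorises, so that,
  as a function of \<open>q\<^sub>r\<close>, the criterion is a constant plus a non-negative multiple of
  \<open>\<Sum>\<^sub>h \<eta> (h) \<chi> (v\<^sub>m (h q\<^sub>r/p))\<close>.  Over the powers of a primitive element this is a cyclic convolution, which is
  computed as a linear one of length a power of two.

  Cost.  Everything before the transforms has to be done in \<open>O (m b\<^sup>m)\<close> as well.  The sieve for \<open>p\<close> does
  \<open>O (b\<^sup>m)\<close> steps for each of the \<open>m\<close> degrees.  The search for a primitive element runs through
  the powers of one element for each of a set of distinct orders, which divide \<open>M = b\<^sup>m - 1\<close>; the sum of the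
  divisors of \<open>M\<close> is at most \<open>\<Sum>\<^sub>k M div k = O (m b\<^sup>m)\<close>, and as there are only \<open>O (\<surd>M)\<close> divisors, one may
  set up multiplication tables of that size for each of them.\<close>

section \<open>Execution and cost of programs\<close>

text \<open>The constant of the cost bound may depend on \<open>b\<close> and \<alpha> only, so an
  elementary operation on residues modulo \<open>p\<close> must take a number of steps independent
  of \<open>m\<close>; digitwise arithmetic would lose a factor \<open>m\<close>. This is why
  polynomials are numbers, sums come from a table indexed by pairs of halves, and multiplication by
  a fixed element amounts to two table lookups and one such sum. Halves have
  \<open>m div 2 + 1\<close> digits: two of them hold degree \<open>m\<close>, while the table stays
  within \<open>b ^ (m + 2)\<close> cells. Memory follows from a bound on indices: the program has a
  fixed finite set of array names, and every index written is below \<open>K\<close>, which is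
  \<open>4 * b * b\<close> times \<open>N\<close>. Time is harder, because rounds of the search for
  a primitive element differ widely in cost; loop invariants therefore carry the accumulated cost,
  and its bound is drawn from what the invariant knows about the earlier rounds. Arithmetic is
  exact: a convolution of real sequences computed through complex transforms is real, so comparing
  real parts finds true minima.\<close>

lemma state_ops [simp]:
  "nmem (tick k \<sigma>) = nmem \<sigma>" "cmem (tick k \<sigma>) = cmem \<sigma>" "results (tick k \<sigma>) = results \<sigma>"
  "weights (tick k \<sigma>) = weights \<sigma>" "ticks (tick k \<sigma>) = ticks \<sigma> + k"
  "nused (tick k \<sigma>) = nused \<sigma>" "cused (tick k \<sigma>) = cused \<sigma>"
  "nmem (nwrite x i v \<sigma>) = (nmem \<sigma>)(x := (nmem \<sigma> x)(i := v))" "cmem (nwrite x i v \<sigma>) = cmem \<sigma>"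
  "results (nwrite x i v \<sigma>) = results \<sigma>" "weights (nwrite x i v \<sigma>) = weights \<sigma>"
  "ticks (nwrite x i v \<sigma>) = ticks \<sigma>" "nused (nwrite x i v \<sigma>) = insert (x, i) (nused \<sigma>)"
  "cused (nwrite x i v \<sigma>) = cused \<sigma>"
  "cmem (cwrite x i w \<sigma>) = (cmem \<sigma>)(x := (cmem \<sigma> x)(i := w))" "nmem (cwrite x i w \<sigma>) = nmem \<sigma>"
  "results (cwrite x i w \<sigma>) = results \<sigma>" "weights (cwrite x i w \<sigma>) = weights \<sigma>"
  "ticks (cwrite x i w \<sigma>) = ticks \<sigma>" "nused (cwrite x i w \<sigma>) = nused \<sigma>"
  "cused (cwrite x i w \<sigma>) = insert (x, i) (cused \<sigma>)"
  by (simp_all add: tick_def nwrite_def cwrite_def)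

text \<open>The array names a program may write, read off its syntax. Frame conditions thus become
  membership tests in explicit finite sets, and together with a bound on the indices these names
  bound the memory.\<close>

primrec nwr :: "com \<Rightarrow> string set" where
  "nwr (NSet x i e) = {x}"
| "nwr (CSet x i e) = {}"
| "nwr (Out e) = {}"
| "nwr (c ;; c') = nwr c \<union> nwr c'"
| "nwr (Cond g c c') = nwr c \<union> nwr c'"
| "nwr (For x e g c) = insert x (nwr c)"

primrec cwr :: "com \<Rightarrow> string set" where
  "cwr (NSet x i e) = {}"
| "cwr (CSet x i e) = {x}"
| "cwr (Out e) = {}"
| "cwr (c ;; c') = cwr c \<union> cwr c'"
| "cwr (Cond g c c') = cwr c \<union> cwr c'"
| "cwr (For x e g c) = cwr c"

primrec silent :: "com \<Rightarrow> bool" where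
  "silent (NSet x i e) = True"
| "silent (CSet x i e) = True"
| "silent (Out e) = False"
| "silent (c ;; c') = (silent c \<and> silent c')"
| "silent (Cond g c c') = (silent c \<and> silent c')"
| "silent (For x e g c) = silent c"

lemma finite_nwr: "finite (nwr c)" and finite_cwr: "finite (cwr c)"
  by (induction c) auto

lemma nmem_run: "y \<notin> nwr c \<Longrightarrow> nmem (run c \<sigma>) y = nmem \<sigma> y"
proof (induction c arbitrary: \<sigma>)
  case (For x e g c)
  have "nmem (for_loop x g (run c) k i \<sigma>) y = nmem \<sigma> y" for k i \<sigma>
    using For by (induction k arbitrary: i \<sigma>) (simp_all add: Let_def)
  then show ?case by simp
qed auto

lemma cmem_run: "y \<notin> cwr c \<Longrightarrow> cmem (run c \<sigma>) y = cmem \<sigma> y"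
proof (induction c arbitrary: \<sigma>)
  case (For x e g c)
  have "cmem (for_loop x g (run c) k i \<sigma>) y = cmem \<sigma> y" for k i \<sigma>
    using For by (induction k arbitrary: i \<sigma>) (simp_all add: Let_def)
  then show ?case by simp
qed auto

lemma results_run: "silent c \<Longrightarrow> results (run c \<sigma>) = results \<sigma>"
proof (induction c arbitrary: \<sigma>)
  case (For x e g c)
  have "results (for_loop x g (run c) k i \<sigma>) = results \<sigma>" for k i \<sigma>
    using For by (induction k arbitrary: i \<sigma>) (simp_all add: Let_def)
  then show ?case by simp
qed auto

lemma weights_run [simp]: "weights (run c \<sigma>) = weights \<sigma>"
proof (induction c arbitrary: \<sigma>)
  case (For x e g c)
  have "weights (for_loop x g (run c) k i \<sigma>) = weights \<sigma>" for k i \<sigma>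
    using For by (induction k arbitrary: i \<sigma>) (simp_all add: Let_def)
  then show ?case by simp
qed auto

text \<open>Time and memory share one judgement: under sequential composition times add and the sets
  of written cells unite, so one rule per construct serves both. Clock and used cells at the start
  are arbitrary, so the judgement applies in the middle of a run.\<close>

definition ok :: "nat \<Rightarrow> com \<Rightarrow> state \<Rightarrow> nat \<Rightarrow> bool" where
  "ok K c \<sigma> t \<longleftrightarrow> ticks (run c \<sigma>) \<le> ticks \<sigma> + t
     \<and> nused (run c \<sigma>) \<subseteq> nused \<sigma> \<union> nwr c \<times> {..<K}
     \<and> cused (run c \<sigma>) \<subseteq> cused \<sigma> \<union> cwr c \<times> {..<K}"

lemma ok_mono: "ok K c \<sigma> t \<Longrightarrow> t \<le> t' \<Longrightarrow> ok K c \<sigma> t'"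
  by (auto simp: ok_def)

lemma ok_NSet: "neval i \<sigma> < K \<Longrightarrow> ok K (NSet x i e) \<sigma> (1 + ncost i + ncost e)"
  by (simp add: ok_def)

lemma ok_CSet: "neval i \<sigma> < K \<Longrightarrow> ok K (CSet x i e) \<sigma> (1 + ncost i + ccost e)"
  by (simp add: ok_def)

lemma ok_Out: "ok K (Out e) \<sigma> (1 + ncost e)"
  by (simp add: ok_def tick_def)

lemma ok_Seq: "ok K c \<sigma> t \<Longrightarrow> ok K c' (run c \<sigma>) t' \<Longrightarrow> ok K (c ;; c') \<sigma> (t + t')"
  by (fastforce simp: ok_def)

text \<open>Each branch is bounded only under the condition that it is taken, so a branch known to
  be unreachable may be charged 0. The sum stands in for the maximum of the two costs.\<close>

lemma ok_Cond:
  "(beval g \<sigma> \<Longrightarrow> ok K c \<sigma> t) \<Longrightarrow> (\<not> beval g \<sigma> \<Longrightarrow> ok K c' \<sigma> t')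
    \<Longrightarrow> ok K (Cond g c c') \<sigma> (1 + bcost g + (t + t'))"
  by (fastforce simp: ok_def)

text \<open>The invariant \<open>I i A\<close> holds before round \<open>i\<close> if the rounds so far have cost at most \<open>A\<close>.\<close>

lemma For_rule:
  fixes I :: "nat \<Rightarrow> nat \<Rightarrow> state \<Rightarrow> bool"
  assumes K: "0 < K" and n: "neval e \<sigma> = n" and I0: "I 0 0 (tick (1 + ncost e) \<sigma>)"
    and wr: "\<And>i A \<tau> k. I i A \<tau> \<Longrightarrow> I i A (tick k (nwrite x 0 i \<tau>))"
    and step: "\<And>i A \<tau>. \<lbrakk>i < n; I i A \<tau>; nmem \<tau> x 0 = i;
        \<And>y. y \<notin> nwr (For x e g c) \<Longrightarrow> nmem \<tau> y = nmem \<sigma> y;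
        \<And>y. y \<notin> cwr c \<Longrightarrow> cmem \<tau> y = cmem \<sigma> y; weights \<tau> = weights \<sigma>; beval g \<tau>\<rbrakk>
      \<Longrightarrow> \<exists>t. ok K c \<tau> t \<and> I (Suc i) (A + (1 + bcost g + t)) (run c \<tau>)"
    and brk: "\<And>i A \<tau>. \<lbrakk>i < n; I i A \<tau>; nmem \<tau> x 0 = i;
        \<And>y. y \<notin> nwr (For x e g c) \<Longrightarrow> nmem \<tau> y = nmem \<sigma> y;
        \<And>y. y \<notin> cwr c \<Longrightarrow> cmem \<tau> y = cmem \<sigma> y; \<not> beval g \<tau>\<rbrakk>
      \<Longrightarrow> J (A + (1 + bcost g)) \<tau>"
    and fin: "\<And>A \<tau>. I n A \<tau> \<Longrightarrow> J A \<tau>"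
  shows "\<exists>A. J A (run (For x e g c) \<sigma>) \<and> ok K (For x e g c) \<sigma> (1 + ncost e + A)"
proof -
  let ?f = "for_loop x g (run c)"
  \<comment> \<open>\<open>A\<close> is the cost of the rounds already done, \<open>A'\<close> that
    of the remaining \<open>k\<close> rounds. The frame equations against the initial state are part
    of the induction, because the body may rely on them in every round.\<close>
  have "\<exists>A'. J (A + A') (?f k i \<tau>) \<and> ticks (?f k i \<tau>) \<le> ticks \<tau> + A'
      \<and> nused (?f k i \<tau>) \<subseteq> nused \<tau> \<union> insert x (nwr c) \<times> {..<K}
      \<and> cused (?f k i \<tau>) \<subseteq> cused \<tau> \<union> cwr c \<times> {..<K}"
    if "i + k = n" "I i A \<tau>" "\<And>y. y \<notin> nwr (For x e g c) \<Longrightarrow> nmem \<tau> y = nmem \<sigma> y"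
      "\<And>y. y \<notin> cwr c \<Longrightarrow> cmem \<tau> y = cmem \<sigma> y" "weights \<tau> = weights \<sigma>" for k i A \<tau>
    using that
  proof (induction k arbitrary: i A \<tau>)
    case 0
    then show ?case using fin[of A \<tau>] by (intro exI[of _ 0]) auto
  next
    case (Suc k)
    define \<rho> where "\<rho> = tick (1 + bcost g) (nwrite x 0 i \<tau>)"
    have \<rho>: "i < n" "I i A \<rho>" "nmem \<rho> x 0 = i"
        "\<And>y. y \<notin> nwr (For x e g c) \<Longrightarrow> nmem \<rho> y = nmem \<sigma> y"
        "\<And>y. y \<notin> cwr c \<Longrightarrow> cmem \<rho> y = cmem \<sigma> y" "weights \<rho> = weights \<sigma>"
      using Suc.prems wr[of i A \<tau>] by (auto simp: \<rho>_def)
    have \<rho>2: "ticks \<rho> = ticks \<tau> + (1 + bcost g)" "nused \<rho> = insert (x, 0) (nused \<tau>)"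
        "cused \<rho> = cused \<tau>"
      by (simp_all add: \<rho>_def)
    show ?case
    proof (cases "beval g \<rho>")
      case True
      from step[OF \<rho> True] obtain t where t: "ok K c \<rho> t" "I (Suc i) (A + (1 + bcost g + t)) (run c \<rho>)"
        by auto
      have "?f (Suc k) i \<tau> = ?f k (Suc i) (run c \<rho>)"
        using True by (simp add: \<rho>_def Let_def)
      moreover obtain A' where "J (A + (1 + bcost g + t) + A') (?f k (Suc i) (run c \<rho>))"
          "ticks (?f k (Suc i) (run c \<rho>)) \<le> ticks (run c \<rho>) + A'"
          "nused (?f k (Suc i) (run c \<rho>)) \<subseteq> nused (run c \<rho>) \<union> insert x (nwr c) \<times> {..<K}"
          "cused (?f k (Suc i) (run c \<rho>)) \<subseteq> cused (run c \<rho>) \<union> cwr c \<times> {..<K}"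
        using Suc.IH[of "Suc i" "A + (1 + bcost g + t)" "run c \<rho>"] Suc.prems(1) t(2) \<rho>
        by (auto simp: nmem_run cmem_run)
      ultimately show ?thesis
        using t(1) K
        by (intro exI[of _ "1 + bcost g + t + A'"]) (auto simp: ok_def \<rho>2 add.assoc)
    next
      case False
      then have "?f (Suc k) i \<tau> = \<rho>"
        by (simp add: \<rho>_def Let_def)
      with brk[OF \<rho>(1-5) False] K show ?thesis
        by (intro exI[of _ "1 + bcost g"]) (auto simp: \<rho>2)
    qed
  qed
  from this[of 0 n 0 "tick (1 + ncost e) \<sigma>"] show ?thesis
    using I0 n by (auto simp: ok_def)
qed

text \<open>With the guard \<open>TT\<close> the loop never ends early, so the accumulated cost of
  \<open>For_rule\<close> can be fixed to the exact partial sum. The 2 in each round pays for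
  setting the counter and testing the guard.\<close>

lemma for_all_rule:
  fixes I :: "nat \<Rightarrow> state \<Rightarrow> bool"
  assumes K: "0 < K" and n: "neval e \<sigma> = n" and I0: "I 0 (tick (1 + ncost e) \<sigma>)"
    and wr: "\<And>i \<tau> k. I i \<tau> \<Longrightarrow> I i (tick k (nwrite x 0 i \<tau>))"
    and step: "\<And>i \<tau>. \<lbrakk>i < n; I i \<tau>; nmem \<tau> x 0 = i;
        \<And>y. y \<notin> nwr (for_all x e c) \<Longrightarrow> nmem \<tau> y = nmem \<sigma> y;
        \<And>y. y \<notin> cwr c \<Longrightarrow> cmem \<tau> y = cmem \<sigma> y; weights \<tau> = weights \<sigma>\<rbrakk>
      \<Longrightarrow> ok K c \<tau> (t i) \<and> I (Suc i) (run c \<tau>)"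
    and T: "1 + ncost e + (\<Sum>i<n. 2 + t i) \<le> T"
  shows "I n (run (for_all x e c) \<sigma>) \<and> ok K (for_all x e c) \<sigma> T"
proof -
  have "\<exists>A. (I n (run (for_all x e c) \<sigma>) \<and> A = (\<Sum>i<n. 2 + t i))
      \<and> ok K (for_all x e c) \<sigma> (1 + ncost e + A)"
  proof (rule For_rule[where I = "\<lambda>i A \<tau>. I i \<tau> \<and> A = (\<Sum>j<i. 2 + t j)"])
    fix i A \<tau>
    assume *: "i < n" "I i \<tau> \<and> A = (\<Sum>j<i. 2 + t j)" "nmem \<tau> x 0 = i"
      "\<And>y. y \<notin> nwr (for_all x e c) \<Longrightarrow> nmem \<tau> y = nmem \<sigma> y"
      "\<And>y. y \<notin> cwr c \<Longrightarrow> cmem \<tau> y = cmem \<sigma> y" "weights \<tau> = weights \<sigma>"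
    then show "\<exists>u. ok K c \<tau> u \<and> I (Suc i) (run c \<tau>) \<and> A + (1 + bcost TT + u) = (\<Sum>j<Suc i. 2 + t j)"
      using step[of i \<tau>] by (intro exI[of _ "t i"]) auto
  qed (use assms in auto)
  with T show ?thesis
    using ok_mono by blast
qed

lemma for_all_const:
  fixes I :: "nat \<Rightarrow> state \<Rightarrow> bool"
  assumes K: "0 < K" and n: "neval e \<sigma> = n" and I0: "I 0 (tick (1 + ncost e) \<sigma>)"
    and wr: "\<And>i \<tau> k. I i \<tau> \<Longrightarrow> I i (tick k (nwrite x 0 i \<tau>))"
    and step: "\<And>i \<tau>. \<lbrakk>i < n; I i \<tau>; nmem \<tau> x 0 = i;
        \<And>y. y \<notin> nwr (for_all x e c) \<Longrightarrow> nmem \<tau> y = nmem \<sigma> y;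
        \<And>y. y \<notin> cwr c \<Longrightarrow> cmem \<tau> y = cmem \<sigma> y; weights \<tau> = weights \<sigma>\<rbrakk>
      \<Longrightarrow> ok K c \<tau> t \<and> I (Suc i) (run c \<tau>)"
    and T: "1 + ncost e + n * (2 + t) \<le> T"
  shows "I n (run (for_all x e c) \<sigma>) \<and> ok K (for_all x e c) \<sigma> T"
  by (rule for_all_rule[where t = "\<lambda>_. t"]) (use assms in auto)

section \<open>Polynomials as numbers\<close>

lemma CARD_gt1 [simp]: "1 < CARD('b::prime_card)" "Suc 0 < CARD('b)" "0 < CARD('b)" "2 \<le> CARD('b)"
  using nontriv[where 'a = 'b] by auto

lemma of_nat_mod_ring_eq_0_iff:
  "i < CARD('b::prime_card) \<Longrightarrow> (of_nat i :: 'b mod_ring) = 0 \<longleftrightarrow> i = 0"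
  using of_nat_0_mod_ring_dvd[of i, where 'a = 'b] dvd_imp_le[of "CARD('b)" i] by auto

lemma of_nat_mod_CARD [simp]: "(of_nat (i mod CARD('b::prime_card)) :: 'b mod_ring) = of_nat i"
  by (metis of_nat_mod_CHAR semiring_char_mod_ring)

lemma of_nat_mod_ring_inj:
  assumes "i < CARD('b::prime_card)" "j < CARD('b)" "(of_nat i :: 'b mod_ring) = of_nat j"
  shows "i = j"
proof -
  have "i = j" if ij: "i \<le> j" "j < CARD('b)" "(of_nat i :: 'b mod_ring) = of_nat j" for i j :: nat
  proof -
    have "(of_nat (j - i) :: 'b mod_ring) = 0" using ij by (simp add: of_nat_diff)
    then have "j - i = 0" using of_nat_mod_ring_eq_0_iff[of "j - i", where 'b = 'b] ij by linarith
    then show ?thesis using ij by simp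
  qed
  from this[of i j] this[of j i] assms show ?thesis by (cases "i \<le> j") auto
qed

lemma coeff_tr:
  "Polynomial.coeff (tr m k :: 'b::prime_card mod_ring poly) i
     = (if i < m then of_nat (k div CARD('b) ^ i) else 0)"
proof -
  have "Polynomial.coeff (tr m k :: 'b mod_ring poly) i
      = (\<Sum>j<m. if j = i then of_nat (k div CARD('b) ^ j) else 0)"
    unfolding tr_def coeff_sum by (intro sum.cong) (auto simp: coeff_monom)
  then show ?thesis by simp
qed

lemma coeff_nat_poly:
  "Polynomial.coeff (nat_poly n :: 'b::prime_card mod_ring poly) i = of_nat (n div CARD('b) ^ i)"
proof -
  have "n div CARD('b) ^ i = 0" if "n < i"
  proof -
    have "n < CARD('b) ^ n" by (rule power_gt_expt) simp
    also have "\<dots> \<le> CARD('b) ^ i" using that by (intro power_increasing) auto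
    finally show ?thesis by simp
  qed
  then show ?thesis by (simp add: nat_poly_def coeff_tr)
qed

text \<open>Makes \<open>tr m\<close> periodic with period \<open>b ^ m\<close>; this reduces
  character sums over long ranges of \<open>k\<close> to sums over one period.\<close>

lemma tr_eq_nat_poly:
  "(tr m k :: 'b::prime_card mod_ring poly) = nat_poly (k mod CARD('b) ^ m)"
proof (rule poly_eqI)
  fix i
  show "Polynomial.coeff (tr m k :: 'b mod_ring poly) i = Polynomial.coeff (nat_poly (k mod CARD('b) ^ m)) i"
  proof (cases "i < m")
    case True
    then obtain j where m: "m = i + Suc j" using less_iff_Suc_add by fastforce
    have "k mod CARD('b) ^ m div CARD('b) ^ i = k div CARD('b) ^ i mod CARD('b) ^ Suc j"
      unfolding m power_add mod_mult2_eq by simp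
    then have "k mod CARD('b) ^ m div CARD('b) ^ i mod CARD('b) = k div CARD('b) ^ i mod CARD('b)"
      by (simp add: mod_mod_cancel)
    then show ?thesis using True by (simp add: coeff_tr coeff_nat_poly) (metis of_nat_mod_CARD)
  next
    case False
    have "k mod CARD('b) ^ m < CARD('b) ^ m" by simp
    also have "\<dots> \<le> CARD('b) ^ i" using False by (intro power_increasing) auto
    finally show ?thesis using False by (simp add: coeff_tr coeff_nat_poly)
  qed
qed

lemma nat_poly_digit:
  assumes "c < CARD('b::prime_card)"
  shows "(nat_poly (n * CARD('b) + c) :: 'b mod_ring poly) = pCons (of_nat c) (nat_poly n)"
proof (rule poly_eqI)
  fix i
  have *: "(n * CARD('b) + c) div CARD('b) = n"
    using assms by simp
  have "(n * CARD('b) + c) div (CARD('b) * CARD('b) ^ j) = n div CARD('b) ^ j" for j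
    using * by (simp only: div_mult2_eq)
  then show "Polynomial.coeff (nat_poly (n * CARD('b) + c) :: 'b mod_ring poly) i
      = Polynomial.coeff (pCons (of_nat c) (nat_poly n)) i"
    by (cases i) (simp_all add: coeff_nat_poly)
qed

lemma nat_poly_rec:
  "(nat_poly n :: 'b::prime_card mod_ring poly)
     = pCons (of_nat (n mod CARD('b))) (nat_poly (n div CARD('b)))"
  using nat_poly_digit[of "n mod CARD('b)" "n div CARD('b)", where 'b = 'b] by simp

lemma nat_poly_0 [simp]: "nat_poly 0 = 0"
  by (rule poly_eqI) (simp add: coeff_nat_poly)

lemma nat_poly_const: "c < CARD('b::prime_card) \<Longrightarrow> (nat_poly c :: 'b mod_ring poly) = [:of_nat c:]"
  using nat_poly_digit[where n = 0] by simp

lemma nat_poly_1 [simp]: "nat_poly (Suc 0) = 1" "nat_poly 1 = 1"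
  by (simp_all add: nat_poly_const)

lemma inj_nat_poly: "inj (nat_poly :: nat \<Rightarrow> 'b::prime_card mod_ring poly)"
proof (rule injI)
  fix x y :: nat
  assume "(nat_poly x :: 'b mod_ring poly) = nat_poly y"
  then show "x = y"
  proof (induction x arbitrary: y rule: less_induct)
    case (less x)
    have "pCons (of_nat (x mod CARD('b))) (nat_poly (x div CARD('b)))
        = (pCons (of_nat (y mod CARD('b))) (nat_poly (y div CARD('b))) :: 'b mod_ring poly)"
      using less.prems unfolding nat_poly_rec[symmetric] .
    then have "x mod CARD('b) = y mod CARD('b)" and
        div: "(nat_poly (x div CARD('b)) :: 'b mod_ring poly) = nat_poly (y div CARD('b))"
      using of_nat_mod_ring_inj[of "x mod CARD('b)" "y mod CARD('b)", where 'b = 'b] by (auto simp del: of_nat_mod_CARD)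
    \<comment> \<open>For \<open>x = 0\<close> the quotient is not smaller than \<open>x\<close>, so
      the induction hypothesis is out of reach; a second induction shows instead that only 0 yields
      the zero polynomial.\<close>
    moreover have "x div CARD('b) = y div CARD('b)"
    proof (cases "x = 0")
      case True
      have "y = 0" if "(nat_poly y :: 'b mod_ring poly) = 0" for y
        using that
      proof (induction y rule: less_induct)
        case (less y)
        show ?case
        proof (rule ccontr)
          assume "y \<noteq> 0"
          have "of_nat (y mod CARD('b)) = (0 :: 'b mod_ring)" "(nat_poly (y div CARD('b)) :: 'b mod_ring poly) = 0"
            using less.prems nat_poly_rec[of y, where 'b = 'b] by (auto simp del: of_nat_mod_CARD)
          then have "y mod CARD('b) = 0" "y div CARD('b) = 0"
            using less.IH[of "y div CARD('b)"] \<open>y \<noteq> 0\<close> of_nat_mod_ring_eq_0_iff[of "y mod CARD('b)", where 'b = 'b]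
            by (auto simp del: of_nat_mod_CARD)
          then show False using \<open>y \<noteq> 0\<close> div_mod_decomp[of y "CARD('b)"] by simp
        qed
      qed
      then show ?thesis using div True by auto
    next
      case False
      then show ?thesis using less.IH[of "x div CARD('b)", OF _ div] by simp
    qed
    ultimately show ?case using div_mod_decomp[of x "CARD('b)"] div_mod_decomp[of y "CARD('b)"] by simp
  qed
qed

lemma surj_nat_poly: "surj (nat_poly :: nat \<Rightarrow> 'b::prime_card mod_ring poly)"
proof -
  have "\<exists>n. q = nat_poly n" for q :: "'b mod_ring poly"
  proof (induction q)
    case (pCons a q)
    then obtain c n where "c < CARD('b)" "a = of_nat c" "q = nat_poly n" using surj_of_nat_mod_ring[of a] by auto
    then show ?case by (intro exI[of _ "n * CARD('b) + c"]) (simp add: nat_poly_digit)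
  qed (auto intro: exI[of _ 0])
  then show ?thesis by (auto simp: surj_def)
qed

text \<open>The content of a memory cell that represents a polynomial. Invariants are stated through
  \<open>enc\<close>, so that a claim about a number in memory is an identity between
  polynomials.\<close>

definition enc :: "'b::prime_card mod_ring poly \<Rightarrow> nat" where
  "enc = inv_into UNIV nat_poly"

lemma nat_poly_enc [simp]: "nat_poly (enc q) = q"
  by (simp add: enc_def surj_f_inv_f surj_nat_poly)

lemma enc_nat_poly [simp]: "enc (nat_poly n :: 'b::prime_card mod_ring poly) = n"
  by (simp add: enc_def inv_f_f inj_nat_poly)

lemma enc_eq_iff [simp]: "enc q = enc r \<longleftrightarrow> q = r"
  by (metis nat_poly_enc)

lemma enc_0 [simp]: "enc 0 = 0" by (metis enc_nat_poly nat_poly_0)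

lemma enc_1 [simp]: "enc 1 = Suc 0" by (metis enc_nat_poly nat_poly_1(1))

lemma enc_eq_0_iff [simp]: "enc q = 0 \<longleftrightarrow> q = 0" by (metis enc_0 enc_eq_iff)

lemma nat_poly_eq_0_iff [simp]: "nat_poly n = (0 :: 'b::prime_card mod_ring poly) \<longleftrightarrow> n = 0"
  by (metis enc_nat_poly nat_poly_0)

lemma enc_pCons:
  "c < CARD('b::prime_card) \<Longrightarrow> enc (pCons (of_nat c) (q :: 'b mod_ring poly)) = enc q * CARD('b) + c"
  using enc_nat_poly[of "enc q * CARD('b) + c", where 'b = 'b] by (simp add: nat_poly_digit)

lemma enc_less:
  assumes "Polynomial.degree (q :: 'b::prime_card mod_ring poly) < k"
  shows "enc q < CARD('b) ^ k"
  using assms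
proof (induction q arbitrary: k)
  case (pCons a q)
  obtain c where c: "c < CARD('b)" "a = of_nat c" using surj_of_nat_mod_ring by blast
  obtain k' where k: "k = Suc k'" using pCons.prems by (cases k) auto
  have "enc q < CARD('b) ^ k'"
  proof (cases "q = 0")
    case False
    then show ?thesis using pCons k by simp
  qed simp
  then have "enc q * CARD('b) + c < CARD('b) ^ k' * CARD('b)"
    using c(1) mult_le_mono1[of "Suc (enc q)" "CARD('b) ^ k'" "CARD('b)"] by simp
  then show ?case using c k by (simp add: enc_pCons mult.commute)
qed simp

lemma degree_nat_poly_less:
  assumes "n < CARD('b::prime_card) ^ k" "0 < k"
  shows "Polynomial.degree (nat_poly n :: 'b mod_ring poly) < k"
proof -
  have "Polynomial.degree (nat_poly n :: 'b mod_ring poly) \<le> k - 1"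
  proof (rule degree_le, intro allI impI)
    fix i assume "k - 1 < i"
    then have "CARD('b) ^ k \<le> CARD('b) ^ i" by (intro power_increasing) auto
    with assms(1) have "n div CARD('b) ^ i = 0" by (intro div_less) linarith
    then show "Polynomial.coeff (nat_poly n :: 'b mod_ring poly) i = 0"
      by (simp add: coeff_nat_poly)
  qed
  with assms(2) show ?thesis by simp
qed

lemma nat_poly_image: "0 < k \<Longrightarrow>
  (nat_poly :: nat \<Rightarrow> 'b::prime_card mod_ring poly) ` {..<CARD('b) ^ k} = {q. Polynomial.degree q < k}"
  using enc_less by (force simp: degree_nat_poly_less intro!: image_eqI[where x = "enc _"])

lemma degree_nat_poly:
  "Polynomial.degree (nat_poly n :: 'b::prime_card mod_ring poly)
     = (if n < CARD('b) then 0 else Suc (Polynomial.degree (nat_poly (n div CARD('b)) :: 'b mod_ring poly)))"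
proof (cases "n < CARD('b)")
  case False
  then have "n div CARD('b) \<noteq> 0" by (simp add: div_eq_0_iff)
  then have "nat_poly (n div CARD('b)) \<noteq> (0 :: 'b mod_ring poly)" by simp
  then show ?thesis using False nat_poly_rec[of n, where 'b = 'b] by simp
qed (simp add: nat_poly_const)

lemma enc_ge:
  assumes "Polynomial.degree (q :: 'b::prime_card mod_ring poly) = k" "q \<noteq> 0"
  shows "CARD('b) ^ k \<le> enc q"
proof (cases "k = 0")
  case True
  have "0 < enc q" using assms by (simp add: neq0_conv[symmetric] del: neq0_conv)
  then show ?thesis using True by (simp add: Suc_le_eq)
next
  case False
  then show ?thesis using degree_nat_poly_less[of "enc q" k, where 'b = 'b] assms by (cases "CARD('b) ^ k \<le> enc q") auto
qed

lemma nat_poly_mult_CARD: "(nat_poly (n * CARD('b::prime_card)) :: 'b mod_ring poly) = [:0, 1:] * nat_poly n"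
  using nat_poly_digit[of 0 n, where 'b = 'b] by simp

text \<open>Quotient and remainder by \<open>b ^ h\<close> are the coefficients from
  \<open>x ^ h\<close> on and those below it; this is what permits arithmetic on halves.\<close>

lemma nat_poly_shift:
  "n < CARD('b::prime_card) ^ h \<Longrightarrow> (nat_poly (k * CARD('b) ^ h + n) :: 'b mod_ring poly)
     = Polynomial.monom 1 h * nat_poly k + nat_poly n"
proof (induction h arbitrary: n)
  case 0
  then show ?case by (simp add: monom_0)
next
  case (Suc h)
  let ?b = "CARD('b)"
  have n: "n div ?b < ?b ^ h" using Suc.prems by (simp add: less_mult_imp_div_less mult.commute)
  have "k * ?b ^ Suc h + n = (k * ?b ^ h + n div ?b) * ?b + n mod ?b"
    by (simp add: algebra_simps)
  then have "(nat_poly (k * ?b ^ Suc h + n) :: 'b mod_ring poly)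
      = pCons (of_nat (n mod ?b)) (nat_poly (k * ?b ^ h + n div ?b))"
    by (simp add: nat_poly_digit del: of_nat_mod_CARD)
  also have "\<dots> = Polynomial.monom 1 (Suc h) * nat_poly k + nat_poly n"
    using nat_poly_rec[of n, where 'b = 'b] by (simp add: Suc.IH[OF n] monom_Suc)
  finally show ?case .
qed

text \<open>Addition of polynomials has no carries, hence acts on the two halves independently; the
  sum of the lower halves again has degree below \<open>h\<close>.\<close>

lemma enc_add_split:
  assumes "0 < h"
  shows "enc (nat_poly e + nat_poly f :: 'b::prime_card mod_ring poly)
    = enc (nat_poly (e div CARD('b) ^ h) + nat_poly (f div CARD('b) ^ h) :: 'b mod_ring poly) * CARD('b) ^ h
      + enc (nat_poly (e mod CARD('b) ^ h) + nat_poly (f mod CARD('b) ^ h) :: 'b mod_ring poly)"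
    (is "_ = enc ?u * ?H + enc ?v")
proof -
  have "Polynomial.degree ?v < h"
    using assms by (intro degree_add_less degree_nat_poly_less) auto
  then have "enc ?v < ?H" by (rule enc_less)
  then have "(nat_poly (enc ?u * ?H + enc ?v) :: 'b mod_ring poly) = Polynomial.monom 1 h * ?u + ?v"
    by (simp add: nat_poly_shift)
  also have "\<dots> = nat_poly e + nat_poly f"
    using nat_poly_shift[of "e mod ?H" h "e div ?H", where 'b = 'b]
      nat_poly_shift[of "f mod ?H" h "f div ?H", where 'b = 'b] by (simp add: algebra_simps)
  finally show ?thesis by (metis enc_nat_poly)
qed

text \<open>The recursion by which the addition table fills itself: the last digits are added modulo
  \<open>b\<close>, and the rest is an entry with both indices divided by \<open>b\<close>.\<close>

lemma enc_add_digit: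
  "enc (nat_poly i + nat_poly k :: 'b::prime_card mod_ring poly)
    = enc (nat_poly (i div CARD('b)) + nat_poly (k div CARD('b)) :: 'b mod_ring poly) * CARD('b)
      + (i + k) mod CARD('b)"
proof -
  have "(nat_poly i + nat_poly k :: 'b mod_ring poly)
      = pCons (of_nat ((i + k) mod CARD('b))) (nat_poly (i div CARD('b)) + nat_poly (k div CARD('b)))"
    using nat_poly_rec[of i, where 'b = 'b] nat_poly_rec[of k, where 'b = 'b] by simp
  then show ?thesis by (simp add: enc_pCons del: of_nat_mod_CARD)
qed

lemma enc_add_less:
  assumes "0 < k" "e < CARD('b::prime_card) ^ k" "f < CARD('b) ^ k"
  shows "enc (nat_poly e + nat_poly f :: 'b mod_ring poly) < CARD('b) ^ k"
  using assms by (intro enc_less degree_add_less degree_nat_poly_less) auto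

section \<open>Laurent expansions of quotients of polynomials and the map \<open>v_m\<close>\<close>

lemma poly_fls_nth:
  "fls_nth (poly_fls q) k = (if k \<le> 0 then Polynomial.coeff q (nat (- k)) else 0)"
    for q :: "'b::prime_card mod_ring poly"
proof -
  have nth_sum: "fls_nth (sum f A) k = (\<Sum>i\<in>A. fls_nth (f i) k)"
      for f :: "nat \<Rightarrow> 'b mod_ring fls" and A
    by (induction A rule: infinite_finite_induct) auto
  have "fls_nth (poly_fls q) k
      = (\<Sum>i\<le>Polynomial.degree q. if i = nat (- k) \<and> k \<le> 0 then Polynomial.coeff q i else 0)"
    unfolding poly_fls_def nth_sum
    by (intro sum.cong) (auto simp: fls_X_intpow_times_conv_shift)
  also have "\<dots> = (if k \<le> 0 then Polynomial.coeff q (nat (- k)) else 0)"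
    by (auto simp: coeff_eq_0)
  finally show ?thesis .
qed

lemma poly_fls_add: "poly_fls (q + r) = poly_fls q + poly_fls r"
  by (rule fls_eqI) (simp add: poly_fls_nth)

lemma poly_fls_0 [simp]: "poly_fls 0 = 0"
  by (rule fls_eqI) (simp add: poly_fls_nth)

lemma poly_fls_smult: "poly_fls (Polynomial.smult a q) = fls_const a * poly_fls q"
  by (rule fls_eqI) (simp add: poly_fls_nth)

text \<open>The series variable is \<open>1/x\<close>, so multiplication by \<open>x\<close> lowers
  every exponent by one.\<close>

lemma poly_fls_pCons_0: "poly_fls (pCons 0 q) = fls_shift 1 1 * poly_fls q"
proof (rule fls_eqI)
  fix n :: int
  have "fls_shift 1 1 * poly_fls q = fls_shift 1 (poly_fls q)"
    using fls_X_intpow_times_conv_shift(1)[of "-1" "poly_fls q"] by simp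
  moreover have "nat (- n) = Suc (nat (- (n + 1)))" if "n < 0" using that by simp
  ultimately show "fls_nth (poly_fls (pCons 0 q)) n = fls_nth (fls_shift 1 1 * poly_fls q) n"
    by (cases "n = 0") (auto simp: poly_fls_nth)
qed

lemma poly_fls_mult: "poly_fls (q * r) = poly_fls q * poly_fls r"
proof (induction q)
  case (pCons a q)
  have "pCons a q = [:a:] + pCons 0 q"
    by simp
  moreover have "poly_fls [:a:] = fls_const a"
    by (rule fls_eqI) (auto simp: poly_fls_nth coeff_pCons split: nat.split)
  ultimately have "poly_fls (pCons a q) = fls_const a + fls_shift 1 1 * poly_fls q"
    by (simp only: poly_fls_add poly_fls_pCons_0)
  then show ?case
    by (simp add: poly_fls_add poly_fls_pCons_0 poly_fls_smult pCons.IH algebra_simps)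
qed simp

lemma poly_fls_subdegree: "q \<noteq> 0 \<Longrightarrow> fls_subdegree (poly_fls q) = - int (Polynomial.degree q)"
  by (intro fls_subdegree_eqI) (auto simp: poly_fls_nth coeff_eq_0)

lemma poly_fls_eq_0_iff [simp]: "poly_fls q = 0 \<longleftrightarrow> q = 0"
proof
  assume "poly_fls q = 0"
  then have "fls_nth (poly_fls q) (- int (Polynomial.degree q)) = 0" by simp
  then show "q = 0" by (simp add: poly_fls_nth)
qed simp

definition lcoef :: "'b::prime_card mod_ring poly \<Rightarrow> 'b mod_ring poly \<Rightarrow> nat \<Rightarrow> 'b mod_ring" where
  "lcoef p h l = fls_nth (poly_fls h / poly_fls p) (int l)"

lemma lcoef_0 [simp]: "lcoef p 0 l = 0"
  by (simp add: lcoef_def)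

lemma lcoef_add: "lcoef p (h + k) l = lcoef p h l + lcoef p k l"
  by (simp add: lcoef_def poly_fls_add add_divide_distrib)

text \<open>\<open>h/p\<close> and \<open>(h mod p)/p\<close> differ by a polynomial, which
  contributes to no negative power of \<open>x\<close>. Hence \<open>v_m\<close> and the characters
  below depend only on the residue class.\<close>

lemma lcoef_mod: "p \<noteq> 0 \<Longrightarrow> 1 \<le> l \<Longrightarrow> lcoef p (h mod p) l = lcoef p h l"
proof -
  assume p: "p \<noteq> 0" and l: "1 \<le> l"
  have "lcoef p h l = lcoef p (p * (h div p)) l + lcoef p (h mod p) l"
    by (simp add: lcoef_add[symmetric])
  also have "lcoef p (p * (h div p)) l = 0"
    using p l by (simp add: lcoef_def poly_fls_mult poly_fls_nth)
  finally show ?thesis by simp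
qed

lemma lcoef_subdegree:
  assumes "p \<noteq> 0" "h \<noteq> 0"
  shows "fls_subdegree (poly_fls h / poly_fls p) = int (Polynomial.degree p) - int (Polynomial.degree h)"
proof -
  have "poly_fls h / poly_fls p * poly_fls p = poly_fls h" using assms by simp
  then have "fls_subdegree (poly_fls h / poly_fls p * poly_fls p) = - int (Polynomial.degree h)"
    using assms by (simp add: poly_fls_subdegree)
  then show ?thesis using assms
    by (subst (asm) fls_subdegree_mult) (auto simp: poly_fls_subdegree)
qed

lemma lcoef_below:
  "p \<noteq> 0 \<Longrightarrow> int l < int (Polynomial.degree p) - int (Polynomial.degree h) \<Longrightarrow> lcoef p h l = 0"
  by (cases "h = 0") (auto simp: lcoef_def lcoef_subdegree)

lemma lcoef_lead:
  assumes "p \<noteq> 0" "h \<noteq> 0" "Polynomial.degree h + l = Polynomial.degree p"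
  shows "lcoef p h l \<noteq> 0"
proof -
  have "int l = fls_subdegree (poly_fls h / poly_fls p)"
    using assms by (simp add: lcoef_subdegree flip: assms(3))
  then show ?thesis using assms by (simp add: lcoef_def)
qed

lemma v_quot_lcoef:
  "v_quot m h p = (\<Sum>l=1..m. of_int (to_int_mod_ring (lcoef p h l)) / real CARD('b) ^ l)"
    for p :: "'b::prime_card mod_ring poly"
  by (simp add: v_quot_def v_map_def lcoef_def)

lemma v_quot_mod: "p \<noteq> 0 \<Longrightarrow> v_quot m (h mod p) p = v_quot m h p"
  by (simp add: v_quot_lcoef lcoef_mod)

lemma v_quot_cong: "p \<noteq> 0 \<Longrightarrow> h mod p = k mod p \<Longrightarrow> v_quot m h p = v_quot m k p"
  by (metis v_quot_mod)

lemma to_int_mod_ring_bounds: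
  "0 \<le> to_int_mod_ring (x :: 'b::prime_card mod_ring)" "to_int_mod_ring x < int CARD('b)"
  by (transfer, simp)+

text \<open>Maximal digits contribute telescoping differences of powers of \<open>1/b\<close>. The
  subtracted last term is kept because it later yields a strict inequality.\<close>

lemma digit_sum_less:
  fixes b :: nat and f :: "nat \<Rightarrow> real"
  assumes "1 < b" "\<And>l. f l \<le> real b - 1"
  shows "(\<Sum>l=Suc k..k + n. f l / real b ^ l) \<le> 1 / real b ^ k - 1 / real b ^ (k + n)"
proof (induction n)
  case (Suc n)
  have "f (Suc (k + n)) / real b ^ Suc (k + n) \<le> (real b - 1) / real b ^ Suc (k + n)"
    using assms by (intro divide_right_mono) auto
  also have "\<dots> = 1 / real b ^ (k + n) - 1 / real b ^ (k + Suc n)"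
    using assms(1) by (simp add: field_simps)
  finally show ?case using Suc by simp
qed simp

text \<open>The first non-zero digit of the expansion stands at position \<open>L\<close>, which
  puts the value between \<open>1/b^L\<close>, included, and \<open>1/b^(L - 1)\<close>, excluded.
  Thus the logarithm in \<chi> sees nothing but the degree of the residue.\<close>

lemma v_quot_floor:
  fixes p h :: "'b::prime_card mod_ring poly"
  assumes m: "Polynomial.degree p = m" "0 < m" and h: "\<not> p dvd h"
  defines "L \<equiv> m - Polynomial.degree (h mod p)"
  shows "1 \<le> L" "L \<le> m" "v_quot m h p \<noteq> 0" "\<lfloor>log (real CARD('b)) (v_quot m h p)\<rfloor> = - int L"
proof -
  let ?b = "real CARD('b)"
  define c where "c l = (of_int (to_int_mod_ring (lcoef p (h mod p) l)) :: real)" for l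
  have p: "p \<noteq> 0" using m by auto
  have h0: "h mod p \<noteq> 0" using h by (simp add: mod_eq_0_iff_dvd)
  have deg: "Polynomial.degree (h mod p) < m"
    using degree_mod_less'[OF p h0] m by simp
  show L: "1 \<le> L" "L \<le> m" using deg by (auto simp: L_def)
  have c0: "0 \<le> c l" "c l \<le> ?b - 1" for l
    using to_int_mod_ring_bounds[of "lcoef p (h mod p) l"] by (auto simp: c_def)
  have cz: "c l = 0" if "l < L" for l
    using that p deg m by (auto simp: c_def L_def intro!: lcoef_below)
  \<comment> \<open>The leading coefficient is non-zero in the field, and its representative is a
    non-negative integer.\<close>
  have cL: "1 \<le> c L"
  proof -
    have "lcoef p (h mod p) L \<noteq> 0"
      using lcoef_lead[OF p h0, of L] deg m by (simp add: L_def)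
    then have "to_int_mod_ring (lcoef p (h mod p) L) \<noteq> 0" by simp
    then have "1 \<le> to_int_mod_ring (lcoef p (h mod p) L)"
      using to_int_mod_ring_bounds(1)[of "lcoef p (h mod p) L"] by linarith
    then show ?thesis by (simp add: c_def)
  qed
  have v: "v_quot m h p = (\<Sum>l=1..m. c l / ?b ^ l)"
    unfolding v_quot_mod[OF p, of m h, symmetric] by (simp add: v_quot_lcoef c_def)
  also have "\<dots> = (\<Sum>l=L..m. c l / ?b ^ l)"
    using L cz by (intro sum.mono_neutral_right) auto
  finally have v: "v_quot m h p = (\<Sum>l=L..m. c l / ?b ^ l)" .
  have lo: "1 / ?b ^ L \<le> v_quot m h p"
  proof -
    have "1 / ?b ^ L \<le> c L / ?b ^ L" using cL by (intro divide_right_mono) auto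
    also have "\<dots> \<le> (\<Sum>l=L..m. c l / ?b ^ l)"
      using L c0 by (intro member_le_sum) auto
    finally show ?thesis using v by simp
  qed
  have "(\<Sum>l=Suc (L - 1)..L - 1 + (m - (L - 1)). c l / ?b ^ l) \<le> 1 / ?b ^ (L - 1) - 1 / ?b ^ (L - 1 + (m - (L - 1)))"
    by (rule digit_sum_less) (use c0 in auto)
  then have "v_quot m h p \<le> 1 / ?b ^ (L - 1) - 1 / ?b ^ m"
    using L v by simp
  then have hi: "v_quot m h p < 1 / ?b ^ (L - 1)"
    by (rule order_le_less_trans) simp
  have pos: "0 < v_quot m h p"
    by (rule order_less_le_trans[OF _ lo]) simp
  then show "v_quot m h p \<noteq> 0" by simp
  have b1: "1 < ?b" by simp
  have lb: "log ?b (1 / ?b ^ k) = - real k" for k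
  proof -
    have "1 / ?b ^ k = ?b powr (- real k)" by (simp add: powr_minus_divide powr_realpow)
    moreover have "log ?b (?b powr (- real k)) = - real k"
      by (rule log_powr_cancel) (use b1 in linarith)+
    ultimately show ?thesis by simp
  qed
  have l1: "- real L \<le> log ?b (v_quot m h p)"
  proof -
    have "log ?b (1 / ?b ^ L) \<le> log ?b (v_quot m h p)"
      using lo pos b1 by (intro log_mono) auto
    then show ?thesis by (simp add: lb)
  qed
  have l2: "log ?b (v_quot m h p) < - real L + 1"
  proof -
    have "log ?b (v_quot m h p) < log ?b (1 / ?b ^ (L - 1))"
      using hi pos b1 by (subst log_less_cancel_iff) auto
    also have "\<dots> = - real (L - 1)" by (rule lb)
    finally show ?thesis using L by (simp add: of_nat_diff)
  qed
  show "\<lfloor>log ?b (v_quot m h p)\<rfloor> = - int L"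
    using l1 l2 by (intro floor_unique) auto
qed

text \<open>The value of \<chi> on arguments whose first non-zero digit has position
  \<open>L\<close>, with the power written the way the program obtains it: by \<open>L\<close>
  divisions by \<open>b ^ (2 * min \<alpha> d - 1)\<close>.\<close>

definition chiL :: "nat \<Rightarrow> nat \<Rightarrow> nat \<Rightarrow> nat \<Rightarrow> real" where
  "chiL b \<alpha> d L = (real b - 1 - (1 / real b ^ (2 * min \<alpha> d - 1)) ^ L * (real b ^ (2 * min \<alpha> d) - 1))
     / (real b ^ \<alpha> * (real b ^ (2 * min \<alpha> d) - real b))"

lemma chi_v_quot_dvd:
  "p \<noteq> 0 \<Longrightarrow> p dvd h \<Longrightarrow> chi b \<alpha> d (v_quot m h p)
     = (real b - 1) / (real b ^ \<alpha> * (real b ^ (2 * min \<alpha> d) - real b))"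
proof -
  assume *: "p \<noteq> 0" "p dvd h"
  then have "v_quot m h p = v_quot m 0 p" by (intro v_quot_cong) auto
  then show ?thesis by (simp add: chi_def v_quot_lcoef)
qed

lemma chi_v_quot:
  fixes p h :: "'b::prime_card mod_ring poly"
  assumes m: "Polynomial.degree p = m" "0 < m" and h: "\<not> p dvd h" and d: "0 < min \<alpha> d"
  shows "chi CARD('b) \<alpha> d (v_quot m h p) = chiL CARD('b) \<alpha> d (m - Polynomial.degree (h mod p))"
proof -
  let ?L = "m - Polynomial.degree (h mod p)"
  have "real CARD('b) powi ((2 * int (min \<alpha> d) - 1) * - int ?L)
      = inverse (real CARD('b) ^ ((2 * min \<alpha> d - 1) * ?L))"
  proof -
    have "(2 * int (min \<alpha> d) - 1) * - int ?L = - int ((2 * min \<alpha> d - 1) * ?L)"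
      using d by (simp add: of_nat_diff)
    then show ?thesis by (simp only: power_int_minus power_int_of_nat)
  qed
  then show ?thesis using v_quot_floor[OF m h]
    by (simp add: chi_def chiL_def power_mult power_one_over divide_inverse power_inverse)
qed

section \<open>Characters\<close>

text \<open>The additive character of the residue ring modulo \<open>p\<close>: the standard
  character of the prime field, applied to the coefficient of \<open>1/x\<close> in
  \<open>h/p\<close>.\<close>

definition psi :: "'b::prime_card mod_ring poly \<Rightarrow> 'b mod_ring poly \<Rightarrow> complex" where
  "psi p h = cis (2 * pi * of_int (to_int_mod_ring (lcoef p h 1)) / real CARD('b))"

lemma norm_psi [simp]: "norm (psi p h) = 1"
  by (simp add: psi_def)

lemma psi_0 [simp]: "psi p 0 = 1"
  by (simp add: psi_def)

lemma psi_add: "psi p (h + k) = psi p h * psi p k" for p :: "'b::prime_card mod_ring poly"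
proof -
  let ?u = "to_int_mod_ring (lcoef p h 1)" and ?v = "to_int_mod_ring (lcoef p k 1)"
  let ?b = "int CARD('b)"
  \<comment> \<open>Addition in the field discards a multiple of \<open>b\<close>, that is, a whole
    number of turns of the angle.\<close>
  have "(?u + ?v) mod ?b = ?u + ?v - ?b * ((?u + ?v) div ?b)"
    by (simp add: minus_mult_div_eq_mod)
  then have *: "real_of_int ((?u + ?v) mod ?b)
      = of_int ?u + of_int ?v - real CARD('b) * of_int ((?u + ?v) div ?b)"
    by (metis of_int_add of_int_diff of_int_mult of_int_of_nat_eq)
  have "2 * pi * of_int ((?u + ?v) mod ?b) / real CARD('b)
      = 2 * pi * of_int ?u / real CARD('b) + 2 * pi * of_int ?v / real CARD('b)
        + 2 * pi * of_int (- ((?u + ?v) div ?b))"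
  proof -
    have "2 * pi * (x + y - c * q) / c = 2 * pi * x / c + 2 * pi * y / c + 2 * pi * - q"
      if "c \<noteq> 0" for x y c q :: real using that by (simp add: field_simps)
    then show ?thesis using * by simp
  qed
  then show ?thesis
    unfolding psi_def lcoef_add to_int_mod_ring_add
    by (simp only: cis_mult[symmetric] cis_multiple_2pi Ints_of_int mult_1_right)
qed

lemma psi_sum: "psi p (\<Sum>i\<in>A. f i) = (\<Prod>i\<in>A. psi p (f i))"
  by (induction A rule: infinite_finite_induct) (auto simp: psi_add)

lemma psi_eq_1_iff: "psi p h = 1 \<longleftrightarrow> lcoef p h 1 = 0" for p :: "'b::prime_card mod_ring poly"
proof
  assume *: "psi p h = 1"
  let ?u = "to_int_mod_ring (lcoef p h 1)"
  from * have "cos (2 * pi * of_int ?u / real CARD('b)) = 1"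
    unfolding psi_def by (metis cis.simps(1) one_complex.simps(1))
  then obtain n :: int where "2 * pi * of_int ?u / real CARD('b) = of_int n * 2 * pi"
    by (auto simp: cos_one_2pi_int)
  then have "real_of_int ?u = of_int n * of_int (int CARD('b))"
    by (simp add: field_simps)
  then have "real_of_int ?u = of_int (n * int CARD('b))" by simp
  then have u: "?u = n * int CARD('b)" by (simp only: of_int_eq_iff)
  have "?u = ?u mod int CARD('b)" using to_int_mod_ring_bounds[of "lcoef p h 1"] by simp
  also have "\<dots> = 0" by (subst u) simp
  finally show "lcoef p h 1 = 0" by simp
qed (simp add: psi_def)

lemma psi_mod: "p \<noteq> 0 \<Longrightarrow> psi p (h mod p) = psi p h"
  by (simp add: psi_def lcoef_mod del: One_nat_def)

lemma psi_cong: "p \<noteq> 0 \<Longrightarrow> h mod p = k mod p \<Longrightarrow> psi p h = psi p k"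
  by (metis psi_mod)

text \<open>With \<open>L = m - degree (h mod p)\<close>: for \<open>a < L\<close> the product of a
  polynomial of degree below \<open>a\<close> with the residue is too small in degree to reach the
  coefficient of \<open>1/x\<close>, and every term is 1. For \<open>a \<ge> L\<close> and
  \<open>p\<close> not dividing \<open>h\<close>, the factor \<open>x ^ (L - 1)\<close> moves the
  leading coefficient exactly to that place; translating the range of summation by it multiplies the
  sum by a number other than 1, so the sum vanishes.\<close>

lemma sum_psi:
  fixes p h :: "'b::prime_card mod_ring poly"
  assumes m: "Polynomial.degree p = m" "0 < m"
  shows "(\<Sum>n<CARD('b) ^ a. psi p (nat_poly n * h))
    = (if p dvd h \<or> a < m - Polynomial.degree (h mod p) then of_nat (CARD('b) ^ a) else 0)"
proof -
  let ?h = "h mod p"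
  have p: "p \<noteq> 0" using m by auto
  have eq: "psi p (q * h) = psi p (q * ?h)" for q
    by (rule psi_cong[OF p]) (simp add: mod_mult_right_eq)
  show ?thesis
  proof (cases "p dvd h \<or> a < m - Polynomial.degree ?h")
    case True
    have "psi p (nat_poly n * h) = 1" if "n < CARD('b) ^ a" for n
    proof (cases "p dvd h \<or> n = 0")
      case True
      then show ?thesis by (auto simp: eq mod_eq_0_iff_dvd[symmetric])
    next
      case False
      with True have "a < m - Polynomial.degree ?h" by auto
      moreover have "Polynomial.degree (nat_poly n :: 'b mod_ring poly) < a \<or> a = 0"
        using degree_nat_poly_less[OF that] by auto
      moreover have "a \<noteq> 0" using that False by (intro notI) auto
      ultimately have "Polynomial.degree (nat_poly n * ?h) + 1 < m"
        using degree_mult_le[of "nat_poly n" ?h] by auto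
      then have "lcoef p (nat_poly n * ?h) 1 = 0"
        using p m by (intro lcoef_below) auto
      then show ?thesis unfolding eq psi_eq_1_iff .
    qed
    then show ?thesis using True by simp
  next
    case False
    let ?L = "m - Polynomial.degree ?h"
    let ?x = "Polynomial.monom 1 (?L - 1) :: 'b mod_ring poly"
    let ?A = "{q :: 'b mod_ring poly. Polynomial.degree q < a}"
    have h0: "?h \<noteq> 0" using False by (auto simp: mod_eq_0_iff_dvd)
    have deg: "Polynomial.degree ?h < m"
      using degree_mod_less'[OF p h0] m by simp
    have a: "0 < a" using False deg by auto
    have "Polynomial.degree (?x * ?h) + 1 = m"
      using deg h0 by (simp add: degree_mult_eq degree_monom_eq)
    then have "lcoef p (?x * ?h) 1 \<noteq> 0"
      using p m h0 by (intro lcoef_lead) auto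
    then have x: "psi p (?x * ?h) \<noteq> 1" unfolding psi_eq_1_iff .
    have "(\<Sum>n<CARD('b) ^ a. psi p (nat_poly n * h)) = (\<Sum>q\<in>?A. psi p (q * h))"
      unfolding nat_poly_image[OF a, symmetric]
      by (subst sum.reindex) (auto intro: inj_on_subset[OF inj_nat_poly])
    also have "\<dots> = (\<Sum>q\<in>?A. psi p (q * ?h))" by (simp add: eq)
    also have "\<dots> = 0"
    proof -
      have "m - Polynomial.degree ?h - 1 < a" using False deg by linarith
      then have xa: "Polynomial.degree ?x < a" by (simp add: degree_monom_eq)
      have "(\<Sum>q\<in>?A. psi p (q * ?h)) = (\<Sum>q\<in>?A. psi p ((q + ?x) * ?h))"
        by (rule sum.reindex_bij_witness[of _ "\<lambda>q. q + ?x" "\<lambda>q. q - ?x"])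
          (use xa in \<open>auto intro: degree_add_less degree_diff_less\<close>)
      also have "\<dots> = psi p (?x * ?h) * (\<Sum>q\<in>?A. psi p (q * ?h))"
        unfolding distrib_right psi_add sum_distrib_left by (simp only: mult.commute)
      finally show ?thesis using x by simp
    qed
    finally show ?thesis using False by simp
  qed
qed

lemma sum_mod_blocks: "(\<Sum>l<c * B. f (l mod B)) = of_nat c * (\<Sum>n<B. f n)"
  for f :: "nat \<Rightarrow> complex"
proof -
  have "(\<Sum>l\<in>{k * B..<k * B + B}. f (l mod B)) = (\<Sum>n<B. f n)" for k
  proof -
    have "(\<Sum>l\<in>{k * B..<k * B + B}. f (l mod B)) = (\<Sum>n\<in>{0..<B}. f ((k * B + n) mod B))"
      by (subst sum.atLeastLessThan_shift_0) (simp add: o_def)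
    also have "\<dots> = (\<Sum>n<B. f n)" by (rule sum.cong) auto
    finally show ?thesis .
  qed
  then show ?thesis
    by (simp flip: sum.nat_group)
qed

text \<open>For \<open>a > m\<close> the truncations run through \<open>b ^ (a - m)\<close> full
  periods. The case distinction survives because neither \<open>a\<close> nor \<open>m\<close> can
  then lie below \<open>m - degree (h mod p)\<close>.\<close>

lemma sum_psi_tr:
  fixes p h :: "'b::prime_card mod_ring poly"
  assumes m: "Polynomial.degree p = m" "0 < m"
  shows "(\<Sum>l<CARD('b) ^ a. psi p (tr m l * h))
    = (if p dvd h \<or> a < m - Polynomial.degree (h mod p) then of_nat (CARD('b) ^ a) else 0)"
proof (cases "a \<le> m")
  case True
  have "tr m l = (nat_poly l :: 'b mod_ring poly)" if "l < CARD('b) ^ a" for l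
  proof -
    have "CARD('b) ^ a \<le> CARD('b) ^ m" using True by (intro power_increasing) auto
    then have "l < CARD('b) ^ m" using that by linarith
    then show ?thesis by (simp add: tr_eq_nat_poly)
  qed
  then have "(\<Sum>l<CARD('b) ^ a. psi p (tr m l * h)) = (\<Sum>l<CARD('b) ^ a. psi p (nat_poly l * h))"
    by (intro sum.cong) auto
  then show ?thesis by (simp only: sum_psi[OF m])
next
  case False
  then have e: "CARD('b) ^ a = CARD('b) ^ (a - m) * CARD('b) ^ m" by (simp flip: power_add)
  have "(\<Sum>l<CARD('b) ^ a. psi p (tr m l * h))
      = of_nat (CARD('b) ^ (a - m)) * (\<Sum>n<CARD('b) ^ m. psi p (nat_poly n * h))"
    unfolding e tr_eq_nat_poly by (rule sum_mod_blocks)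
  also have "\<dots> = (if p dvd h \<or> a < m - Polynomial.degree (h mod p) then of_nat (CARD('b) ^ a) else 0)"
  proof (cases "p dvd h")
    case True
    then show ?thesis by (simp add: sum_psi[OF m] e)
  next
    case nd: False
    moreover have "\<not> m < m - Polynomial.degree (h mod p)" "\<not> a < m - Polynomial.degree (h mod p)"
      using False by linarith+
    ultimately show ?thesis by (simp only: sum_psi[OF m]) simp
  qed
  finally show ?thesis .
qed

section \<open>Size and summability of the coefficients \<open>r\<close>\<close>

lemma mu1_eq:
  assumes "1 < b" "1 \<le> a" "b ^ (a - 1) \<le> l" "l < b ^ a"
  shows "mu1 b l = a"
  unfolding mu1_def
proof (rule the_equality)
  fix c assume c: "1 \<le> c \<and> b ^ (c - 1) \<le> l \<and> l < b ^ c"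
  have "b ^ (a - 1) < b ^ c" "b ^ (c - 1) < b ^ a" using assms c by linarith+
  then have "a - 1 < c" "c - 1 < a" using assms(1) power_less_imp_less_exp by blast+
  then show "c = a" using c assms by auto
qed (use assms in auto)

lemma ex_mu1:
  assumes "1 < b" "1 \<le> (l::nat)"
  obtains a where "1 \<le> a" "b ^ (a - 1) \<le> l" "l < b ^ a" "mu1 b l = a"
proof -
  define a where "a = (LEAST a. l < b ^ a)"
  have ex: "l < b ^ l" using assms by (intro power_gt_expt) auto
  have a: "l < b ^ a" unfolding a_def by (rule LeastI[of "\<lambda>a. l < b ^ a", OF ex])
  have a1: "1 \<le> a" using a assms by (cases a) auto
  have "\<not> l < b ^ (a - 1)" using a1 not_less_Least[of "a - 1" "\<lambda>a. l < b ^ a"] by (simp add: a_def)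
  then show thesis using that[of a] a a1 assms mu1_eq[of b a l] by auto
qed

lemma r_coeff_nonneg [simp]: "0 \<le> r_coeff b \<alpha> d l"
  by (simp add: r_coeff_def)

text \<open>\<open>l < b ^ mu1 b l\<close>, and the exponent in \<open>r_coeff\<close> is at least
  \<open>2 * mu1 b l\<close>. Comparison with inverse squares then provides the absolute convergence
  of all series below.\<close>

lemma r_coeff_le:
  assumes "1 < b" "1 \<le> l" "0 < min \<alpha> d"
  shows "r_coeff b \<alpha> d l \<le> inverse (real l ^ 2)"
proof -
  from ex_mu1[OF assms(1,2)] obtain a where a: "l < b ^ a" "mu1 b l = a" by blast
  have "l ^ 2 \<le> (b ^ a) ^ 2" using a by (intro power_mono) auto
  also have "\<dots> = b ^ (2 * a)" by (simp add: power_mult[symmetric] mult.commute)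
  also have "\<dots> \<le> b ^ (2 * min \<alpha> d * mu1 b l + \<alpha>)"
    using assms a by (intro power_increasing) (auto simp: trans_le_add1)
  finally have "real (l ^ 2) \<le> real (b ^ (2 * min \<alpha> d * mu1 b l + \<alpha>))" by (simp only: of_nat_le_iff)
  then show ?thesis unfolding r_coeff_def using assms
    by (simp add: inverse_eq_divide) (intro divide_left_mono, auto)
qed

lemma summable_r_coeff:
  assumes "1 < b" "0 < min \<alpha> d"
  shows "(\<lambda>l. r_coeff b \<alpha> d l) summable_on {1..}"
proof -
  have "summable (\<lambda>l. norm (r_coeff b \<alpha> d l))"
    by (rule summable_comparison_test[OF _ inverse_power_summable[of 2]])
      (use r_coeff_le[OF assms(1) _ assms(2)] in \<open>auto intro!: exI[of _ 1]\<close>)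
  then have "(\<lambda>l. r_coeff b \<alpha> d l) summable_on UNIV" by (rule norm_summable_imp_summable_on)
  then show ?thesis by (rule summable_on_subset_banach) auto
qed

section \<open>Irreducible polynomials and primitive elements\<close>

text \<open>At each prime divisor of \<open>a\<close> the multiplicity is 1 in \<open>a\<close> and
  at least 1 in \<open>c\<close>. It will be applied to \<open>frob m\<close> and the product of the
  \<open>frob i\<close> with \<open>i < m\<close>.\<close>

lemma dvd_if_squarefree:
  fixes a c :: "'a::{factorial_semiring, normalization_semidom_multiplicative}"
  assumes "a \<noteq> 0" "c \<noteq> 0" and sf: "\<And>q. Factorial_Ring.prime q \<Longrightarrow> q dvd a \<Longrightarrow> \<not> q ^ 2 dvd a \<and> q dvd c"
  shows "a dvd c"
proof (rule multiplicity_le_imp_dvd[OF assms(1)])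
  fix q :: 'a assume q: "Factorial_Ring.prime q"
  have "\<not> is_unit q" using q by auto
  show "multiplicity q a \<le> multiplicity q c"
  proof (cases "q dvd a")
    case True
    have "multiplicity q a < 2"
      by (rule multiplicity_lessI) (use sf[OF q True] assms(1) \<open>\<not> is_unit q\<close> in auto)
    moreover have "1 \<le> multiplicity q c"
      by (rule multiplicity_geI) (use sf[OF q True] assms(2) \<open>\<not> is_unit q\<close> in auto)
    ultimately show ?thesis by linarith
  qed (simp add: not_dvd_imp_multiplicity_0)
qed

text \<open>\<open>x ^ (b ^ n) - x\<close>, whose roots form the field with \<open>b ^ n\<close>
  elements.\<close>

abbreviation frob :: "nat \<Rightarrow> 'b::prime_card mod_ring poly" where
  "frob n \<equiv> Polynomial.monom 1 1 ^ (CARD('b) ^ n) - Polynomial.monom 1 1"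

lemma degree_frob: "0 < n \<Longrightarrow> Polynomial.degree (frob n :: 'b::prime_card mod_ring poly) = CARD('b) ^ n"
proof -
  assume n: "0 < n"
  have "1 < CARD('b) ^ n" using n one_less_power[of "CARD('b)" n] by simp
  then show ?thesis
    by (simp add: Polynomial.monom_power degree_monom_eq degree_add_eq_left del: add_uminus_conv_diff add: diff_conv_add_uminus)
qed

text \<open>The square of an irreducible \<open>q\<close> dividing \<open>frob n\<close> would force
  \<open>q\<close> to divide the derivative, here a unit; so \<open>frob n\<close> is
  squarefree.\<close>

lemma pderiv_frob: "0 < n \<Longrightarrow> pderiv (frob n :: 'b::prime_card mod_ring poly) = - 1"
proof -
  assume n: "0 < n"
  have "(of_nat (CARD('b) ^ n) :: 'b mod_ring) = 0"
    using n by (simp del: of_nat_power add: of_nat_power)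
  then show ?thesis
    by (simp add: Polynomial.monom_power pderiv_diff pderiv_monom monom_0)
qed

text \<open>A comparison of degrees. If no irreducible polynomial had degree \<open>m\<close>, every
  irreducible factor of \<open>frob m\<close> would have some degree \<open>i < m\<close> and divide
  \<open>frob i\<close>. Since \<open>frob m\<close> is squarefree, it would divide the product of
  the \<open>frob i\<close> over \<open>1 \<le> i < m\<close>; but the degree of that product is the
  sum of the \<open>b ^ i\<close>, which is less than \<open>b ^ m\<close>.\<close>

lemma ex_irreducible:
  assumes m: "0 < m"
  shows "\<exists>p :: 'b::prime_card mod_ring poly. Factorial_Ring.irreducible p \<and> Polynomial.degree p = m"
proof (rule ccontr)
  assume *: "\<not> ?thesis"
  let ?f = "frob m :: 'b mod_ring poly"
  let ?c = "\<Prod>i\<in>{1..<m}. (frob i :: 'b mod_ring poly)"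
  have nz: "frob i \<noteq> (0 :: 'b mod_ring poly)" if "0 < i" for i
    using degree_frob[OF that, where 'b = 'b] by auto
  have c0: "?c \<noteq> 0" using nz by auto
  have "?f dvd ?c"
  proof (rule dvd_if_squarefree[OF nz[OF m] c0])
    fix q :: "'b mod_ring poly" assume q: "Factorial_Ring.prime q" "q dvd ?f"
    then have irr: "Factorial_Ring.irreducible q" by auto
    have dq: "0 < Polynomial.degree q"
      using irr is_unit_iff_degree[of q] by (cases "Polynomial.degree q") (auto simp: Factorial_Ring.irreducible_def)
    have "\<not> m < Polynomial.degree q"
      using degree_divisor(2)[OF irr refl, of m] q(2) m by auto
    moreover have "Polynomial.degree q \<noteq> m" using * irr by auto
    ultimately have "Polynomial.degree q \<in> {1..<m}" using dq by auto
    then have "frob (Polynomial.degree q) dvd ?c" by (intro dvd_prodI) auto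
    moreover have "q dvd frob (Polynomial.degree q)" using degree_divisor(1)[OF irr refl] .
    moreover have "\<not> q ^ 2 dvd ?f"
    proof
      assume "q ^ 2 dvd ?f"
      then obtain r where r: "?f = q * (q * r)" by (auto simp: power2_eq_square dvd_def mult.assoc)
      have "pderiv ?f = q * (pderiv (q * r) + r * pderiv q)"
        unfolding r by (simp only: pderiv_mult distrib_left mult_ac)
      then have "q dvd - 1" unfolding pderiv_frob[OF m] by (metis dvd_triv_left)
      then show False using irr by (simp add: Factorial_Ring.irreducible_def)
    qed
    ultimately show "\<not> q ^ 2 dvd ?f \<and> q dvd ?c" by (meson dvd_trans)
  qed
  then have "CARD('b) ^ m \<le> Polynomial.degree ?c"
    using divides_degree c0 degree_frob[OF m, where 'b = 'b] by metis
  also have "Polynomial.degree ?c = (\<Sum>i\<in>{1..<m}. CARD('b) ^ i)"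
    proof -
    have "Polynomial.degree ?c = (\<Sum>i\<in>{1..<m}. Polynomial.degree (frob i :: 'b mod_ring poly))"
      by (rule degree_prod_eq_sum_degree) (use nz in force)
    also have "\<dots> = (\<Sum>i\<in>{1..<m}. CARD('b) ^ i)"
      by (rule sum.cong[OF refl], rule degree_frob) simp
    finally show ?thesis .
  qed
  also have "\<dots> < CARD('b) ^ m"
  proof -
    have "(\<Sum>i\<in>{1..<k}. CARD('b) ^ i) < CARD('b) ^ k" if "0 < k" for k
      using that
    proof (induction k)
      case (Suc k)
      show ?case
      proof (cases "k = 0")
        case False
        then have "(\<Sum>i\<in>{1..<Suc k}. CARD('b) ^ i) < CARD('b) ^ k + CARD('b) ^ k"
          using Suc by simp
        also have "\<dots> \<le> CARD('b) ^ Suc k"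
          unfolding power_Suc by (metis CARD_gt1(4) mult_2 mult_le_mono1)
        finally show ?thesis .
      qed simp
    qed simp
    then show ?thesis using m .
  qed
  finally show False by simp
qed

lemma ex_monic_irreducible:
  assumes m: "0 < m"
  shows "\<exists>p :: 'b::prime_card mod_ring poly. Factorial_Ring.irreducible p \<and> Polynomial.degree p = m
    \<and> lead_coeff p = 1"
proof -
  from ex_irreducible[OF m] obtain p :: "'b mod_ring poly" where
    p: "Factorial_Ring.irreducible p" "Polynomial.degree p = m" by blast
  let ?c = "inverse (lead_coeff p)"
  have c: "?c \<noteq> 0" using p by auto
  have "Factorial_Ring.irreducible (Polynomial.smult ?c p)"
    using p c irreducible_smult_field by blast
  moreover have "Polynomial.degree (Polynomial.smult ?c p) = m" using p c by simp
  moreover have "lead_coeff (Polynomial.smult ?c p) = 1" using c by simp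
  ultimately show ?thesis by blast
qed

section \<open>The residue field modulo an irreducible polynomial and orders of its elements\<close>

locale residue_field =
  fixes p :: "'b::prime_card mod_ring poly" and m M :: nat
  assumes irr: "Factorial_Ring.irreducible p" and deg: "Polynomial.degree p = m"
    and M_def: "M = CARD('b) ^ m - 1"
begin

sublocale F: poly_mod_type_irr "CARD('b)" p
  by unfold_locales (use irr in auto)

lemma m_pos: "0 < m"
  using F.degree_f deg by simp

lemma p_nz [simp]: "p \<noteq> 0" using irr by auto

lemma M_pos: "0 < M"
  using one_less_power[of "CARD('b)" m] m_pos by (simp add: M_def)

lemma carrier_R: "carrier F.R = {q. Polynomial.degree q < m}"
  by (auto simp: F.R_def F.carrier_irr_def deg)

lemma carrier_mult: "carrier (mult_of F.R) = R_set m"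
  by (auto simp: R_set_def carrier_mult_of F.R_def F.carrier_irr_def deg)

lemma one_R: "\<one>\<^bsub>F.R\<^esub> = 1" "\<one>\<^bsub>mult_of F.R\<^esub> = 1"
  by (simp_all add: F.R_def)

lemma finite_R_set: "finite (R_set m :: 'b mod_ring poly set)"
  using F.finite_carrier_mult_of unfolding carrier_mult .

sublocale Gr: group "mult_of F.R"
  using F.field_R.field_mult_group .

definition ord_of :: "'b mod_ring poly \<Rightarrow> nat" where
  "ord_of a = group.ord (mult_of F.R) a"

lemma mod_less: "a \<in> R_set m \<Longrightarrow> a mod p = a"
  by (auto simp: R_set_def mod_poly_less deg)

lemma mod_R_set: "\<not> p dvd a \<Longrightarrow> a mod p \<in> R_set m"
  using degree_mod_less'[of p a] by (auto simp: R_set_def deg mod_eq_0_iff_dvd)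

lemma R_set_not_dvd: "a \<in> R_set m \<Longrightarrow> \<not> p dvd a"
  using mod_less by (auto simp: R_set_def mod_eq_0_iff_dvd[symmetric])

lemma prime_p: "p dvd a * b \<longleftrightarrow> p dvd a \<or> p dvd b"
  using irr by (metis irreducible_imp_prime_elem_gcd prime_elem_dvd_mult_iff)

lemma prime_p_power: "p dvd a ^ n \<Longrightarrow> p dvd a"
  by (induction n) (use irr in \<open>auto simp: prime_p irreducible_def\<close>)

lemma pow_R_set: "a \<in> R_set m \<Longrightarrow> a ^ i mod p \<in> R_set m"
  using R_set_not_dvd prime_p_power mod_R_set by blast

lemma one_R_set: "1 \<in> R_set m"
  using m_pos by (simp add: R_set_def)

lemma pow_M: "a \<in> R_set m \<Longrightarrow> a ^ M mod p = 1"
  using F.element_power_order_eq_1[of a]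
  unfolding carrier_mult F.order_irr F.pow_irr_mult_of one_R deg M_def .

lemma ord_of_dvd: "a \<in> R_set m \<Longrightarrow> a ^ k mod p = 1 \<longleftrightarrow> ord_of a dvd k"
  using Gr.pow_eq_id[of a k] unfolding carrier_mult ord_of_def F.pow_irr_mult_of one_R by simp

lemma ord_of_dvd_M: "a \<in> R_set m \<Longrightarrow> ord_of a dvd M"
  using ord_of_dvd pow_M by blast

lemma ord_of_pos: "a \<in> R_set m \<Longrightarrow> 0 < ord_of a"
  using ord_of_dvd_M[of a] M_pos by (cases "ord_of a") auto

lemma ord_of_minimal: "a \<in> R_set m \<Longrightarrow> 0 < k \<Longrightarrow> k < ord_of a \<Longrightarrow> a ^ k mod p \<noteq> 1"
  using ord_of_dvd by (auto dest: dvd_imp_le)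

lemma pow_mod_period:
  "a \<in> R_set m \<Longrightarrow> a ^ k mod p = 1 \<Longrightarrow> a ^ (i mod k) mod p = a ^ i mod p"
proof -
  assume a: "a \<in> R_set m" "a ^ k mod p = 1"
  have "a ^ i = (a ^ k) ^ (i div k) * a ^ (i mod k)"
    by (simp flip: power_mult power_add)
  then have "a ^ i mod p = ((a ^ k) ^ (i div k) mod p) * a ^ (i mod k) mod p"
    by (simp add: mod_mult_left_eq)
  also have "(a ^ k) ^ (i div k) mod p = 1 ^ (i div k) mod p"
    using a(2) power_mod[of "a ^ k" p] by metis
  also have "\<dots> = 1" using mod_less[OF one_R_set] by simp
  finally show ?thesis by simp
qed

lemma pow_inj:
  assumes a: "a \<in> R_set m"
  shows "inj_on (\<lambda>i. a ^ i mod p) {..<ord_of a}"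
proof (rule linorder_inj_onI)
  fix i j assume ij: "i < j" "i \<in> {..<ord_of a}" "j \<in> {..<ord_of a}"
  show "a ^ i mod p \<noteq> a ^ j mod p"
  proof
    assume "a ^ i mod p = a ^ j mod p"
    then have "p dvd a ^ j - a ^ i" by (metis mod_eq_dvd_iff_poly)
    moreover have "a ^ j - a ^ i = a ^ i * (a ^ (j - i) - 1)"
      using ij by (simp add: right_diff_distrib flip: power_add)
    ultimately have "p dvd a ^ (j - i) - 1"
      using prime_p prime_p_power R_set_not_dvd[OF a] by auto
    then have "a ^ (j - i) mod p = 1"
      using mod_less[OF one_R_set] by (metis mod_eq_dvd_iff_poly)
    moreover have "0 < j - i" "j - i < ord_of a" using ij by auto
    ultimately show False using ord_of_minimal[OF a] by blast
  qed
qed auto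

text \<open>In a field there are at most \<open>d\<close> roots of unity of order \<open>d\<close>.\<close>

lemma pow_image:
  assumes a: "a \<in> R_set m"
  shows "(\<lambda>i. a ^ i mod p) ` {..<ord_of a} = {z \<in> R_set m. z ^ ord_of a mod p = 1}"
proof (rule card_seteq)
  show "finite {z \<in> R_set m. z ^ ord_of a mod p = 1}" using finite_R_set by auto
  show "(\<lambda>i. a ^ i mod p) ` {..<ord_of a} \<subseteq> {z \<in> R_set m. z ^ ord_of a mod p = 1}"
  proof safe
    fix i
    show "a ^ i mod p \<in> R_set m" using pow_R_set[OF a] .
    have "(a ^ i mod p) ^ ord_of a mod p = (a ^ ord_of a) ^ i mod p"
      by (metis power_mod power_mult mult.commute)
    also have "\<dots> = 1"
      using ord_of_dvd[OF a] mod_less[OF one_R_set] by (metis dvd_refl power_mod power_one)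
    finally show "(a ^ i mod p) ^ ord_of a mod p = 1" .
  qed
  have "card {x \<in> carrier F.R. x [^]\<^bsub>F.R\<^esub> ord_of a = \<one>\<^bsub>F.R\<^esub>} \<le> ord_of a"
    by (rule F.field_R.num_roots_le_deg[OF F.finite_carrier_R]) (use ord_of_pos[OF a] in simp)
  moreover have "{x \<in> carrier F.R. x [^]\<^bsub>F.R\<^esub> ord_of a = \<one>\<^bsub>F.R\<^esub>} = {z \<in> R_set m. z ^ ord_of a mod p = 1}"
    unfolding carrier_R F.pow_irr one_R using ord_of_pos[OF a] by (auto simp: R_set_def power_0_left)
  moreover have "card ((\<lambda>i. a ^ i mod p) ` {..<ord_of a}) = ord_of a"
    using pow_inj[OF a] by (simp add: card_image)
  ultimately show "card {z \<in> R_set m. z ^ ord_of a mod p = 1} \<le> card ((\<lambda>i. a ^ i mod p) ` {..<ord_of a})"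
    by simp
qed

lemma ex_primitive: "\<exists>a\<in>R_set m. ord_of a = M"
proof -
  obtain a where "a \<in> carrier (mult_of F.R)" "group.ord (mult_of F.R) a = Coset.order (mult_of F.R)"
    using F.field_R.finite_field_mult_group_has_gen2[OF F.finite_carrier_R] by blast
  then show ?thesis
    unfolding carrier_mult ord_of_def F.order_irr deg M_def by blast
qed

lemma primitive_image:
  assumes a: "a \<in> R_set m" "ord_of a = M"
  shows "(\<lambda>i. a ^ i mod p) ` {..<M} = R_set m"
  using pow_image[OF a(1)] pow_M a by auto

lemma primitive_mod_iff:
  assumes a: "a \<in> R_set m" "ord_of a = M"
  shows "primitive_mod m p a"
proof -
  have "{0..CARD('b) ^ m - 2} = {..<M}" using M_pos by (auto simp: M_def)
  then show ?thesis using a primitive_image[OF a] by (simp add: primitive_mod_def)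
qed

end

section \<open>Walsh series and the dual net\<close>

text \<open>\<open>mu1\<close> is constant for \<open>b ^ (a - 1) \<le> l < b ^ a\<close>, so the
  weighted sum sees \<open>g\<close> only through differences of its partial sums at powers of
  \<open>b\<close>.\<close>

lemma sum_r_coeff_blocks:
  fixes g :: "nat \<Rightarrow> complex" and \<alpha> d :: nat
  assumes b: "1 < b"
  defines "S \<equiv> \<lambda>a. \<Sum>l<b ^ a. g l" and "w \<equiv> \<lambda>a. 1 / real b ^ (2 * min \<alpha> d * a + \<alpha>)"
  shows "(\<Sum>l\<in>{1..<b ^ A}. of_real (r_coeff b \<alpha> d l) * g l) = (\<Sum>a\<in>{1..A}. of_real (w a) * (S a - S (a - 1)))"
proof (induction A)
  case (Suc A)
  have le: "1 \<le> b ^ A" "b ^ A \<le> b ^ Suc A" using b by auto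
  have "(\<Sum>l\<in>{1..<b ^ Suc A}. of_real (r_coeff b \<alpha> d l) * g l)
      = (\<Sum>l\<in>{1..<b ^ A}. of_real (r_coeff b \<alpha> d l) * g l)
        + (\<Sum>l\<in>{b ^ A..<b ^ Suc A}. of_real (r_coeff b \<alpha> d l) * g l)"
    by (rule sum.atLeastLessThan_concat[OF le, symmetric])
  also have "(\<Sum>l\<in>{b ^ A..<b ^ Suc A}. of_real (r_coeff b \<alpha> d l) * g l)
      = (\<Sum>l\<in>{b ^ A..<b ^ Suc A}. of_real (w (Suc A)) * g l)"
  proof (rule sum.cong[OF refl])
    fix l assume "l \<in> {b ^ A..<b ^ Suc A}"
    then have "mu1 b l = Suc A" using b by (intro mu1_eq) auto
    then show "of_real (r_coeff b \<alpha> d l) * g l = of_real (w (Suc A)) * g l"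
      by (simp add: r_coeff_def w_def)
  qed
  also have "\<dots> = of_real (w (Suc A)) * (S (Suc A) - S A)"
    unfolding S_def sum_distrib_left[symmetric] lessThan_atLeast0
    by (subst sum_diff_nat_ivl) (use le in auto)
  finally show ?case using Suc by simp
qed simp

lemma geometric_sum_minus:
  fixes B :: real
  assumes "B \<noteq> 0"
  shows "(B - 1) * (\<Sum>a\<in>{1..n}. (1 / B) ^ a) = 1 - (1 / B) ^ n"
  by (induction n) (use assms in \<open>simp_all add: distrib_left field_simps\<close>)

text \<open>After summation by blocks only the character sums \<open>T a\<close> matter. If
  \<open>p\<close> divides \<open>h\<close>, they equal \<open>b ^ a\<close> throughout and leave an
  infinite geometric series with limit \<chi>(0). Otherwise they equal \<open>b ^ a\<close> for
  \<open>a < L\<close> and 0 from \<open>L\<close> on: the series breaks off, and \<chi> is a finite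
  geometric sum with one negative boundary term.\<close>

lemma walsh_partial_sums:
  fixes p h :: "'b::prime_card mod_ring poly"
  assumes m: "Polynomial.degree p = m" "0 < m" and d: "0 < min \<alpha> d"
  defines "f \<equiv> \<lambda>l. of_real (r_coeff CARD('b) \<alpha> d l) * psi p (tr m l * h)"
  shows "(\<lambda>A. \<Sum>l\<in>{1..<CARD('b) ^ A}. f l) \<longlonglongrightarrow> of_real (chi CARD('b) \<alpha> d (v_quot m h p))"
proof -
  let ?b = "real CARD('b)"
  define k where "k = min \<alpha> d"
  define B1 where "B1 = ?b ^ (2 * k - 1)"
  define T where "T a = (\<Sum>l<CARD('b) ^ a. psi p (tr m l * h))" for a
  define w where "w a = 1 / ?b ^ (2 * k * a + \<alpha>)" for a
  have b1: "1 < ?b" by simp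
  have k: "0 < k" using d by (simp add: k_def)
  have B1: "1 < B1" unfolding B1_def using b1 k by (intro one_less_power) auto
  have B2: "?b ^ (2 * k) = ?b * B1"
    using k unfolding B1_def by (simp flip: power_Suc)
  \<comment> \<open>Of the factor \<open>1/b ^ (2 * k)\<close> gained from one block to the next,
    one \<open>b\<close> is lost to the growing block; the ratio is \<open>1/B1\<close>, with
    exponent \<open>2 * k - 1\<close> as in \<chi>.\<close>
  have wb: "w a * ?b ^ a = (1 / B1) ^ a / ?b ^ \<alpha>" for a
  proof -
    have "?b ^ (2 * k * a + \<alpha>) = (?b * B1) ^ a * ?b ^ \<alpha>"
      unfolding power_add power_mult[of _ "2 * k"] B2 ..
    then show ?thesis using B1 by (simp add: w_def power_mult_distrib power_one_over field_simps)
  qed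
  have step: "w a * (?b ^ a - ?b ^ (a - 1)) = (?b - 1) / (?b * ?b ^ \<alpha>) * (1 / B1) ^ a" if "1 \<le> a" for a
  proof -
    have "?b ^ a - ?b ^ (a - 1) = ?b ^ a * ((?b - 1) / ?b)"
      using that by (cases a) (auto simp: field_simps)
    then have "w a * (?b ^ a - ?b ^ (a - 1)) = w a * ?b ^ a * ((?b - 1) / ?b)" by simp
    then show ?thesis unfolding wb by (simp add: field_simps)
  qed
  have sum_eq: "(\<Sum>l\<in>{1..<CARD('b) ^ A}. f l) = (\<Sum>a\<in>{1..A}. of_real (w a) * (T a - T (a - 1)))" for A
    unfolding f_def w_def T_def k_def by (rule sum_r_coeff_blocks) simp
  have geo: "(\<Sum>a\<in>{1..n}. (1 / B1) ^ a) = (1 - (1 / B1) ^ n) / (B1 - 1)" for n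
    using geometric_sum_minus[of B1 n] B1 by (simp add: field_simps)
  show ?thesis
  proof (cases "p dvd h")
    case True
    then have T: "T a = of_real (?b ^ a)" for a
      unfolding T_def by (subst sum_psi_tr[OF m]) simp
    have "(\<Sum>l\<in>{1..<CARD('b) ^ A}. f l)
        = of_real ((?b - 1) / (?b * ?b ^ \<alpha>) * ((1 - (1 / B1) ^ A) / (B1 - 1)))" for A
    proof -
      have "(\<Sum>l\<in>{1..<CARD('b) ^ A}. f l) = (\<Sum>a\<in>{1..A}. of_real (w a * (?b ^ a - ?b ^ (a - 1))))"
        unfolding sum_eq T by (simp only: of_real_mult of_real_diff)
      also have "\<dots> = of_real (\<Sum>a\<in>{1..A}. (?b - 1) / (?b * ?b ^ \<alpha>) * (1 / B1) ^ a)"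
        unfolding of_real_sum by (intro sum.cong refl) (simp only: step atLeastAtMost_iff)
      finally show ?thesis unfolding sum_distrib_left[symmetric] geo .
    qed
    moreover have "(\<lambda>A. (?b - 1) / (?b * ?b ^ \<alpha>) * ((1 - (1 / B1) ^ A) / (B1 - 1)))
        \<longlonglongrightarrow> (?b - 1) / (?b * ?b ^ \<alpha>) * ((1 - 0) / (B1 - 1))"
      using B1 by (intro tendsto_intros LIMSEQ_power_zero) auto
    moreover have "(?b - 1) / (?b * ?b ^ \<alpha>) * ((1 - 0) / (B1 - 1)) = chi CARD('b) \<alpha> d (v_quot m h p)"
    proof -
      have "p \<noteq> 0" using m by auto
      show ?thesis unfolding chi_v_quot_dvd[OF \<open>p \<noteq> 0\<close> True] k_def[symmetric] B2
        by (simp add: field_simps)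
    qed
    ultimately show ?thesis by (simp only: tendsto_of_real)
  next
    case False
    define L where "L = m - Polynomial.degree (h mod p)"
    have L: "1 \<le> L" using v_quot_floor(1)[OF m False] by (simp add: L_def)
    have T: "T a = (if a < L then of_real (?b ^ a) else 0)" for a
      unfolding T_def by (subst sum_psi_tr[OF m]) (use False in \<open>simp add: L_def\<close>)
    have "(\<Sum>l\<in>{1..<CARD('b) ^ A}. f l) = of_real (chi CARD('b) \<alpha> d (v_quot m h p))" if "L \<le> A" for A
    proof -
      have "(\<Sum>l\<in>{1..<CARD('b) ^ A}. f l) = (\<Sum>a\<in>{1..L}. of_real (w a) * (T a - T (a - 1)))"
        unfolding sum_eq using that by (intro sum.mono_neutral_right) (auto simp: T)
      also have "\<dots> = (\<Sum>a\<in>{1..L - 1}. of_real (w a) * (T a - T (a - 1))) + of_real (w L) * (T L - T (L - 1))"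
        using L by (cases L) auto
      also have "(\<Sum>a\<in>{1..L - 1}. of_real (w a) * (T a - T (a - 1)))
          = (\<Sum>a\<in>{1..L - 1}. of_real (w a * (?b ^ a - ?b ^ (a - 1))))"
        by (intro sum.cong refl) (auto simp: T)
      also have "\<dots> = of_real (\<Sum>a\<in>{1..L - 1}. (?b - 1) / (?b * ?b ^ \<alpha>) * (1 / B1) ^ a)"
        unfolding of_real_sum by (intro sum.cong refl) (simp only: step atLeastAtMost_iff)
      \<comment> \<open>The boundary term: \<open>T L = 0\<close> while
        \<open>T (L - 1) = b ^ (L - 1)\<close>.\<close>
      also have "of_real (w L) * (T L - T (L - 1)) = of_real (- (w L * ?b ^ L) / ?b)"
        using L by (cases L) (auto simp: T)
      finally have "(\<Sum>l\<in>{1..<CARD('b) ^ A}. f l)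
          = of_real ((?b - 1) / (?b * ?b ^ \<alpha>) * ((1 - (1 / B1) ^ (L - 1)) / (B1 - 1)) + - (w L * ?b ^ L) / ?b)"
        unfolding sum_distrib_left[symmetric] geo of_real_add .
      moreover have "(?b - 1) / (?b * ?b ^ \<alpha>) * ((1 - (1 / B1) ^ (L - 1)) / (B1 - 1)) + - (w L * ?b ^ L) / ?b
          = chi CARD('b) \<alpha> d (v_quot m h p)"
      proof -
        have x: "(1 / B1) ^ (L - 1) = (1 / B1) ^ L * B1"
          using L B1 by (cases L) auto
        have id: "(u - 1) / (u * a) * ((1 - y * B1) / (B1 - 1)) + - (y / a) / u
            = (u - 1 - y * (u * B1 - 1)) / (a * (u * B1 - u))" if "u \<noteq> 0" "a \<noteq> 0" for u a y :: real
        proof -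
          have *: "a * (u * B1 - u) = (u * a) * (B1 - 1)" by (simp add: algebra_simps)
          have "- (y / a) / u = - (y * (B1 - 1)) / ((u * a) * (B1 - 1))"
            using that B1 by (simp add: field_simps)
          moreover have "(u - 1) / (u * a) * ((1 - y * B1) / (B1 - 1)) = (u - 1) * (1 - y * B1) / ((u * a) * (B1 - 1))"
            by simp
          ultimately show ?thesis unfolding * by (simp only: add_divide_distrib[symmetric]) (simp add: algebra_simps)
        qed
        show ?thesis unfolding chi_v_quot[OF m False d] chiL_def k_def[symmetric] B1_def[symmetric] L_def[symmetric]
            B2 x wb by (rule id) auto
      qed
      ultimately show ?thesis by (simp only:)
    qed
    then have "\<forall>\<^sub>F A in sequentially. (\<Sum>l\<in>{1..<CARD('b) ^ A}. f l) = of_real (chi CARD('b) \<alpha> d (v_quot m h p))"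
      by (rule eventually_sequentiallyI)
    then show ?thesis by (rule tendsto_eventually)
  qed
qed

text \<open>The unordered sum converges absolutely, so it may be evaluated along any exhausting
  sequence; the partial sums up to \<open>b ^ A\<close> are the ones known in closed form.\<close>

lemma walsh_sum:
  fixes p h :: "'b::prime_card mod_ring poly"
  assumes m: "Polynomial.degree p = m" "0 < m" and d: "0 < min \<alpha> d"
  defines "f \<equiv> \<lambda>l. of_real (r_coeff CARD('b) \<alpha> d l) * psi p (tr m l * h)"
  shows "(\<lambda>l. norm (f l)) summable_on {1..}"
    and "infsum f {1..} = of_real (chi CARD('b) \<alpha> d (v_quot m h p))"
proof -
  have nf: "norm (f l) = r_coeff CARD('b) \<alpha> d l" for l
    by (simp add: f_def norm_mult)
  show abs: "(\<lambda>l. norm (f l)) summable_on {1..}"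
    unfolding nf by (rule summable_r_coeff[OF _ d]) simp
  then have "f summable_on {1..}" by (rule abs_summable_summable)
  then have hs: "(f has_sum infsum f {1..}) {1..}" by (rule has_sum_infsum)
  have "((\<lambda>l. if 1 \<le> l then f l else 0) has_sum infsum f {1..}) UNIV"
    by (rule has_sum_cong_neutral[THEN iffD1, OF _ _ _ hs]) auto
  then have "(\<lambda>n. \<Sum>l<n. if 1 \<le> l then f l else 0) \<longlonglongrightarrow> infsum f {1..}"
    using has_sum_imp_sums by (auto simp: sums_def)
  moreover have "strict_mono (\<lambda>A. CARD('b) ^ A)" by (intro strict_monoI power_strict_increasing) auto
  ultimately have "(\<lambda>A. \<Sum>l<CARD('b) ^ A. if 1 \<le> l then f l else 0) \<longlonglongrightarrow> infsum f {1..}"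
    using LIMSEQ_subseq_LIMSEQ by (fastforce simp: o_def)
  moreover have "(\<Sum>l<n. if 1 \<le> l then f l else 0) = (\<Sum>l\<in>{1..<n}. f l)" for n
    by (rule sum.mono_neutral_cong_right) auto
  ultimately have "(\<lambda>A. \<Sum>l\<in>{1..<CARD('b) ^ A}. f l) \<longlonglongrightarrow> infsum f {1..}" by simp
  with walsh_partial_sums[OF m d, of h] show "infsum f {1..} = of_real (chi CARD('b) \<alpha> d (v_quot m h p))"
    unfolding f_def using LIMSEQ_unique by blast
qed

lemma has_sum_finite_sum:
  fixes f :: "'i \<Rightarrow> 'a \<Rightarrow> complex"
  assumes "\<And>i. i \<in> I \<Longrightarrow> (f i has_sum s i) A"
  shows "((\<lambda>x. \<Sum>i\<in>I. f i x) has_sum (\<Sum>i\<in>I. s i)) A"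
  using assms by (induction I rule: infinite_finite_induct) (auto intro!: has_sum_add)

lemma infsum_dual_net:
  fixes p :: "'b::prime_card mod_ring poly" and q :: "nat \<Rightarrow> 'b mod_ring poly"
  assumes m: "Polynomial.degree p = m" "0 < m" and d: "0 < min \<alpha> d" and w: "w \<subseteq> {1..r}"
  defines "X \<equiv> \<lambda>n j. chi CARD('b) \<alpha> d (v_quot m (nat_poly n * q j) p)"
  shows "infsum (\<lambda>l. \<Prod>j\<in>w. r_coeff CARD('b) \<alpha> d (l j))
      {l \<in> w \<rightarrow>\<^sub>E {1..}. (\<lambda>j. if j \<in> w then l j else 0) \<in> dual_net m r q p}
    = (\<Sum>n<CARD('b) ^ m. \<Prod>j\<in>w. X n j) / real (CARD('b) ^ m)"
proof -
  let ?b = "CARD('b)" and ?E = "w \<rightarrow>\<^sub>E {1::nat..}"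
  let ?D = "{l \<in> ?E. (\<lambda>j. if j \<in> w then l j else 0) \<in> dual_net m r q p}"
  define R where "R l = (\<Prod>j\<in>w. r_coeff ?b \<alpha> d (l j))" for l
  define G where "G n l = (\<Prod>j\<in>w. of_real (r_coeff ?b \<alpha> d (l j)) * psi p (tr m (l j) * (nat_poly n * q j)))" for n l
  have fw: "finite w" using w finite_subset by blast
  have normG: "norm (G n l) = R l" for n l
    by (simp add: G_def R_def norm_mult flip: prod_norm)
  \<comment> \<open>A sum that does not exist has the value 0 by convention, yet the product formula
    would make it a product of positive numbers.\<close>
  have Rsum: "R summable_on ?E"
  proof (rule ccontr)
    assume "\<not> R summable_on ?E"
    then have "infsum R ?E = 0" by (rule infsum_not_exists)
    moreover have "infsum R ?E = (\<Prod>j\<in>w. infsum (r_coeff ?b \<alpha> d) {1..})"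
      unfolding R_def
      by (rule infsum_prod_PiE_abs[OF fw]) (use summable_r_coeff[OF _ d, of ?b] in simp)
    moreover have "0 < infsum (r_coeff ?b \<alpha> d) {1..}"
    proof -
      have "0 < sum (r_coeff ?b \<alpha> d) {1}" by (simp add: r_coeff_def)
      also have "\<dots> \<le> infsum (r_coeff ?b \<alpha> d) {1..}"
        by (rule finite_sum_le_infsum) (use summable_r_coeff[OF _ d, of ?b] in auto)
      finally show ?thesis .
    qed
    ultimately show False using fw by simp
  qed
  have G: "(G n has_sum (\<Prod>j\<in>w. of_real (X n j))) ?E" for n
  proof -
    have "(\<lambda>l. norm (G n l)) summable_on ?E" unfolding normG by (rule Rsum)
    then have "G n summable_on ?E" by (rule abs_summable_summable)
    moreover have "infsum (G n) ?E = (\<Prod>j\<in>w. of_real (X n j))"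
      unfolding G_def X_def
      by (subst infsum_prod_PiE_abs[OF fw]) (use walsh_sum[OF m d] in \<open>auto simp: fw\<close>)
    ultimately show ?thesis by (metis has_sum_infsum)
  qed
  have ind: "(\<Sum>n<?b ^ m. G n l) = (if l \<in> ?D then of_real (R l) * of_nat (?b ^ m) else 0)" if l: "l \<in> ?E" for l
  proof -
    let ?h = "\<Sum>j\<in>w. tr m (l j) * q j"
    have "G n l = of_real (R l) * psi p (nat_poly n * ?h)" for n
    proof -
      have "nat_poly n * ?h = (\<Sum>j\<in>w. tr m (l j) * (nat_poly n * q j))"
        by (simp add: sum_distrib_left mult_ac)
      then show ?thesis by (simp add: G_def R_def prod.distrib psi_sum)
    qed
    then have "(\<Sum>n<?b ^ m. G n l) = of_real (R l) * (\<Sum>n<?b ^ m. psi p (nat_poly n * ?h))"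
      by (simp add: sum_distrib_left)
    \<comment> \<open>For a full period the second alternative of \<open>sum_psi\<close> reads
      \<open>m < m - degree\<close>, which is false; only divisibility by \<open>p\<close>
      remains.\<close>
    also have "(\<Sum>n<?b ^ m. psi p (nat_poly n * ?h)) = (if p dvd ?h then of_nat (?b ^ m) else 0)"
      by (subst sum_psi[OF m]) simp
    also have "p dvd ?h \<longleftrightarrow> l \<in> ?D"
    proof -
      have "(\<Sum>j=1..r. tr m (if j \<in> w then l j else 0) * q j) = ?h"
        using w by (intro sum.mono_neutral_cong_right) (auto simp: tr_eq_nat_poly)
      then show ?thesis using l w
        by (auto simp: dual_net_def Cong.cong_def mod_eq_0_iff_dvd)
    qed
    finally show ?thesis by simp
  qed
  have "((\<lambda>l. \<Sum>n<?b ^ m. G n l) has_sum (\<Sum>n<?b ^ m. \<Prod>j\<in>w. of_real (X n j))) ?E"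
    by (rule has_sum_finite_sum) (rule G)
  then have "((\<lambda>l. of_real (R l) * of_nat (?b ^ m)) has_sum (\<Sum>n<?b ^ m. \<Prod>j\<in>w. of_real (X n j :: real) :: complex)) ?D"
    by (rule has_sum_cong_neutral[THEN iffD1, rotated -1]) (auto simp: ind)
  then have "((\<lambda>l. complex_of_real (R l * real (?b ^ m))) has_sum of_real (\<Sum>n<?b ^ m. \<Prod>j\<in>w. X n j)) ?D"
    by simp
  then have "((\<lambda>l. R l * real (?b ^ m)) has_sum (\<Sum>n<?b ^ m. \<Prod>j\<in>w. X n j)) ?D"
    unfolding has_sum_of_real_iff .
  then have "((\<lambda>l. R l * real (?b ^ m) * inverse (real (?b ^ m))) has_sum
      (\<Sum>n<?b ^ m. \<Prod>j\<in>w. X n j) * inverse (real (?b ^ m))) ?D"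
    by (rule has_sum_cmult_left)
  then have "(R has_sum (\<Sum>n<?b ^ m. \<Prod>j\<in>w. X n j) / real (?b ^ m)) ?D"
    by (simp add: divide_inverse mult.assoc)
  then show ?thesis unfolding R_def by (rule infsumI)
qed

section \<open>Sums over subsets of components for product weights\<close>

lemma sum_Pow_prod: "finite B \<Longrightarrow> (\<Sum>v\<in>Pow B. \<Prod>i\<in>v. x i) = (\<Prod>i\<in>B. 1 + x i)" for x :: "'a \<Rightarrow> real"
  using prod_add[of B x "\<lambda>_. 1"] by (simp add: add.commute)

lemma phi_set_Un:
  assumes "u \<subseteq> {1..d * J}" "v \<subseteq> {d * J + 1..d * Suc J}" "Suc J \<le> s" "0 < d"
  shows "phi_set s d (u \<union> v) = phi_set s d u \<union> (if v = {} then {} else {Suc J})" "Suc J \<notin> phi_set s d u"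
proof -
  have disj: "{d * (j - 1) + 1..d * j} \<inter> {d * (k - 1) + 1..d * k} = {}" if "1 \<le> j" "j < k" for j k
  proof -
    have "d * j \<le> d * (k - 1)" using that by (intro mult_le_mono) auto
    then have "x \<notin> {d * (k - 1) + 1..d * k}" if "x \<in> {d * (j - 1) + 1..d * j}" for x
      using that unfolding atLeastAtMost_iff by linarith
    then show ?thesis by blast
  qed
  have "v \<inter> {d * (j - 1) + 1..d * j} \<noteq> {} \<longleftrightarrow> v \<noteq> {} \<and> j = Suc J" if "1 \<le> j" for j
  proof (cases "j = Suc J")
    case True then show ?thesis using assms(2) by auto
  next
    case False
    then have "{d * (j - 1) + 1..d * j} \<inter> {d * J + 1..d * Suc J} = {}"
      using disj[of j "Suc J"] disj[of "Suc J" j] that by (cases "j < Suc J") (auto simp: Int_commute)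
    then show ?thesis using False assms(2) by blast
  qed
  then show "phi_set s d (u \<union> v) = phi_set s d u \<union> (if v = {} then {} else {Suc J})"
    using assms(3) by (auto simp: phi_set_def Int_Un_distrib2)
  show "Suc J \<notin> phi_set s d u"
    using assms(1) by (auto simp: phi_set_def)
qed

lemma finite_phi_set [simp]: "finite (phi_set s d w)"
  by (simp add: phi_set_def)

lemma phi_set_empty [simp]: "phi_set s d {} = {}"
  by (simp add: phi_set_def)

text \<open>A set is split into its part below the new block and its part \<open>v\<close> inside.
  However many elements \<open>v\<close> has, it activates the coordinate \<open>Suc J\<close> once,
  so the factor \<open>c (Suc J)\<close> appears exactly when \<open>v\<close> is non-empty.\<close>

lemma sum_Pow_block:
  fixes x c :: "nat \<Rightarrow> real"
  assumes B: "B \<subseteq> {d * J + 1..d * Suc J}" and J: "Suc J \<le> s" and d: "0 < d"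
  defines "W \<equiv> \<lambda>w. (\<Prod>j\<in>phi_set s d w. c j) * (\<Prod>i\<in>w. x i)"
  shows "(\<Sum>w\<in>Pow ({1..d * J} \<union> B). W w)
    = (\<Sum>w\<in>Pow {1..d * J}. W w) * (1 - c (Suc J) + c (Suc J) * (\<Prod>i\<in>B. 1 + x i))"
proof -
  let ?A = "{1..d * J}"
  have AB: "?A \<inter> B = {}" using B by auto
  have fB: "finite B" using B finite_subset by blast
  have "(\<Sum>w\<in>Pow (?A \<union> B). W w) = (\<Sum>(u, v)\<in>Pow ?A \<times> Pow B. W (u \<union> v))"
    by (rule sum.reindex_bij_witness[of _ "\<lambda>(u, v). u \<union> v" "\<lambda>w. (w \<inter> ?A, w \<inter> B)"]) (use AB in \<open>auto simp: Int_Un_distrib[symmetric] Int_absorb2\<close>)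
  also have "\<dots> = (\<Sum>(u, v)\<in>Pow ?A \<times> Pow B. W u * ((if v = {} then 1 else c (Suc J)) * (\<Prod>i\<in>v. x i)))"
  proof (rule sum.cong[OF refl], clarify)
    fix u v assume u: "u \<subseteq> ?A" and v: "v \<subseteq> B"
    have fin: "finite u" "finite v" using u v fB finite_subset by (blast, blast)
    have "(\<Prod>i\<in>u \<union> v. x i) = (\<Prod>i\<in>u. x i) * (\<Prod>i\<in>v. x i)"
      using fin AB u v by (intro prod.union_disjoint) auto
    moreover have "(\<Prod>j\<in>phi_set s d (u \<union> v). c j)
        = (\<Prod>j\<in>phi_set s d u. c j) * (if v = {} then 1 else c (Suc J))"
      using phi_set_Un[OF u order_trans[OF v B] J d] by auto
    ultimately show "W (u \<union> v) = W u * ((if v = {} then 1 else c (Suc J)) * (\<Prod>i\<in>v. x i))"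
      by (simp add: W_def)
  qed
  also have "\<dots> = (\<Sum>u\<in>Pow ?A. W u) * (\<Sum>v\<in>Pow B. (if v = {} then 1 else c (Suc J)) * (\<Prod>i\<in>v. x i))"
    by (simp add: sum_product sum.cartesian_product)
  \<comment> \<open>The empty set carries 1 in place of \<open>c\<close>; charging \<open>c\<close>
    to all sets and correcting this one is the origin of \<open>1 - c\<close>.\<close>
  also have "(\<Sum>v\<in>Pow B. (if v = {} then 1 else c (Suc J)) * (\<Prod>i\<in>v. x i))
      = (\<Sum>v\<in>Pow B. c (Suc J) * (\<Prod>i\<in>v. x i) + (if v = {} then 1 - c (Suc J) else 0))"
    by (rule sum.cong) auto
  also have "\<dots> = 1 - c (Suc J) + c (Suc J) * (\<Prod>i\<in>B. 1 + x i)"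
    using fB by (simp add: sum.distrib sum_distrib_left[symmetric] sum_Pow_prod)
  finally show ?thesis .
qed

lemma prod_block: "(\<Prod>i\<in>{k + 1..k + n}. f i) = (\<Prod>l=1..n. f (k + l))" for f :: "nat \<Rightarrow> real"
  using prod.shift_bounds_cl_nat_ivl[of f 1 k n] by (simp add: add.commute)

text \<open>Complete blocks followed by the first \<open>n\<close> components of the next one: the
  shape in which the criterion occurs in the middle of a coordinate.\<close>

lemma sum_Pow_phi_set:
  fixes x c :: "nat \<Rightarrow> real"
  assumes d: "0 < d" and J: "Suc J \<le> s" and n: "n \<le> d"
  defines "W \<equiv> \<lambda>w. (\<Prod>j\<in>phi_set s d w. c j) * (\<Prod>i\<in>w. x i)"
  shows "(\<Sum>w\<in>Pow {1..d * J + n}. W w)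
    = (\<Prod>j=1..J. 1 - c j + c j * (\<Prod>l=1..d. 1 + x (d * (j - 1) + l)))
      * (1 - c (Suc J) + c (Suc J) * (\<Prod>l=1..n. 1 + x (d * J + l)))"
proof -
  have step: "(\<Sum>w\<in>Pow {1..d * J + n}. W w)
      = (\<Sum>w\<in>Pow {1..d * J}. W w) * (1 - c (Suc J) + c (Suc J) * (\<Prod>l=1..n. 1 + x (d * J + l)))"
    if "Suc J \<le> s" "n \<le> d" for J n
  proof -
    have "{1..d * J + n} = {1..d * J} \<union> {d * J + 1..d * J + n}" by auto
    then show ?thesis
      using sum_Pow_block[of "{d * J + 1..d * J + n}" d J s c x] that d
      by (simp only: W_def prod_block) auto
  qed
  have "(\<Sum>w\<in>Pow {1..d * J}. W w) = (\<Prod>j=1..J. 1 - c j + c j * (\<Prod>l=1..d. 1 + x (d * (j - 1) + l)))"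
    using J
  proof (induction J)
    case 0
    then show ?case by (simp add: W_def)
  next
    case (Suc J)
    have "d * Suc J = d * J + d" by simp
    then show ?case using Suc step[of J d] by (simp only: prod.nat_ivl_Suc') (simp add: mult.commute)
  qed
  with step[OF J n] show ?thesis by simp
qed

section \<open>Cost of programs without loops\<close>

primrec straight_cost :: "com \<Rightarrow> nat" where
  "straight_cost (NSet x i e) = 1 + ncost i + ncost e"
| "straight_cost (CSet x i e) = 1 + ncost i + ccost e"
| "straight_cost (Out e) = 1 + ncost e"
| "straight_cost (c ;; c') = straight_cost c + straight_cost c'"
| "straight_cost (Cond g c c') = 1 + bcost g + (straight_cost c + straight_cost c')"
| "straight_cost (For x e g c) = 0"

text \<open>The side condition on indices, followed along the actual run and thus only on branches
  taken. It rejects loops, which makes the value 0 that \<open>straight_cost\<close> gives them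
  harmless.\<close>

primrec safe :: "nat \<Rightarrow> com \<Rightarrow> state \<Rightarrow> bool" where
  "safe K (NSet x i e) \<sigma> = (neval i \<sigma> < K)"
| "safe K (CSet x i e) \<sigma> = (neval i \<sigma> < K)"
| "safe K (Out e) \<sigma> = True"
| "safe K (c ;; c') \<sigma> = (safe K c \<sigma> \<and> safe K c' (run c \<sigma>))"
| "safe K (Cond g c c') \<sigma> = (if beval g \<sigma> then safe K c \<sigma> else safe K c' \<sigma>)"
| "safe K (For x e g c) \<sigma> = False"

lemma ok_straight: "safe K c \<sigma> \<Longrightarrow> straight_cost c \<le> t \<Longrightarrow> ok K c \<sigma> t"
proof -
  have "safe K c \<sigma> \<Longrightarrow> ok K c \<sigma> (straight_cost c)"
  proof (induction c arbitrary: \<sigma>)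
    case (Cond g c c')
    then have "ok K (Cond g c c') \<sigma> (1 + bcost g + (straight_cost c + straight_cost c'))"
      by (intro ok_Cond) auto
    then show ?case by simp
  qed (use ok_NSet ok_CSet ok_Out ok_Seq in auto)
  then show "safe K c \<sigma> \<Longrightarrow> straight_cost c \<le> t \<Longrightarrow> ok K c \<sigma> t"
    using ok_mono by blast
qed

section \<open>The fast Fourier transform\<close>

text \<open>Both directions of the transform at once: \<open>sg\<close> is 1 for the forward and -1
  for the inverse one. The butterfly only uses that \<open>sg\<close> is odd.\<close>

definition unit_root :: "int \<Rightarrow> real \<Rightarrow> complex" where
  "unit_root sg x = cis (of_int sg * (2 * pi * x))"

lemma unit_root_add: "unit_root sg (x + y) = unit_root sg x * unit_root sg y"
  by (simp add: unit_root_def cis_mult distrib_left)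

lemma unit_root_int: "x \<in> \<int> \<Longrightarrow> unit_root sg x = 1"
proof -
  assume "x \<in> \<int>"
  then have "of_int sg * x \<in> \<int>" by simp
  then have "cis (2 * pi * (of_int sg * x)) = 1" by (rule cis_multiple_2pi)
  then show ?thesis by (simp add: unit_root_def mult_ac)
qed

lemma unit_root_half: "odd sg \<Longrightarrow> unit_root sg (1 / 2) = -1"
proof -
  assume "odd sg"
  then obtain k where k: "sg = 2 * k + 1" by (auto elim: oddE)
  have "unit_root sg (1 / 2) = cis (2 * pi * of_int k) * cis pi"
    unfolding unit_root_def k cis_mult by (rule arg_cong[of _ _ cis]) (simp add: algebra_simps)
  also have "cis (2 * pi * of_int k) = 1" by (rule cis_multiple_2pi) simp
  finally show ?thesis by simp
qed

definition dft :: "int \<Rightarrow> nat \<Rightarrow> (nat \<Rightarrow> complex) \<Rightarrow> nat \<Rightarrow> complex" where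
  "dft sg n x j = (\<Sum>k<n. x k * unit_root sg (real (j * k) / real n))"

text \<open>The array after one pass. Index \<open>q + 2 * st * k\<close> with \<open>q < st\<close>
  holds the sum of two entries half a sequence apart, which carries the even frequencies; with
  \<open>q \<ge> st\<close> it holds their twiddled difference, which carries the odd ones.\<close>

definition stage :: "int \<Rightarrow> nat \<Rightarrow> nat \<Rightarrow> (nat \<Rightarrow> complex) \<Rightarrow> nat \<Rightarrow> complex" where
  "stage sg half st x i =
     (let k = i div (2 * st); q = i mod (2 * st) in
      if q < st then x (q + st * k) + x (q + st * (k + half))
      else (x (q - st + st * k) - x (q - st + st * (k + half))) * unit_root sg (real k / real (2 * half)))"

lemma sum_double: "(\<Sum>k<2 * h. f k) = (\<Sum>k<h. f k + f (k + h))" for f :: "nat \<Rightarrow> complex"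
proof -
  have "(\<Sum>k<2 * h. f k) = (\<Sum>k\<in>{0..<h}. f k) + (\<Sum>k\<in>{h..<2 * h}. f k)"
    unfolding lessThan_atLeast0 by (rule sum.atLeastLessThan_concat[symmetric]) auto
  also have "(\<Sum>k\<in>{h..<2 * h}. f k) = (\<Sum>k\<in>{0..<h}. f (k + h))"
    using sum.shift_bounds_nat_ivl[of f 0 h h] by (simp add: mult_2)
  finally show ?thesis by (simp add: sum.distrib lessThan_atLeast0)
qed

text \<open>The exponents met in a butterfly with frequency \<open>J\<close>, position
  \<open>K\<close> and half length \<open>H\<close>: an additional integer \<open>J\<close> is
  invisible to the root of unity, an additional \<open>1/2\<close> turns into the sign -1.\<close>

lemma twiddle_arith:
  fixes J K H :: real
  assumes "H \<noteq> 0"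
  shows "2 * J * (K + H) / (2 * H) = J * K / H + J"
    and "(2 * J + 1) * K / (2 * H) = K / (2 * H) + J * K / H"
    and "(2 * J + 1) * (K + H) / (2 * H) = (2 * J + 1) * K / (2 * H) + (J + 1 / 2)"
proof -
  define t where "t = K / H"
  have K: "K = t * H" using assms by (simp add: t_def)
  have H: "2 * H \<noteq> 0" using assms by simp
  have t: "J * K / H = J * t" by (simp add: t_def)
  have t2: "x * K / (2 * H) = x * t / 2" "K / (2 * H) = t / 2" for x by (simp_all add: t_def)
  have "2 * J * (K + H) = (J * t + J) * (2 * H)" unfolding K by (simp add: algebra_simps)
  then show "2 * J * (K + H) / (2 * H) = J * K / H + J"
    unfolding t by (simp only: nonzero_mult_div_cancel_right[OF H])
  have "(2 * J + 1) * t / 2 = t / 2 + J * t" by (simp add: algebra_simps add_divide_distrib)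
  then show "(2 * J + 1) * K / (2 * H) = K / (2 * H) + J * K / H"
    unfolding t t2 .
  have "(2 * J + 1) * (K + H) = ((2 * J + 1) * t / 2 + (J + 1 / 2)) * (2 * H)" unfolding K by (simp add: algebra_simps)
  then show "(2 * J + 1) * (K + H) / (2 * H) = (2 * J + 1) * K / (2 * H) + (J + 1 / 2)"
    unfolding t2 by (simp only: nonzero_mult_div_cancel_right[OF H])
qed

text \<open>Decimation in frequency. Terms \<open>k\<close> and \<open>k + half\<close> have equal
  roots at frequency \<open>2 * j\<close> and opposite ones at \<open>2 * j + 1\<close>; in the
  latter case the part of the exponent not belonging to the shorter transform is the twiddle factor.
  Here \<open>a\<close> is the full transform, and each residue \<open>q\<close> modulo
  \<open>st\<close> splits into \<open>q\<close> and \<open>q + st\<close> modulo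
  \<open>2 * st\<close>.\<close>

lemma dft_stage:
  assumes sg: "odd sg" and half: "0 < half" and st: "0 < st"
    and inv: "\<And>q j. q < st \<Longrightarrow> j < 2 * half \<Longrightarrow> dft sg (2 * half) (\<lambda>k. x (q + st * k)) j = a (q + st * j)"
    and q: "q < 2 * st" and j: "j < half"
  shows "dft sg half (\<lambda>k. stage sg half st x (q + 2 * st * k)) j = a (q + 2 * st * j)"
proof -
  have dm: "(q + 2 * st * k) div (2 * st) = k" "(q + 2 * st * k) mod (2 * st) = q" for k
    using q by simp_all
  have half_nz: "real half \<noteq> 0" using half by simp
  show ?thesis
  proof (cases "q < st")
    case True
    have "a (q + 2 * st * j) = dft sg (2 * half) (\<lambda>k. x (q + st * k)) (2 * j)"
      using inv[of q "2 * j"] True j by (simp add: mult_ac)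
    also have "\<dots> = (\<Sum>k<half. (x (q + st * k) + x (q + st * (k + half))) * unit_root sg (real (j * k) / real half))"
    proof -
      have 1: "unit_root sg (real (2 * j * k) / real (2 * half)) = unit_root sg (real (j * k) / real half)" for k
      proof -
        have "real (2 * j * k) / real (2 * half) = (2 * real (j * k)) / (2 * real half)"
          by (simp only: of_nat_mult of_nat_numeral mult.assoc)
        also have "\<dots> = real (j * k) / real half" by (rule mult_divide_mult_cancel_left) simp
        finally show ?thesis by (simp only:)
      qed
      have 2: "unit_root sg (real (2 * j * (k + half)) / real (2 * half)) = unit_root sg (real (j * k) / real half)" for k
      proof -
        have "real (2 * j * (k + half)) / real (2 * half) = real (j * k) / real half + real j"
          using twiddle_arith(1)[OF half_nz, of "real j" "real k"]
          by (simp only: of_nat_mult of_nat_add of_nat_numeral)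
        then show ?thesis by (simp only: unit_root_add unit_root_int Ints_of_nat mult_1_right)
      qed
      show ?thesis unfolding dft_def sum_double unfolding 2 unfolding 1 by (simp only: distrib_right)
    qed
    finally show ?thesis unfolding dft_def stage_def dm using True by (simp add: Let_def)
  next
    case False
    define q' where "q' = q - st"
    have q': "q = q' + st" "q' < st" using False q by (auto simp: q'_def)
    have "a (q + 2 * st * j) = dft sg (2 * half) (\<lambda>k. x (q' + st * k)) (2 * j + 1)"
      using inv[of q' "2 * j + 1"] q' j by (simp add: algebra_simps)
    also have "\<dots> = (\<Sum>k<half. (x (q' + st * k) - x (q' + st * (k + half)))
        * unit_root sg (real k / real (2 * half)) * unit_root sg (real (j * k) / real half))"
    proof -
      have 1: "unit_root sg (real ((2 * j + 1) * k) / real (2 * half))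
          = unit_root sg (real k / real (2 * half)) * unit_root sg (real (j * k) / real half)" for k
        unfolding unit_root_add[symmetric] using twiddle_arith(2)[OF half_nz, of "real j" "real k"]
        by (simp only: of_nat_mult of_nat_add of_nat_numeral of_nat_1)
      have 2: "unit_root sg (real ((2 * j + 1) * (k + half)) / real (2 * half))
          = - (unit_root sg (real k / real (2 * half)) * unit_root sg (real (j * k) / real half))" for k
      proof -
        have "real ((2 * j + 1) * (k + half)) / real (2 * half)
            = real ((2 * j + 1) * k) / real (2 * half) + (real j + 1 / 2)"
          using twiddle_arith(3)[OF half_nz, of "real j" "real k"]
          by (simp only: of_nat_mult of_nat_add of_nat_numeral of_nat_1)
        then show ?thesis unfolding 1[symmetric]
          by (simp only: unit_root_add unit_root_half[OF sg] unit_root_int Ints_of_nat) simp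
      qed
      show ?thesis unfolding dft_def sum_double unfolding 2 unfolding 1
        by (simp only: left_diff_distrib mult_minus_right add_uminus_conv_diff mult.assoc)
    qed
    finally show ?thesis unfolding dft_def stage_def dm using q' by (simp add: Let_def)
  qed
qed

definition butterfly :: com where
  "butterfly =
     (clet ''x'' (CCell ''X'' (nv ''q'' \<^bold>+ nv ''st'' \<^bold>* nv ''k'')) ;;
      clet ''y'' (CCell ''X'' (nv ''q'' \<^bold>+ nv ''st'' \<^bold>* (nv ''k'' \<^bold>+ nv ''half''))) ;;
      CSet ''Y'' (nv ''q'' \<^bold>+ nv ''st'' \<^bold>* (Num 2 \<^bold>* nv ''k'')) (cv ''x'' \<boxplus> cv ''y'') ;;
      CSet ''Y'' (nv ''q'' \<^bold>+ nv ''st'' \<^bold>* (Num 2 \<^bold>* nv ''k'' \<^bold>+ Num 1))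
        ((cv ''x'' \<boxminus> cv ''y'') \<boxtimes> cv ''w''))"

lemma run_butterfly_loop:
  fixes \<sigma> :: state
  assumes st: "nmem \<sigma> ''st'' 0 = st" and k: "nmem \<sigma> ''k'' 0 = k" and half: "nmem \<sigma> ''half'' 0 = half"
    and w: "cmem \<sigma> ''w'' 0 = unit_root sg (real k / real (2 * half))"
    and kh: "k < half" and K: "2 * half * st < K"
    and Y: "\<And>i. i < 2 * st * k \<Longrightarrow> cmem \<sigma> ''Y'' i = stage sg half st (cmem \<sigma> ''X'') i"
  defines "\<sigma>' \<equiv> run (for_all ''q'' (nv ''st'') butterfly) \<sigma>"
  shows "(\<forall>i<2 * st * (k + 1). cmem \<sigma>' ''Y'' i = stage sg half st (cmem \<sigma> ''X'') i)
    \<and> ok K (for_all ''q'' (nv ''st'') butterfly) \<sigma> (10 + 100 * st)"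
proof -
  define B where "B = 2 * st * k"
  have idx: "q + st * (2 * k) = B + q" "q + st * (2 * k + 1) = B + (st + q)" for q
    by (simp_all add: B_def algebra_simps)
  have bound: "B + 2 * st < K"
  proof -
    have "2 * st * (k + 1) \<le> 2 * st * half" using kh by (intro mult_le_mono) auto
    then show ?thesis using K by (simp add: B_def algebra_simps)
  qed
  have F1: "stage sg half st x (B + q) = x (q + st * k) + x (q + st * (k + half))" if "q < st" for q x
  proof -
    have "(B + q) div (2 * st) = k" "(B + q) mod (2 * st) = q" using that by (simp_all add: B_def)
    then show ?thesis using that by (simp add: stage_def)
  qed
  have F2: "stage sg half st x (B + (st + q))
      = (x (q + st * k) - x (q + st * (k + half))) * unit_root sg (real k / real (2 * half))" if "q < st" for q x
  proof -
    have "st + q < 2 * st" using that by simp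
    then have "(B + (st + q)) div (2 * st) = k" "(B + (st + q)) mod (2 * st) = st + q"
      by (simp_all add: B_def)
    then show ?thesis by (simp add: stage_def)
  qed
  \<comment> \<open>Each round writes one cell in each of two segments of length \<open>st\<close>,
    so the finished part consists of two growing intervals that join after \<open>st\<close>
    rounds.\<close>
  let ?I = "\<lambda>q (\<tau>::state). \<forall>i. i < B + q \<or> B + st \<le> i \<and> i < B + (st + q)
      \<longrightarrow> cmem \<tau> ''Y'' i = stage sg half st (cmem \<sigma> ''X'') i"
  have "?I st \<sigma>' \<and> ok K (for_all ''q'' (nv ''st'') butterfly) \<sigma> (10 + 100 * st)"
    unfolding \<sigma>'_def
  proof (rule for_all_const[where I = ?I and t = 80])
    show "0 < K" using K by simp
    show "neval (nv ''st'') \<sigma> = st" by (simp add: st)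
    show "?I 0 (tick (1 + ncost (nv ''st'')) \<sigma>)" using Y by (auto simp: B_def)
    show "?I i (tick k (nwrite ''q'' 0 i \<tau>))" if "?I i \<tau>" for i \<tau> k
      using that by simp
    show "1 + ncost (nv ''st'') + st * (2 + 80) \<le> 10 + 100 * st" by simp
  next
    fix q \<tau>
    assume q: "q < st" and I: "?I q \<tau>" and nq: "nmem \<tau> ''q'' 0 = q"
      and fn: "\<And>y. y \<notin> nwr (for_all ''q'' (nv ''st'') butterfly) \<Longrightarrow> nmem \<tau> y = nmem \<sigma> y"
      and fc: "\<And>y. y \<notin> cwr butterfly \<Longrightarrow> cmem \<tau> y = cmem \<sigma> y"
    have vals: "nmem \<tau> ''st'' 0 = st" "nmem \<tau> ''k'' 0 = k" "nmem \<tau> ''half'' 0 = half"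
        "cmem \<tau> ''w'' 0 = unit_root sg (real k / real (2 * half))" "cmem \<tau> ''X'' = cmem \<sigma> ''X''"
      using st k half w by (simp_all add: fn fc butterfly_def)
    have Yq: "cmem (run butterfly \<tau>) ''Y'' = (cmem \<tau> ''Y'')
       (B + q := stage sg half st (cmem \<sigma> ''X'') (B + q),
        B + (st + q) := stage sg half st (cmem \<sigma> ''X'') (B + (st + q)))"
      unfolding F1[OF q] F2[OF q] by (simp add: butterfly_def vals nq idx[simplified] add_ac)
    have "ok K butterfly \<tau> 80"
      unfolding butterfly_def
      by (rule ok_straight) (use bound q in \<open>simp_all add: vals nq idx[simplified] add_ac\<close>)
    moreover have "?I (Suc q) (run butterfly \<tau>)"
      unfolding Yq using I by (auto simp: less_Suc_eq)
    ultimately show "ok K butterfly \<tau> 80 \<and> ?I (Suc q) (run butterfly \<tau>)" by blast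
  qed
  then show ?thesis by (auto simp: B_def algebra_simps)
qed

definition fft_stage :: "cexp \<Rightarrow> com" where
  "fft_stage tw =
     (nlet ''half'' (nv ''n'' \<^bold>/ Num 2) ;;
      for_all ''k'' (nv ''half'') (clet ''w'' tw ;; for_all ''q'' (nv ''st'') butterfly) ;;
      for_all ''q'' (nv ''Len'') (CSet ''X'' (nv ''q'') (CCell ''Y'' (nv ''q''))) ;;
      nlet ''n'' (nv ''half'') ;;
      nlet ''st'' (Num 2 \<^bold>* nv ''st''))"

lemma fft_altdef:
  "fft tw = (nlet ''n'' (nv ''Len'') ;; nlet ''st'' (Num 1) ;;
     For ''r'' (nv ''Len'') (Num 1 \<^bold>< nv ''n'') (fft_stage tw))"
  by (simp add: fft_def fft_stage_def butterfly_def)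

text \<open>What an expression must satisfy to serve as twiddle factor, so that one verification
  covers both transforms. The restriction \<open>k < n\<close> keeps the truncated subtraction in
  the inverse factor exact.\<close>

definition twiddle :: "int \<Rightarrow> cexp \<Rightarrow> bool" where
  "twiddle sg tw \<longleftrightarrow> ccost tw \<le> 20 \<and>
     (\<forall>\<tau>. nmem \<tau> ''k'' 0 < nmem \<tau> ''n'' 0 \<longrightarrow>
        ceval tw \<tau> = unit_root sg (real (nmem \<tau> ''k'' 0) / real (nmem \<tau> ''n'' 0)))"

lemma twiddle_forward: "twiddle 1 (Root (nv ''k'') (nv ''n''))"
  by (simp add: twiddle_def unit_root_def mult_ac)

text \<open>Exponents of roots on the machine are natural numbers; \<open>n - k\<close> replaces
  \<open>- k\<close>, from which it differs by a full turn.\<close>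

lemma twiddle_inverse: "twiddle (-1) (Root (nv ''n'' \<^bold>- nv ''k'') (nv ''n''))"
proof -
  have "cis (2 * pi * real (n - k) / real n) = cis (- (2 * pi * (real k / real n)))" if "k < n" for k n :: nat
  proof -
    have n: "real n \<noteq> 0" using that by simp
    have "2 * pi * real (n - k) / real n = 2 * pi * (real n / real n) + - (2 * pi * (real k / real n))"
      using that by (simp only: of_nat_diff[OF less_imp_le]) (simp add: diff_divide_distrib right_diff_distrib)
    then have "2 * pi * real (n - k) / real n = 2 * pi + - (2 * pi * (real k / real n))"
      using n by simp
    then show ?thesis by (simp only: cis_mult[symmetric] cis_2pi mult_1_left)
  qed
  then show ?thesis by (simp add: twiddle_def unit_root_def)
qed

lemma run_stage_loop:
  fixes \<sigma> :: state
  assumes st: "nmem \<sigma> ''st'' 0 = st" and half: "nmem \<sigma> ''half'' 0 = half" and n: "nmem \<sigma> ''n'' 0 = 2 * half"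
    and tw: "twiddle sg tw" and K: "2 * half * st < K"
  defines "c \<equiv> for_all ''k'' (nv ''half'') (clet ''w'' tw ;; for_all ''q'' (nv ''st'') butterfly)"
  shows "(\<forall>i<2 * st * half. cmem (run c \<sigma>) ''Y'' i = stage sg half st (cmem \<sigma> ''X'') i)
    \<and> ok K c \<sigma> (10 + half * (40 + 100 * st))"
  unfolding c_def
proof (rule for_all_const[where I = "\<lambda>k \<tau>. \<forall>i<2 * st * k. cmem \<tau> ''Y'' i = stage sg half st (cmem \<sigma> ''X'') i"
      and t = "32 + 100 * st"])
  show "0 < K" using K by simp
  show "neval (nv ''half'') \<sigma> = half" by (simp add: half)
  fix k and \<tau> :: state
  let ?b = "clet ''w'' tw ;; for_all ''q'' (nv ''st'') butterfly"
  assume k: "k < half" and I: "\<forall>i<2 * st * k. cmem \<tau> ''Y'' i = stage sg half st (cmem \<sigma> ''X'') i"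
    and nk: "nmem \<tau> ''k'' 0 = k"
    and fn: "\<And>y. y \<notin> nwr (for_all ''k'' (nv ''half'') ?b) \<Longrightarrow> nmem \<tau> y = nmem \<sigma> y"
    and fc: "\<And>y. y \<notin> cwr ?b \<Longrightarrow> cmem \<tau> y = cmem \<sigma> y"
  have vals: "nmem \<tau> ''st'' 0 = st" "nmem \<tau> ''half'' 0 = half" "nmem \<tau> ''n'' 0 = 2 * half"
      "cmem \<tau> ''X'' = cmem \<sigma> ''X''"
    using st half n by (simp_all add: fn fc butterfly_def)
  have cw: "ceval tw \<tau> = unit_root sg (real k / real (2 * half))" "ccost tw \<le> 20"
    using tw k by (auto simp: twiddle_def nk vals)
  let ?\<tau> = "run (clet ''w'' tw) \<tau>"
  have *: "(\<forall>i<2 * st * (k + 1). cmem (run (for_all ''q'' (nv ''st'') butterfly) ?\<tau>) ''Y'' i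
        = stage sg half st (cmem ?\<tau> ''X'') i)
    \<and> ok K (for_all ''q'' (nv ''st'') butterfly) ?\<tau> (10 + 100 * st)"
    by (rule run_butterfly_loop) (use vals nk k K I cw in auto)
  have "ok K (clet ''w'' tw) \<tau> 22"
    by (rule ok_mono, rule ok_CSet) (use K cw in auto)
  then have "ok K ?b \<tau> (22 + (10 + 100 * st))"
    using * by (intro ok_Seq) auto
  moreover have "cmem ?\<tau> ''X'' = cmem \<sigma> ''X''" using vals by simp
  ultimately show "ok K ?b \<tau> (32 + 100 * st)
      \<and> (\<forall>i<2 * st * Suc k. cmem (run ?b \<tau>) ''Y'' i = stage sg half st (cmem \<sigma> ''X'') i)"
    using * by simp
qed (auto simp: algebra_simps)

lemma run_copy:
  fixes x y q :: string
  assumes "neval e \<sigma> = n" "n \<le> K" "0 < K" "x \<noteq> y"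
  defines "c \<equiv> for_all q e (CSet x (nv q) (CCell y (nv q)))"
  shows "(\<forall>i<n. cmem (run c \<sigma>) x i = cmem \<sigma> y i) \<and> ok K c \<sigma> (1 + ncost e + 10 * n)"
  unfolding c_def
proof (rule for_all_const[where I = "\<lambda>k \<tau>. \<forall>i<k. cmem \<tau> x i = cmem \<sigma> y i" and t = 8])
  fix i and \<tau> :: state
  let ?b = "CSet x (nv q) (CCell y (nv q))"
  assume i: "i < n" and I: "\<forall>k<i. cmem \<tau> x k = cmem \<sigma> y k" "nmem \<tau> q 0 = i"
    and fc: "\<And>z. z \<notin> cwr ?b \<Longrightarrow> cmem \<tau> z = cmem \<sigma> z"
  have "ok K ?b \<tau> 8"
    by (rule ok_mono, rule ok_CSet) (use i I assms in auto)
  then show "ok K ?b \<tau> 8 \<and> (\<forall>k<Suc i. cmem (run ?b \<tau>) x k = cmem \<sigma> y k)"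
    using I fc[of y] assms(4) by (auto simp: less_Suc_eq)
qed (use assms in auto)

text \<open>Every stage treats \<open>half * st\<close> pairs, half the length of the array
  regardless of its shape; hence a cost proportional to the length.\<close>

lemma run_fft_stage:
  fixes \<sigma> :: state
  assumes st: "nmem \<sigma> ''st'' 0 = st" and n: "nmem \<sigma> ''n'' 0 = 2 * half" and Len: "nmem \<sigma> ''Len'' 0 = 2 * half * st"
    and tw: "twiddle sg tw" and K: "2 * half * st < K" and pos: "0 < half" "0 < st"
  defines "\<sigma>' \<equiv> run (fft_stage tw) \<sigma>"
  shows "nmem \<sigma>' ''n'' 0 = half" "nmem \<sigma>' ''st'' 0 = 2 * st"
    "\<And>i. i < 2 * half * st \<Longrightarrow> cmem \<sigma>' ''X'' i = stage sg half st (cmem \<sigma> ''X'') i"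
    "ok K (fft_stage tw) \<sigma> (140 * (2 * half * st))"
proof -
  let ?c1 = "nlet ''half'' (nv ''n'' \<^bold>/ Num 2)"
    and ?c2 = "for_all ''k'' (nv ''half'') (clet ''w'' tw ;; for_all ''q'' (nv ''st'') butterfly)"
    and ?c3 = "for_all ''q'' (nv ''Len'') (CSet ''X'' (nv ''q'') (CCell ''Y'' (nv ''q'')))"
    and ?c4 = "nlet ''n'' (nv ''half'') ;; nlet ''st'' (Num 2 \<^bold>* nv ''st'')"
  define \<sigma>1 where "\<sigma>1 = run ?c1 \<sigma>"
  define \<sigma>2 where "\<sigma>2 = run ?c2 \<sigma>1"
  define \<sigma>3 where "\<sigma>3 = run ?c3 \<sigma>2"
  have split: "fft_stage tw = (?c1 ;; ?c2 ;; ?c3 ;; ?c4)" by (simp add: fft_stage_def)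
  have \<sigma>': "\<sigma>' = run ?c4 \<sigma>3" by (simp only: \<sigma>'_def split run.simps \<sigma>1_def \<sigma>2_def \<sigma>3_def)
  have v1: "nmem \<sigma>1 ''half'' 0 = half" "nmem \<sigma>1 ''st'' 0 = st" "nmem \<sigma>1 ''n'' 0 = 2 * half"
      "nmem \<sigma>1 ''Len'' 0 = 2 * half * st" "cmem \<sigma>1 = cmem \<sigma>"
    using st n Len by (simp_all add: \<sigma>1_def)
  have f2: "nmem \<sigma>2 y = nmem \<sigma>1 y" if "y \<notin> nwr ?c2" for y using that by (simp only: \<sigma>2_def nmem_run not_False_eq_True)
  have v2: "nmem \<sigma>2 ''half'' 0 = half" "nmem \<sigma>2 ''st'' 0 = st" "nmem \<sigma>2 ''Len'' 0 = 2 * half * st"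
    using v1 f2 by (simp_all add: butterfly_def)
  have f3: "nmem \<sigma>3 y = nmem \<sigma>2 y" if "y \<notin> nwr ?c3" for y using that by (simp only: \<sigma>3_def nmem_run not_False_eq_True)
  have v3: "nmem \<sigma>3 ''half'' 0 = half" "nmem \<sigma>3 ''st'' 0 = st"
    using v2 f3 by simp_all
  have s2: "(\<forall>i<2 * st * half. cmem \<sigma>2 ''Y'' i = stage sg half st (cmem \<sigma>1 ''X'') i)
      \<and> ok K ?c2 \<sigma>1 (10 + half * (40 + 100 * st))"
    unfolding \<sigma>2_def by (rule run_stage_loop) (use v1 tw K in auto)
  have s3: "(\<forall>i<2 * half * st. cmem \<sigma>3 ''X'' i = cmem \<sigma>2 ''Y'' i)
      \<and> ok K ?c3 \<sigma>2 (1 + ncost (nv ''Len'') + 10 * (2 * half * st))"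
    unfolding \<sigma>3_def by (rule run_copy) (use v2 K in auto)
  show "nmem \<sigma>' ''n'' 0 = half" "nmem \<sigma>' ''st'' 0 = 2 * st"
    using v3 by (simp_all add: \<sigma>')
  show "cmem \<sigma>' ''X'' i = stage sg half st (cmem \<sigma> ''X'') i" if "i < 2 * half * st" for i
    using s2 s3 v1(5) that by (simp add: \<sigma>' mult.commute mult.left_commute)
  have o1: "ok K ?c1 \<sigma> 10" by (rule ok_mono, rule ok_NSet) (use K in auto)
  have o4: "ok K ?c4 \<sigma>3 20" by (rule ok_straight) (use K in auto)
  have "ok K (fft_stage tw) \<sigma> (10 + ((10 + half * (40 + 100 * st)) + ((1 + ncost (nv ''Len'') + 10 * (2 * half * st)) + 20)))"
    unfolding split using o1 s2 s3 o4 by (intro ok_Seq) (simp_all only: \<sigma>1_def \<sigma>2_def \<sigma>3_def)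
  moreover have "10 + ((10 + half * (40 + 100 * st)) + ((1 + ncost (nv ''Len'') + 10 * (2 * half * st)) + 20))
      \<le> 140 * (2 * half * st)"
  proof -
    have "half \<le> half * st" "1 \<le> half * st" using pos by (cases st; simp)+
    moreover have "half * (40 + 100 * st) = 40 * half + 100 * (half * st)" by (simp add: distrib_left)
    moreover have "2 * half * st = 2 * (half * st)" by simp
    ultimately show ?thesis by (simp only: ncost.simps)
  qed
  ultimately show "ok K (fft_stage tw) \<sigma> (140 * (2 * half * st))" by (rule ok_mono)
qed

lemma run_fft:
  fixes \<sigma> :: state
  assumes Len: "nmem \<sigma> ''Len'' 0 = 2 ^ t" and tw: "twiddle sg tw" and sg: "odd sg" and K: "2 ^ t < K"
  defines "\<sigma>' \<equiv> run (fft tw) \<sigma>"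
  shows "\<forall>i<2 ^ t. cmem \<sigma>' ''X'' i = dft sg (2 ^ t) (cmem \<sigma> ''X'') i"
    and "ok K (fft tw) \<sigma> (200 * (t + 1) * 2 ^ t)"
proof -
  let ?L = "2 ^ t :: nat"
  let ?c = "nlet ''n'' (nv ''Len'') ;; nlet ''st'' (Num 1)"
    and ?loop = "For ''r'' (nv ''Len'') (Num 1 \<^bold>< nv ''n'') (fft_stage tw)"
  define \<sigma>1 where "\<sigma>1 = run ?c \<sigma>"
  have v1: "nmem \<sigma>1 ''n'' 0 = ?L" "nmem \<sigma>1 ''st'' 0 = 1" "nmem \<sigma>1 ''Len'' 0 = ?L" "cmem \<sigma>1 = cmem \<sigma>"
    by (simp_all add: \<sigma>1_def Len)
  let ?I = "\<lambda>i A (\<tau>::state). i \<le> t \<and> nmem \<tau> ''n'' 0 = 2 ^ (t - i) \<and> nmem \<tau> ''st'' 0 = 2 ^ i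
    \<and> (\<forall>q<2 ^ i. \<forall>j<2 ^ (t - i). dft sg (2 ^ (t - i)) (\<lambda>k. cmem \<tau> ''X'' (q + 2 ^ i * k)) j
          = dft sg ?L (cmem \<sigma> ''X'') (q + 2 ^ i * j))
    \<and> A \<le> i * (150 * ?L)"
  let ?J = "\<lambda>A (\<tau>::state). (\<forall>i<?L. cmem \<tau> ''X'' i = dft sg ?L (cmem \<sigma> ''X'') i) \<and> A \<le> t * (150 * ?L) + 10"
  have "\<exists>A. ?J A (run ?loop \<sigma>1) \<and> ok K ?loop \<sigma>1 (1 + ncost (nv ''Len'') + A)"
  proof (rule For_rule[where I = ?I])
    show "0 < K" using K by simp
    show "neval (nv ''Len'') \<sigma>1 = ?L" using v1 by simp
    show "?I 0 0 (tick (1 + ncost (nv ''Len'')) \<sigma>1)" using v1 by simp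
    show "?I i A (tick k (nwrite ''r'' 0 i \<tau>))" if "?I i A \<tau>" for i A \<tau> k using that by simp
  next
    fix i A \<tau>
    assume I: "?I i A \<tau>" and g: "beval (Num 1 \<^bold>< nv ''n'') \<tau>"
      and fn: "\<And>y. y \<notin> nwr ?loop \<Longrightarrow> nmem \<tau> y = nmem \<sigma>1 y"
    have it: "i < t" using I g by (cases "i = t") auto
    define half st :: nat where "half = 2 ^ (t - Suc i)" and "st = 2 ^ i"
    have n2: "2 ^ (t - i) = 2 * half" using it by (simp add: half_def Suc_diff_Suc flip: power_Suc)
    have L: "2 * half * st = ?L" using it unfolding n2[symmetric] st_def by (simp flip: power_add)
    have pos: "0 < half" "0 < st" by (simp_all add: half_def st_def)
    have LenT: "nmem \<tau> ''Len'' 0 = 2 * half * st"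
      using v1 fn[of "''Len''"] by (simp add: L fft_stage_def butterfly_def)
    note S = run_fft_stage[OF _ _ LenT tw _ pos, unfolded L, of K]
    have S': "nmem (run (fft_stage tw) \<tau>) ''n'' 0 = half" "nmem (run (fft_stage tw) \<tau>) ''st'' 0 = 2 * st"
        "\<And>i. i < ?L \<Longrightarrow> cmem (run (fft_stage tw) \<tau>) ''X'' i = stage sg half st (cmem \<tau> ''X'') i"
        "ok K (fft_stage tw) \<tau> (140 * ?L)"
      using S I K unfolding n2 st_def[symmetric] by auto
    have "dft sg half (\<lambda>k. cmem (run (fft_stage tw) \<tau>) ''X'' (q + 2 * st * k)) j
        = dft sg ?L (cmem \<sigma> ''X'') (q + 2 * st * j)" if q: "q < 2 * st" and j: "j < half" for q j
    proof -
      have "q + 2 * st * k < ?L" if "k < half" for k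
      proof -
        have "q + 2 * st * k < 2 * st * (k + 1)" using q by simp
        also have "\<dots> \<le> 2 * st * half" using that by (intro mult_le_mono) auto
        finally show ?thesis using L by (simp add: mult_ac)
      qed
      then have "dft sg half (\<lambda>k. cmem (run (fft_stage tw) \<tau>) ''X'' (q + 2 * st * k)) j
          = dft sg half (\<lambda>k. stage sg half st (cmem \<tau> ''X'') (q + 2 * st * k)) j"
        unfolding dft_def by (intro sum.cong) (auto simp: S'(3))
      also have "\<dots> = dft sg ?L (cmem \<sigma> ''X'') (q + 2 * st * j)"
        by (rule dft_stage[OF sg pos _ q j]) (use I in \<open>unfold n2 st_def[symmetric], blast\<close>)
      finally show ?thesis .
    qed
    then have "\<forall>q<2 ^ Suc i. \<forall>j<2 ^ (t - Suc i).
        dft sg (2 ^ (t - Suc i)) (\<lambda>k. cmem (run (fft_stage tw) \<tau>) ''X'' (q + 2 ^ Suc i * k)) j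
          = dft sg ?L (cmem \<sigma> ''X'') (q + 2 ^ Suc i * j)"
      unfolding half_def[symmetric] power_Suc st_def[symmetric] by blast
    moreover have "A + (1 + bcost (Num 1 \<^bold>< nv ''n'') + 140 * ?L) \<le> Suc i * (150 * ?L)"
    proof -
      have "1 \<le> ?L" "A \<le> i * (150 * ?L)" using I by auto
      then show ?thesis by (simp only: bcost.simps ncost.simps mult_Suc)
    qed
    ultimately show "\<exists>u. ok K (fft_stage tw) \<tau> u
        \<and> ?I (Suc i) (A + (1 + bcost (Num 1 \<^bold>< nv ''n'') + u)) (run (fft_stage tw) \<tau>)"
      using S' it by (intro exI[of _ "140 * ?L"]) (auto simp: half_def st_def)
  next
    fix i A \<tau>
    assume I: "?I i A \<tau>" and g: "\<not> beval (Num 1 \<^bold>< nv ''n'') \<tau>"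
    have it: "i = t"
    proof (rule ccontr)
      assume "i \<noteq> t"
      then have "0 < t - i" using I by simp
      then have "(1::nat) < 2 ^ (t - i)" by (rule one_less_power[rotated]) simp
      then show False using I g by simp
    qed
    \<comment> \<open>At length 1 the transforms left to be done are trivial, so the array already
      holds the result.\<close>
    show "?J (A + (1 + bcost (Num 1 \<^bold>< nv ''n''))) \<tau>"
      using I unfolding it by (auto simp: dft_def unit_root_def)
  next
    fix A \<tau>
    assume "?I ?L A \<tau>"
    \<comment> \<open>The bound \<open>Len\<close> on the number of rounds is never exhausted: the
      guard fails after \<open>t\<close> rounds, and \<open>t < 2 ^ t\<close>.\<close>
    then have "?L \<le> t" by blast
    moreover have "t < ?L" by (rule less_exp)
    ultimately show "?J A \<tau>" by simp
  qed
  then obtain A where A: "?J A (run ?loop \<sigma>1)" "ok K ?loop \<sigma>1 (1 + ncost (nv ''Len'') + A)" by blast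
  have run_eq: "run (fft tw) \<sigma> = run ?loop \<sigma>1" by (simp only: fft_altdef \<sigma>1_def run.simps)
  show "\<forall>i<2 ^ t. cmem \<sigma>' ''X'' i = dft sg (2 ^ t) (cmem \<sigma> ''X'') i"
    unfolding \<sigma>'_def run_eq using A(1) by blast
  have "ok K (fft tw) \<sigma> (5 + (5 + (1 + ncost (nv ''Len'') + A)))"
    unfolding fft_altdef
  proof (intro ok_Seq)
    show "ok K (nlet ''n'' (nv ''Len'')) \<sigma> 5" by (rule ok_mono, rule ok_NSet) (use K in auto)
    show "ok K (nlet ''st'' (Num 1)) (run (nlet ''n'' (nv ''Len'')) \<sigma>) 5" by (rule ok_mono, rule ok_NSet) (use K in auto)
    show "ok K ?loop (run (nlet ''st'' (Num 1)) (run (nlet ''n'' (nv ''Len'')) \<sigma>)) (1 + ncost (nv ''Len'') + A)"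
      using A(2) by (simp only: \<sigma>1_def run.simps)
  qed
  moreover have "5 + (5 + (1 + ncost (nv ''Len'') + A)) \<le> 200 * (t + 1) * ?L"
  proof -
    have "1 \<le> ?L" "A \<le> t * (150 * ?L) + 10" using A(1) by auto
    moreover have "200 * (t + 1) * ?L = t * (150 * ?L) + 50 * (t * ?L) + 200 * ?L"
      by (simp add: algebra_simps)
    ultimately show ?thesis by (simp only: ncost.simps)
  qed
  ultimately show "ok K (fft tw) \<sigma> (200 * (t + 1) * 2 ^ t)" by (rule ok_mono)
qed

section \<open>Convolution by means of the discrete Fourier transform\<close>

lemma unit_root_power: "unit_root sg (real k * x) = unit_root sg x ^ k"
proof (induction k)
  case 0
  then show ?case by (simp add: unit_root_def)
next
  case (Suc k)
  have "real (Suc k) * x = x + real k * x" by (simp add: distrib_right)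
  then show ?case by (simp only: unit_root_add Suc power_Suc)
qed

lemma sum_unit_root:
  assumes "0 < n"
  shows "(\<Sum>k<n. unit_root 1 (real k * (of_int d / real n))) = (if int n dvd d then of_nat n else 0)"
proof -
  define z where "z = unit_root 1 (of_int d / real n)"
  have pow: "unit_root 1 (real k * (of_int d / real n)) = z ^ k" for k
    unfolding z_def by (rule unit_root_power)
  show ?thesis
  proof (cases "int n dvd d")
    case True
    then obtain e where e: "d = int n * e" ..
    have "of_int d / real n = of_int e" using assms by (simp add: e)
    then have "z = 1" by (simp add: z_def unit_root_int)
    then show ?thesis unfolding pow using True by simp
  next
    case False
    have "z \<noteq> 1"
    proof
      assume "z = 1"
      then have "cos (2 * pi * (of_int d / real n)) = 1"
        unfolding z_def unit_root_def by (metis cis.simps(1) one_complex.simps(1) of_int_1 mult_1_left)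
      then obtain e :: int where "2 * pi * (of_int d / real n) = of_int e * 2 * pi"
        by (auto simp: cos_one_2pi_int)
      then have "(2 * pi) * (of_int d / real n) = (2 * pi) * of_int e"
        by (simp only: mult.commute mult.left_commute)
      then have "of_int d / real n = of_int e" by (rule mult_left_cancel[THEN iffD1, rotated]) simp
      then have "real_of_int d = of_int e * real n" using assms by (simp add: divide_eq_eq)
      then have "real_of_int d = of_int (e * int n)" by simp
      then have "d = e * int n" by (simp only: of_int_eq_iff)
      then show False using False by simp
    qed
    moreover have "z ^ n = 1"
    proof -
      have "z ^ n = unit_root 1 (of_int d)" unfolding pow[symmetric] using assms by simp
      then show ?thesis by (simp add: unit_root_int)
    qed
    ultimately show ?thesis unfolding pow using False by (simp add: sum_gp_strict)
  qed
qed

text \<open>The three roots combine into one with exponent \<open>k * (a + c - j) / n\<close>;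
  summing over \<open>k\<close> selects the pairs with \<open>a + c\<close> congruent to
  \<open>j\<close>.\<close>

lemma dft_convolution:
  assumes j: "j < n"
  shows "dft (-1) n (\<lambda>k. dft 1 n x k * dft 1 n y k) j / of_nat n
    = (\<Sum>a<n. \<Sum>c<n. if (a + c) mod n = j then x a * y c else 0)"
proof -
  have n: "0 < n" using j by simp
  define e where "e k a c = unit_root 1 (real k * (of_int (int a + int c - int j) / real n))" for k a c :: nat
  have e: "unit_root 1 (real (k * a) / real n) * unit_root 1 (real (k * c) / real n) * unit_root (-1) (real (j * k) / real n)
      = e k a c" for k a c
  proof -
    have "unit_root (-1) u = unit_root 1 (- u)" for u by (simp add: unit_root_def)
    moreover have "real (k * a) / real n + real (k * c) / real n + - (real (j * k) / real n)
        = real k * (of_int (int a + int c - int j) / real n)"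
      by (simp add: add_divide_distrib diff_divide_distrib ring_distribs mult_ac)
    ultimately show ?thesis unfolding e_def by (simp only: unit_root_add[symmetric])
  qed
  have "dft (-1) n (\<lambda>k. dft 1 n x k * dft 1 n y k) j = (\<Sum>k<n. \<Sum>a<n. \<Sum>c<n. x a * y c * e k a c)"
    unfolding dft_def sum_product unfolding sum_distrib_right
    by (intro sum.cong refl) (simp add: e[symmetric] mult_ac)
  also have "\<dots> = (\<Sum>a<n. \<Sum>c<n. \<Sum>k<n. x a * y c * e k a c)"
    by (subst sum.swap, rule sum.cong[OF refl], rule sum.swap)
  also have "\<dots> = (\<Sum>a<n. \<Sum>c<n. if (a + c) mod n = j then x a * y c * of_nat n else 0)"
  proof (intro sum.cong refl)
    fix a c
    have "int n dvd int a + int c - int j \<longleftrightarrow> (a + c) mod n = j"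
    proof -
      have "int n dvd int (a + c) - int j \<longleftrightarrow> (int (a + c)) mod int n = int j mod int n"
        by (rule mod_eq_dvd_iff[symmetric])
      also have "\<dots> \<longleftrightarrow> (a + c) mod n = j mod n" by (simp only: of_nat_mod[symmetric] of_nat_eq_iff)
      finally show ?thesis using j by simp
    qed
    then show "(\<Sum>k<n. x a * y c * e k a c) = (if (a + c) mod n = j then x a * y c * of_nat n else 0)"
      unfolding sum_distrib_left[symmetric] e_def sum_unit_root[OF n] by simp
  qed
  finally show ?thesis
    using n by (simp add: sum_divide_distrib) (intro sum.cong refl, auto)
qed

text \<open>The wanted convolution is cyclic modulo \<open>M\<close>, whereas the transform length
  is a power of two. With room for \<open>2 * M\<close> entries nothing wraps around and the linear
  convolution is obtained; of its indices below \<open>2 * M\<close>, exactly \<open>i\<close> and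
  \<open>i + M\<close> are congruent to \<open>i\<close> modulo \<open>M\<close>.\<close>

lemma folded_convolution:
  fixes x y :: "nat \<Rightarrow> complex"
  assumes M: "0 < M" "2 * M \<le> n" and i: "i < M"
    and x: "\<And>k. M \<le> k \<Longrightarrow> k < n \<Longrightarrow> x k = 0" and y: "\<And>k. M \<le> k \<Longrightarrow> k < n \<Longrightarrow> y k = 0"
  defines "z \<equiv> \<lambda>j. dft (-1) n (\<lambda>k. dft 1 n x k * dft 1 n y k) j / of_nat n"
  shows "z i + z (i + M) = (\<Sum>a<M. x a * y ((i + (M - a)) mod M))"
proof -
  have z: "z j = (\<Sum>a<M. \<Sum>c<M. if a + c = j then x a * y c else 0)" if "j < n" for j
  proof -
    have "z j = (\<Sum>a<n. \<Sum>c<n. if (a + c) mod n = j then x a * y c else 0)"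
      unfolding z_def by (rule dft_convolution[OF that])
    also have "\<dots> = (\<Sum>a<M. \<Sum>c<n. if (a + c) mod n = j then x a * y c else 0)"
      using M x by (intro sum.mono_neutral_right) (auto intro!: sum.neutral)
    also have "\<dots> = (\<Sum>a<M. \<Sum>c<M. if (a + c) mod n = j then x a * y c else 0)"
      using M y by (intro sum.cong sum.mono_neutral_right refl) auto
    \<comment> \<open>Here \<open>a + c < 2 * M \<le> n\<close>, so the reduction modulo
      \<open>n\<close> changes nothing.\<close>
    also have "\<dots> = (\<Sum>a<M. \<Sum>c<M. if a + c = j then x a * y c else 0)"
      using M by (intro sum.cong refl) auto
    finally show ?thesis .
  qed
  have "z i + z (i + M) = (\<Sum>a<M. \<Sum>c<M. (if a + c = i then x a * y c else 0) + (if a + c = i + M then x a * y c else 0))"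
    using M i by (simp add: z sum.distrib)
  also have "\<dots> = (\<Sum>a<M. \<Sum>c<M. if c = (i + (M - a)) mod M then x a * y c else 0)"
  proof (intro sum.cong refl)
    fix a c assume "a \<in> {..<M}" "c \<in> {..<M}"
    then have ac: "a < M" "c < M" by auto
    have "(i + (M - a)) mod M = (if a \<le> i then i - a else i + (M - a))"
    proof (cases "a \<le> i")
      case True
      then have "i + (M - a) = (i - a) + M" using ac by simp
      then show ?thesis using True i by (simp only: mod_add_self2) simp
    qed (use ac in simp)
    then show "(if a + c = i then x a * y c else 0) + (if a + c = i + M then x a * y c else 0)
        = (if c = (i + (M - a)) mod M then x a * y c else 0)"
      using ac i by auto
  qed
  also have "\<dots> = (\<Sum>a<M. x a * y ((i + (M - a)) mod M))"
    using M by (intro sum.cong refl) simp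
  finally show ?thesis .
qed

section \<open>Arithmetic tables\<close>

text \<open>\<open>K\<close> dominates all indices ever written: transform arrays are shorter than
  \<open>4 * N\<close>, arrays addressed by polynomials of degree at most \<open>m\<close> need
  \<open>b * N\<close> cells, and the addition table has \<open>H * H \<le> b ^ (m + 2)\<close>
  entries.\<close>

locale machine =
  fixes ty :: "'b::prime_card itself" and b m h H N M K :: nat
  assumes b: "b = CARD('b)" and m: "1 \<le> m" and h: "h = m div 2 + 1" and H: "H = b ^ h"
    and N: "N = b ^ m" and M: "M = N - 1" and K: "4 * b ^ (m + 2) \<le> K"
begin

abbreviation np :: "nat \<Rightarrow> 'b mod_ring poly" where "np \<equiv> nat_poly"

lemma b2: "2 \<le> b" and b_pos: "0 < b"
  by (simp_all add: b)

text \<open>\<open>2 * h \<ge> m + 1\<close>: two halves hold every polynomial of degree at most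
  \<open>m\<close>, in particular the modulus itself.\<close>

lemma bN_le_HH: "b * N \<le> H * H"
proof -
  have "b * N = b ^ (m + 1)" by (simp add: N)
  also have "\<dots> \<le> b ^ (h + h)" using b2 by (intro power_increasing) (auto simp: h)
  also have "\<dots> = H * H" by (simp only: H power_add)
  finally show ?thesis .
qed

text \<open>\<open>2 * h \<le> m + 2\<close>: the price of rounding up is at most one digit beyond
  \<open>b * N\<close>.\<close>

lemma HH_le: "H * H \<le> b ^ (m + 2)"
proof -
  have "H * H = b ^ (h + h)" by (simp only: H power_add)
  also have "\<dots> \<le> b ^ (m + 2)" using b2 by (intro power_increasing) (auto simp: h)
  finally show ?thesis .
qed

lemma b_pow_m2: "b ^ (m + 2) = b * (b * N)"
  by (simp add: N)

lemma N_bounds: "1 < N" "0 < H" "2 * N \<le> b * N" "b * N \<le> b ^ (m + 2)" "N \<le> b * N" "b \<le> N" "b \<le> H"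
proof -
  show "1 < N" using one_less_power[of b m] b2 m by (simp add: N)
  show "0 < H" using b2 by (simp add: H)
  show "2 * N \<le> b * N" using b2 by simp
  show "N \<le> b * N" using b2 by simp
  show "b * N \<le> b ^ (m + 2)" unfolding b_pow_m2 using b2 by simp
  show "b \<le> N" using self_le_power[of b m] b2 m by (simp add: N)
  show "b \<le> H" using self_le_power[of b h] b2 by (simp add: H h)
qed

lemma H_le: "H \<le> b * N"
proof -
  have "b ^ h \<le> b ^ (m + 1)" using b2 by (intro power_increasing) (auto simp: h)
  then show ?thesis by (simp add: H N)
qed

lemma K_bounds: "4 * (b * N) \<le> K" "H * H < K" "0 < K" "4 * N \<le> K" "H < K" "b < K" "b * N < K"
proof -
  have 1: "4 * (b * N) \<le> K" using K N_bounds(4) by linarith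
  then show "4 * (b * N) \<le> K" .
  show "4 * N \<le> K" "b * N < K" "0 < K" "b < K" "H < K" using 1 N_bounds H_le by linarith+
  have "0 < b ^ (m + 2)" using b2 by simp
  then show "H * H < K" using K HH_le by linarith
qed

lemma enc_less_bN: "Polynomial.degree q \<le> m \<Longrightarrow> enc (q :: 'b mod_ring poly) < b * N"
  using enc_less[of q "m + 1"] by (simp add: b N)

lemma enc_less_N: "Polynomial.degree q < m \<Longrightarrow> enc (q :: 'b mod_ring poly) < N"
  using enc_less[of q m] by (simp add: b N)

lemma degree_np: "v < N \<Longrightarrow> Polynomial.degree (np v) < m"
  using degree_nat_poly_less[of v m, where 'b = 'b] m by (simp add: b N)

lemma degree_np_le: "v < b * N \<Longrightarrow> Polynomial.degree (np v) \<le> m"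
  using degree_nat_poly_less[of v "m + 1", where 'b = 'b] by (simp add: b N)

definition tables :: "state \<Rightarrow> bool" where
  "tables \<tau> \<longleftrightarrow> nmem \<tau> ''b'' 0 = b \<and> nmem \<tau> ''m'' 0 = m \<and> nmem \<tau> ''N'' 0 = N \<and> nmem \<tau> ''M'' 0 = M
     \<and> nmem \<tau> ''h'' 0 = h \<and> nmem \<tau> ''H'' 0 = H
     \<and> (\<forall>j<H * H. nmem \<tau> ''Add'' j = enc (np (j div H) + np (j mod H)))"

lemma tablesD:
  assumes "tables \<tau>"
  shows "nmem \<tau> ''b'' 0 = b" "nmem \<tau> ''m'' 0 = m" "nmem \<tau> ''N'' 0 = N" "nmem \<tau> ''M'' 0 = M"
    "nmem \<tau> ''h'' 0 = h" "nmem \<tau> ''H'' 0 = H"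
    "\<And>i k. i < H \<Longrightarrow> k < H \<Longrightarrow> nmem \<tau> ''Add'' (i * H + k) = enc (np i + np k)"
proof -
  fix i k assume ik: "i < H" "k < H"
  have "i * H + k < Suc i * H" using ik by simp
  also have "\<dots> \<le> H * H" using ik by (intro mult_le_mono) auto
  finally show "nmem \<tau> ''Add'' (i * H + k) = enc (np i + np k)"
    using assms ik by (simp add: tables_def)
qed (use assms in \<open>simp_all add: tables_def\<close>)

abbreviation table_names :: "string set" where
  "table_names \<equiv> {''b'', ''m'', ''N'', ''M'', ''h'', ''H'', ''Add''}"

lemma tables_cong:
  assumes "tables \<sigma>" "\<And>y. y \<in> table_names \<Longrightarrow> nmem \<tau> y = nmem \<sigma> y"
  shows "tables \<tau>"
  using assms by (simp add: tables_def)

lemma tables_run: "tables \<sigma> \<Longrightarrow> table_names \<inter> nwr c = {} \<Longrightarrow> tables (run c \<sigma>)"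
  by (erule tables_cong) (auto intro!: nmem_run)

lemma run_power_loop:
  fixes x y z :: string
  assumes n: "neval e \<sigma> = n" and xyz: "x \<noteq> y" "z \<noteq> y" "z \<noteq> x"
  defines "c \<equiv> for_all x e (nlet y (nv y \<^bold>* nv z))"
  shows "nmem (run c \<sigma>) y 0 = nmem \<sigma> y 0 * nmem \<sigma> z 0 ^ n \<and> ok K c \<sigma> (1 + ncost e + 10 * n)"
  unfolding c_def
proof (rule for_all_const[where I = "\<lambda>i \<tau>. nmem \<tau> y 0 = nmem \<sigma> y 0 * nmem \<sigma> z 0 ^ i" and t = 8])
  fix i and \<tau> :: state
  let ?b = "nlet y (nv y \<^bold>* nv z)"
  assume I: "nmem \<tau> y 0 = nmem \<sigma> y 0 * nmem \<sigma> z 0 ^ i"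
    and fn: "\<And>w. w \<notin> nwr (for_all x e ?b) \<Longrightarrow> nmem \<tau> w = nmem \<sigma> w"
  have "nmem \<tau> z = nmem \<sigma> z" using xyz fn by simp
  then show "ok K ?b \<tau> 8 \<and> nmem (run ?b \<tau>) y 0 = nmem \<sigma> y 0 * nmem \<sigma> z 0 ^ Suc i"
    using I K_bounds by (auto intro!: ok_straight)
qed (use xyz n K_bounds in auto)

abbreviation add_entry :: com where
  "add_entry \<equiv> NSet ''Add'' (nv ''i'' \<^bold>* nv ''H'' \<^bold>+ nv ''k'')
         (NCell ''Add'' (nv ''i'' \<^bold>/ nv ''b'' \<^bold>* nv ''H'' \<^bold>+ nv ''k'' \<^bold>/ nv ''b'') \<^bold>* nv ''b''
          \<^bold>+ (nv ''i'' \<^bold>+ nv ''k'') \<^bold>% nv ''b'')"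

text \<open>Entry \<open>(i, k)\<close> refers to \<open>(i div b, k div b)\<close>, which comes
  earlier in row order unless \<open>i = k = 0\<close>. That one entry refers to itself, which is
  why the invariant records that cell 0 holds 0.\<close>

lemma run_add_row:
  fixes \<sigma> :: state
  assumes v: "nmem \<sigma> ''i'' 0 = i" "nmem \<sigma> ''H'' 0 = H" "nmem \<sigma> ''b'' 0 = b" and i: "i < H"
    and A: "\<forall>j<i * H. nmem \<sigma> ''Add'' j = enc (np (j div H) + np (j mod H))" "nmem \<sigma> ''Add'' 0 = 0"
  defines "c \<equiv> for_all ''k'' (nv ''H'') add_entry"
  shows "((\<forall>j<i * H + H. nmem (run c \<sigma>) ''Add'' j = enc (np (j div H) + np (j mod H)))
      \<and> nmem (run c \<sigma>) ''Add'' 0 = 0) \<and> ok K c \<sigma> (5 + 60 * H)"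
  unfolding c_def
proof (rule for_all_const[where I = "\<lambda>k \<tau>. (\<forall>j<i * H + k. nmem \<tau> ''Add'' j = enc (np (j div H) + np (j mod H)))
     \<and> nmem \<tau> ''Add'' 0 = 0" and t = 50])
  fix k and \<tau> :: state
  assume k: "k < H" and nk: "nmem \<tau> ''k'' 0 = k"
    and I: "(\<forall>j<i * H + k. nmem \<tau> ''Add'' j = enc (np (j div H) + np (j mod H))) \<and> nmem \<tau> ''Add'' 0 = 0"
    and fn: "\<And>w. w \<notin> nwr (for_all ''k'' (nv ''H'') add_entry) \<Longrightarrow> nmem \<tau> w = nmem \<sigma> w"
  have v': "nmem \<tau> ''i'' 0 = i" "nmem \<tau> ''H'' 0 = H" "nmem \<tau> ''b'' 0 = b" using v fn by simp_all
  have iH: "i * H + k < H * H"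
  proof -
    have "i * H + k < Suc i * H" using k by simp
    also have "\<dots> \<le> H * H" using i by (intro mult_le_mono) auto
    finally show ?thesis .
  qed
  let ?j = "i div b * H + k div b"
  have kb: "k div b < H" using k div_le_dividend[of k b] by linarith
  then have jd: "?j div H = i div b" "?j mod H = k div b" by simp_all
  have Aj: "nmem \<tau> ''Add'' ?j = enc (np (i div b) + np (k div b))"
  proof (cases "?j < i * H + k")
    case True
    then show ?thesis using I jd by simp
  next
    case False
    have "i = 0"
    proof (rule ccontr)
      assume "i \<noteq> 0"
      then have "Suc (i div b) \<le> i" using b2 by (simp add: Suc_leI)
      then have "Suc (i div b) * H \<le> i * H" by (rule mult_le_mono1)
      then show False using False kb by simp
    qed
    moreover have "k = 0"
    proof (rule ccontr)
      assume "k \<noteq> 0"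
      then have "k div b < k" using b2 by simp
      then show False using False \<open>i = 0\<close> by simp
    qed
    ultimately show ?thesis using I by simp
  qed
  have "nmem (run add_entry \<tau>) ''Add'' = (nmem \<tau> ''Add'')(i * H + k := enc (np i + np k))"
    using Aj enc_add_digit[of i k, where 'b = 'b] by (simp add: nk v' b)
  moreover have "(i * H + k) div H = i" "(i * H + k) mod H = k" using k by simp_all
  moreover have "i * H + k = 0 \<Longrightarrow> enc (np i + np k) = 0" using i by auto
  moreover have "ok K add_entry \<tau> 50" using iH K_bounds by (intro ok_straight) (simp_all add: nk v')
  ultimately show "ok K add_entry \<tau> 50
      \<and> (\<forall>j<i * H + Suc k. nmem (run add_entry \<tau>) ''Add'' j = enc (np (j div H) + np (j mod H)))
      \<and> nmem (run add_entry \<tau>) ''Add'' 0 = 0"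
    using I by (auto simp: less_Suc_eq simp del: run.simps)
qed (use v A K_bounds in auto)

lemma run_add_table:
  fixes \<sigma> :: state
  assumes v: "nmem \<sigma> ''H'' 0 = H" "nmem \<sigma> ''b'' 0 = b" and A: "nmem \<sigma> ''Add'' 0 = 0"
  defines "c \<equiv> for_all ''i'' (nv ''H'') (for_all ''k'' (nv ''H'') add_entry)"
  shows "((\<forall>j<H * H. nmem (run c \<sigma>) ''Add'' j = enc (np (j div H) + np (j mod H)))
      \<and> nmem (run c \<sigma>) ''Add'' 0 = 0) \<and> ok K c \<sigma> (5 + 70 * (H * H))"
  unfolding c_def
proof (rule for_all_const[where I = "\<lambda>k \<tau>. (\<forall>j<k * H. nmem \<tau> ''Add'' j = enc (np (j div H) + np (j mod H)))
     \<and> nmem \<tau> ''Add'' 0 = 0" and t = "5 + 60 * H"])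
  fix i and \<tau> :: state
  let ?b = "for_all ''k'' (nv ''H'') add_entry"
  assume i: "i < H" and ni: "nmem \<tau> ''i'' 0 = i"
    and I: "(\<forall>j<i * H. nmem \<tau> ''Add'' j = enc (np (j div H) + np (j mod H))) \<and> nmem \<tau> ''Add'' 0 = 0"
    and fn: "\<And>w. w \<notin> nwr (for_all ''i'' (nv ''H'') ?b) \<Longrightarrow> nmem \<tau> w = nmem \<sigma> w"
  have v': "nmem \<tau> ''H'' 0 = H" "nmem \<tau> ''b'' 0 = b" using v fn by simp_all
  show "ok K ?b \<tau> (5 + 60 * H) \<and> (\<forall>j<Suc i * H. nmem (run ?b \<tau>) ''Add'' j = enc (np (j div H) + np (j mod H)))
      \<and> nmem (run ?b \<tau>) ''Add'' 0 = 0"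
    using run_add_row[OF ni v' i] I by (simp only: mult_Suc add.commute[of H]) blast
next
  have "H \<le> H * H" using N_bounds(2) by simp
  moreover have "H * (2 + (5 + 60 * H)) = 7 * H + 60 * (H * H)" by (simp add: distrib_left)
  ultimately show "1 + ncost (nv ''H'') + H * (2 + (5 + 60 * H)) \<le> 5 + 70 * (H * H)"
    unfolding ncost.simps by linarith
qed (use v A K_bounds in auto)

lemma run_init_tables:
  fixes \<sigma> :: state
  assumes v: "nmem \<sigma> ''b'' 0 = b" "nmem \<sigma> ''m'' 0 = m"
  shows "tables (run init_tables \<sigma>)" "ok K init_tables \<sigma> (100 + 20 * m + 70 * (H * H))"
proof -
  let ?c1 = "nlet ''N'' (Num 1)" and ?c2 = "for_all ''i'' (nv ''m'') (nlet ''N'' (nv ''N'' \<^bold>* nv ''b''))"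
  let ?c3 = "nlet ''M'' (nv ''N'' \<^bold>- Num 1)" and ?c4 = "nlet ''h'' (nv ''m'' \<^bold>/ Num 2 \<^bold>+ Num 1)"
    and ?c5 = "nlet ''H'' (Num 1)" and ?c6 = "for_all ''i'' (nv ''h'') (nlet ''H'' (nv ''H'' \<^bold>* nv ''b''))"
    and ?c7 = "NSet ''Add'' (Num 0) (Num 0)" and ?c8 = "for_all ''i'' (nv ''H'') (for_all ''k'' (nv ''H'') add_entry)"
  have split: "init_tables = (?c1 ;; ?c2 ;; ?c3 ;; ?c4 ;; ?c5 ;; ?c6 ;; ?c7 ;; ?c8)"
    by (simp add: init_tables_def)
  define \<sigma>1 where "\<sigma>1 = run ?c1 \<sigma>"
  define \<sigma>2 where "\<sigma>2 = run ?c2 \<sigma>1"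
  define \<sigma>3 where "\<sigma>3 = run ?c3 \<sigma>2"
  define \<sigma>4 where "\<sigma>4 = run ?c4 \<sigma>3"
  define \<sigma>5 where "\<sigma>5 = run ?c5 \<sigma>4"
  define \<sigma>6 where "\<sigma>6 = run ?c6 \<sigma>5"
  define \<sigma>7 where "\<sigma>7 = run ?c7 \<sigma>6"
  define \<sigma>8 where "\<sigma>8 = run ?c8 \<sigma>7"
  have v1: "nmem \<sigma>1 ''N'' 0 = 1" "nmem \<sigma>1 ''b'' 0 = b" "nmem \<sigma>1 ''m'' 0 = m" using v by (simp_all add: \<sigma>1_def)
  have L2: "nmem \<sigma>2 ''N'' 0 = nmem \<sigma>1 ''N'' 0 * nmem \<sigma>1 ''b'' 0 ^ m \<and> ok K ?c2 \<sigma>1 (1 + ncost (nv ''m'') + 10 * m)"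
    unfolding \<sigma>2_def by (rule run_power_loop) (use v1 in auto)
  have f2: "nmem \<sigma>2 y = nmem \<sigma>1 y" if "y \<notin> nwr ?c2" for y using that by (simp only: \<sigma>2_def nmem_run not_False_eq_True)
  have v2: "nmem \<sigma>2 ''N'' 0 = N" "nmem \<sigma>2 ''b'' 0 = b" "nmem \<sigma>2 ''m'' 0 = m"
    using L2 v1 f2 by (simp_all add: N)
  have v5: "nmem \<sigma>5 ''N'' 0 = N" "nmem \<sigma>5 ''b'' 0 = b" "nmem \<sigma>5 ''m'' 0 = m" "nmem \<sigma>5 ''M'' 0 = M"
      "nmem \<sigma>5 ''h'' 0 = h" "nmem \<sigma>5 ''H'' 0 = 1"
    using v2 by (simp_all add: \<sigma>3_def \<sigma>4_def \<sigma>5_def M h)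
  have L6: "nmem \<sigma>6 ''H'' 0 = nmem \<sigma>5 ''H'' 0 * nmem \<sigma>5 ''b'' 0 ^ h \<and> ok K ?c6 \<sigma>5 (1 + ncost (nv ''h'') + 10 * h)"
    unfolding \<sigma>6_def by (rule run_power_loop) (use v5 in auto)
  have f6: "nmem \<sigma>6 y = nmem \<sigma>5 y" if "y \<notin> nwr ?c6" for y using that by (simp only: \<sigma>6_def nmem_run not_False_eq_True)
  have v7: "nmem \<sigma>7 ''N'' 0 = N" "nmem \<sigma>7 ''b'' 0 = b" "nmem \<sigma>7 ''m'' 0 = m" "nmem \<sigma>7 ''M'' 0 = M"
      "nmem \<sigma>7 ''h'' 0 = h" "nmem \<sigma>7 ''H'' 0 = H" "nmem \<sigma>7 ''Add'' 0 = 0"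
    using L6 v5 f6 by (simp_all add: \<sigma>7_def H)
  have L8: "((\<forall>j<H * H. nmem \<sigma>8 ''Add'' j = enc (np (j div H) + np (j mod H)))
      \<and> nmem \<sigma>8 ''Add'' 0 = 0) \<and> ok K ?c8 \<sigma>7 (5 + 70 * (H * H))"
    unfolding \<sigma>8_def by (rule run_add_table) (use v7 in auto)
  have f8: "nmem \<sigma>8 y = nmem \<sigma>7 y" if "y \<notin> nwr ?c8" for y using that by (simp only: \<sigma>8_def nmem_run not_False_eq_True)
  have run8: "run init_tables \<sigma> = \<sigma>8"
    by (simp only: split run.simps(4) \<sigma>8_def \<sigma>7_def \<sigma>6_def \<sigma>5_def \<sigma>4_def \<sigma>3_def \<sigma>2_def \<sigma>1_def)
  show "tables (run init_tables \<sigma>)" unfolding run8 tables_def using L8 v7 f8 by simp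
  have st: "ok K (nlet x e) \<tau> (2 + ncost e)" for x e \<tau> using K_bounds by (intro ok_straight) simp_all
  have "ok K init_tables \<sigma> ((2 + ncost (Num 1)) + ((1 + ncost (nv ''m'') + 10 * m) + ((2 + ncost (nv ''N'' \<^bold>- Num 1))
     + ((2 + ncost (nv ''m'' \<^bold>/ Num 2 \<^bold>+ Num 1)) + ((2 + ncost (Num 1)) + ((1 + ncost (nv ''h'') + 10 * h)
     + ((2 + ncost (Num 0)) + (5 + 70 * (H * H)))))))))"
    unfolding split
    by (intro ok_Seq st)
      (use L2 L6 L8 in \<open>simp_all only: \<sigma>8_def \<sigma>7_def \<sigma>6_def \<sigma>5_def \<sigma>4_def \<sigma>3_def \<sigma>2_def \<sigma>1_def\<close>)
  then show "ok K init_tables \<sigma> (100 + 20 * m + 70 * (H * H))"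
    by (rule ok_mono) (use h m in simp)
qed

lemma neval_padd:
  assumes t: "tables \<tau>" and e: "neval e \<tau> < b * N" and f: "neval f \<tau> < b * N"
  shows "neval (padd e f) \<tau> = enc (np (neval e \<tau>) + np (neval f \<tau>))"
proof -
  \<comment> \<open>The upper half must also be a valid row or column of the table.\<close>
  have q: "x div H < H" if "x < b * N" for x
    using that bN_le_HH by (simp add: less_mult_imp_div_less)
  have "enc (np (neval e \<tau>) + np (neval f \<tau>)) = enc (np (neval e \<tau> div H) + np (neval f \<tau> div H)) * H
      + enc (np (neval e \<tau> mod H) + np (neval f \<tau> mod H))"
    using enc_add_split[of h "neval e \<tau>" "neval f \<tau>", where 'b = 'b] by (simp add: H b h)
  then show ?thesis
    using tablesD[OF t] q[OF e] q[OF f] N_bounds(2) by (simp add: padd_def)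
qed

lemma ncost_padd [simp]: "ncost (padd e f) = 2 * ncost e + 2 * ncost f + 26"
  by (simp add: padd_def)

lemma nwr_scalar_multiples: "nwr (scalar_multiples S e) = {S, ''k''}" "cwr (scalar_multiples S e) = {}"
  "silent (scalar_multiples S e)"
  by (auto simp: scalar_multiples_def)

lemma np_Suc: "Suc c < b \<Longrightarrow> np (Suc c) = np c + 1"
  by (simp add: b nat_poly_const one_pCons del: pCons_one)

lemma np_const_mult_less: "c < b \<Longrightarrow> v < b * N \<Longrightarrow> enc (np c * np v) < b * N"
proof -
  assume c: "c < b" and v: "v < b * N"
  have "Polynomial.degree (np c * np v) \<le> m"
    using degree_np_le[OF v] degree_mult_le[of "np c" "np v"] c by (simp add: b nat_poly_const)
  then show ?thesis by (rule enc_less_bN)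
qed

lemma run_scalar_multiples:
  fixes \<sigma> :: state
  assumes t: "tables \<sigma>" and y: "nmem \<sigma> y 0 = v" "v < b * N" and S: "S \<notin> insert ''k'' table_names" "y \<noteq> S" "y \<noteq> ''k''"
  defines "c \<equiv> scalar_multiples S (nv y)"
  shows "\<forall>c'<b. nmem (run c \<sigma>) S c' = enc (np c' * np v)" "ok K c \<sigma> (10 + 70 * b)"
proof -
  let ?c1 = "NSet S (Num 0) (Num 0)"
    and ?body = "NSet S (nv ''k'' \<^bold>+ Num 1) (padd (NCell S (nv ''k'')) (nv y))"
  let ?c2 = "for_all ''k'' (nv ''b'' \<^bold>- Num 1) ?body"
  define \<sigma>1 where "\<sigma>1 = run ?c1 \<sigma>"
  have t1: "tables \<sigma>1" unfolding \<sigma>1_def by (rule tables_run[OF t]) (use S in auto)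
  have v1: "nmem \<sigma>1 S 0 = 0" "nmem \<sigma>1 y 0 = v" using S y by (simp_all add: \<sigma>1_def)
  have L: "(\<forall>c'<(b - 1) + 1. nmem (run ?c2 \<sigma>1) S c' = enc (np c' * np v)) \<and> ok K ?c2 \<sigma>1 (5 + 60 * b)"
  proof (rule for_all_const[where I = "\<lambda>k \<tau>. \<forall>c'<k + 1. nmem \<tau> S c' = enc (np c' * np v)" and t = 50])
    fix k and \<tau> :: state
    assume k: "k < b - 1" and nk: "nmem \<tau> ''k'' 0 = k" and I: "\<forall>c'<k + 1. nmem \<tau> S c' = enc (np c' * np v)"
      and fn: "\<And>w. w \<notin> nwr ?c2 \<Longrightarrow> nmem \<tau> w = nmem \<sigma>1 w"
    have tt: "tables \<tau>" by (rule tables_cong[OF t1], rule fn) (use S in auto)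
    have vy: "nmem \<tau> y 0 = v" using v1 fn[of y] S by simp
    have "neval (padd (NCell S (nv ''k'')) (nv y)) \<tau> = enc (np k * np v + np v)"
      using I np_const_mult_less[of k v] k y nk vy by (subst neval_padd[OF tt]) auto
    also have "np k * np v + np v = np (Suc k) * np v"
      using np_Suc[of k] k by (simp add: distrib_right)
    finally have "nmem (run ?body \<tau>) S = (nmem \<tau> S)(k + 1 := enc (np (Suc k) * np v))"
      using nk by simp
    moreover have "ok K ?body \<tau> 50"
      by (rule ok_straight) (use k nk K_bounds in auto)
    ultimately show "ok K ?body \<tau> 50 \<and> (\<forall>c'<Suc k + 1. nmem (run ?body \<tau>) S c' = enc (np c' * np v))"
      using I by (auto simp: less_Suc_eq simp del: run.simps)
  qed (use S v1 b2 tablesD[OF t1] K_bounds in auto)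
  have run_eq: "run c \<sigma> = run ?c2 \<sigma>1" by (simp only: c_def scalar_multiples_def run.simps(4) \<sigma>1_def)
  show "\<forall>c'<b. nmem (run c \<sigma>) S c' = enc (np c' * np v)"
    unfolding run_eq using L b2 by simp
  have "ok K c \<sigma> (3 + (5 + 60 * b))"
    unfolding c_def scalar_multiples_def
    by (rule ok_Seq) (use K_bounds L in \<open>auto intro!: ok_straight simp: \<sigma>1_def\<close>)
  then show "ok K c \<sigma> (10 + 70 * b)" by (rule ok_mono) simp
qed

end

section \<open>The criterion for product weights\<close>

text \<open>The maximum is at least its member for \<nu> = 1, a sum of squares and even powers. The
  sign is what lets a comparison of sums pass to the criterion.\<close>

lemma D_tilde_nonneg: "1 \<le> \<alpha> \<Longrightarrow> 0 \<le> D_tilde b \<alpha> d"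
proof -
  assume \<alpha>: "1 \<le> \<alpha>"
  have "0 \<le> C_tilde b \<alpha>"
    by (simp add: C_tilde_def power_mult)
  then have "0 \<le> C_prime b \<alpha> 1 + C_tilde b \<alpha> / real b ^ (2 * (\<alpha> - 1))"
    by (intro add_nonneg_nonneg) (auto simp: C_prime_def intro!: sum_nonneg)
  also have "\<dots> \<le> D_const b \<alpha>"
    unfolding D_const_def using \<alpha> by (intro Max_ge) auto
  finally show ?thesis by (simp add: D_tilde_def)
qed

lemma product_weights_mult:
  "product_weights \<gamma> u * D ^ card u = (\<Prod>j\<in>u. \<gamma> j * D)"
  by (simp add: product_weights_def prod.distrib)

text \<open>The average over all polynomials is pulled out of the sum over \<open>w\<close>, which
  then factorises. The empty set, absent from the criterion, would contribute 1; this is the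
  \<open>- 1\<close>.\<close>

lemma B_crit_eq:
  fixes p :: "'b::prime_card mod_ring poly" and q :: "nat \<Rightarrow> 'b mod_ring poly"
    and \<gamma> :: "nat \<Rightarrow> real"
  assumes m: "Polynomial.degree p = m" "0 < m" and mn: "0 < min \<alpha> d"
    and r: "r = d * J + n" "Suc J \<le> s" "n \<le> d"
  defines "c \<equiv> \<lambda>j. \<gamma> j * D_tilde CARD('b) \<alpha> d"
    and "X \<equiv> \<lambda>k j. chi CARD('b) \<alpha> d (v_quot m (nat_poly k * q j) p)"
  shows "B_crit m s \<alpha> d (product_weights \<gamma>) r q p
    = (\<Sum>k<CARD('b) ^ m.
        (\<Prod>j=1..J. 1 - c j + c j * (\<Prod>l=1..d. 1 + X k (d * (j - 1) + l)))
        * (1 - c (Suc J) + c (Suc J) * (\<Prod>l=1..n. 1 + X k (d * J + l))) - 1) / real (CARD('b) ^ m)"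
proof -
  let ?W = "\<lambda>k w. (\<Prod>j\<in>phi_set s d w. c j) * (\<Prod>i\<in>w. X k i)"
  have d: "0 < d" using mn by simp
  have "B_crit m s \<alpha> d (product_weights \<gamma>) r q p
      = (\<Sum>w\<in>Pow {1..r} - {{}}. (\<Sum>k<CARD('b) ^ m. ?W k w) / real (CARD('b) ^ m))"
    unfolding B_crit_def
  proof (rule sum.cong[OF refl])
    fix w assume "w \<in> Pow {1..r} - {{}}"
    then have w: "w \<subseteq> {1..r}" by blast
    show "product_weights \<gamma> (phi_set s d w) * D_tilde CARD('b) \<alpha> d ^ card (phi_set s d w) *
        infsum (\<lambda>l. \<Prod>j\<in>w. r_coeff CARD('b) \<alpha> d (l j))
          {l \<in> w \<rightarrow>\<^sub>E {1..}. (\<lambda>j. if j \<in> w then l j else 0) \<in> dual_net m r q p}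
        = (\<Sum>k<CARD('b) ^ m. ?W k w) / real (CARD('b) ^ m)"
      unfolding product_weights_mult infsum_dual_net[OF m mn w] X_def c_def
      by (simp add: sum_distrib_left)
  qed
  also have "\<dots> = (\<Sum>k<CARD('b) ^ m. \<Sum>w\<in>Pow {1..r} - {{}}. ?W k w) / real (CARD('b) ^ m)"
    by (subst sum.swap) (simp add: sum_divide_distrib)
  also have "(\<Sum>k<CARD('b) ^ m. \<Sum>w\<in>Pow {1..r} - {{}}. ?W k w)
      = (\<Sum>k<CARD('b) ^ m. (\<Sum>w\<in>Pow {1..r}. ?W k w) - 1)"
    by (intro sum.cong refl) (simp add: sum_diff1)
  finally show ?thesis
    unfolding r(1) by (subst (asm) sum_Pow_phi_set[OF d r(2,3)])
qed

lemma eta_split: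
  fixes p :: "'b::prime_card mod_ring poly" and q :: "nat \<Rightarrow> 'b mod_ring poly" and \<alpha> m :: nat
  assumes d: "0 < d" and r: "r = d * J + Suc n" "n < d"
  defines "x \<equiv> \<lambda>h i. chi CARD('b) \<alpha> d (v_quot m (h * q i) p)"
  shows "eta m \<alpha> d \<gamma> p q r h
    = (\<Prod>j=1..J. 1 - \<gamma> j * D_tilde CARD('b) \<alpha> d
         + \<gamma> j * D_tilde CARD('b) \<alpha> d * (\<Prod>l=1..d. 1 + x h (d * (j - 1) + l)))
      * (\<Prod>l=1..n. 1 + x h (d * J + l))"
proof -
  have "(r - 1) div d = J" "(r - 1) mod d = n" using d r by simp_all
  then show ?thesis by (simp add: eta_def Let_def x_def)
qed

lemma block_end_le: "1 \<le> j \<Longrightarrow> j \<le> J \<Longrightarrow> d * (j - 1) + d \<le> d * J" for d j J :: nat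
  using mult_le_mono2[of j J d] by (cases j) auto

text \<open>The quantity for step \<open>r\<close> reads only earlier components, so it can be
  computed from the output produced so far.\<close>

lemma eta_cong:
  assumes "0 < d" "\<And>i. 1 \<le> i \<Longrightarrow> i < r \<Longrightarrow> q i = q' i"
  shows "eta m \<alpha> d \<gamma> p q r h = eta m \<alpha> d \<gamma> p q' r h"
proof (cases "r = 0")
  case True
  then show ?thesis by (simp add: eta_def Let_def)
next
  case False
  define J n where "J = (r - 1) div d" and "n = (r - 1) mod d"
  have r: "r = d * J + Suc n" "n < d" using False assms(1) by (simp_all add: J_def n_def)
  have "q (d * (j - 1) + l) = q' (d * (j - 1) + l)" if "j \<in> {1..J}" "l \<in> {1..d}" for j l
  proof -
    have "d * (j - 1) + d \<le> d * J" using that by (intro block_end_le) auto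
    then show ?thesis using that r by (intro assms(2)) auto
  qed
  moreover have "q (d * J + l) = q' (d * J + l)" if "l \<in> {1..n}" for l
    using that r by (intro assms(2)) auto
  ultimately show ?thesis unfolding eta_split[OF assms(1) r]
    by (intro arg_cong2[where f = "(*)"] prod.cong arg_cong2[where f = "(+)"] refl) simp_all
qed

text \<open>The zero polynomial is split off because its term does not involve the new component;
  the minimisation concerns the others.\<close>

lemma sum_nonzero_polys:
  fixes f :: "'b::prime_card mod_ring poly \<Rightarrow> real"
  assumes "0 < m"
  shows "(\<Sum>k<CARD('b) ^ m. f (nat_poly k)) = f 0 + (\<Sum>h\<in>R_set m. f h)"
proof -
  have "(\<Sum>k<CARD('b) ^ m. f (nat_poly k)) = (\<Sum>h\<in>{q. Polynomial.degree q < m}. f h)"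
    unfolding nat_poly_image[OF assms, symmetric]
    by (subst sum.reindex) (auto intro: inj_on_subset[OF inj_nat_poly])
  also have "{q :: 'b mod_ring poly. Polynomial.degree q < m} = insert 0 (R_set m)"
    using assms by (auto simp: R_set_def)
  also have "(\<Sum>h\<in>insert 0 (R_set m). f h) = f 0 + (\<Sum>h\<in>R_set m. f h)"
  proof (rule sum.insert)
    have "finite {q :: 'b mod_ring poly. Polynomial.degree q < m}"
      unfolding nat_poly_image[OF assms, symmetric] by simp
    then show "finite (R_set m :: 'b mod_ring poly set)" by (rule finite_subset[rotated]) (auto simp: R_set_def)
  qed (simp add: R_set_def)
  finally show ?thesis .
qed

text \<open>An implication and not an equivalence: if the weight of the current coordinate vanishes,
  the criterion is constant in the new component and has further minimizers.\<close>

lemma B_crit_arg_min: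
  fixes p :: "'b::prime_card mod_ring poly" and q :: "nat \<Rightarrow> 'b mod_ring poly"
  assumes m: "Polynomial.degree p = m" "0 < m" and \<alpha>: "1 \<le> \<alpha>" and d: "1 \<le> d"
    and r: "1 \<le> r" "r \<le> d * s" and \<gamma>: "\<forall>j\<in>{1..s}. \<gamma> j \<ge> 0"
    and min: "is_arg_min (\<lambda>q'. \<Sum>h\<in>R_set m. eta m \<alpha> d \<gamma> p q r h * chi CARD('b) \<alpha> d (v_quot m (h * q') p))
      (\<lambda>q'. q' \<in> R_set m) q0"
  shows "is_arg_min (\<lambda>q'. B_crit m s \<alpha> d (product_weights \<gamma>) r (q(r := q')) p) (\<lambda>q'. q' \<in> R_set m) q0"
proof -
  have d0: "0 < d" and mn: "0 < min \<alpha> d" using d \<alpha> by auto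
  define J n where "J = (r - 1) div d" and "n = (r - 1) mod d"
  have rJ: "r = d * J + Suc n" "n < d" using r(1) d0 by (simp_all add: J_def n_def)
  have J: "Suc J \<le> s"
  proof -
    have "d * J < d * s" using rJ(1) r(2) by linarith
    then show ?thesis by simp
  qed
  let ?c = "\<lambda>j. \<gamma> j * D_tilde CARD('b) \<alpha> d"
  let ?S = "\<lambda>q'. \<Sum>h\<in>R_set m. eta m \<alpha> d \<gamma> p q r h * chi CARD('b) \<alpha> d (v_quot m (h * q') p)"
  define P where "P h = (\<Prod>j=1..J. 1 - ?c j + ?c j * (\<Prod>l=1..d. 1 + chi CARD('b) \<alpha> d (v_quot m (h * q (d * (j - 1) + l)) p)))" for h
  define E where "E h = (\<Prod>l=1..n. 1 + chi CARD('b) \<alpha> d (v_quot m (h * q (d * J + l)) p))" for h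
  define f where "f q' h = P h * (1 - ?c (Suc J) + ?c (Suc J) * (E h * (1 + chi CARD('b) \<alpha> d (v_quot m (h * q') p)))) - 1" for q' h
  \<comment> \<open>In \<open>E h * (1 + chi) = E h + E h * chi\<close> the first summand is
    independent of the new component and goes into \<open>A\<close>, together with the term of the
    zero polynomial.\<close>
  define A where "A = f 0 0 + (\<Sum>h\<in>R_set m. P h * (1 - ?c (Suc J) + ?c (Suc J) * E h) - 1)"
  have eta: "eta m \<alpha> d \<gamma> p q r h = P h * E h" for h
    unfolding eta_split[OF d0 rJ] P_def E_def ..
  have B: "B_crit m s \<alpha> d (product_weights \<gamma>) r (q(r := q')) p = (A + ?c (Suc J) * ?S q') / real (CARD('b) ^ m)" for q'
  proof -
    define Q where "Q = q(r := q')"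
    have q1: "Q (d * (j - 1) + l) = q (d * (j - 1) + l)" if "j \<in> {1..J}" "l \<in> {1..d}" for j l
    proof -
      have "d * (j - 1) + d \<le> d * J" using that by (intro block_end_le) auto
      then show ?thesis using that rJ by (auto simp: Q_def)
    qed
    have q2: "Q (d * J + l) = q (d * J + l)" if "l \<in> {1..n}" for l
      using that rJ by (auto simp: Q_def)
    have prod_Suc: "(\<Prod>l=1..Suc n. g l) = (\<Prod>l=1..n. g l) * g (Suc n)" for g :: "nat \<Rightarrow> real"
      by (simp add: mult.commute)
    have q3: "Q (d * J + Suc n) = q'" using rJ by (simp add: Q_def)
    have "B_crit m s \<alpha> d (product_weights \<gamma>) r Q p = (\<Sum>k<CARD('b) ^ m. f q' (nat_poly k)) / real (CARD('b) ^ m)"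
      unfolding B_crit_eq[OF m mn rJ(1) J Suc_leI[OF rJ(2)]] f_def P_def E_def prod_Suc q3
      by (intro arg_cong2[where f = "(/)"] sum.cong arg_cong2[where f = "(-)"] arg_cong2[where f = "(*)"]
          arg_cong2[where f = "(+)"] prod.cong refl) (simp_all add: q1[simplified] q2[simplified])
    also have "(\<Sum>k<CARD('b) ^ m. f q' (nat_poly k)) = f q' 0 + (\<Sum>h\<in>R_set m. f q' h)"
      by (rule sum_nonzero_polys[OF m(2)])
    also have "f q' 0 = f 0 0" by (simp add: f_def)
    also have "(\<Sum>h\<in>R_set m. f q' h) = (\<Sum>h\<in>R_set m. P h * (1 - ?c (Suc J) + ?c (Suc J) * E h) - 1) + ?c (Suc J) * ?S q'"
      unfolding sum_distrib_left sum.distrib[symmetric] eta f_def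
      by (intro sum.cong refl) (simp add: algebra_simps)
    finally show ?thesis unfolding A_def Q_def by (simp only: add.assoc)
  qed
  have c: "0 \<le> ?c (Suc J)" using \<gamma> J D_tilde_nonneg[OF \<alpha>] by (intro mult_nonneg_nonneg) auto
  have "(A + ?c (Suc J) * ?S q0) / real (CARD('b) ^ m) \<le> (A + ?c (Suc J) * ?S q') / real (CARD('b) ^ m)"
    if "q' \<in> R_set m" for q'
  proof -
    have "?S q0 \<le> ?S q'" using min that unfolding is_arg_min_linorder by blast
    then show ?thesis using c by (intro divide_right_mono add_left_mono mult_left_mono) auto
  qed
  then show ?thesis using min unfolding is_arg_min_linorder B by blast
qed

section \<open>Powers of a primitive element and the circulant matrix\<close>

context residue_field
begin

lemma pow_mod_cong:
  assumes g: "g \<in> R_set m" "ord_of g = M" and k: "int k mod int M = i mod int M"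
  shows "pow_mod m p g i = g ^ k mod p"
proof -
  have "nat (i mod int M) = k mod M" using k by (metis nat_int of_nat_mod)
  then show ?thesis unfolding pow_mod_def M_def[symmetric]
    using pow_mod_period[OF g(1) pow_M[OF g(1)]] by simp
qed

text \<open>Matrix indices run from 1 to \<open>M\<close>, reduced exponents from 0 to
  \<open>M - 1\<close>; the maps \<open>M - n\<close> and \<open>n mod M\<close> translate between
  them, the latter taking \<open>M\<close> to 0.\<close>

lemma bij_pow_mod:
  assumes g: "g \<in> R_set m" "ord_of g = M"
  shows "bij_betw (\<lambda>n. pow_mod m p g (- int n)) {1..M} (R_set m)"
    and "bij_betw (\<lambda>n. pow_mod m p g (int n)) {1..M} (R_set m)"
proof -
  have e1: "pow_mod m p g (- int n) = g ^ (M - n) mod p" if "n \<in> {1..M}" for n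
  proof (rule pow_mod_cong[OF g])
    have "int (M - n) = - int n + int M" using that by simp
    then show "int (M - n) mod int M = - int n mod int M" by simp
  qed
  have b: "bij_betw (\<lambda>i. g ^ i mod p) {..<M} (R_set m)"
    using pow_inj[OF g(1)] primitive_image[OF g] g(2) by (simp add: bij_betw_def)
  have "bij_betw (\<lambda>n. M - n) {1..M} {..<M}"
    by (rule bij_betw_byWitness[where f' = "\<lambda>n. M - n"]) auto
  from bij_betw_trans[OF this b] show "bij_betw (\<lambda>n. pow_mod m p g (- int n)) {1..M} (R_set m)"
    by (rule bij_betw_cong[THEN iffD1, rotated]) (simp add: e1)
  have e2: "pow_mod m p g (int n) = g ^ (n mod M) mod p" for n
    by (rule pow_mod_cong[OF g]) (simp add: zmod_int)
  have "bij_betw (\<lambda>n. n mod M) {1..M} {..<M}"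
  proof (rule bij_betw_byWitness[where f' = "\<lambda>n. if n = 0 then M else n"])
    show "\<forall>n\<in>{1..M}. (if n mod M = 0 then M else n mod M) = n"
    proof
      fix n assume "n \<in> {1..M}"
      then show "(if n mod M = 0 then M else n mod M) = n" by (cases "n = M") auto
    qed
  qed (use M_pos in auto)
  from bij_betw_trans[OF this b] show "bij_betw (\<lambda>n. pow_mod m p g (int n)) {1..M} (R_set m)"
    by (rule bij_betw_cong[THEN iffD1, rotated]) (simp add: e2)
qed

lemma pow_mod_add:
  assumes g: "g \<in> R_set m" "ord_of g = M"
  shows "pow_mod m p g i * pow_mod m p g j mod p = pow_mod m p g (i + j)"
proof -
  let ?a = "nat (i mod int M)" and ?b = "nat (j mod int M)"
  have "pow_mod m p g i * pow_mod m p g j mod p = g ^ (?a + ?b) mod p"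
    unfolding pow_mod_def M_def[symmetric] by (simp add: power_add mod_mult_eq)
  also have "\<dots> = pow_mod m p g (i + j)"
  proof (rule pow_mod_cong[OF g, symmetric])
    have "int (?a + ?b) = i mod int M + j mod int M" using M_pos by simp
    then show "int (?a + ?b) mod int M = (i + j) mod int M" by (simp add: mod_add_eq)
  qed
  finally show ?thesis .
qed

text \<open>Modulo \<open>p\<close> the power with exponent \<open>i - n\<close> is the product of
  those with exponents \<open>- n\<close> and \<open>i\<close>; substituting \<open>h\<close> for
  the power with exponent \<open>- n\<close> turns the matrix row into a sum over all non-zero
  residues.\<close>

lemma c_vec_eq:
  assumes g: "g \<in> R_set m" "ord_of g = M"
  shows "c_vec m \<alpha> d \<gamma> p g q r i
    = (\<Sum>h\<in>R_set m. eta m \<alpha> d \<gamma> p q r h * chi CARD('b) \<alpha> d (v_quot m (h * pow_mod m p g (int i)) p))"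
proof -
  have "c_vec m \<alpha> d \<gamma> p g q r i = (\<Sum>n\<in>{1..M}. eta m \<alpha> d \<gamma> p q r (pow_mod m p g (- int n))
      * chi CARD('b) \<alpha> d (v_quot m (pow_mod m p g (- int n) * pow_mod m p g (int i)) p))"
    unfolding c_vec_def M_def[symmetric]
  proof (rule sum.cong[OF refl])
    fix n
    have "v_quot m (pow_mod m p g (- int n) * pow_mod m p g (int i)) p = v_quot m (pow_mod m p g (int i - int n)) p"
      using pow_mod_add[OF g, of "- int n" "int i"] by (intro v_quot_cong) (simp_all add: pow_mod_def)
    then show "chi CARD('b) \<alpha> d (v_quot m (pow_mod m p g (int i - int n)) p) * eta m \<alpha> d \<gamma> p q r (pow_mod m p g (- int n))
      = eta m \<alpha> d \<gamma> p q r (pow_mod m p g (- int n))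
      * chi CARD('b) \<alpha> d (v_quot m (pow_mod m p g (- int n) * pow_mod m p g (int i)) p)" by simp
  qed
  also have "\<dots> = (\<Sum>h\<in>R_set m. eta m \<alpha> d \<gamma> p q r h * chi CARD('b) \<alpha> d (v_quot m (h * pow_mod m p g (int i)) p))"
    by (rule sum.reindex_bij_betw[OF bij_pow_mod(1)[OF g], of "\<lambda>h. eta m \<alpha> d \<gamma> p q r h * chi CARD('b) \<alpha> d (v_quot m (h * pow_mod m p g (int i)) p)"])
  finally show ?thesis .
qed

lemma cbc_result_if_fast:
  assumes g: "g \<in> R_set m" "ord_of g = M" and \<alpha>: "1 \<le> \<alpha>" and d: "1 \<le> d"
    and \<gamma>: "\<forall>j\<in>{1..s}. \<gamma> j \<ge> 0" and q1: "q 1 = 1"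
    and q: "\<And>r. r \<in> {2..d * s} \<Longrightarrow> \<exists>i0. is_arg_min (c_vec m \<alpha> d \<gamma> p g q r) (\<lambda>i. i \<in> {1..M}) i0
        \<and> q r = pow_mod m p g (int i0)"
  shows "cbc_result m s \<alpha> d (product_weights \<gamma>) p q"
  unfolding cbc_result_def
proof (intro conjI ballI)
  fix r assume r: "r \<in> {2..d * s}"
  from q[OF r] obtain i0 where i0: "is_arg_min (c_vec m \<alpha> d \<gamma> p g q r) (\<lambda>i. i \<in> {1..M}) i0"
    "q r = pow_mod m p g (int i0)" by blast
  show "is_arg_min (\<lambda>q'. B_crit m s \<alpha> d (product_weights \<gamma>) r (q(r := q')) p) (\<lambda>q'. q' \<in> R_set m) (q r)"
  proof (rule B_crit_arg_min[OF deg m_pos \<alpha> d _ _ \<gamma>])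
    have im: "(\<lambda>n. pow_mod m p g (int n)) ` {1..M} = R_set m"
      using bij_pow_mod(2)[OF g] by (simp add: bij_betw_def)
    show "is_arg_min (\<lambda>q'. \<Sum>h\<in>R_set m. eta m \<alpha> d \<gamma> p q r h * chi CARD('b) \<alpha> d (v_quot m (h * q') p))
        (\<lambda>q'. q' \<in> R_set m) (q r)"
      unfolding is_arg_min_linorder im[symmetric] i0(2)
      using i0(1) unfolding is_arg_min_linorder c_vec_eq[OF g] im[symmetric] by blast
  qed (use r in auto)
qed (use irr deg q1 in auto)

end

section \<open>The modulus\<close>

context machine
begin

lemma bbN_ge: "4 \<le> b * (b * N)"
proof -
  have "2 \<le> b * N" using N_bounds(1,5) by linarith
  then have "2 * 2 \<le> b * (b * N)" by (rule mult_le_mono[OF b2])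
  then show ?thesis by simp
qed

lemma np_digit_split: "np j = [:0, 1:] * np (j div b) + np (j mod b)"
  using nat_poly_rec[of j, where 'b = 'b] by (simp add: b nat_poly_const)

lemma enc_mult_b: "enc ([:0, 1:] * q :: 'b mod_ring poly) = enc q * b"
  using nat_poly_mult_CARD[of "enc q", where 'b = 'b] by (metis b enc_nat_poly nat_poly_enc)

text \<open>\<open>x * v\<close> has degree at most \<open>m\<close>, and its coefficient at
  \<open>x ^ m\<close> is the digit \<open>t' = v * b div N\<close>. Adding \<open>- t'\<close>
  times the monic modulus removes it. The digit of \<open>- t'\<close> is
  \<open>(b - t') mod b\<close>, the last reduction being for \<open>t' = 0\<close>.\<close>

lemma neval_xtimes:
  fixes P :: "'b mod_ring poly"
  assumes t: "tables \<tau>" and P: "Polynomial.degree P = m" "lead_coeff P = 1"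
    and tab: "\<forall>c<b. nmem \<tau> ''P'' c = enc (np c * P)" and v: "neval e \<tau> < N"
  shows "neval (xtimes e) \<tau> = enc (([:0, 1:] * np (neval e \<tau>)) mod P)"
proof -
  let ?v = "neval e \<tau>" and ?w = "[:0, 1:] * np (neval e \<tau>)"
  define t' where "t' = ?v * b div N"
  define c where "c = (b - t') mod b"
  have "?v * b < b * N" using v b_pos by simp
  then have t'b: "t' < b" by (simp add: t'_def less_mult_imp_div_less)
  have cb: "c < b" using b_pos by (simp add: c_def)
  have w: "np (?v * b) = ?w" using nat_poly_mult_CARD[of ?v, where 'b = 'b] by (simp add: b)
  have enc_w: "enc ?w = ?v * b" using w by (metis enc_nat_poly)
  have npc: "np c = [:- of_nat t':]"
  proof -
    have "(of_nat c :: 'b mod_ring) = of_nat (b - t')" by (simp add: c_def b)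
    also have "\<dots> = - of_nat t'" using t'b by (simp add: of_nat_diff b)
    finally show ?thesis using cb by (simp add: b nat_poly_const)
  qed
  have coeff: "Polynomial.coeff ?w m = of_nat t'"
    unfolding w[symmetric] coeff_nat_poly t'_def by (simp add: b N)
  have degw: "Polynomial.degree ?w \<le> m"
    unfolding w[symmetric] by (rule degree_np_le) (use \<open>?v * b < b * N\<close> in simp)
  let ?r = "?w + np c * P"
  have "Polynomial.degree ?r < m"
  proof -
    have "Polynomial.degree (np c * P) \<le> m" using degree_mult_le[of "np c" P] P by (simp add: npc)
    then have "Polynomial.degree ?r \<le> m" using degw by (rule degree_add_le[rotated])
    moreover have "Polynomial.coeff ?r m = 0" using P coeff by (simp add: npc)
    moreover have "Polynomial.degree ?r \<noteq> m" if "?r \<noteq> 0"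
      using \<open>Polynomial.coeff ?r m = 0\<close> that leading_coeff_0_iff[of ?r] by metis
    ultimately show ?thesis using m by (cases "?r = 0") (simp, linarith)
  qed
  then have "?r mod P = ?r" using P(1) by (intro mod_poly_less) (simp only:)
  moreover have "?r mod P = ?w mod P" by (rule mod_mult_self1)
  ultimately have r: "?r = ?w mod P" by (simp only:)
  have "neval (padd (e \<^bold>* nv ''b'') (NCell ''P'' ((nv ''b'' \<^bold>- e \<^bold>* nv ''b'' \<^bold>/ nv ''N'') \<^bold>% nv ''b''))) \<tau>
      = enc (np (?v * b) + np (enc (np c * P)))"
  proof (subst neval_padd[OF t])
    have "enc (np c * P) < b * N"
      using degree_mult_le[of "np c" P] P by (intro enc_less_bN) (simp add: npc)
    then show "neval (NCell ''P'' ((nv ''b'' \<^bold>- e \<^bold>* nv ''b'' \<^bold>/ nv ''N'') \<^bold>% nv ''b'')) \<tau> < b * N"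
      using tab cb tablesD[OF t] by (simp add: c_def t'_def)
    show "neval (e \<^bold>* nv ''b'') \<tau> < b * N" using \<open>?v * b < b * N\<close> tablesD[OF t] by simp
  qed (use tab cb tablesD[OF t] in \<open>simp add: c_def t'_def\<close>)
  then show ?thesis using r w by (simp add: xtimes_def)
qed

lemma ncost_xtimes [simp]: "ncost (xtimes e) = 4 * ncost e + 58"
  by (simp add: xtimes_def)

section \<open>Sieve for reducible polynomials of degree m\<close>

definition sieve_row :: com where
  "sieve_row = for_all ''j'' (nv ''hi'')
          (NSet ''T'' (nv ''j'') (padd (NCell ''T'' (nv ''j'' \<^bold>/ nv ''b'') \<^bold>* nv ''b'')
                                     (NCell ''S'' (nv ''j'' \<^bold>% nv ''b''))) ;;
           NSet ''Mark'' (NCell ''T'' (nv ''j'')) (Num 1))"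

text \<open>A Horner scheme over the digits:
  \<open>y * u = x * ((y div b) * u) + (y mod b) * u\<close>, so each product costs one shift and
  one addition. The entry for \<open>y = 0\<close> refers to itself, hence the assumption that it
  holds 0.\<close>

lemma run_sieve_row:
  fixes \<sigma> :: state
  assumes t: "tables \<sigma>" and hi: "nmem \<sigma> ''hi'' 0 = hi" "hi \<le> N"
    and S: "\<forall>c<b. nmem \<sigma> ''S'' c = enc (np c * np u)" and u: "u < b * N" and T: "nmem \<sigma> ''T'' 0 = 0"
    and small: "\<And>y. y < hi \<Longrightarrow> enc (np y * np u) < b * N"
  shows "(\<forall>x. 0 < nmem (run sieve_row \<sigma>) ''Mark'' x \<longleftrightarrow>
        0 < nmem \<sigma> ''Mark'' x \<or> (\<exists>y<hi. x = enc (np y * np u)))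
    \<and> ok K sieve_row \<sigma> (5 + 80 * hi)"
proof -
  let ?body = "NSet ''T'' (nv ''j'') (padd (NCell ''T'' (nv ''j'' \<^bold>/ nv ''b'') \<^bold>* nv ''b'')
                                     (NCell ''S'' (nv ''j'' \<^bold>% nv ''b''))) ;;
           NSet ''Mark'' (NCell ''T'' (nv ''j'')) (Num 1)"
  let ?I = "\<lambda>j (\<tau>::state). nmem \<tau> ''T'' 0 = 0 \<and> (\<forall>y<j. nmem \<tau> ''T'' y = enc (np y * np u))
    \<and> (\<forall>x. 0 < nmem \<tau> ''Mark'' x \<longleftrightarrow> 0 < nmem \<sigma> ''Mark'' x \<or> (\<exists>y<j. x = enc (np y * np u)))"
  have "?I hi (run sieve_row \<sigma>) \<and> ok K sieve_row \<sigma> (5 + 80 * hi)"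
    unfolding sieve_row_def
  proof (rule for_all_const[where I = ?I and t = 70])
    fix j and \<tau> :: state
    assume j: "j < hi" and nj: "nmem \<tau> ''j'' 0 = j" and I: "?I j \<tau>"
      and fn: "\<And>w. w \<notin> nwr (for_all ''j'' (nv ''hi'') ?body) \<Longrightarrow> nmem \<tau> w = nmem \<sigma> w"
    have tt: "tables \<tau>" by (rule tables_cong[OF t], rule fn) auto
    have S': "\<forall>c<b. nmem \<tau> ''S'' c = enc (np c * np u)" using S fn by simp
    let ?q = "np (j div b) * np u"
    have Tj: "nmem \<tau> ''T'' (j div b) = enc ?q"
    proof (cases "j = 0")
      case False
      then have "j div b < j" using b2 by simp
      then show ?thesis using I by simp
    qed (use I in simp)
    \<comment> \<open>The shifted summand is itself a product with a number
      \<open>(j div b) * b \<le> j < hi\<close>, so the assumed size bound covers it and the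
      addition table applies.\<close>
    have "enc (np (j div b * b) * np u) < b * N"
      using j div_times_less_eq_dividend[of j b] by (intro small) linarith
    moreover have "np (j div b * b) * np u = [:0, 1:] * ?q"
      using nat_poly_mult_CARD[of "j div b", where 'b = 'b] by (simp only: b mult.assoc)
    ultimately have q: "enc ?q * b < b * N" by (simp only: enc_mult_b)
    have c: "j mod b < b" using b_pos by simp
    have cu: "enc (np (j mod b) * np u) < b * N" by (rule np_const_mult_less[OF c u])
    have ev: "neval (padd (NCell ''T'' (nv ''j'' \<^bold>/ nv ''b'') \<^bold>* nv ''b'') (NCell ''S'' (nv ''j'' \<^bold>% nv ''b''))) \<tau>
        = enc (np j * np u)"
    proof -
      have "np (enc ?q * b) = [:0, 1:] * ?q" by (metis enc_mult_b nat_poly_enc)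
      then have "np (enc ?q * b) + np (j mod b) * np u = np j * np u"
        by (subst (3) np_digit_split) (simp only: distrib_right mult.assoc)
      then show ?thesis
        using q cu S' Tj c by (subst neval_padd[OF tt]) (simp_all add: nj tablesD[OF tt])
    qed
    have st: "nmem (run ?body \<tau>) ''T'' = (nmem \<tau> ''T'')(j := enc (np j * np u))"
        "nmem (run ?body \<tau>) ''Mark'' = (nmem \<tau> ''Mark'')(enc (np j * np u) := 1)"
      using ev by (simp_all add: nj)
    have "ok K ?body \<tau> 70"
    proof (rule ok_straight)
      show "safe K ?body \<tau>"
        using ev small[OF j] j hi(2) K_bounds by (simp add: nj)
    qed simp
    moreover have "?I (Suc j) (run ?body \<tau>)"
      unfolding st using I by (auto simp: less_Suc_eq simp del: enc_eq_iff)
    ultimately show "ok K ?body \<tau> 70 \<and> ?I (Suc j) (run ?body \<tau>)" by blast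
  qed (use hi T K_bounds in auto)
  then show ?thesis by blast
qed

definition sieve_degree :: com where
  "sieve_degree = for_all ''i'' (nv ''lo'' \<^bold>* nv ''b'' \<^bold>- nv ''lo'')
        (nlet ''u'' (nv ''lo'' \<^bold>+ nv ''i'') ;;
         scalar_multiples ''S'' (nv ''u'') ;;
         NSet ''T'' (Num 0) (Num 0) ;;
         sieve_row)"

lemma run_sieve_degree:
  fixes \<sigma> :: state
  assumes t: "tables \<sigma>" and hi: "nmem \<sigma> ''hi'' 0 = hi" "hi \<le> N" and lo: "nmem \<sigma> ''lo'' 0 = lo" "lo \<le> N"
    and small: "\<And>u y. u < lo * b \<Longrightarrow> y < hi \<Longrightarrow> enc (np y * np u) < b * N"
  shows "(\<forall>x. 0 < nmem (run sieve_degree \<sigma>) ''Mark'' x \<longleftrightarrow>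
        0 < nmem \<sigma> ''Mark'' x \<or> (\<exists>u\<in>{lo..<lo * b}. \<exists>y<hi. x = enc (np y * np u)))
    \<and> ok K sieve_degree \<sigma> (10 + lo * b * (50 + 70 * b + 80 * hi))"
proof -
  let ?c1 = "nlet ''u'' (nv ''lo'' \<^bold>+ nv ''i'')" and ?c2 = "scalar_multiples ''S'' (nv ''u'')"
    and ?c3 = "NSet ''T'' (Num 0) (Num 0)"
  let ?body = "?c1 ;; ?c2 ;; ?c3 ;; sieve_row"
  let ?n = "lo * b - lo"
  have lo_le: "lo \<le> lo * b" using b2 by simp
  let ?I = "\<lambda>i (\<tau>::state). \<forall>x. 0 < nmem \<tau> ''Mark'' x \<longleftrightarrow>
    0 < nmem \<sigma> ''Mark'' x \<or> (\<exists>u\<in>{lo..<lo + i}. \<exists>y<hi. x = enc (np y * np u))"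
  have "?I ?n (run sieve_degree \<sigma>) \<and> ok K sieve_degree \<sigma> (10 + lo * b * (50 + 70 * b + 80 * hi))"
    unfolding sieve_degree_def
  proof (rule for_all_const[where I = ?I and t = "40 + 70 * b + 80 * hi"])
    fix i and \<tau> :: state
    assume i: "i < ?n" and ni: "nmem \<tau> ''i'' 0 = i" and I: "?I i \<tau>"
      and fn: "\<And>w. w \<notin> nwr (for_all ''i'' (nv ''lo'' \<^bold>* nv ''b'' \<^bold>- nv ''lo'') ?body) \<Longrightarrow> nmem \<tau> w = nmem \<sigma> w"
    have fr: "nmem \<tau> w = nmem \<sigma> w" if "w \<in> table_names \<union> {''lo'', ''hi''}" for w
      using that by (intro fn) (auto simp: nwr_scalar_multiples sieve_row_def)
    have tt: "tables \<tau>" by (rule tables_cong[OF t], rule fr) auto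
    have lohi: "nmem \<tau> ''lo'' 0 = lo" "nmem \<tau> ''hi'' 0 = hi" using lo hi fr by simp_all
    define u where "u = lo + i"
    have u: "u < lo * b" using i by (simp add: u_def)
    have ubN: "u < b * N" using u lo(2) by (metis less_le_trans mult.commute mult_le_mono1)
    define \<tau>1 where "\<tau>1 = run ?c1 \<tau>"
    define \<tau>2 where "\<tau>2 = run ?c2 \<tau>1"
    define \<tau>3 where "\<tau>3 = run ?c3 \<tau>2"
    have v1: "nmem \<tau>1 ''u'' 0 = u" "nmem \<tau>1 ''hi'' 0 = hi" "nmem \<tau>1 ''Mark'' = nmem \<tau> ''Mark''"
      using ni lohi by (simp_all add: \<tau>1_def u_def)
    have t1: "tables \<tau>1" unfolding \<tau>1_def by (rule tables_run[OF tt]) auto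
    note S2 = run_scalar_multiples[OF t1 v1(1) ubN, of "''S''", folded \<tau>2_def, simplified]
    have f2: "nmem \<tau>2 w = nmem \<tau>1 w" if "w \<notin> {''S'', ''k''}" for w
      using that by (simp add: \<tau>2_def nmem_run nwr_scalar_multiples)
    have t2: "tables \<tau>2" by (rule tables_cong[OF t1], rule f2) auto
    have v3: "nmem \<tau>3 ''hi'' 0 = hi" "nmem \<tau>3 ''T'' 0 = 0" "nmem \<tau>3 ''Mark'' = nmem \<tau> ''Mark''"
        "\<forall>c<b. nmem \<tau>3 ''S'' c = enc (np c * np u)"
      using v1 f2 S2 by (simp_all add: \<tau>3_def)
    have t3: "tables \<tau>3" unfolding \<tau>3_def by (rule tables_run[OF t2]) auto
    note R = run_sieve_row[OF t3 v3(1) hi(2) v3(4) ubN v3(2) small[OF u]]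
    have run_eq: "run ?body \<tau> = run sieve_row \<tau>3" by (simp only: run.simps(4) \<tau>1_def \<tau>2_def \<tau>3_def)
    have "ok K ?body \<tau> (10 + ((10 + 70 * b) + (10 + (5 + 80 * hi))))"
    proof (intro ok_Seq)
      show "ok K ?c1 \<tau> 10" by (rule ok_straight) (use K_bounds in auto)
      show "ok K ?c2 (run ?c1 \<tau>) (10 + 70 * b)" using S2(2) by (simp only: \<tau>1_def)
      show "ok K ?c3 (run ?c2 (run ?c1 \<tau>)) 10" by (rule ok_straight) (use K_bounds in auto)
      show "ok K sieve_row (run ?c3 (run ?c2 (run ?c1 \<tau>))) (5 + 80 * hi)" using R by (simp only: \<tau>1_def \<tau>2_def \<tau>3_def)
    qed
    then have "ok K ?body \<tau> (40 + 70 * b + 80 * hi)" by (rule ok_mono) simp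
    moreover have "?I (Suc i) (run ?body \<tau>)"
    proof -
      have "{lo..<lo + Suc i} = insert u {lo..<lo + i}" by (auto simp: u_def)
      then show ?thesis unfolding run_eq using R I v3(3) by auto
    qed
    ultimately show "ok K ?body \<tau> (40 + 70 * b + 80 * hi) \<and> ?I (Suc i) (run ?body \<tau>)" by blast
  next
    have "?n * (2 + (40 + 70 * b + 80 * hi)) \<le> lo * b * (50 + 70 * b + 80 * hi)" by (intro mult_le_mono) auto
    then show "1 + ncost (nv ''lo'' \<^bold>* nv ''b'' \<^bold>- nv ''lo'') + ?n * (2 + (40 + 70 * b + 80 * hi))
        \<le> 10 + lo * b * (50 + 70 * b + 80 * hi)" by simp
  qed (use lo tablesD[OF t] K_bounds in auto)
  then show ?thesis using lo_le by simp
qed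

definition sieve :: com where
  "sieve = for_all ''e'' (nv ''m'' \<^bold>- Num 1)
      (sieve_degree ;;
       nlet ''lo'' (nv ''lo'' \<^bold>* nv ''b'') ;;
       nlet ''hi'' (nv ''hi'' \<^bold>/ nv ''b''))"

text \<open>The numbers marked after \<open>n\<close> rounds: \<open>u\<close> has degree exactly
  \<open>e\<close>, and \<open>y\<close> has degree at most \<open>m - e\<close>.\<close>

definition products :: "nat \<Rightarrow> nat set" where
  "products n = {x. \<exists>e\<in>{1..n}. \<exists>u\<in>{b ^ e..<b ^ Suc e}. \<exists>y<b ^ (m + 1 - e). x = enc (np y * np u)}"

lemma products_Suc:
  "products (Suc n) = products n \<union> {x. \<exists>u\<in>{b ^ Suc n..<b ^ Suc n * b}. \<exists>y<b ^ (m - n). x = enc (np y * np u)}"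
proof -
  have "{1..Suc n} = insert (Suc n) {1..n}" "b ^ Suc (Suc n) = b ^ Suc n * b" "m + 1 - Suc n = m - n" by auto
  then show ?thesis unfolding products_def by (simp only: bex_simps Collect_disj_eq Un_commute)
qed

lemma run_sieve:
  fixes \<sigma> :: state
  assumes t: "tables \<sigma>" and lo: "nmem \<sigma> ''lo'' 0 = b" and hi: "nmem \<sigma> ''hi'' 0 = N"
    and Mark: "nmem \<sigma> ''Mark'' = (\<lambda>_. 0)"
  shows "(\<forall>x. 0 < nmem (run sieve \<sigma>) ''Mark'' x \<longleftrightarrow> x \<in> products (m - 1))
    \<and> ok K sieve \<sigma> (10 + m * (250 * (b * (b * N))))"
proof -
  let ?c = "nlet ''lo'' (nv ''lo'' \<^bold>* nv ''b'') ;; nlet ''hi'' (nv ''hi'' \<^bold>/ nv ''b'')"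
  let ?body = "sieve_degree ;; ?c"
  let ?I = "\<lambda>i (\<tau>::state). nmem \<tau> ''lo'' 0 = b ^ Suc i \<and> nmem \<tau> ''hi'' 0 = b ^ (m - i)
    \<and> (\<forall>x. 0 < nmem \<tau> ''Mark'' x \<longleftrightarrow> x \<in> products i)"
  let ?t = "240 * (b * (b * N))"
  have "?I (m - 1) (run sieve \<sigma>) \<and> ok K sieve \<sigma> (10 + m * (250 * (b * (b * N))))"
    unfolding sieve_def
  proof (rule for_all_const[where I = ?I and t = ?t])
    fix i and \<tau> :: state
    assume i: "i < m - 1" and I: "?I i \<tau>"
      and fn: "\<And>w. w \<notin> nwr (for_all ''e'' (nv ''m'' \<^bold>- Num 1) ?body) \<Longrightarrow> nmem \<tau> w = nmem \<sigma> w"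
    have nwr: "nwr sieve_degree = {''i'', ''u'', ''S'', ''k'', ''T'', ''j'', ''Mark''}"
      by (auto simp: sieve_degree_def sieve_row_def nwr_scalar_multiples)
    have tt: "tables \<tau>" by (rule tables_cong[OF t], rule fn) (auto simp: nwr)
    have lo: "nmem \<tau> ''lo'' 0 = b ^ Suc i" "b ^ Suc i \<le> N" and hi: "nmem \<tau> ''hi'' 0 = b ^ (m - i)" "b ^ (m - i) \<le> N"
      using I i b2 power_increasing[of "Suc i" m b] power_increasing[of "m - i" m b] unfolding N by auto
    \<comment> \<open>As \<open>lo\<close> grows by the factor \<open>b\<close>, \<open>hi\<close>
      shrinks by it; the number of products formed is therefore of the same order for every
      degree.\<close>
    have lohi: "b ^ Suc i * b ^ (m - i) = b * N" using i by (simp add: N flip: power_add)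
    have small: "enc (np y * np u) < b * N" if "u < b ^ Suc i * b" "y < b ^ (m - i)" for u y
    proof (rule enc_less_bN)
      have "Polynomial.degree (np u) < Suc (Suc i)"
        using that(1) by (intro degree_nat_poly_less) (simp_all add: b mult_ac)
      moreover have "Polynomial.degree (np y) < m - i"
        using that(2) i by (intro degree_nat_poly_less) (simp_all add: b)
      ultimately show "Polynomial.degree (np y * np u) \<le> m"
        using degree_mult_le[of "np y" "np u"] i by linarith
    qed
    note R = run_sieve_degree[OF tt hi lo small]
    define \<tau>1 where "\<tau>1 = run sieve_degree \<tau>"
    have v1: "nmem \<tau>1 ''lo'' 0 = b ^ Suc i" "nmem \<tau>1 ''hi'' 0 = b ^ (m - i)" "nmem \<tau>1 ''b'' 0 = b"
      using I tablesD[OF tt] by (simp_all add: \<tau>1_def nmem_run nwr)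
    have I1: "?I (Suc i) (run ?body \<tau>)"
    proof -
      have "m - i = Suc (m - Suc i)" using i by simp
      then have "b ^ (m - i) div b = b ^ (m - Suc i)" using b_pos by simp
      then show ?thesis using v1 R I unfolding products_Suc by (auto simp: \<tau>1_def[symmetric] mult.commute)
    qed
    have "ok K ?body \<tau> ((10 + b ^ Suc i * b * (50 + 70 * b + 80 * b ^ (m - i))) + 20)"
    proof (rule ok_Seq)
      show "ok K sieve_degree \<tau> (10 + b ^ Suc i * b * (50 + 70 * b + 80 * b ^ (m - i)))" using R by blast
      show "ok K ?c (run sieve_degree \<tau>) 20" by (rule ok_straight) (use K_bounds in auto)
    qed
    moreover have "(10 + b ^ Suc i * b * (50 + 70 * b + 80 * b ^ (m - i))) + 20 \<le> ?t"
    proof -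
      have "b ^ Suc i * b * (50 + 70 * b + 80 * b ^ (m - i))
          = b * (b ^ Suc i * (50 + 70 * b)) + 80 * (b * (b ^ Suc i * b ^ (m - i)))"
        by (simp only: distrib_left mult_ac)
      also have "\<dots> \<le> b * (N * (50 + 70 * b)) + 80 * (b * (b * N))"
        unfolding lohi using lo(2) by (intro add_mono mult_le_mono order_refl)
      also have "b * (N * (50 + 70 * b)) = 50 * (b * N) + 70 * (b * (b * N))" by (simp add: distrib_left)
      also have "50 * (b * N) \<le> 25 * (b * (b * N))" using mult_le_mono1[OF b2, of "b * N"] by simp
      finally have "b ^ Suc i * b * (50 + 70 * b + 80 * b ^ (m - i)) \<le> 175 * (b * (b * N))" by simp
      moreover have "4 \<le> b * (b * N)" by (rule bbN_ge)
      ultimately show ?thesis by linarith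
    qed
    ultimately have "ok K ?body \<tau> ?t" by (rule ok_mono)
    with I1 show "ok K ?body \<tau> ?t \<and> ?I (Suc i) (run ?body \<tau>)" by blast
  next
    have "1 \<le> b * (b * N)" using bbN_ge by linarith
    then have "(m - 1) * (2 + ?t) \<le> m * (250 * (b * (b * N)))" by (intro mult_le_mono) auto
    then show "1 + ncost (nv ''m'' \<^bold>- Num 1) + (m - 1) * (2 + ?t) \<le> 10 + m * (250 * (b * (b * N)))" by simp
  qed (use lo hi Mark tablesD[OF t] K_bounds in \<open>auto simp: products_def N\<close>)
  then show ?thesis by blast
qed

text \<open>Non-constant factors of \<open>P\<close> have complementary degrees between 1 and
  \<open>m - 1\<close>, and one of them was met as \<open>u\<close>. Conversely, when a marked
  product has degree \<open>m\<close>, the bounds on the two degrees leave no room for a constant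
  factor.\<close>

lemma irreducible_iff_unmarked:
  assumes P: "Polynomial.degree (P :: 'b mod_ring poly) = m"
  shows "Factorial_Ring.irreducible P \<longleftrightarrow> enc P \<notin> products (m - 1)"
proof
  assume irr: "Factorial_Ring.irreducible P"
  show "enc P \<notin> products (m - 1)"
  proof
    assume "enc P \<in> products (m - 1)"
    then obtain e u y where e: "1 \<le> e" "e \<le> m - 1" and u: "b ^ e \<le> u" "u < b ^ Suc e" and y: "y < b ^ (m + 1 - e)"
      and "enc P = enc (np y * np u)" by (auto simp: products_def)
    then have Pyu: "P = np y * np u" by simp
    have nz: "np y \<noteq> 0" "np u \<noteq> 0" proof -
      have "P \<noteq> 0" using P m by auto
      then show "np y \<noteq> 0" "np u \<noteq> 0" using Pyu mult_zero_left mult_zero_right by metis+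
    qed
    have "Polynomial.degree (np y) < m + 1 - e" using y e by (intro degree_nat_poly_less) (auto simp: b)
    moreover have "Polynomial.degree (np u) < Suc e" using u by (intro degree_nat_poly_less) (auto simp: b)
    moreover have "Polynomial.degree P = Polynomial.degree (np y) + Polynomial.degree (np u)"
      unfolding Pyu by (rule degree_mult_eq[OF nz])
    ultimately have "Polynomial.degree (np y) \<noteq> 0" "Polynomial.degree (np u) \<noteq> 0" using P e by linarith+
    moreover have "np y dvd 1 \<or> np u dvd 1" using irr Pyu unfolding Factorial_Ring.irreducible_def by blast
    ultimately show False by (auto simp: poly_dvd_1)
  qed
next
  assume nm: "enc P \<notin> products (m - 1)"
  show "Factorial_Ring.irreducible P"
    unfolding Factorial_Ring.irreducible_def
  proof (intro conjI allI impI)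
    show "P \<noteq> 0" using P m by auto
    then show "\<not> P dvd 1" using P m by (auto simp: poly_dvd_1)
    fix y u assume yu: "P = y * u"
    show "y dvd 1 \<or> u dvd 1"
    proof (rule ccontr)
      assume *: "\<not> (y dvd 1 \<or> u dvd 1)"
      have nz: "y \<noteq> 0" "u \<noteq> 0" using \<open>P \<noteq> 0\<close> yu by auto
      let ?e = "Polynomial.degree u"
      have dy: "Polynomial.degree y \<noteq> 0" and du: "?e \<noteq> 0" using * nz is_unit_iff_degree by blast+
      have sum: "m = Polynomial.degree y + ?e" using P nz unfolding yu by (simp add: degree_mult_eq)
      have "enc y < b ^ (m + 1 - ?e)" unfolding b by (rule enc_less) (use sum in simp)
      moreover have "enc u \<in> {b ^ ?e..<b ^ Suc ?e}" unfolding b using enc_ge[OF refl nz(2)] enc_less[of u "Suc ?e"] by simp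
      moreover have "?e \<in> {1..m - 1}" using sum dy du by simp
      moreover have "enc P = enc (np (enc y) * np (enc u))" using yu by simp
      ultimately have "enc P \<in> products (m - 1)" unfolding products_def by blast
      then show False using nm by blast
    qed
  qed
qed

text \<open>The digit at position \<open>m\<close> is 1; a search upwards from \<open>N\<close>
  therefore meets the monic polynomials of degree \<open>m\<close> first, as \<open>xtimes\<close>
  demands.\<close>

lemma monic_range:
  assumes "N \<le> x" "x < 2 * N"
  shows "Polynomial.degree (np x) = m" "lead_coeff (np x) = 1"
proof -
  have c: "Polynomial.coeff (np x) m = 1"
  proof -
    have "x div N = 1" using assms N_bounds(1) by (intro div_nat_eqI) auto
    then show ?thesis by (simp add: coeff_nat_poly N b)
  qed
  moreover have "Polynomial.degree (np x) \<le> m" using assms N_bounds by (intro degree_np_le) linarith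
  moreover have "m \<le> Polynomial.degree (np x)" using c by (intro le_degree) simp
  ultimately show "Polynomial.degree (np x) = m" by simp
  with c show "lead_coeff (np x) = 1" by simp
qed

lemma monic_enc_range:
  assumes "Polynomial.degree (P :: 'b mod_ring poly) = m" "lead_coeff P = 1"
  shows "N \<le> enc P" "enc P < 2 * N"
proof -
  have "P \<noteq> 0" using assms(1) m by auto
  then show ge: "N \<le> enc P" using enc_ge[OF assms(1)] by (simp add: N b)
  have lt: "enc P < b * N" using assms by (intro enc_less_bN) simp
  have "(of_nat (enc P div N) :: 'b mod_ring) = of_nat 1"
    using assms coeff_nat_poly[of "enc P" m, where 'b = 'b] by (simp add: N b)
  moreover have "enc P div N < b" using lt by (simp add: less_mult_imp_div_less)
  ultimately have "enc P div N = 1"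
    using of_nat_mod_ring_inj[of "enc P div N" 1, where 'b = 'b] by (simp add: b)
  then have "enc P = N + enc P mod N" using div_mult_mod_eq[of "enc P" N] by simp
  moreover have "enc P mod N < N" using N_bounds(1) by (intro mod_less_divisor) simp
  ultimately show "enc P < 2 * N" by linarith
qed

definition search_p :: com where
  "search_p = For ''i'' (nv ''N'') (Num 0 \<^bold>< NCell ''Mark'' (nv ''p'')) (nlet ''p'' (nv ''p'' \<^bold>+ Num 1))"

text \<open>All \<open>N\<close> monic candidates precede the end of the loop; were all of them
  marked, the existence of a monic irreducible polynomial of degree \<open>m\<close> would be
  contradicted.\<close>

lemma run_search_p:
  fixes \<sigma> :: state
  assumes t: "tables \<sigma>" and p: "nmem \<sigma> ''p'' 0 = N"
    and Mark: "\<forall>x. 0 < nmem \<sigma> ''Mark'' x \<longleftrightarrow> x \<in> products (m - 1)"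
  shows "(\<exists>P :: 'b mod_ring poly. Factorial_Ring.irreducible P \<and> Polynomial.degree P = m \<and> lead_coeff P = 1
      \<and> nmem (run search_p \<sigma>) ''p'' 0 = enc P)"
    and "ok K search_p \<sigma> (10 + 20 * N)"
proof -
  let ?g = "Num 0 \<^bold>< NCell ''Mark'' (nv ''p'')" and ?body = "nlet ''p'' (nv ''p'' \<^bold>+ Num 1)"
  let ?I = "\<lambda>i A (\<tau>::state). nmem \<tau> ''p'' 0 = N + i \<and> (\<forall>x\<in>{N..<N + i}. x \<in> products (m - 1)) \<and> A \<le> i * 20"
  let ?J = "\<lambda>A (\<tau>::state). (\<exists>P :: 'b mod_ring poly. Factorial_Ring.irreducible P \<and> Polynomial.degree P = m \<and> lead_coeff P = 1
      \<and> nmem \<tau> ''p'' 0 = enc P) \<and> A \<le> N * 20"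
  have "\<exists>A. ?J A (run search_p \<sigma>) \<and> ok K search_p \<sigma> (1 + ncost (nv ''N'') + A)"
    unfolding search_p_def
  proof (rule For_rule[where I = ?I])
    fix i A and \<tau> :: state
    assume i: "i < N" and I: "?I i A \<tau>" and g: "beval ?g \<tau>"
      and fn: "\<And>w. w \<notin> nwr (For ''i'' (nv ''N'') ?g ?body) \<Longrightarrow> nmem \<tau> w = nmem \<sigma> w"
    have "N + i \<in> products (m - 1)" using g I Mark fn[of "''Mark''"] by simp
    moreover have "ok K ?body \<tau> 10" by (rule ok_straight) (use K_bounds in auto)
    ultimately show "\<exists>u. ok K ?body \<tau> u \<and> ?I (Suc i) (A + (1 + bcost ?g + u)) (run ?body \<tau>)"
      using I by (intro exI[of _ 10]) (auto simp: less_Suc_eq)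
  next
    fix i A and \<tau> :: state
    assume i: "i < N" and I: "?I i A \<tau>" and g: "\<not> beval ?g \<tau>"
      and fn: "\<And>w. w \<notin> nwr (For ''i'' (nv ''N'') ?g ?body) \<Longrightarrow> nmem \<tau> w = nmem \<sigma> w"
    have "N + i \<notin> products (m - 1)" using g I Mark fn[of "''Mark''"] by simp
    moreover have deg: "Polynomial.degree (np (N + i)) = m" "lead_coeff (np (N + i)) = 1"
      using i by (intro monic_range; simp)+
    ultimately have "Factorial_Ring.irreducible (np (N + i))"
      using irreducible_iff_unmarked[OF deg(1)] by simp
    moreover have "A + (1 + bcost ?g) \<le> N * 20"
    proof -
      have "Suc i * 20 \<le> N * 20" using i by (intro mult_le_mono) auto
      then show ?thesis using I by simp
    qed
    ultimately show "?J (A + (1 + bcost ?g)) \<tau>"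
      using I deg by (intro conjI exI[of _ "np (N + i)"]) auto
  next
    fix A and \<tau> :: state
    assume I: "?I N A \<tau>"
    obtain P :: "'b mod_ring poly" where P: "Factorial_Ring.irreducible P" "Polynomial.degree P = m" "lead_coeff P = 1"
      using ex_monic_irreducible[of m] m by auto
    then have "enc P \<in> {N..<N + N}" using monic_enc_range[of P] by auto
    then have "enc P \<in> products (m - 1)" using I by blast
    then show "?J A \<tau>" using P irreducible_iff_unmarked by blast
  qed (use p tablesD[OF t] K_bounds in auto)
  then obtain A where A: "?J A (run search_p \<sigma>)" "ok K search_p \<sigma> (1 + ncost (nv ''N'') + A)" by blast
  show "(\<exists>P :: 'b mod_ring poly. Factorial_Ring.irreducible P \<and> Polynomial.degree P = m \<and> lead_coeff P = 1
      \<and> nmem (run search_p \<sigma>) ''p'' 0 = enc P)" using A(1) by blast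
  show "ok K search_p \<sigma> (10 + 20 * N)" by (rule ok_mono[OF A(2)]) (use A(1) in simp)
qed

lemma find_p_altdef:
  "find_p = (nlet ''lo'' (nv ''b'') ;; nlet ''hi'' (nv ''N'') ;; sieve ;; nlet ''p'' (nv ''N'') ;;
     search_p ;; scalar_multiples ''P'' (nv ''p''))"
  by (simp add: find_p_def sieve_def sieve_degree_def sieve_row_def search_p_def)

lemma run_find_p:
  fixes \<sigma> :: state
  assumes t: "tables \<sigma>" and Mark: "nmem \<sigma> ''Mark'' = (\<lambda>_. 0)"
  shows "(\<exists>P :: 'b mod_ring poly. Factorial_Ring.irreducible P \<and> Polynomial.degree P = m \<and> lead_coeff P = 1
      \<and> nmem (run find_p \<sigma>) ''p'' 0 = enc P \<and> (\<forall>c<b. nmem (run find_p \<sigma>) ''P'' c = enc (np c * P)))"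
    and "ok K find_p \<sigma> (400 * (m * (b * (b * N))))"
proof -
  let ?c1 = "nlet ''lo'' (nv ''b'')" and ?c2 = "nlet ''hi'' (nv ''N'')" and ?c4 = "nlet ''p'' (nv ''N'')"
    and ?c6 = "scalar_multiples ''P'' (nv ''p'')"
  define \<sigma>1 where "\<sigma>1 = run ?c1 \<sigma>"
  define \<sigma>2 where "\<sigma>2 = run ?c2 \<sigma>1"
  define \<sigma>3 where "\<sigma>3 = run sieve \<sigma>2"
  define \<sigma>4 where "\<sigma>4 = run ?c4 \<sigma>3"
  define \<sigma>5 where "\<sigma>5 = run search_p \<sigma>4"
  define \<sigma>6 where "\<sigma>6 = run ?c6 \<sigma>5"
  have nwr: "nwr sieve = {''e'', ''lo'', ''hi'', ''i'', ''u'', ''S'', ''k'', ''T'', ''j'', ''Mark''}"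
    "nwr search_p = {''i'', ''p''}"
    by (auto simp: sieve_def sieve_degree_def sieve_row_def nwr_scalar_multiples search_p_def)
  have t2: "tables \<sigma>2" unfolding \<sigma>2_def \<sigma>1_def by (intro tables_run t) auto
  have v2: "nmem \<sigma>2 ''lo'' 0 = b" "nmem \<sigma>2 ''hi'' 0 = N" "nmem \<sigma>2 ''Mark'' = (\<lambda>_. 0)"
    using tablesD[OF t] Mark by (simp_all add: \<sigma>1_def \<sigma>2_def)
  note L3 = run_sieve[OF t2 v2, folded \<sigma>3_def]
  have t3: "tables \<sigma>3" unfolding \<sigma>3_def by (rule tables_run[OF t2]) (simp add: nwr)
  have t4: "tables \<sigma>4" unfolding \<sigma>4_def by (rule tables_run[OF t3]) simp
  have v4: "nmem \<sigma>4 ''p'' 0 = N" "\<forall>x. 0 < nmem \<sigma>4 ''Mark'' x \<longleftrightarrow> x \<in> products (m - 1)"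
    using L3 tablesD[OF t3] by (simp_all add: \<sigma>4_def)
  note L5 = run_search_p[OF t4 v4, folded \<sigma>5_def]
  then obtain P :: "'b mod_ring poly" where P: "Factorial_Ring.irreducible P" "Polynomial.degree P = m" "lead_coeff P = 1"
    "nmem \<sigma>5 ''p'' 0 = enc P" by blast
  have t5: "tables \<sigma>5" unfolding \<sigma>5_def by (rule tables_run[OF t4]) (simp add: nwr)
  have "enc P < b * N" using P by (intro enc_less_bN) simp
  note L6 = run_scalar_multiples[OF t5 P(4) this, of "''P''", folded \<sigma>6_def, simplified]
  have run_eq: "run find_p \<sigma> = \<sigma>6"
    by (simp only: find_p_altdef run.simps(4) \<sigma>1_def \<sigma>2_def \<sigma>3_def \<sigma>4_def \<sigma>5_def \<sigma>6_def)
  have "nmem \<sigma>6 ''p'' = nmem \<sigma>5 ''p''" by (simp add: \<sigma>6_def nmem_run nwr_scalar_multiples)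
  then show "(\<exists>P :: 'b mod_ring poly. Factorial_Ring.irreducible P \<and> Polynomial.degree P = m \<and> lead_coeff P = 1
      \<and> nmem (run find_p \<sigma>) ''p'' 0 = enc P \<and> (\<forall>c<b. nmem (run find_p \<sigma>) ''P'' c = enc (np c * P)))"
    unfolding run_eq using P L6 by (intro exI[of _ P]) simp
  have st: "ok K (nlet x (nv e)) \<tau> 5" for x e \<tau> using K_bounds by (intro ok_straight) simp_all
  have "ok K find_p \<sigma> (5 + (5 + ((10 + m * (250 * (b * (b * N)))) + (5 + ((10 + 20 * N) + (10 + 70 * b))))))"
    unfolding find_p_altdef
    by (intro ok_Seq st) (use L3 L5 L6 in \<open>simp_all only: \<sigma>1_def \<sigma>2_def \<sigma>3_def \<sigma>4_def \<sigma>5_def\<close>)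
  moreover have "5 + (5 + ((10 + m * (250 * (b * (b * N)))) + (5 + ((10 + 20 * N) + (10 + 70 * b)))))
      \<le> 400 * (m * (b * (b * N)))"
  proof -
    let ?X = "b * (b * N)"
    have "2 * (2 * N) \<le> ?X" using b2 by (intro mult_le_mono) auto
    then have "4 * N \<le> ?X" by simp
    moreover have "?X \<le> m * ?X" using m by simp
    ultimately have "4 * N \<le> m * ?X" "2 \<le> N" "b \<le> N" using N_bounds by linarith+
    moreover have "m * (250 * ?X) = 250 * (m * ?X)" by simp
    ultimately show ?thesis by linarith
  qed
  ultimately show "ok K find_p \<sigma> (400 * (m * (b * (b * N))))" by (rule ok_mono)
qed

lemma nwr_find_p: "nwr find_p = {''lo'', ''hi'', ''e'', ''i'', ''u'', ''S'', ''k'', ''T'', ''j'', ''Mark'', ''p'', ''P''}"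
  "cwr find_p = {}" "silent find_p"
  by (auto simp: find_p_def nwr_scalar_multiples)

end

section \<open>The primitive element\<close>

text \<open>A harmonic sum cut at powers of \<open>b\<close>: fewer than \<open>b ^ Suc m\<close>
  values \<open>k \<ge> b ^ m\<close> contribute at most \<open>x div b ^ m\<close> each, so each of
  the blocks costs at most \<open>b * x\<close>.\<close>

lemma sum_div_le:
  fixes b m x :: nat
  assumes "1 < b"
  shows "(\<Sum>k\<in>{1..<b ^ m}. x div k) \<le> m * (b * x)"
proof (induction m)
  case (Suc m)
  have le: "1 \<le> b ^ m" "b ^ m \<le> b ^ Suc m" using assms by auto
  have "(\<Sum>k\<in>{b ^ m..<b ^ Suc m}. x div k) \<le> (\<Sum>k\<in>{b ^ m..<b ^ Suc m}. x div b ^ m)"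
    by (intro sum_mono div_le_mono2) (use assms in auto)
  also have "\<dots> \<le> b ^ Suc m * (x div b ^ m)" by simp
  also have "\<dots> = b * (b ^ m * (x div b ^ m))" by simp
  also have "\<dots> \<le> b * x" by (intro mult_le_mono2) (simp add: mult.commute)
  finally have "(\<Sum>k\<in>{b ^ m..<b ^ Suc m}. x div k) \<le> b * x" .
  moreover have "(\<Sum>k\<in>{1..<b ^ Suc m}. x div k)
      = (\<Sum>k\<in>{1..<b ^ m}. x div k) + (\<Sum>k\<in>{b ^ m..<b ^ Suc m}. x div k)"
    by (rule sum.atLeastLessThan_concat[OF le, symmetric])
  ultimately show ?case using Suc by simp
qed simp

lemma inj_on_codivisor: "0 < n \<Longrightarrow> D \<subseteq> {d. d dvd n} \<Longrightarrow> inj_on (\<lambda>d. n div d) D" for n :: nat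
proof (rule inj_onI)
  fix x y assume n: "0 < n" and D: "D \<subseteq> {d. d dvd n}" "x \<in> D" "y \<in> D" and eq: "n div x = n div y"
  have "n div (n div x) = x" "n div (n div y) = y"
    using D n by (auto simp: dvd_div_eq_mult elim!: dvdE)
  then show "x = y" using eq by metis
qed

lemma sum_divisors_le:
  fixes b m :: nat
  assumes "1 < b" "0 < n" "n < b ^ m" and D: "D \<subseteq> {d. d dvd n}"
  shows "\<Sum>D \<le> m * (b * n)"
proof -
  have "\<Sum>D = (\<Sum>d\<in>D. n div (n div d))"
    by (rule sum.cong[OF refl]) (use assms D in \<open>auto elim!: dvdE\<close>)
  also have "\<dots> = (\<Sum>k\<in>(\<lambda>d. n div d) ` D. n div k)"
    by (subst sum.reindex[OF inj_on_codivisor[OF assms(2) D]]) simp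
  also have "\<dots> \<le> (\<Sum>k\<in>{1..<b ^ m}. n div k)"
  proof (rule sum_mono2)
    show "(\<lambda>d. n div d) ` D \<subseteq> {1..<b ^ m}"
    proof
      fix k assume "k \<in> (\<lambda>d. n div d) ` D"
      then obtain d where d: "d dvd n" "k = n div d" using D by auto
      have "0 < k" using d assms(2) by (auto elim!: dvdE)
      moreover have "k \<le> n" using d(2) div_le_dividend by simp
      ultimately show "k \<in> {1..<b ^ m}" using assms(3) by simp
    qed
  qed auto
  also have "\<dots> \<le> m * (b * n)" by (rule sum_div_le[OF assms(1)])
  finally show ?thesis .
qed

text \<open>Divisors below \<open>H\<close> are few; the others have a complementary divisor below
  \<open>H\<close>, as \<open>n < H * H\<close>.\<close>

lemma card_divisors_le:
  fixes n H :: nat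
  assumes "0 < n" "n < H * H" and D: "D \<subseteq> {d. d dvd n}"
  shows "card D \<le> 2 * H"
proof -
  have fin: "finite D" by (rule finite_subset[OF D]) (use assms in simp)
  have "card {d \<in> D. d < H} \<le> card {..<H}" by (intro card_mono) auto
  moreover have "card {d \<in> D. \<not> d < H} \<le> card {..<H}"
  proof -
    have "(\<lambda>d. n div d) ` {d \<in> D. \<not> d < H} \<subseteq> {..<H}"
    proof
      fix k assume "k \<in> (\<lambda>d. n div d) ` {d \<in> D. \<not> d < H}"
      then obtain d where d: "H \<le> d" "k = n div d" by (force simp: not_less)
      have H: "0 < H" using assms(2) by (cases H) auto
      have "k \<le> n div H" unfolding d(2) by (rule div_le_mono2[OF H d(1)])
      also have "\<dots> < H" using assms(2) by (simp add: less_mult_imp_div_less)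
      finally show "k \<in> {..<H}" by simp
    qed
    moreover have "{d \<in> D. \<not> d < H} \<subseteq> {d. d dvd n}" using D by auto
    ultimately show ?thesis
      using card_inj_on_le[OF inj_on_codivisor[OF assms(1)]] by blast
  qed
  moreover have "card D = card {d \<in> D. d < H} + card {d \<in> D. \<not> d < H}"
  proof -
    have "D = {d \<in> D. d < H} \<union> {d \<in> D. \<not> d < H}" by blast
    then show ?thesis using fin by (metis (no_types, lifting) card_Un_disjoint finite_Un disjoint_iff mem_Collect_eq)
  qed
  ultimately show ?thesis by simp
qed

section \<open>Multiplication tables and powers modulo P\<close>

locale machine_mod = machine ty b m h H N M K
  for ty :: "'b::prime_card itself" and b m h H N M K +
  fixes P :: "'b mod_ring poly"
  assumes P_irr: "Factorial_Ring.irreducible P" and P_deg: "Polynomial.degree P = m" and P_lead: "lead_coeff P = 1"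
begin

sublocale Q: residue_field P m M
  by unfold_locales (simp_all add: P_irr P_deg M N b)

definition ptab :: "state \<Rightarrow> bool" where
  "ptab \<tau> \<longleftrightarrow> (\<forall>c<b. nmem \<tau> ''P'' c = enc (np c * P))"

lemma deg_mod: "Polynomial.degree (q mod P) < m"
  using Q.mod_R_set[of q] m by (cases "P dvd q") (auto simp: R_set_def mod_eq_0_iff_dvd)

lemma enc_mod_less: "enc (q mod P) < N"
  by (rule enc_less_N[OF deg_mod])

lemma N_le_bN: "x < N \<Longrightarrow> x < b * N"
  using N_bounds(5) by linarith

definition table_body :: "string \<Rightarrow> com" where
  "table_body T = NSet T (nv ''j'') (padd (xtimes (NCell T (nv ''j'' \<^bold>/ nv ''b'')))
                              (NCell ''S'' (nv ''j'' \<^bold>% nv ''b'')))"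

lemma mult_table_altdef:
  "mult_table T e = (scalar_multiples ''S'' e ;; NSet T (Num 0) (Num 0) ;; for_all ''j'' (nv ''H'') (table_body T))"
  by (simp add: mult_table_def table_body_def)

lemma nwr_mult_table: "nwr (mult_table T e) = {T, ''S'', ''k'', ''j''}" "cwr (mult_table T e) = {}" "silent (mult_table T e)"
  by (auto simp: mult_table_def nwr_scalar_multiples)

text \<open>The same Horner scheme as in the sieve, with a reduction after each multiplication by
  \<open>x\<close>. The digit multiples of \<open>v\<close> are already reduced, since
  \<open>v < N\<close> has degree below \<open>m\<close>.\<close>

lemma run_mult_table:
  fixes \<sigma> :: state
  assumes t: "tables \<sigma>" and p: "ptab \<sigma>" and y: "nmem \<sigma> y 0 = v" "v < N" "y \<notin> {''S'', ''k''}"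
    and T: "T \<notin> {''S'', ''k'', ''j'', ''P''} \<union> table_names"
  defines "c \<equiv> mult_table T (nv y)"
  shows "(\<forall>j<H. nmem (run c \<sigma>) T j = enc (np j * np v mod P)) \<and> ok K c \<sigma> (30 + 70 * b + 250 * H)"
proof -
  let ?c1 = "scalar_multiples ''S'' (nv y)" and ?c2 = "NSet T (Num 0) (Num 0)" and ?c3 = "for_all ''j'' (nv ''H'') (table_body T)"
  define \<sigma>1 where "\<sigma>1 = run ?c1 \<sigma>"
  define \<sigma>2 where "\<sigma>2 = run ?c2 \<sigma>1"
  note S1 = run_scalar_multiples[OF t y(1) N_le_bN[OF y(2)], of "''S''", folded \<sigma>1_def, simplified]
  have yS: "''S'' \<noteq> y" "''k'' \<noteq> y" using y(3) by auto
  have t1: "tables \<sigma>1" unfolding \<sigma>1_def by (rule tables_run[OF t]) (simp add: nwr_scalar_multiples)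
  have p1: "ptab \<sigma>1" using p by (simp add: ptab_def \<sigma>1_def nmem_run nwr_scalar_multiples)
  have t2: "tables \<sigma>2" unfolding \<sigma>2_def by (rule tables_run[OF t1]) (use T in auto)
  have "''P'' \<noteq> T" using T by auto
  then have p2: "ptab \<sigma>2" using p1 by (simp add: ptab_def \<sigma>2_def)
  have S2: "\<forall>c'<b. nmem \<sigma>2 ''S'' c' = enc (np c' * np v)" "nmem \<sigma>2 T 0 = 0"
    using S1 T yS y(3) by (auto simp: \<sigma>2_def)
  have L: "(nmem (run ?c3 \<sigma>2) T 0 = 0 \<and> (\<forall>j<H. nmem (run ?c3 \<sigma>2) T j = enc (np j * np v mod P)))
      \<and> ok K ?c3 \<sigma>2 (10 + 245 * H)"
  proof (rule for_all_const[where I = "\<lambda>j (\<tau>::state). nmem \<tau> T 0 = 0 \<and> (\<forall>i<j. nmem \<tau> T i = enc (np i * np v mod P))" and t = 240])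
    fix j and \<tau> :: state
    assume j: "j < H" and nj: "nmem \<tau> ''j'' 0 = j" and I: "nmem \<tau> T 0 = 0 \<and> (\<forall>i<j. nmem \<tau> T i = enc (np i * np v mod P))"
      and fn: "\<And>w. w \<notin> nwr (for_all ''j'' (nv ''H'') (table_body T)) \<Longrightarrow> nmem \<tau> w = nmem \<sigma>2 w"
    have fr: "nmem \<tau> w = nmem \<sigma>2 w" if "w \<in> table_names \<union> {''P'', ''S''}" for w
      using that T by (intro fn) (auto simp: table_body_def)
    have tt: "tables \<tau>" by (rule tables_cong[OF t2], rule fr) auto
    have pt: "\<forall>c<b. nmem \<tau> ''P'' c = enc (np c * P)" using p2 fr by (simp add: ptab_def)
    let ?q = "np (j div b) * np v mod P"
    have Tj: "nmem \<tau> T (j div b) = enc ?q"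
    proof (cases "j = 0")
      case False
      then have "j div b < j" using b2 by simp
      then show ?thesis using I by simp
    qed (use I in simp)
    let ?e = "NCell T (nv ''j'' \<^bold>/ nv ''b'')"
    have ev: "neval ?e \<tau> = enc ?q" using Tj by (simp add: nj tablesD[OF tt])
    have x: "neval (xtimes ?e) \<tau> = enc ([:0, 1:] * ?q mod P)"
      by (subst neval_xtimes[OF tt P_deg P_lead pt]) (simp_all only: ev enc_mod_less nat_poly_enc)
    have c: "j mod b < b" using b_pos by simp
    have degc: "Polynomial.degree (np (j mod b) * np v) < m"
      using degree_np[OF y(2)] degree_mult_le[of "np (j mod b)" "np v"] c by (simp add: b nat_poly_const)
    have s: "neval (NCell ''S'' (nv ''j'' \<^bold>% nv ''b'')) \<tau> = enc (np (j mod b) * np v)"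
    proof -
      have "nmem \<tau> ''S'' = nmem \<sigma>2 ''S''" by (rule fr) simp
      then show ?thesis using S2(1) c by (simp add: nj tablesD[OF tt])
    qed
    have "[:0, 1:] * ?q mod P + np (j mod b) * np v = np j * np v mod P"
    proof -
      have "np j * np v = [:0, 1:] * (np (j div b) * np v) + np (j mod b) * np v"
        by (subst np_digit_split) (simp only: distrib_right mult.assoc)
      then have "np j * np v mod P = ([:0, 1:] * (np (j div b) * np v)) mod P + (np (j mod b) * np v) mod P"
        by (simp only: poly_mod_add_left)
      also have "(np (j mod b) * np v) mod P = np (j mod b) * np v"
        using degc by (intro mod_poly_less) (simp add: P_deg)
      also have "([:0, 1:] * (np (j div b) * np v)) mod P = [:0, 1:] * ?q mod P"
        by (simp only: mod_mult_right_eq)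
      finally show ?thesis by (rule sym)
    qed
    then have "neval (padd (xtimes ?e) (NCell ''S'' (nv ''j'' \<^bold>% nv ''b''))) \<tau> = enc (np j * np v mod P)"
      by (subst neval_padd[OF tt]) (simp_all only: x s nat_poly_enc N_le_bN enc_mod_less N_le_bN[OF enc_less_N[OF degc]])
    then have st: "nmem (run (table_body T) \<tau>) T = (nmem \<tau> T)(j := enc (np j * np v mod P))"
      by (simp add: table_body_def nj)
    have "ok K (table_body T) \<tau> 240"
      unfolding table_body_def by (rule ok_straight) (use j K_bounds nj in simp_all)
    then show "ok K (table_body T) \<tau> 240 \<and> nmem (run (table_body T) \<tau>) T 0 = 0
        \<and> (\<forall>i<Suc j. nmem (run (table_body T) \<tau>) T i = enc (np i * np v mod P))"
      unfolding st using I by (auto simp: less_Suc_eq)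
  qed (use T S2 K_bounds tablesD[OF t2] in auto)
  have run_eq: "run c \<sigma> = run ?c3 \<sigma>2" by (simp only: c_def mult_table_altdef run.simps(4) \<sigma>1_def \<sigma>2_def)
  have "ok K c \<sigma> ((10 + 70 * b) + (5 + (10 + 245 * H)))"
    unfolding c_def mult_table_altdef
  proof (intro ok_Seq)
    show "ok K ?c1 \<sigma> (10 + 70 * b)" using run_scalar_multiples(2)[OF t y(1) N_le_bN[OF y(2)], of "''S''"] yS by auto
    show "ok K ?c2 (run ?c1 \<sigma>) 5" by (rule ok_straight) (use K_bounds in auto)
    show "ok K ?c3 (run ?c2 (run ?c1 \<sigma>)) (10 + 245 * H)" using L by (simp only: \<sigma>1_def \<sigma>2_def)
  qed
  then have "ok K c \<sigma> (30 + 70 * b + 250 * H)" by (rule ok_mono) simp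
  then show ?thesis unfolding run_eq using L by blast
qed

lemma run_shift_loop:
  fixes \<sigma> :: state
  assumes t: "tables \<sigma>" and p: "ptab \<sigma>" and z: "nmem \<sigma> ''z'' 0 = enc (a mod P)"
  defines "c \<equiv> for_all ''j'' (nv ''h'') (nlet ''z'' (xtimes (nv ''z'')))"
  shows "nmem (run c \<sigma>) ''z'' 0 = enc (Polynomial.monom 1 h * a mod P) \<and> ok K c \<sigma> (10 + 80 * h)"
  unfolding c_def
proof (rule for_all_const[where I = "\<lambda>i (\<tau>::state). nmem \<tau> ''z'' 0 = enc (Polynomial.monom 1 i * a mod P)" and t = 70])
  fix i and \<tau> :: state
  let ?b = "nlet ''z'' (xtimes (nv ''z''))"
  assume I: "nmem \<tau> ''z'' 0 = enc (Polynomial.monom 1 i * a mod P)"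
    and fn: "\<And>w. w \<notin> nwr (for_all ''j'' (nv ''h'') ?b) \<Longrightarrow> nmem \<tau> w = nmem \<sigma> w"
  have tt: "tables \<tau>" by (rule tables_cong[OF t], rule fn) auto
  have pt: "\<forall>c<b. nmem \<tau> ''P'' c = enc (np c * P)" using p fn by (simp add: ptab_def)
  have ev: "neval (nv ''z'') \<tau> = enc (Polynomial.monom 1 i * a mod P)" using I by simp
  have "neval (xtimes (nv ''z'')) \<tau> = enc ([:0, 1:] * (Polynomial.monom 1 i * a mod P) mod P)"
    by (subst neval_xtimes[OF tt P_deg P_lead pt]) (simp_all only: ev enc_mod_less nat_poly_enc)
  also have "[:0, 1:] * (Polynomial.monom 1 i * a mod P) mod P = Polynomial.monom 1 (Suc i) * a mod P"
    by (simp only: mod_mult_right_eq) (simp add: monom_Suc)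
  finally show "ok K ?b \<tau> 70 \<and> nmem (run ?b \<tau>) ''z'' 0 = enc (Polynomial.monom 1 (Suc i) * a mod P)"
    using K_bounds by (auto intro!: ok_straight)
qed (use z tablesD[OF t] K_bounds in \<open>auto simp: monom_0\<close>)

definition gmult :: nexp where
  "gmult = padd (NCell ''L'' (nv ''z'' \<^bold>% nv ''H'')) (NCell ''U'' (nv ''z'' \<^bold>/ nv ''H''))"

definition powers_loop :: com where
  "powers_loop = For ''j'' (nv ''M'') (Num 1 \<^bold>< nv ''z'')
          (NSet ''G'' (nv ''ord'') (nv ''z'') ;;
           NSet ''Seen'' (nv ''z'') (Num 1) ;;
           nlet ''ord'' (nv ''ord'' \<^bold>+ Num 1) ;;
           nlet ''z'' gmult)"

text \<open>Writing \<open>z\<close> as \<open>x ^ h\<close> times its upper half plus its lower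
  half, \<open>z * a\<close> is the upper half times \<open>x ^ h * a\<close> plus the lower half
  times \<open>a\<close>; each product is one table entry.\<close>

lemma neval_gmult:
  assumes t: "tables \<tau>" and z: "nmem \<tau> ''z'' 0 = z" "z < N"
    and L: "\<forall>j<H. nmem \<tau> ''L'' j = enc (np j * a mod P)"
    and U: "\<forall>j<H. nmem \<tau> ''U'' j = enc (np j * (Polynomial.monom 1 h * a mod P) mod P)"
  shows "neval gmult \<tau> = enc (np z * a mod P)"
proof -
  have zH: "z div H < H" "z mod H < H"
    using z(2) N_le_bN bN_le_HH N_bounds(2) by (auto intro!: less_mult_imp_div_less) (meson N_le_bN less_le_trans)
  have "np z = Polynomial.monom 1 h * np (z div H) + np (z mod H)"
  proof -
    have "np (z div H * H + z mod H) = Polynomial.monom 1 h * np (z div H) + np (z mod H)"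
      unfolding H b by (rule nat_poly_shift) simp
    then show ?thesis by (simp only: div_mult_mod_eq)
  qed
  then have "np z * a = (Polynomial.monom 1 h * np (z div H) + np (z mod H)) * a" by (rule arg_cong)
  then have "np z * a = np (z div H) * (Polynomial.monom 1 h * a) + np (z mod H) * a"
    by (simp only: distrib_right mult.assoc mult.left_commute)
  then have "np z * a mod P = np (z div H) * (Polynomial.monom 1 h * a) mod P + np (z mod H) * a mod P"
    by (simp only: poly_mod_add_left)
  also have "np (z div H) * (Polynomial.monom 1 h * a) mod P = np (z div H) * (Polynomial.monom 1 h * a mod P) mod P"
    by (simp only: mod_mult_right_eq)
  finally have eq: "np z * a mod P = np (z div H) * (Polynomial.monom 1 h * a mod P) mod P + np (z mod H) * a mod P" .
  have ev: "neval (NCell ''L'' (nv ''z'' \<^bold>% nv ''H'')) \<tau> = enc (np (z mod H) * a mod P)"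
      "neval (NCell ''U'' (nv ''z'' \<^bold>/ nv ''H'')) \<tau> = enc (np (z div H) * (Polynomial.monom 1 h * a mod P) mod P)"
    using L U zH z tablesD[OF t] by simp_all
  show ?thesis unfolding gmult_def
    by (subst neval_padd[OF t]) (simp_all only: ev nat_poly_enc N_le_bN enc_mod_less eq add.commute)
qed

text \<open>The loop stops when the power becomes 1, hence after exactly as many entries as the
  order of \<open>a\<close>. The power 1 itself is recorded in \<open>G\<close> but never marked as
  seen.\<close>

lemma run_powers_loop:
  fixes \<sigma> :: state
  assumes t: "tables \<sigma>" and a: "a \<in> R_set m" and z: "nmem \<sigma> ''z'' 0 = enc a" and o: "nmem \<sigma> ''ord'' 0 = 1"
    and G: "nmem \<sigma> ''G'' 0 = 1"
    and L: "\<forall>j<H. nmem \<sigma> ''L'' j = enc (np j * a mod P)"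
    and U: "\<forall>j<H. nmem \<sigma> ''U'' j = enc (np j * (Polynomial.monom 1 h * a mod P) mod P)"
  shows "nmem (run powers_loop \<sigma>) ''ord'' 0 = Q.ord_of a"
    "\<forall>i<Q.ord_of a. nmem (run powers_loop \<sigma>) ''G'' i = enc (a ^ i mod P)"
    "\<forall>x. 0 < nmem (run powers_loop \<sigma>) ''Seen'' x \<longleftrightarrow>
       0 < nmem \<sigma> ''Seen'' x \<or> (\<exists>i\<in>{1..<Q.ord_of a}. x = enc (a ^ i mod P))"
    "ok K powers_loop \<sigma> (10 + 100 * Q.ord_of a)"
proof -
  let ?ord = "Q.ord_of a"
  let ?g = "Num 1 \<^bold>< nv ''z''"
  let ?body = "NSet ''G'' (nv ''ord'') (nv ''z'') ;; NSet ''Seen'' (nv ''z'') (Num 1) ;;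
     nlet ''ord'' (nv ''ord'' \<^bold>+ Num 1) ;; nlet ''z'' gmult"
  let ?I = "\<lambda>j A (\<tau>::state). j < ?ord \<and> nmem \<tau> ''ord'' 0 = j + 1 \<and> nmem \<tau> ''z'' 0 = enc (a ^ (j + 1) mod P)
    \<and> (\<forall>i<j + 1. nmem \<tau> ''G'' i = enc (a ^ i mod P))
    \<and> (\<forall>x. 0 < nmem \<tau> ''Seen'' x \<longleftrightarrow> 0 < nmem \<sigma> ''Seen'' x \<or> (\<exists>i\<in>{1..<j + 1}. x = enc (a ^ i mod P)))
    \<and> A \<le> j * 100"
  let ?J = "\<lambda>A (\<tau>::state). nmem \<tau> ''ord'' 0 = ?ord
    \<and> (\<forall>i<?ord. nmem \<tau> ''G'' i = enc (a ^ i mod P))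
    \<and> (\<forall>x. 0 < nmem \<tau> ''Seen'' x \<longleftrightarrow> 0 < nmem \<sigma> ''Seen'' x \<or> (\<exists>i\<in>{1..<?ord}. x = enc (a ^ i mod P)))
    \<and> A \<le> ?ord * 100"
  have ordM: "?ord \<le> M" using Q.ord_of_dvd_M[OF a] Q.M_pos by (rule dvd_imp_le)
  have one: "1 mod P = 1" using Q.mod_less[OF Q.one_R_set] .
  have zR: "a ^ i mod P \<in> R_set m" for i by (rule Q.pow_R_set[OF a])
  have "\<exists>A. ?J A (run powers_loop \<sigma>) \<and> ok K powers_loop \<sigma> (1 + ncost (nv ''M'') + A)"
    unfolding powers_loop_def
  proof (rule For_rule[where I = ?I])
    fix j A and \<tau> :: state
    assume jM: "j < M" and I: "?I j A \<tau>" and g: "beval ?g \<tau>"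
      and fn: "\<And>w. w \<notin> nwr (For ''j'' (nv ''M'') ?g ?body) \<Longrightarrow> nmem \<tau> w = nmem \<sigma> w"
    have tt: "tables \<tau>" by (rule tables_cong[OF t], rule fn) auto
    have LU: "\<forall>j<H. nmem \<tau> ''L'' j = enc (np j * a mod P)"
        "\<forall>j<H. nmem \<tau> ''U'' j = enc (np j * (Polynomial.monom 1 h * a mod P) mod P)"
      using L U fn by simp_all
    define z where "z = enc (a ^ (j + 1) mod P)"
    have zN: "z < N" unfolding z_def by (rule enc_mod_less)
    have j1: "j + 1 < ?ord"
    proof (rule ccontr)
      assume "\<not> j + 1 < ?ord"
      then have "j + 1 = ?ord" using I by simp
      then have "a ^ (j + 1) mod P = 1" using Q.ord_of_dvd[OF a] by simp
      then show False using I g by simp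
    qed
    let ?\<tau>1 = "run (NSet ''G'' (nv ''ord'') (nv ''z'') ;; NSet ''Seen'' (nv ''z'') (Num 1) ;;
     nlet ''ord'' (nv ''ord'' \<^bold>+ Num 1)) \<tau>"
    have t1: "tables ?\<tau>1" by (rule tables_run[OF tt]) simp
    have z1: "nmem ?\<tau>1 ''z'' 0 = z" using I by (simp add: z_def)
    have "neval gmult ?\<tau>1 = enc (np z * a mod P)"
      by (rule neval_gmult[OF t1 z1 zN]) (use LU in simp_all)
    also have "np z * a mod P = a ^ (j + 2) mod P"
      unfolding z_def nat_poly_enc mod_mult_left_eq by (simp add: mult.commute)
    finally have ev: "neval gmult ?\<tau>1 = enc (a ^ (j + 2) mod P)" .
    have st: "nmem (run ?body \<tau>) ''z'' 0 = enc (a ^ (j + 2) mod P)" "nmem (run ?body \<tau>) ''ord'' 0 = j + 2"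
        "nmem (run ?body \<tau>) ''G'' = (nmem \<tau> ''G'')(j + 1 := z)"
        "nmem (run ?body \<tau>) ''Seen'' = (nmem \<tau> ''Seen'')(z := 1)"
      using ev I by (simp_all add: z_def)
    have o90: "ok K ?body \<tau> 90"
    proof (rule ok_straight)
      show "safe K ?body \<tau>" using zN jM I K_bounds M by (simp add: z_def)
      show "straight_cost ?body \<le> 90" by (simp add: gmult_def)
    qed
    have ins: "{1..<Suc j + 1} = insert (j + 1) {1..<j + 1}" by auto
    have seen: "\<forall>x. 0 < ((nmem \<tau> ''Seen'')(z := 1)) x \<longleftrightarrow>
        0 < nmem \<sigma> ''Seen'' x \<or> (\<exists>i\<in>{1..<Suc j + 1}. x = enc (a ^ i mod P))"
    proof
      fix x
      show "0 < ((nmem \<tau> ''Seen'')(z := 1)) x \<longleftrightarrow>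
        0 < nmem \<sigma> ''Seen'' x \<or> (\<exists>i\<in>{1..<Suc j + 1}. x = enc (a ^ i mod P))"
      proof (cases "x = z")
        case True
        then have "\<exists>i\<in>{1..<Suc j + 1}. x = enc (a ^ i mod P)" unfolding ins by (simp add: z_def)
        then show ?thesis using True by simp
      next
        case False
        have "0 < nmem \<tau> ''Seen'' x \<longleftrightarrow> 0 < nmem \<sigma> ''Seen'' x \<or> (\<exists>i\<in>{1..<j + 1}. x = enc (a ^ i mod P))"
          using I by (elim conjE) (erule spec)
        then show ?thesis using False unfolding ins by (simp add: z_def)
      qed
    qed
    have gs: "\<forall>i<Suc j + 1. ((nmem \<tau> ''G'')(j + 1 := z)) i = enc (a ^ i mod P)"
      using I by (auto simp: z_def less_Suc_eq)
    have i90: "?I (Suc j) (A + (1 + bcost ?g + 90)) (run ?body \<tau>)"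
      unfolding st using I j1 seen gs by simp
    show "\<exists>u. ok K ?body \<tau> u \<and> ?I (Suc j) (A + (1 + bcost ?g + u)) (run ?body \<tau>)"
      by (rule exI[of _ 90]) (rule conjI[OF o90 i90])
  next
    fix j A and \<tau> :: state
    assume jM: "j < M" and I: "?I j A \<tau>" and g: "\<not> beval ?g \<tau>"
    \<comment> \<open>A failing guard only says that the number is 0 or 1; 0 is impossible for a
      power of a unit.\<close>
    have "(0 :: 'b mod_ring poly) \<notin> R_set m" by (simp add: R_set_def)
    then have "a ^ (j + 1) mod P \<noteq> 0" using zR by metis
    then have "enc (a ^ (j + 1) mod P) \<noteq> 0" unfolding enc_eq_0_iff .
    moreover have "nmem \<tau> ''z'' 0 = enc (a ^ (j + 1) mod P)" using I by (elim conjE)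
    moreover have "\<not> 1 < nmem \<tau> ''z'' 0" using g by simp
    ultimately have "enc (a ^ (j + 1) mod P) = 1" by linarith
    then have "a ^ (j + 1) mod P = 1" by (metis enc_1 enc_eq_iff One_nat_def)
    then have "?ord dvd j + 1" using Q.ord_of_dvd[OF a] by blast
    then have "?ord = j + 1" using I by (auto dest: dvd_imp_le)
    then show "?J (A + (1 + bcost ?g)) \<tau>" using I by simp
  next
    fix A and \<tau> :: state
    assume "?I M A \<tau>"
    then show "?J A \<tau>" using ordM by simp
  next
    show "?I 0 0 (tick (1 + ncost (nv ''M'')) \<sigma>)"
      using z o G Q.ord_of_pos[OF a] Q.mod_less[OF a] one by simp
  qed (use tablesD[OF t] K_bounds in auto)
  then obtain A where A0: "?J A (run powers_loop \<sigma>) \<and> ok K powers_loop \<sigma> (1 + ncost (nv ''M'') + A)" ..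
  note A = conjunct1[OF A0] conjunct2[OF A0]
  show "nmem (run powers_loop \<sigma>) ''ord'' 0 = Q.ord_of a"
    "\<forall>i<Q.ord_of a. nmem (run powers_loop \<sigma>) ''G'' i = enc (a ^ i mod P)"
    "\<forall>x. 0 < nmem (run powers_loop \<sigma>) ''Seen'' x \<longleftrightarrow>
       0 < nmem \<sigma> ''Seen'' x \<or> (\<exists>i\<in>{1..<Q.ord_of a}. x = enc (a ^ i mod P))"
    using A(1) by simp_all
  show "ok K powers_loop \<sigma> (10 + 100 * Q.ord_of a)" by (rule ok_mono[OF A(2)]) (use A(1) in simp)
qed

definition process :: com where
  "process =
     (mult_table ''L'' (nv ''a'') ;;
         nlet ''z'' (nv ''a'') ;;
         for_all ''j'' (nv ''h'') (nlet ''z'' (xtimes (nv ''z''))) ;;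
         mult_table ''U'' (nv ''z'') ;;
         NSet ''G'' (Num 0) (Num 1) ;;
         nlet ''ord'' (Num 1) ;;
         nlet ''z'' (nv ''a'') ;;
         powers_loop)"

lemma run_process:
  fixes \<sigma> :: state
  assumes t: "tables \<sigma>" and p: "ptab \<sigma>" and a: "a \<in> R_set m" and va: "nmem \<sigma> ''a'' 0 = enc a"
  shows "nmem (run process \<sigma>) ''ord'' 0 = Q.ord_of a"
    "\<forall>i<Q.ord_of a. nmem (run process \<sigma>) ''G'' i = enc (a ^ i mod P)"
    "\<forall>x. 0 < nmem (run process \<sigma>) ''Seen'' x \<longleftrightarrow>
       0 < nmem \<sigma> ''Seen'' x \<or> (\<exists>i\<in>{1..<Q.ord_of a}. x = enc (a ^ i mod P))"
    "ok K process \<sigma> (850 * H + 100 * Q.ord_of a)"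
proof -
  let ?c1 = "mult_table ''L'' (nv ''a'')" and ?c2 = "nlet ''z'' (nv ''a'')"
    and ?c3 = "for_all ''j'' (nv ''h'') (nlet ''z'' (xtimes (nv ''z'')))"
    and ?c4 = "mult_table ''U'' (nv ''z'')" and ?c5 = "NSet ''G'' (Num 0) (Num 1)"
    and ?c6 = "nlet ''ord'' (Num 1)"
  define \<sigma>1 where "\<sigma>1 = run ?c1 \<sigma>"
  define \<sigma>2 where "\<sigma>2 = run ?c2 \<sigma>1"
  define \<sigma>3 where "\<sigma>3 = run ?c3 \<sigma>2"
  define \<sigma>4 where "\<sigma>4 = run ?c4 \<sigma>3"
  define \<sigma>5 where "\<sigma>5 = run ?c5 \<sigma>4"
  define \<sigma>6 where "\<sigma>6 = run ?c6 \<sigma>5"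
  define \<sigma>7 where "\<sigma>7 = run ?c2 \<sigma>6"
  have aN: "enc a < N" using a by (intro enc_less_N) (simp add: R_set_def)
  have L1: "(\<forall>j<H. nmem \<sigma>1 ''L'' j = enc (np j * np (enc a) mod P)) \<and> ok K ?c1 \<sigma> (30 + 70 * b + 250 * H)"
    unfolding \<sigma>1_def by (rule run_mult_table[OF t p va aN]) auto
  have f1: "nmem \<sigma>1 w = nmem \<sigma> w" if "w \<notin> {''L'', ''S'', ''k'', ''j''}" for w
    using that by (simp add: \<sigma>1_def nmem_run nwr_mult_table)
  have t1: "tables \<sigma>1" by (rule tables_cong[OF t], rule f1) auto
  have t2: "tables \<sigma>2" unfolding \<sigma>2_def by (rule tables_run[OF t1]) auto
  have p2: "ptab \<sigma>2" using p f1 by (simp add: ptab_def \<sigma>2_def)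
  have z2: "nmem \<sigma>2 ''z'' 0 = enc (a mod P)" using va f1 Q.mod_less[OF a] by (simp add: \<sigma>2_def)
  note L3 = run_shift_loop[OF t2 p2 z2, folded \<sigma>3_def]
  have f3: "nmem \<sigma>3 w = nmem \<sigma>2 w" if "w \<notin> {''j'', ''z''}" for w
    unfolding \<sigma>3_def by (rule nmem_run) (use that in auto)
  have t3: "tables \<sigma>3" by (rule tables_cong[OF t2], rule f3) auto
  have p3: "ptab \<sigma>3" using p2 f3 by (simp add: ptab_def)
  have L4: "(\<forall>j<H. nmem \<sigma>4 ''U'' j = enc (np j * np (enc (Polynomial.monom 1 h * a mod P)) mod P))
      \<and> ok K ?c4 \<sigma>3 (30 + 70 * b + 250 * H)"
    unfolding \<sigma>4_def by (rule run_mult_table[OF t3 p3 conjunct1[OF L3] enc_mod_less]) auto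
  have f4: "nmem \<sigma>4 w = nmem \<sigma>3 w" if "w \<notin> {''U'', ''S'', ''k'', ''j''}" for w
    using that by (simp add: \<sigma>4_def nmem_run nwr_mult_table)
  have t4: "tables \<sigma>4" by (rule tables_cong[OF t3], rule f4) auto
  have t7: "tables \<sigma>7" unfolding \<sigma>7_def \<sigma>6_def \<sigma>5_def by (intro tables_run t4) auto
  have v4: "nmem \<sigma>4 ''a'' 0 = enc a" "nmem \<sigma>4 ''Seen'' = nmem \<sigma> ''Seen''" "\<forall>j<H. nmem \<sigma>4 ''L'' j = enc (np j * a mod P)"
    using va L1 f1 f3 f4 by (simp_all add: \<sigma>2_def)
  have v7: "nmem \<sigma>7 ''z'' 0 = enc a" "nmem \<sigma>7 ''ord'' 0 = 1" "nmem \<sigma>7 ''G'' 0 = 1"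
      "\<forall>j<H. nmem \<sigma>7 ''L'' j = enc (np j * a mod P)"
      "\<forall>j<H. nmem \<sigma>7 ''U'' j = enc (np j * (Polynomial.monom 1 h * a mod P) mod P)"
      "nmem \<sigma>7 ''Seen'' = nmem \<sigma> ''Seen''"
    using v4 L4 by (simp_all add: \<sigma>7_def \<sigma>6_def \<sigma>5_def)
  note L8 = run_powers_loop[OF t7 a v7(1-5)]
  have run_eq: "run process \<sigma> = run powers_loop \<sigma>7"
    by (simp only: process_def run.simps(4) \<sigma>1_def \<sigma>2_def \<sigma>3_def \<sigma>4_def \<sigma>5_def \<sigma>6_def \<sigma>7_def)
  show "nmem (run process \<sigma>) ''ord'' 0 = Q.ord_of a"
    "\<forall>i<Q.ord_of a. nmem (run process \<sigma>) ''G'' i = enc (a ^ i mod P)"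
    "\<forall>x. 0 < nmem (run process \<sigma>) ''Seen'' x \<longleftrightarrow>
       0 < nmem \<sigma> ''Seen'' x \<or> (\<exists>i\<in>{1..<Q.ord_of a}. x = enc (a ^ i mod P))"
    unfolding run_eq using L8 v7(6) by simp_all
  have st: "ok K (NSet x (Num 0) e) \<tau> (2 + ncost e)" for x e \<tau> using K_bounds by (intro ok_straight) simp_all
  have "ok K process \<sigma> ((30 + 70 * b + 250 * H) + ((2 + ncost (nv ''a'')) + ((10 + 80 * h) + ((30 + 70 * b + 250 * H)
      + ((2 + ncost (Num 1)) + ((2 + ncost (Num 1)) + ((2 + ncost (nv ''a'')) + (10 + 100 * Q.ord_of a))))))))"
    unfolding process_def
    by (intro ok_Seq st) (use L1 L3 L4 L8(4) in \<open>simp_all only: \<sigma>1_def \<sigma>2_def \<sigma>3_def \<sigma>4_def \<sigma>5_def \<sigma>6_def \<sigma>7_def\<close>)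
  moreover have "h \<le> H"
    using less_imp_le[OF power_gt_expt[of b h]] b2 by (simp add: H)
  ultimately show "ok K process \<sigma> (850 * H + 100 * Q.ord_of a)"
    using N_bounds(2,7) b2 by (elim ok_mono) simp
qed

lemma nwr_process: "nwr process = {''L'', ''S'', ''k'', ''j'', ''z'', ''U'', ''G'', ''ord'', ''Seen''}"
  "cwr process = {}" "silent process"
  by (auto simp: process_def nwr_mult_table powers_loop_def)

lemma find_g_altdef:
  "find_g = (nlet ''ord'' (Num 0) ;;
     For ''i'' (nv ''M'') (nv ''ord'' \<^bold>< nv ''M'')
      (nlet ''a'' (nv ''i'' \<^bold>+ Num 1) ;; Cond (NCell ''Seen'' (nv ''a'') \<^bold>< Num 1) process skip))"
  by (simp add: find_g_def process_def powers_loop_def gmult_def)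

lemma nwr_find_g: "nwr find_g = {''L'', ''S'', ''k'', ''j'', ''z'', ''U'', ''G'', ''ord'', ''Seen'', ''i'', ''a'', ''tmp''}"
  "cwr find_g = {}" "silent find_g"
  by (auto simp: find_g_altdef nwr_process)

text \<open>\<open>D\<close> is the set of the orders of the elements processed so far; an element is seen if its order
  divides one of them, as the multiplicative group is cyclic.  Hence the orders are distinct and the
  total cost is governed by the sum and the number of the divisors of \<open>M\<close>.\<close>

lemma run_find_g:
  fixes \<sigma> :: state
  assumes t: "tables \<sigma>" and p: "ptab \<sigma>" and Seen: "nmem \<sigma> ''Seen'' = (\<lambda>_. 0)"
  shows "\<exists>g\<in>R_set m. Q.ord_of g = M \<and> (\<forall>i<M. nmem (run find_g \<sigma>) ''G'' i = enc (g ^ i mod P))"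
    and "ok K find_g \<sigma> (3000 * (m * (b * (b * N))))"
proof -
  let ?g = "nv ''ord'' \<^bold>< nv ''M''"
  let ?c1 = "nlet ''a'' (nv ''i'' \<^bold>+ Num 1)" and ?c2 = "Cond (NCell ''Seen'' (nv ''a'') \<^bold>< Num 1) process skip"
  let ?body = "?c1 ;; ?c2"
  let ?loop = "For ''i'' (nv ''M'') ?g ?body"
  define found where "found \<tau> \<longleftrightarrow> nmem \<tau> ''ord'' 0 = M \<and>
    (\<exists>g\<in>R_set m. Q.ord_of g = M \<and> (\<forall>i<M. nmem \<tau> ''G'' i = enc (g ^ i mod P)))" for \<tau> :: state
  \<comment> \<open>Processing an element of order \<open>d\<close> takes tables of size
    \<open>H\<close> and then \<open>d\<close> steps. As \<open>D\<close> is a set, an order that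
    occurred twice would not be paid for; that each new order lies outside \<open>D\<close> is the
    heart of the estimate.\<close>
  define cost where "cost D = (\<Sum>d\<in>D. 850 * H + 100 * d)" for D
  \<comment> \<open>The clause for \<open>i = 0\<close> is there for the element 1, which is never
    marked as seen: it is met in round 0, when no order has been processed yet.
    \<open>M \<notin> D\<close> and \<open>ord < M\<close> say that the search is still on.\<close>
  define sinv where "sinv D i \<tau> \<longleftrightarrow> nmem \<tau> ''ord'' 0 < M \<and> M \<notin> D \<and> (i = 0 \<longrightarrow> D = {})
    \<and> (\<forall>x. 0 < nmem \<tau> ''Seen'' x \<longleftrightarrow> (\<exists>z\<in>R_set m. z \<noteq> 1 \<and> x = enc z \<and> (\<exists>d\<in>D. z ^ d mod P = 1)))
    \<and> (\<forall>z\<in>R_set m. enc z \<le> i \<longrightarrow> (\<exists>d\<in>D. z ^ d mod P = 1))" for D i and \<tau> :: state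
  let ?I = "\<lambda>i A (\<tau>::state). \<exists>D\<subseteq>{d. d dvd M}. A \<le> i * 50 + cost D \<and> (found \<tau> \<or> sinv D i \<tau>)"
  let ?J = "\<lambda>A (\<tau>::state). found \<tau> \<and> (\<exists>D\<subseteq>{d. d dvd M}. A \<le> M * 50 + cost D)"
  define \<sigma>1 where "\<sigma>1 = run (nlet ''ord'' (Num 0)) \<sigma>"
  have t1: "tables \<sigma>1" unfolding \<sigma>1_def by (rule tables_run[OF t]) auto
  have p1: "ptab \<sigma>1" using p by (simp add: ptab_def \<sigma>1_def)
  have Mpos: "0 < M" by (rule Q.M_pos)
  have finD: "finite {d. d dvd M}" using Mpos by simp
  have "\<exists>A. ?J A (run ?loop \<sigma>1) \<and> ok K ?loop \<sigma>1 (1 + ncost (nv ''M'') + A)"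
  proof (rule For_rule[where I = ?I])
    fix i A and \<tau> :: state
    assume iM: "i < M" and I: "?I i A \<tau>" and ni: "nmem \<tau> ''i'' 0 = i" and g: "beval ?g \<tau>"
      and fn: "\<And>w. w \<notin> nwr ?loop \<Longrightarrow> nmem \<tau> w = nmem \<sigma>1 w"
    have tt: "tables \<tau>" by (rule tables_cong[OF t1], rule fn) (auto simp: nwr_process)
    have pt: "ptab \<tau>" using p1 fn[of "''P''"] by (simp add: ptab_def nwr_process)
    have "\<not> found \<tau>" using g tablesD[OF tt] by (simp add: found_def)
    then obtain D where D: "D \<subseteq> {d. d dvd M}" "A \<le> i * 50 + cost D" "sinv D i \<tau>" using I by blast
    have fD: "finite D" using D(1) finD finite_subset by blast
    define a where "a = np (i + 1)"
    have iN: "i + 1 < N" using iM by (simp add: M)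
    have enc_a: "enc a = i + 1" by (simp add: a_def)
    have a: "a \<in> R_set m" using degree_np[OF iN] by (simp add: R_set_def a_def)
    define \<tau>1 where "\<tau>1 = run ?c1 \<tau>"
    have tt1: "tables \<tau>1" unfolding \<tau>1_def by (rule tables_run[OF tt]) auto
    have pt1: "ptab \<tau>1" using pt by (simp add: ptab_def \<tau>1_def)
    have v1: "nmem \<tau>1 ''a'' 0 = enc a" "nmem \<tau>1 ''Seen'' = nmem \<tau> ''Seen''" "nmem \<tau>1 ''ord'' 0 = nmem \<tau> ''ord'' 0"
      using ni by (simp_all add: \<tau>1_def enc_a)
    have o1: "ok K ?c1 \<tau> 10" by (rule ok_straight) (use K_bounds in auto)
    show "\<exists>u. ok K ?body \<tau> u \<and> ?I (Suc i) (A + (1 + bcost ?g + u)) (run ?body \<tau>)"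
    proof (cases "0 < nmem \<tau> ''Seen'' (enc a)")
      case True
      have ev: "\<not> beval (NCell ''Seen'' (nv ''a'') \<^bold>< Num 1) \<tau>1" using True v1 by simp
      have "ok K ?c2 \<tau>1 30"
        unfolding ok_def using ev K_bounds by simp
      then have ok: "ok K ?body \<tau> (10 + 30)" using o1 by (intro ok_Seq) (simp_all only: \<tau>1_def)
      obtain d where d: "d \<in> D" "a ^ d mod P = 1" using D(3) True unfolding sinv_def by auto
      have "run ?body \<tau> = run ?c2 \<tau>1" by (simp only: run.simps(4) \<tau>1_def)
      then have r: "nmem (run ?body \<tau>) ''ord'' 0 = nmem \<tau> ''ord'' 0" "nmem (run ?body \<tau>) ''Seen'' = nmem \<tau> ''Seen''"
        using ev v1 by simp_all
      have "sinv D (Suc i) (run ?body \<tau>)"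
        unfolding sinv_def r
      proof (intro conjI ballI impI)
        fix z :: "'b mod_ring poly" assume z: "z \<in> R_set m" "enc z \<le> Suc i"
        show "\<exists>d\<in>D. z ^ d mod P = 1"
        proof (cases "enc z = Suc i")
          case True
          then have "z = a" using enc_a by (metis Suc_eq_plus1 enc_eq_iff)
          then show ?thesis using d by blast
        qed (use z D(3) in \<open>auto simp: sinv_def\<close>)
      qed (use D(3) in \<open>auto simp: sinv_def\<close>)
      then show ?thesis using D(1,2)
        by (intro exI[of _ "10 + 30"] conjI[OF ok] exI[of _ D]) auto
    next
      case False
      have ev: "beval (NCell ''Seen'' (nv ''a'') \<^bold>< Num 1) \<tau>1" using False v1 by simp
      let ?o = "Q.ord_of a"
      note R = run_process[OF tt1 pt1 a v1(1)]
      have "ok K ?c2 \<tau>1 (1 + bcost (NCell ''Seen'' (nv ''a'') \<^bold>< Num 1) + ((850 * H + 100 * ?o) + 0))"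
        by (rule ok_Cond) (use R(4) ev in auto)
      then have ok: "ok K ?body \<tau> (10 + (1 + bcost (NCell ''Seen'' (nv ''a'') \<^bold>< Num 1) + ((850 * H + 100 * ?o) + 0)))"
        using o1 by (intro ok_Seq) (simp_all only: \<tau>1_def)
      have run_eq: "run ?body \<tau> = tick (1 + bcost (NCell ''Seen'' (nv ''a'') \<^bold>< Num 1)) (run process \<tau>1)"
        using ev by (simp add: \<tau>1_def)
      have oD: "?o \<notin> D"
      proof
        assume o: "?o \<in> D"
        have "a ^ ?o mod P = 1" using Q.ord_of_dvd[OF a] by simp
        moreover have "a \<noteq> 1"
        proof
          assume "a = 1"
          then have "i = 0" using enc_a by simp
          then show False using D(3) o by (simp add: sinv_def)
        qed
        ultimately have "0 < nmem \<tau> ''Seen'' (enc a)" using D(3) a o unfolding sinv_def by blast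
        then show False using False by blast
      qed
      let ?D = "insert ?o D"
      have D': "?D \<subseteq> {d. d dvd M}" using D(1) Q.ord_of_dvd_M[OF a] by simp
      have cost: "cost ?D = 850 * H + 100 * ?o + cost D" using oD fD by (simp add: cost_def)
      have ordle: "?o \<le> M" using Q.ord_of_dvd_M[OF a] Mpos by (rule dvd_imp_le)
      have "found (run ?body \<tau>) \<or> sinv ?D (Suc i) (run ?body \<tau>)"
      proof (cases "?o = M")
        case True
        then have "found (run ?body \<tau>)"
          using R(1,2) a unfolding found_def run_eq by auto
        then show ?thesis ..
      next
        case oM: False
        \<comment> \<open>By cyclicity the newly marked elements can be described through the order
          alone, without mentioning \<open>a\<close>; this is the form the invariant uses.\<close>
        have pw: "(\<exists>i\<in>{1..<?o}. x = enc (a ^ i mod P)) \<longleftrightarrow> (\<exists>z\<in>R_set m. z \<noteq> 1 \<and> x = enc z \<and> z ^ ?o mod P = 1)" for x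
        proof
          assume "\<exists>i\<in>{1..<?o}. x = enc (a ^ i mod P)"
          then obtain i where i: "1 \<le> i" "i < ?o" "x = enc (a ^ i mod P)" by auto
          have "a ^ i mod P \<in> {z \<in> R_set m. z ^ ?o mod P = 1}" unfolding Q.pow_image[OF a, symmetric] using i by auto
          moreover have "a ^ i mod P \<noteq> 1" using Q.ord_of_minimal[OF a, of i] i by simp
          ultimately show "\<exists>z\<in>R_set m. z \<noteq> 1 \<and> x = enc z \<and> z ^ ?o mod P = 1" using i(3) by blast
        next
          assume "\<exists>z\<in>R_set m. z \<noteq> 1 \<and> x = enc z \<and> z ^ ?o mod P = 1"
          then obtain z where z: "z \<in> R_set m" "z \<noteq> 1" "x = enc z" "z ^ ?o mod P = 1" by blast
          then have "z \<in> (\<lambda>i. a ^ i mod P) ` {..<?o}" unfolding Q.pow_image[OF a] by blast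
          then obtain i where i: "i < ?o" "z = a ^ i mod P" by auto
          have "i \<noteq> 0" using z(2) i(2) Q.mod_less[OF Q.one_R_set] by (intro notI) simp
          then show "\<exists>i\<in>{1..<?o}. x = enc (a ^ i mod P)" using i z(3) by (intro bexI[of _ i]) auto
        qed
        have Sn: "0 < nmem (run ?body \<tau>) ''Seen'' x \<longleftrightarrow> (\<exists>z\<in>R_set m. z \<noteq> 1 \<and> x = enc z \<and> (\<exists>d\<in>?D. z ^ d mod P = 1))" for x
        proof -
          have "0 < nmem (run ?body \<tau>) ''Seen'' x \<longleftrightarrow> 0 < nmem \<tau> ''Seen'' x \<or> (\<exists>i\<in>{1..<?o}. x = enc (a ^ i mod P))"
            unfolding run_eq using R(3) v1(2) by simp
          also have "0 < nmem \<tau> ''Seen'' x \<longleftrightarrow> (\<exists>z\<in>R_set m. z \<noteq> 1 \<and> x = enc z \<and> (\<exists>d\<in>D. z ^ d mod P = 1))"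
            using D(3) unfolding sinv_def by blast
          finally show ?thesis unfolding pw by blast
        qed
        have "sinv ?D (Suc i) (run ?body \<tau>)"
          unfolding sinv_def
        proof (intro conjI ballI impI allI)
          show "nmem (run ?body \<tau>) ''ord'' 0 < M" unfolding run_eq using R(1) oM ordle by simp
          show "M \<notin> ?D" using oM D(3) by (auto simp: sinv_def)
          fix z :: "'b mod_ring poly" assume z: "z \<in> R_set m" "enc z \<le> Suc i"
          show "\<exists>d\<in>?D. z ^ d mod P = 1"
          proof (cases "enc z = Suc i")
            case True
            then have "z = a" using enc_a by (metis Suc_eq_plus1 enc_eq_iff)
            then show ?thesis using Q.ord_of_dvd[OF a] by auto
          qed (use z D(3) in \<open>auto simp: sinv_def\<close>)
        qed (use Sn in auto)
        then show ?thesis ..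
      qed
      moreover have "A + (1 + bcost ?g + (10 + (1 + bcost (NCell ''Seen'' (nv ''a'') \<^bold>< Num 1) + ((850 * H + 100 * ?o) + 0))))
          \<le> Suc i * 50 + cost ?D"
        using D(2) unfolding cost by simp
      ultimately show ?thesis
        by (intro exI[of _ "10 + (1 + bcost (NCell ''Seen'' (nv ''a'') \<^bold>< Num 1) + ((850 * H + 100 * ?o) + 0))"]
            conjI[OF ok] exI[of _ ?D] conjI D') auto
    qed
  next
    fix i A and \<tau> :: state
    assume iM: "i < M" and I: "?I i A \<tau>" and g: "\<not> beval ?g \<tau>"
      and fn: "\<And>w. w \<notin> nwr ?loop \<Longrightarrow> nmem \<tau> w = nmem \<sigma>1 w"
    have tt: "tables \<tau>" by (rule tables_cong[OF t1], rule fn) (auto simp: nwr_process)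
    obtain D where D: "D \<subseteq> {d. d dvd M}" "A \<le> i * 50 + cost D" "found \<tau> \<or> sinv D i \<tau>" using I by blast
    have "found \<tau>" using D(3) g tablesD[OF tt] by (auto simp: sinv_def)
    moreover have "A + (1 + bcost ?g) \<le> M * 50 + cost D"
    proof -
      have "Suc i * 50 \<le> M * 50" using iM by (intro mult_le_mono) auto
      then show ?thesis using D(2) by simp
    qed
    ultimately show "?J (A + (1 + bcost ?g)) \<tau>" using D(1) by blast
  next
    fix A and \<tau> :: state
    assume "?I M A \<tau>"
    then obtain D where D: "D \<subseteq> {d. d dvd M}" "A \<le> M * 50 + cost D" "found \<tau> \<or> sinv D M \<tau>" by blast
    have "\<not> sinv D M \<tau>"
    proof
      assume sinv: "sinv D M \<tau>"
      \<comment> \<open>If every element had been dealt with, a primitive one would satisfy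
        \<open>a0 ^ d = 1\<close> for some \<open>d\<close> in \<open>D\<close>. Then
        \<open>M\<close> divides \<open>d\<close> and \<open>d\<close> divides \<open>M\<close>,
        although \<open>M\<close> is not in \<open>D\<close>.\<close>
      obtain a0 where a0: "a0 \<in> R_set m" "Q.ord_of a0 = M" using Q.ex_primitive by blast
      have "enc a0 < N" using a0(1) by (intro enc_less_N) (simp add: R_set_def)
      then have "enc a0 \<le> M" by (simp add: M)
      moreover have "\<forall>z\<in>R_set m. enc z \<le> M \<longrightarrow> (\<exists>d\<in>D. z ^ d mod P = 1)"
        using sinv unfolding sinv_def by (elim conjE)
      ultimately obtain d where d: "d \<in> D" "a0 ^ d mod P = 1" using a0(1) by blast
      have "M dvd d" using Q.ord_of_dvd[OF a0(1)] d(2) a0(2) by simp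
      moreover have "d dvd M" using D(1) d(1) by blast
      ultimately have "d = M" by (simp add: dvd_antisym)
      then show False using sinv d(1) by (simp add: sinv_def)
    qed
    then show "?J A \<tau>" using D by blast
  next
    show "?I 0 0 (tick (1 + ncost (nv ''M'')) \<sigma>1)"
    proof (intro exI[of _ "{}"] conjI disjI2)
      show "sinv {} 0 (tick (1 + ncost (nv ''M'')) \<sigma>1)"
        using Seen Mpos by (auto simp: sinv_def \<sigma>1_def R_set_def)
    qed auto
  next
    fix i A k and \<tau> :: state
    assume "?I i A \<tau>"
    then show "?I i A (tick k (nwrite ''i'' 0 i \<tau>))" by (simp add: sinv_def found_def)
  qed (use tablesD[OF t1] K_bounds in auto)
  then obtain A where A0: "?J A (run ?loop \<sigma>1) \<and> ok K ?loop \<sigma>1 (1 + ncost (nv ''M'') + A)" ..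
  note A = conjunct1[OF A0] conjunct2[OF A0]
  have run_eq: "run find_g \<sigma> = run ?loop \<sigma>1" by (simp only: find_g_altdef run.simps(4) \<sigma>1_def)
  show "\<exists>g\<in>R_set m. Q.ord_of g = M \<and> (\<forall>i<M. nmem (run find_g \<sigma>) ''G'' i = enc (g ^ i mod P))"
    unfolding run_eq using A(1) unfolding found_def by blast
  obtain D where D: "D \<subseteq> {d. d dvd M}" "A \<le> M * 50 + cost D" using A(1) by blast
  have MN: "M < N" using N_bounds(1) by (simp add: M)
  have "cost D = card D * (850 * H) + 100 * \<Sum>D"
    by (simp add: cost_def sum.distrib sum_distrib_left)
  moreover have "card D * (850 * H) \<le> 1700 * (b * (b * N))"
  proof -
    have "card D \<le> 2 * H"
      by (rule card_divisors_le[OF Mpos _ D(1)]) (use MN N_le_bN bN_le_HH in \<open>meson less_le_trans less_trans\<close>)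
    then have "card D * (850 * H) \<le> 2 * H * (850 * H)" by (rule mult_le_mono1)
    also have "\<dots> = 1700 * (H * H)" by simp
    also have "\<dots> \<le> 1700 * (b * (b * N))" using HH_le unfolding b_pow_m2 by simp
    finally show ?thesis .
  qed
  moreover have "\<Sum>D \<le> m * (b * M)"
    by (rule sum_divisors_le[OF _ Mpos _ D(1)]) (use b2 MN N in auto)
  moreover have "m * (b * M) \<le> m * (b * (b * N))"
  proof -
    have "M \<le> b * N" using MN N_bounds(5) by linarith
    then show ?thesis by (intro mult_le_mono2)
  qed
  moreover have "b * (b * N) \<le> m * (b * (b * N))" using m by simp
  moreover have "M \<le> b * (b * N)"
    using MN N_bounds(4) unfolding b_pow_m2 using N_bounds(5) by linarith
  ultimately have "A \<le> 1900 * (m * (b * (b * N)))" using D(2) by linarith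
  moreover have "ok K find_g \<sigma> (5 + (1 + ncost (nv ''M'') + A))"
    unfolding find_g_altdef
  proof (rule ok_Seq)
    show "ok K (nlet ''ord'' (Num 0)) \<sigma> 5" by (rule ok_straight) (use K_bounds in auto)
  qed (use A(2) in \<open>simp only: \<sigma>1_def\<close>)
  moreover have "4 \<le> m * (b * (b * N))" using bbN_ge \<open>b * (b * N) \<le> m * (b * (b * N))\<close> by linarith
  ultimately show "ok K find_g \<sigma> (3000 * (m * (b * (b * N))))"
    by (elim ok_mono) simp
qed

end

section \<open>Constants and the circulant matrix\<close>

text \<open>In round \<open>i\<close> the array \<open>X\<close> is still unchanged from \<open>i\<close> on, so the assigned
  expression may refer to these entries.\<close>

lemma run_cset_loop:
  fixes \<sigma> :: state and X q :: string
  assumes n: "neval e \<sigma> = n" and K: "n \<le> K" "0 < K"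
    and ev: "\<And>i \<tau>. \<lbrakk>i < n; nmem \<tau> q 0 = i; \<And>y. y \<noteq> q \<Longrightarrow> nmem \<tau> y = nmem \<sigma> y;
       \<And>y. y \<noteq> X \<Longrightarrow> cmem \<tau> y = cmem \<sigma> y; \<And>k. i \<le> k \<Longrightarrow> cmem \<tau> X k = cmem \<sigma> X k; weights \<tau> = weights \<sigma>\<rbrakk>
       \<Longrightarrow> ceval ex \<tau> = v i"
  defines "c \<equiv> for_all q e (CSet X (nv q) ex)"
  shows "(\<forall>i. cmem (run c \<sigma>) X i = (if i < n then v i else cmem \<sigma> X i))
    \<and> ok K c \<sigma> (1 + ncost e + n * (5 + ccost ex))"
  unfolding c_def
proof (rule for_all_const[where I = "\<lambda>k \<tau>. \<forall>i. cmem \<tau> X i = (if i < k then v i else cmem \<sigma> X i)" and t = "3 + ccost ex"])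
  fix i and \<tau> :: state
  let ?b = "CSet X (nv q) ex"
  assume i: "i < n" and I: "\<forall>k. cmem \<tau> X k = (if k < i then v k else cmem \<sigma> X k)" and nq: "nmem \<tau> q 0 = i"
    and fn: "\<And>y. y \<notin> nwr (for_all q e ?b) \<Longrightarrow> nmem \<tau> y = nmem \<sigma> y"
    and fc: "\<And>y. y \<notin> cwr ?b \<Longrightarrow> cmem \<tau> y = cmem \<sigma> y" and w: "weights \<tau> = weights \<sigma>"
  have "ceval ex \<tau> = v i" by (rule ev[OF i nq]) (use fn fc I w in auto)
  then have "cmem (run ?b \<tau>) X = (cmem \<tau> X)(i := v i)" using nq by simp
  moreover have "ok K ?b \<tau> (3 + ccost ex)" by (rule ok_straight) (use i nq K in auto)
  ultimately show "ok K ?b \<tau> (3 + ccost ex) \<and> (\<forall>k. cmem (run ?b \<tau>) X k = (if k < Suc i then v k else cmem \<sigma> X k))"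
    using I by (auto simp: less_Suc_eq)
qed (use n K in \<open>auto simp: algebra_simps\<close>)

lemma run_cpower_loop:
  fixes y q :: string
  assumes n: "neval e \<sigma> = n" and K: "0 < K"
    and ev: "\<And>\<tau>. (\<And>z. z \<noteq> y \<Longrightarrow> cmem \<tau> z = cmem \<sigma> z) \<Longrightarrow> ceval ex \<tau> = cmem \<tau> y 0 * u"
  defines "c \<equiv> for_all q e (clet y ex)"
  shows "cmem (run c \<sigma>) y 0 = cmem \<sigma> y 0 * u ^ n \<and> ok K c \<sigma> (1 + ncost e + n * (4 + ccost ex))"
  unfolding c_def
proof (rule for_all_const[where I = "\<lambda>i \<tau>. cmem \<tau> y 0 = cmem \<sigma> y 0 * u ^ i" and t = "2 + ccost ex"])
  fix i and \<tau> :: state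
  let ?b = "clet y ex"
  assume I: "cmem \<tau> y 0 = cmem \<sigma> y 0 * u ^ i"
    and fc: "\<And>w. w \<notin> cwr ?b \<Longrightarrow> cmem \<tau> w = cmem \<sigma> w"
  have "ceval ex \<tau> = cmem \<tau> y 0 * u" by (rule ev) (use fc in auto)
  then show "ok K ?b \<tau> (2 + ccost ex) \<and> cmem (run ?b \<tau>) y 0 = cmem \<sigma> y 0 * u ^ Suc i"
    using I K by (auto intro!: ok_straight)
qed (use n K in \<open>auto simp: algebra_simps\<close>)

text \<open>A Horner recursion descending in \<nu>: the sum for the next \<nu> costs one square, one
  addition and a division by \<open>b ^ 2\<close>.\<close>

lemma C_prime_rec:
  assumes "\<nu> \<le> \<alpha>"
  shows "C_prime b \<alpha> \<nu> = (C_const b \<nu>)\<^sup>2 + C_prime b \<alpha> (Suc \<nu>) / (real b * real b)"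
proof -
  have "C_prime b \<alpha> \<nu> = (C_const b \<nu>)\<^sup>2 + (\<Sum>\<tau>=Suc \<nu>..\<alpha>. (C_const b \<tau>)\<^sup>2 / real b ^ (2 * (\<tau> - \<nu>)))"
    unfolding C_prime_def by (subst sum.atLeast_Suc_atMost[OF assms]) simp
  also have "(\<Sum>\<tau>=Suc \<nu>..\<alpha>. (C_const b \<tau>)\<^sup>2 / real b ^ (2 * (\<tau> - \<nu>)))
      = (\<Sum>\<tau>=Suc \<nu>..\<alpha>. (C_const b \<tau>)\<^sup>2 / real b ^ (2 * (\<tau> - Suc \<nu>)) / (real b * real b))"
  proof (rule sum.cong[OF refl])
    fix \<tau> assume "\<tau> \<in> {Suc \<nu>..\<alpha>}"
    then have "2 * (\<tau> - \<nu>) = Suc (Suc (2 * (\<tau> - Suc \<nu>)))" by auto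
    then show "(C_const b \<tau>)\<^sup>2 / real b ^ (2 * (\<tau> - \<nu>)) = (C_const b \<tau>)\<^sup>2 / real b ^ (2 * (\<tau> - Suc \<nu>)) / (real b * real b)"
      by (simp only: power_Suc) simp
  qed
  also have "\<dots> = C_prime b \<alpha> (Suc \<nu>) / (real b * real b)"
    by (simp add: C_prime_def sum_divide_distrib)
  finally show ?thesis .
qed

text \<open>The expression maximised in \<open>D_const\<close>, indexed by
  \<open>k = \<alpha> - \<nu>\<close>, which is the order in which the program meets it.\<close>

definition D_val :: "nat \<Rightarrow> nat \<Rightarrow> nat \<Rightarrow> real" where
  "D_val b \<alpha> k = C_prime b \<alpha> (\<alpha> - k) + C_tilde b \<alpha> / real b ^ (2 * k)"

primrec D_max :: "nat \<Rightarrow> nat \<Rightarrow> nat \<Rightarrow> real" where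
  "D_max b \<alpha> 0 = 0"
| "D_max b \<alpha> (Suc k) = max (D_max b \<alpha> k) (D_val b \<alpha> k)"

lemma D_max_eq: "D_max b \<alpha> k = Max (insert 0 (D_val b \<alpha> ` {..<k}))"
proof (induction k)
  case (Suc k)
  have "insert 0 (D_val b \<alpha> ` {..<Suc k}) = insert (D_val b \<alpha> k) (insert 0 (D_val b \<alpha> ` {..<k}))"
    by (auto simp: lessThan_Suc)
  then show ?case using Suc by (simp add: max.commute del: Max_insert) (subst Max_insert, auto simp: max.commute)
qed simp

lemma D_val_nonneg: "0 \<le> D_val b \<alpha> k"
  unfolding D_val_def
  by (intro add_nonneg_nonneg) (auto simp: C_prime_def C_tilde_def power_mult intro!: sum_nonneg)

text \<open>The running maximum starts from 0, which leaves the result unchanged because all values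
  compared are non-negative.\<close>

lemma D_max_D_const:
  assumes "1 \<le> \<alpha>"
  shows "D_max b \<alpha> \<alpha> = D_const b \<alpha>"
proof -
  have "D_val b \<alpha> ` {..<\<alpha>} = (\<lambda>\<nu>. C_prime b \<alpha> \<nu> + C_tilde b \<alpha> / real b ^ (2 * (\<alpha> - \<nu>))) ` {1..\<alpha>}"
  proof (intro equalityI subsetI)
    fix x assume "x \<in> D_val b \<alpha> ` {..<\<alpha>}"
    then obtain k where "k < \<alpha>" "x = D_val b \<alpha> k" by auto
    then show "x \<in> (\<lambda>\<nu>. C_prime b \<alpha> \<nu> + C_tilde b \<alpha> / real b ^ (2 * (\<alpha> - \<nu>))) ` {1..\<alpha>}"
      by (intro image_eqI[of _ _ "\<alpha> - k"]) (auto simp: D_val_def)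
  next
    fix x assume "x \<in> (\<lambda>\<nu>. C_prime b \<alpha> \<nu> + C_tilde b \<alpha> / real b ^ (2 * (\<alpha> - \<nu>))) ` {1..\<alpha>}"
    then obtain \<nu> where "\<nu> \<in> {1..\<alpha>}" "x = C_prime b \<alpha> \<nu> + C_tilde b \<alpha> / real b ^ (2 * (\<alpha> - \<nu>))" by auto
    then show "x \<in> D_val b \<alpha> ` {..<\<alpha>}" by (intro image_eqI[of _ _ "\<alpha> - \<nu>"]) (auto simp: D_val_def)
  qed
  moreover have "Max (insert 0 (D_val b \<alpha> ` {..<\<alpha>})) = Max (D_val b \<alpha> ` {..<\<alpha>})"
  proof -
    have ne: "D_val b \<alpha> ` {..<\<alpha>} \<noteq> {}" using assms by (auto simp: lessThan_empty_iff)
    have "D_val b \<alpha> 0 \<le> Max (D_val b \<alpha> ` {..<\<alpha>})" using assms by (intro Max_ge) auto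
    then have "0 \<le> Max (D_val b \<alpha> ` {..<\<alpha>})" using D_val_nonneg[of b \<alpha> 0] by linarith
    then show ?thesis using ne by (subst Max_insert) auto
  qed
  ultimately show ?thesis by (simp add: D_max_eq D_const_def)
qed

abbreviation comp_D_step :: com where
  "comp_D_step \<equiv>
      (clet ''E'' (cv ''c'' \<boxtimes> cv ''c'' \<boxplus> cv ''E'' \<div> (cv ''b'' \<boxtimes> cv ''b'')) ;;
       clet ''val'' (cv ''E'' \<boxplus> cv ''Ct'' \<boxtimes> cv ''t'') ;;
       Cond (CLess (cv ''Dt'') (cv ''val'')) (clet ''Dt'' (cv ''val'')) skip ;;
       clet ''t'' (cv ''t'' \<div> (cv ''b'' \<boxtimes> cv ''b'')) ;;
       Cond (nv ''k'' \<^bold>+ Num 2 \<^bold>< nv ''alpha'')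
         (clet ''c'' (cv ''c'' \<boxtimes> cv ''sg'' \<div> cv ''rho''))
         (clet ''c'' (cv ''c'' \<boxtimes> cv ''sg'')))"

text \<open>Descending from \<tau> to \<tau> - 1 multiplies by \<open>s/\<rho>\<close>, except from
  2 to 1: the exponent of \<rho> is already 0 at \<tau> = 2, so only \<open>s\<close> remains. This
  is the source of the case distinction in the program.\<close>

lemma C_const_step:
  fixes b :: nat
  defines "s \<equiv> 2 * sin (pi / b)" and "\<rho> \<equiv> 1 + 1 / real b + 1 / (real b * (real b + 1))"
  assumes b: "2 \<le> b"
  shows "0 < s" "0 < \<rho>" "\<And>\<tau>. 2 \<le> \<tau> \<Longrightarrow> C_const b \<tau> = \<rho> ^ (\<tau> - 2) / s ^ \<tau>"
    "\<And>\<tau>. 3 \<le> \<tau> \<Longrightarrow> C_const b \<tau> * s / \<rho> = C_const b (\<tau> - 1)" "C_const b 2 * s = C_const b 1"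
    "C_tilde b \<alpha> = 2 * \<rho> ^ (2 * \<alpha> - 2) / s ^ (2 * \<alpha>)"
proof -
  have "pi / b < pi" using b by (simp add: field_simps)
  then show s: "0 < s" using b by (auto simp: s_def intro!: sin_gt_zero)
  show \<rho>: "0 < \<rho>" using b unfolding \<rho>_def by (intro add_pos_nonneg) auto
  show C: "C_const b \<tau> = \<rho> ^ (\<tau> - 2) / s ^ \<tau>" if "2 \<le> \<tau>" for \<tau>
    using that by (simp add: C_const_def s_def \<rho>_def add.commute)
  show "C_const b \<tau> * s / \<rho> = C_const b (\<tau> - 1)" if "3 \<le> \<tau>" for \<tau>
  proof -
    obtain k where k: "\<tau> = Suc (Suc (Suc k))" using \<open>3 \<le> \<tau>\<close> by (metis Suc_le_D numeral_3_eq_3 Suc_le_mono)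
    show ?thesis using s \<rho> C[of \<tau>] C[of "\<tau> - 1"] by (simp add: k)
  qed
  show "C_const b 2 * s = C_const b 1"
    using s C[of 2] by (simp add: C_const_def s_def[symmetric] power2_eq_square)
  show "C_tilde b \<alpha> = 2 * \<rho> ^ (2 * \<alpha> - 2) / s ^ (2 * \<alpha>)"
    by (simp add: C_tilde_def s_def \<rho>_def add.commute)
qed

lemma run_comp_D_loop:
  fixes \<sigma> :: state
  assumes b: "2 \<le> b" and \<alpha>: "2 \<le> \<alpha>" and K: "0 < K"
  defines "s \<equiv> 2 * sin (pi / b)" and "\<rho> \<equiv> 1 + 1 / real b + 1 / (real b * (real b + 1))"
  assumes v: "nmem \<sigma> ''alpha'' 0 = \<alpha>" "cmem \<sigma> ''b'' 0 = of_real b" "cmem \<sigma> ''rho'' 0 = of_real \<rho>"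
    "cmem \<sigma> ''sg'' 0 = of_real s" "cmem \<sigma> ''Ct'' 0 = of_real (C_tilde b \<alpha>)" "cmem \<sigma> ''c'' 0 = of_real (C_const b \<alpha>)"
    "cmem \<sigma> ''E'' 0 = 0" "cmem \<sigma> ''t'' 0 = 1" "cmem \<sigma> ''Dt'' 0 = 0"
  defines "c \<equiv> for_all ''k'' (nv ''alpha'') comp_D_step"
  shows "cmem (run c \<sigma>) ''Dt'' 0 = of_real (D_const b \<alpha>) \<and> ok K c \<sigma> (5 + 120 * \<alpha>)"
proof -
  note CC = C_const_step[OF b, folded s_def \<rho>_def]
  \<comment> \<open>After the last round \<open>c\<close> has no meaning, hence the premise
    \<open>k < \<alpha>\<close>. \<open>E\<close> lags one step behind, from the empty sum at
    \<open>Suc \<alpha>\<close>.\<close>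
  let ?I = "\<lambda>k (\<tau>::state). (k < \<alpha> \<longrightarrow> cmem \<tau> ''c'' 0 = of_real (C_const b (\<alpha> - k)))
    \<and> cmem \<tau> ''E'' 0 = of_real (C_prime b \<alpha> (Suc \<alpha> - k)) \<and> cmem \<tau> ''t'' 0 = of_real (1 / real b ^ (2 * k))
    \<and> cmem \<tau> ''Dt'' 0 = of_real (D_max b \<alpha> k)"
  have "?I \<alpha> (run c \<sigma>) \<and> ok K c \<sigma> (5 + 120 * \<alpha>)"
    unfolding c_def
  proof (rule for_all_const[where I = ?I and t = 110])
    fix k and \<tau> :: state
    assume k: "k < \<alpha>" and I: "?I k \<tau>" and nk: "nmem \<tau> ''k'' 0 = k"
      and fn: "\<And>y. y \<notin> nwr (for_all ''k'' (nv ''alpha'') comp_D_step) \<Longrightarrow> nmem \<tau> y = nmem \<sigma> y"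
      and fc: "\<And>y. y \<notin> cwr comp_D_step \<Longrightarrow> cmem \<tau> y = cmem \<sigma> y"
    have vt: "nmem \<tau> ''alpha'' 0 = \<alpha>" "cmem \<tau> ''b'' 0 = of_real b" "cmem \<tau> ''rho'' 0 = of_real \<rho>"
        "cmem \<tau> ''sg'' 0 = of_real s" "cmem \<tau> ''Ct'' 0 = of_real (C_tilde b \<alpha>)"
      using v fn fc by simp_all
    have cv': "cmem \<tau> ''c'' 0 = of_real (C_const b (\<alpha> - k))" "cmem \<tau> ''E'' 0 = of_real (C_prime b \<alpha> (Suc \<alpha> - k))"
        "cmem \<tau> ''t'' 0 = of_real (1 / real b ^ (2 * k))" "cmem \<tau> ''Dt'' 0 = of_real (D_max b \<alpha> k)"
      using I k by auto
    have E: "C_const b (\<alpha> - k) * C_const b (\<alpha> - k) + C_prime b \<alpha> (Suc \<alpha> - k) / (real b * real b) = C_prime b \<alpha> (\<alpha> - k)"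
      using C_prime_rec[of "\<alpha> - k" \<alpha> b] k by (simp add: power2_eq_square Suc_diff_le)
    have V: "C_prime b \<alpha> (\<alpha> - k) + C_tilde b \<alpha> * (1 / real b ^ (2 * k)) = D_val b \<alpha> k"
      by (simp add: D_val_def)
    define \<tau>1 where "\<tau>1 = run (clet ''E'' (cv ''c'' \<boxtimes> cv ''c'' \<boxplus> cv ''E'' \<div> (cv ''b'' \<boxtimes> cv ''b'')) ;;
       clet ''val'' (cv ''E'' \<boxplus> cv ''Ct'' \<boxtimes> cv ''t'')) \<tau>"
    have E1: "ceval (cv ''c'' \<boxtimes> cv ''c'' \<boxplus> cv ''E'' \<div> (cv ''b'' \<boxtimes> cv ''b'')) \<tau> = of_real (C_prime b \<alpha> (\<alpha> - k))"
      unfolding E[symmetric] by (simp only: ceval.simps neval.simps cv' vt of_real_add of_real_mult of_real_divide)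
    have V1: "of_real (C_prime b \<alpha> (\<alpha> - k)) + of_real (C_tilde b \<alpha>) * of_real (1 / real b ^ (2 * k)) = complex_of_real (D_val b \<alpha> k)"
      unfolding V[symmetric] by (simp only: of_real_add of_real_mult)
    have v1: "cmem \<tau>1 ''E'' 0 = of_real (C_prime b \<alpha> (\<alpha> - k))" "cmem \<tau>1 ''val'' 0 = of_real (D_val b \<alpha> k)"
        "cmem \<tau>1 ''Dt'' 0 = of_real (D_max b \<alpha> k)" "cmem \<tau>1 ''t'' 0 = of_real (1 / real b ^ (2 * k))"
        "cmem \<tau>1 ''b'' 0 = of_real b" "cmem \<tau>1 ''c'' 0 = of_real (C_const b (\<alpha> - k))" "cmem \<tau>1 ''sg'' 0 = of_real s"
        "cmem \<tau>1 ''rho'' 0 = of_real \<rho>" "nmem \<tau>1 ''k'' 0 = k" "nmem \<tau>1 ''alpha'' 0 = \<alpha>"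
      unfolding \<tau>1_def run.simps using E1 V1 cv' vt nk by (simp_all del: of_real_divide)
    define \<tau>2 where "\<tau>2 = run (Cond (CLess (cv ''Dt'') (cv ''val'')) (clet ''Dt'' (cv ''val'')) skip) \<tau>1"
    have v2: "cmem \<tau>2 ''E'' 0 = of_real (C_prime b \<alpha> (\<alpha> - k))"
        "cmem \<tau>2 ''Dt'' 0 = of_real (D_max b \<alpha> (Suc k))" "cmem \<tau>2 ''t'' 0 = of_real (1 / real b ^ (2 * k))"
        "cmem \<tau>2 ''b'' 0 = of_real b" "cmem \<tau>2 ''c'' 0 = of_real (C_const b (\<alpha> - k))" "cmem \<tau>2 ''sg'' 0 = of_real s"
        "cmem \<tau>2 ''rho'' 0 = of_real \<rho>" "nmem \<tau>2 ''k'' 0 = k" "nmem \<tau>2 ''alpha'' 0 = \<alpha>"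
      unfolding \<tau>2_def using v1 by (auto simp: max_def)
    let ?r = "clet ''t'' (cv ''t'' \<div> (cv ''b'' \<boxtimes> cv ''b'')) ;;
       Cond (nv ''k'' \<^bold>+ Num 2 \<^bold>< nv ''alpha'')
         (clet ''c'' (cv ''c'' \<boxtimes> cv ''sg'' \<div> cv ''rho''))
         (clet ''c'' (cv ''c'' \<boxtimes> cv ''sg''))"
    have run_eq: "run comp_D_step \<tau> = run ?r \<tau>2"
      by (simp only: run.simps(4) \<tau>1_def \<tau>2_def)
    have T: "of_real (1 / real b ^ (2 * k)) / (of_real b * of_real b) = complex_of_real (1 / real b ^ (2 * Suc k))"
      by (simp add: power2_eq_square)
    have c3: "of_real (C_const b (\<alpha> - k)) * of_real s / of_real \<rho> = complex_of_real (C_const b (\<alpha> - Suc k))" if "k + 2 < \<alpha>"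
    proof -
      have "3 \<le> \<alpha> - k" using that by linarith
      from CC(4)[OF this] have "C_const b (\<alpha> - k) * s / \<rho> = C_const b (\<alpha> - Suc k)" by simp
      then show ?thesis by (simp only: of_real_mult[symmetric] of_real_divide[symmetric])
    qed
    have c2: "of_real (C_const b (\<alpha> - k)) * of_real s = complex_of_real (C_const b (\<alpha> - Suc k))" if "\<not> k + 2 < \<alpha>" "Suc k < \<alpha>"
    proof -
      have "\<alpha> - k = 2" "\<alpha> - Suc k = 1" using that by linarith+
      then show ?thesis using CC(5) by (simp only: of_real_mult[symmetric])
    qed
    have "?I (Suc k) (run comp_D_step \<tau>)"
      unfolding run_eq using v2 T c3 c2
      by (simp del: of_real_divide D_max.simps)
    moreover have "ok K comp_D_step \<tau> 110"
      by (rule ok_straight) (use K in simp_all)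
    ultimately show "ok K comp_D_step \<tau> 110 \<and> ?I (Suc k) (run comp_D_step \<tau>)" by (rule conjI[rotated])
  next
    show "?I 0 (tick (1 + ncost (nv ''alpha'')) \<sigma>)" using v by (simp add: C_prime_def)
  qed (use v K in auto)
  then show ?thesis using D_max_D_const[of \<alpha> b] \<alpha> by simp
qed

lemma comp_D_altdef:
  "comp_D = (clet ''b'' (OfN (nv ''b'')) ;;
     clet ''rho'' (OfN (Num 1) \<boxplus> OfN (Num 1) \<div> cv ''b''
                  \<boxplus> OfN (Num 1) \<div> (cv ''b'' \<boxtimes> (cv ''b'' \<boxplus> OfN (Num 1)))) ;;
     clet ''sg'' ((Root (Num 1) (Num 2 \<^bold>* nv ''b'')
                   \<boxminus> Root (Num 2 \<^bold>* nv ''b'' \<^bold>- Num 1) (Num 2 \<^bold>* nv ''b'')) \<div> Root (Num 1) (Num 4)) ;;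
     clet ''c'' (OfN (Num 1) \<div> (cv ''sg'' \<boxtimes> cv ''sg'')) ;;
     for_all ''k'' (nv ''alpha'' \<^bold>- Num 2) (clet ''c'' (cv ''c'' \<boxtimes> cv ''rho'' \<div> cv ''sg'')) ;;
     clet ''Ct'' (OfN (Num 2) \<boxtimes> cv ''c'' \<boxtimes> cv ''c'' \<boxtimes> cv ''rho'' \<boxtimes> cv ''rho'') ;;
     clet ''E'' (OfN (Num 0)) ;;
     clet ''t'' (OfN (Num 1)) ;;
     clet ''Dt'' (OfN (Num 0)) ;;
     for_all ''k'' (nv ''alpha'') comp_D_step ;;
     for_all ''k'' ((Num 2 \<^bold>* nv ''d'' \<^bold>- Num 1) \<^bold>* nv ''alpha'')
      (clet ''Dt'' (cv ''Dt'' \<boxtimes> cv ''b'')))"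
  by (simp add: comp_D_def)

text \<open>The machine offers roots of unity only; the sine is the difference of two conjugate ones
  of order \<open>2 * b\<close>, divided by the imaginary unit, itself a fourth root.\<close>

lemma sin_root:
  assumes "2 \<le> b"
  shows "(cis (2 * pi * real 1 / real (2 * b)) - cis (2 * pi * real (2 * b - 1) / real (2 * b))) / cis (2 * pi * real 1 / real 4)
    = of_real (2 * sin (pi / real b))"
proof -
  have "2 * pi * real 1 / real (2 * b) = pi / real b" by simp
  moreover have "cis (2 * pi * real (2 * b - 1) / real (2 * b)) = cis (- (pi / real b))"
  proof -
    have "2 * pi * real (2 * b - 1) / real (2 * b) = 2 * pi + - (pi / real b)"
      using assms by (simp add: of_nat_diff field_simps)
    then show ?thesis by (simp only: cis_mult[symmetric] cis_2pi mult_1_left)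
  qed
  moreover have "2 * pi * real 1 / real 4 = pi / 2" by simp
  ultimately have "(cis (2 * pi * real 1 / real (2 * b)) - cis (2 * pi * real (2 * b - 1) / real (2 * b))) / cis (2 * pi * real 1 / real 4)
      = (cis (pi / real b) - cis (- (pi / real b))) / \<i>" by (simp only: cis_pi_half)
  also have "cis (pi / real b) - cis (- (pi / real b)) = of_real (2 * sin (pi / real b)) * \<i>"
    by (simp add: complex_eq_iff)
  also have "of_real (2 * sin (pi / real b)) * \<i> / \<i> = complex_of_real (2 * sin (pi / real b))"
    by (rule nonzero_mult_div_cancel_right) simp
  finally show ?thesis .
qed

lemma run_comp_D:
  fixes \<sigma> :: state
  assumes b: "2 \<le> b" and \<alpha>: "2 \<le> \<alpha>" and K: "0 < K"
    and v: "nmem \<sigma> ''b'' 0 = b" "nmem \<sigma> ''alpha'' 0 = \<alpha>" "nmem \<sigma> ''d'' 0 = d"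
  shows "cmem (run comp_D \<sigma>) ''Dt'' 0 = of_real (D_tilde b \<alpha> d)" "cmem (run comp_D \<sigma>) ''b'' 0 = of_real (real b)"
    "ok K comp_D \<sigma> (300 + 150 * \<alpha> + 10 * ((2 * d - 1) * \<alpha>))"
proof -
  let ?A = "clet ''b'' (OfN (nv ''b'')) ;;
     clet ''rho'' (OfN (Num 1) \<boxplus> OfN (Num 1) \<div> cv ''b''
                  \<boxplus> OfN (Num 1) \<div> (cv ''b'' \<boxtimes> (cv ''b'' \<boxplus> OfN (Num 1)))) ;;
     clet ''sg'' ((Root (Num 1) (Num 2 \<^bold>* nv ''b'')
                   \<boxminus> Root (Num 2 \<^bold>* nv ''b'' \<^bold>- Num 1) (Num 2 \<^bold>* nv ''b'')) \<div> Root (Num 1) (Num 4)) ;;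
     clet ''c'' (OfN (Num 1) \<div> (cv ''sg'' \<boxtimes> cv ''sg''))"
    and ?B = "for_all ''k'' (nv ''alpha'' \<^bold>- Num 2) (clet ''c'' (cv ''c'' \<boxtimes> cv ''rho'' \<div> cv ''sg''))"
    and ?C = "clet ''Ct'' (OfN (Num 2) \<boxtimes> cv ''c'' \<boxtimes> cv ''c'' \<boxtimes> cv ''rho'' \<boxtimes> cv ''rho'') ;;
     clet ''E'' (OfN (Num 0)) ;; clet ''t'' (OfN (Num 1)) ;; clet ''Dt'' (OfN (Num 0))"
    and ?D = "for_all ''k'' (nv ''alpha'') comp_D_step"
    and ?E = "for_all ''k'' ((Num 2 \<^bold>* nv ''d'' \<^bold>- Num 1) \<^bold>* nv ''alpha'') (clet ''Dt'' (cv ''Dt'' \<boxtimes> cv ''b''))"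
  define s \<rho> where "s = 2 * sin (pi / b)" and "\<rho> = 1 + 1 / real b + 1 / (real b * (real b + 1))"
  note CC = C_const_step[OF b, folded s_def \<rho>_def]
  define \<sigma>1 where "\<sigma>1 = run ?A \<sigma>"
  define \<sigma>2 where "\<sigma>2 = run ?B \<sigma>1"
  define \<sigma>3 where "\<sigma>3 = run ?C \<sigma>2"
  define \<sigma>4 where "\<sigma>4 = run ?D \<sigma>3"
  have v1: "cmem \<sigma>1 ''b'' 0 = of_real (real b)" "cmem \<sigma>1 ''rho'' 0 = of_real \<rho>" "cmem \<sigma>1 ''sg'' 0 = of_real s"
      "cmem \<sigma>1 ''c'' 0 = of_real (1 / (s * s))" "nmem \<sigma>1 = nmem \<sigma>"
  proof -
    show sg: "cmem \<sigma>1 ''sg'' 0 = of_real s"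
      using sin_root[OF b, folded s_def] v(1) by (simp add: \<sigma>1_def)
    have "cmem \<sigma>1 ''c'' 0 = 1 / (cmem \<sigma>1 ''sg'' 0 * cmem \<sigma>1 ''sg'' 0)" by (simp add: \<sigma>1_def)
    then show "cmem \<sigma>1 ''c'' 0 = of_real (1 / (s * s))" by (simp only: sg of_real_mult of_real_divide of_real_1)
  qed (use v(1) in \<open>simp_all add: \<sigma>1_def \<rho>_def add.commute\<close>)
  have L2: "cmem \<sigma>2 ''c'' 0 = cmem \<sigma>1 ''c'' 0 * (of_real (\<rho> / s)) ^ (\<alpha> - 2)
      \<and> ok K ?B \<sigma>1 (1 + ncost (nv ''alpha'' \<^bold>- Num 2) + (\<alpha> - 2) * (4 + ccost (cv ''c'' \<boxtimes> cv ''rho'' \<div> cv ''sg'')))"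
    unfolding \<sigma>2_def by (rule run_cpower_loop) (use v v1 K in auto)
  have c2: "cmem \<sigma>2 ''c'' 0 = of_real (C_const b \<alpha>)"
  proof -
    have "1 / (s * s) * (\<rho> / s) ^ (\<alpha> - 2) = C_const b \<alpha>"
    proof -
      have "\<alpha> = Suc (Suc (\<alpha> - 2))" using \<alpha> by simp
      then have "s ^ \<alpha> = s * s * s ^ (\<alpha> - 2)" by (metis power_Suc mult.assoc)
      then show ?thesis unfolding CC(3)[OF \<alpha>] by (simp add: power_divide)
    qed
    then show ?thesis using L2 v1(4) by (simp only: of_real_mult[symmetric] of_real_power[symmetric])
  qed
  have f2: "cmem \<sigma>2 y = cmem \<sigma>1 y" if "y \<noteq> ''c''" for y unfolding \<sigma>2_def by (rule cmem_run) (use that in auto)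
  have n2: "nmem \<sigma>2 y = nmem \<sigma> y" if "y \<noteq> ''k''" for y
    using that nmem_run[of y ?B \<sigma>1] v1(5) by (simp only: \<sigma>2_def) simp
  \<comment> \<open>The square of \<open>C_const b \<alpha>\<close> contains \<rho> to the power
    \<open>2 * \<alpha> - 4\<close>; two further factors complete
    \<open>2 * \<alpha> - 2\<close>.\<close>
  have Ct: "2 * C_const b \<alpha> * C_const b \<alpha> * \<rho> * \<rho> = C_tilde b \<alpha>"
  proof -
    define k where "k = \<alpha> - 2"
    have k: "\<alpha> = Suc (Suc k)" using \<alpha> by (simp add: k_def)
    have *: "2 * \<alpha> - 2 = k + k + 2" "2 * \<alpha> = \<alpha> + \<alpha>" by (simp_all add: k)
    have "2 * (\<rho> ^ k / s ^ \<alpha>) * (\<rho> ^ k / s ^ \<alpha>) * \<rho> * \<rho> = 2 * (\<rho> ^ k * \<rho> ^ k * (\<rho> * \<rho>)) / (s ^ \<alpha> * s ^ \<alpha>)" by simp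
    then show ?thesis unfolding CC(3)[OF \<alpha>] CC(6) *(1) unfolding *(2) power_add power2_eq_square k_def[symmetric] .
  qed
  have v3: "cmem \<sigma>3 ''b'' 0 = of_real (real b)" "cmem \<sigma>3 ''rho'' 0 = of_real \<rho>" "cmem \<sigma>3 ''sg'' 0 = of_real s"
      "cmem \<sigma>3 ''c'' 0 = of_real (C_const b \<alpha>)" "cmem \<sigma>3 ''E'' 0 = 0" "cmem \<sigma>3 ''t'' 0 = 1" "cmem \<sigma>3 ''Dt'' 0 = 0"
      "nmem \<sigma>3 = nmem \<sigma>2"
    using v1 c2 f2 by (simp_all add: \<sigma>3_def)
  have Ct3: "cmem \<sigma>3 ''Ct'' 0 = of_real (C_tilde b \<alpha>)"
    unfolding Ct[symmetric] using v1 c2 f2 by (simp add: \<sigma>3_def)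
  have L4: "cmem \<sigma>4 ''Dt'' 0 = of_real (D_const b \<alpha>) \<and> ok K ?D \<sigma>3 (5 + 120 * \<alpha>)"
    unfolding \<sigma>4_def by (rule run_comp_D_loop[OF b \<alpha> K]) (use v v3 Ct3 n2 in \<open>simp_all add: s_def \<rho>_def\<close>)
  have f4: "cmem \<sigma>4 ''b'' = cmem \<sigma>3 ''b''" unfolding \<sigma>4_def by (rule cmem_run) auto
  have n4: "nmem \<sigma>4 y = nmem \<sigma> y" if "y \<notin> {''k'', ''tmp''}" for y
  proof -
    have "nmem \<sigma>4 y = nmem \<sigma>3 y" unfolding \<sigma>4_def by (rule nmem_run) (use that in auto)
    then show ?thesis using v3(8) n2[of y] that by simp
  qed
  let ?n = "(2 * d - 1) * \<alpha>"
  have L5: "cmem (run ?E \<sigma>4) ''Dt'' 0 = cmem \<sigma>4 ''Dt'' 0 * of_real (real b) ^ ?n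
      \<and> ok K ?E \<sigma>4 (1 + ncost ((Num 2 \<^bold>* nv ''d'' \<^bold>- Num 1) \<^bold>* nv ''alpha'') + ?n * (4 + ccost (cv ''Dt'' \<boxtimes> cv ''b'')))"
    by (rule run_cpower_loop) (use v n4 v3 f4 K in auto)
  have run_eq: "run comp_D \<sigma> = run ?E \<sigma>4"
    by (simp only: comp_D_altdef run.simps(4) \<sigma>1_def \<sigma>2_def \<sigma>3_def \<sigma>4_def)
  show "cmem (run comp_D \<sigma>) ''Dt'' 0 = of_real (D_tilde b \<alpha> d)"
    unfolding run_eq using L5 L4 by (simp add: D_tilde_def mult.commute)
  have "cmem (run ?E \<sigma>4) ''b'' = cmem \<sigma>4 ''b''" by (rule cmem_run) simp
  then show "cmem (run comp_D \<sigma>) ''b'' 0 = of_real (real b)"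
    unfolding run_eq using f4 v3 by simp
  have oA: "ok K ?A \<sigma> 100" by (rule ok_straight) (use K in simp_all)
  have oC: "ok K ?C \<sigma>2 100" by (rule ok_straight) (use K in simp_all)
  \<comment> \<open>The judgement depends only on the final state and the names written, both
    insensitive to the bracketing of sequential composition.\<close>
  have assoc: "ok K comp_D \<sigma> t" if "ok K (?A ;; ?B ;; ?C ;; ?D ;; ?E) \<sigma> t" for t
    using that unfolding comp_D_altdef ok_def by (simp only: run.simps(4) nwr.simps cwr.simps Un_assoc)
  have "ok K (?A ;; ?B ;; ?C ;; ?D ;; ?E) \<sigma> (100 + ((1 + ncost (nv ''alpha'' \<^bold>- Num 2) + (\<alpha> - 2) * (4 + ccost (cv ''c'' \<boxtimes> cv ''rho'' \<div> cv ''sg'')))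
      + (100 + ((5 + 120 * \<alpha>) + (1 + ncost ((Num 2 \<^bold>* nv ''d'' \<^bold>- Num 1) \<^bold>* nv ''alpha'') + ?n * (4 + ccost (cv ''Dt'' \<boxtimes> cv ''b'')))))))"
    by (intro ok_Seq oA) (use L2 oC L4 L5 in \<open>simp_all only: \<sigma>1_def \<sigma>2_def \<sigma>3_def \<sigma>4_def\<close>)
  moreover have "(\<alpha> - 2) * 12 \<le> 12 * \<alpha>" by simp
  ultimately show "ok K comp_D \<sigma> (300 + 150 * \<alpha> + 10 * ((2 * d - 1) * \<alpha>))"
    by (intro assoc, elim ok_mono) simp
qed

lemma writes_comp_D: "nwr comp_D = {''k'', ''tmp''}"
  "cwr comp_D = {''b'', ''rho'', ''sg'', ''c'', ''Ct'', ''E'', ''t'', ''Dt'', ''val''}" "silent comp_D"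
  by (auto simp: comp_D_def)

section \<open>Tables of the values of \<chi> and of degrees\<close>

context machine
begin

lemma m_le_N: "m \<le> N"
proof -
  have "m < 2 ^ m" by simp
  also have "(2::nat) ^ m \<le> N" unfolding N using b2 by (intro power_mono) auto
  finally show ?thesis by simp
qed

abbreviation "chi_loop \<equiv> for_all ''k'' (nv ''m'')
      (clet ''t'' (cv ''t'' \<div> cv ''B1'') ;;
       CSet ''chi'' (nv ''k'' \<^bold>+ Num 1)
        ((cv ''b'' \<boxminus> OfN (Num 1) \<boxminus> cv ''t'' \<boxtimes> (cv ''B2'' \<boxminus> OfN (Num 1))) \<div> cv ''den''))"

lemma run_chi_loop:
  fixes \<sigma> :: state and \<alpha> d :: nat
  assumes v: "nmem \<sigma> ''m'' 0 = m" "cmem \<sigma> ''b'' 0 = of_real (real b)"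
    "cmem \<sigma> ''B2'' 0 = of_real (real b ^ (2 * min \<alpha> d))" "cmem \<sigma> ''B1'' 0 = of_real (real b ^ (2 * min \<alpha> d - 1))"
    "cmem \<sigma> ''den'' 0 = of_real (real b ^ \<alpha> * (real b ^ (2 * min \<alpha> d) - real b))" "cmem \<sigma> ''t'' 0 = 1"
  shows "(cmem (run chi_loop \<sigma>) ''t'' 0 = of_real ((1 / real b ^ (2 * min \<alpha> d - 1)) ^ m)
      \<and> (\<forall>k\<in>{1..m}. cmem (run chi_loop \<sigma>) ''chi'' k = of_real (chiL b \<alpha> d k)))
    \<and> ok K chi_loop \<sigma> (5 + 40 * m)"
proof (rule for_all_const[where I = "\<lambda>i \<tau>. cmem \<tau> ''t'' 0 = of_real ((1 / real b ^ (2 * min \<alpha> d - 1)) ^ i)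
      \<and> (\<forall>k\<in>{1..i}. cmem \<tau> ''chi'' k = of_real (chiL b \<alpha> d k))" and t = 38])
  fix i and \<tau> :: state
  let ?b1 = "clet ''t'' (cv ''t'' \<div> cv ''B1'')"
    and ?e = "(cv ''b'' \<boxminus> OfN (Num 1) \<boxminus> cv ''t'' \<boxtimes> (cv ''B2'' \<boxminus> OfN (Num 1))) \<div> cv ''den''"
  let ?b = "?b1 ;; CSet ''chi'' (nv ''k'' \<^bold>+ Num 1) ?e"
  assume i: "i < m" and I: "cmem \<tau> ''t'' 0 = of_real ((1 / real b ^ (2 * min \<alpha> d - 1)) ^ i)
      \<and> (\<forall>k\<in>{1..i}. cmem \<tau> ''chi'' k = of_real (chiL b \<alpha> d k))" and nk: "nmem \<tau> ''k'' 0 = i"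
    and fc: "\<And>y. y \<notin> cwr ?b \<Longrightarrow> cmem \<tau> y = cmem \<sigma> y"
  have vt: "cmem \<tau> ''b'' 0 = of_real (real b)"
    "cmem \<tau> ''B2'' 0 = of_real (real b ^ (2 * min \<alpha> d))" "cmem \<tau> ''B1'' 0 = of_real (real b ^ (2 * min \<alpha> d - 1))"
    "cmem \<tau> ''den'' 0 = of_real (real b ^ \<alpha> * (real b ^ (2 * min \<alpha> d) - real b))"
    using v fc by simp_all
  define u where "u = (1 / real b ^ (2 * min \<alpha> d - 1)) ^ Suc i"
  define \<tau>1 where "\<tau>1 = run ?b1 \<tau>"
  have t1: "cmem \<tau>1 ''t'' 0 = of_real u"
  proof -
    have "cmem \<tau>1 ''t'' 0 = cmem \<tau> ''t'' 0 / cmem \<tau> ''B1'' 0" by (simp add: \<tau>1_def)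
    also have "\<dots> = of_real ((1 / real b ^ (2 * min \<alpha> d - 1)) ^ i / real b ^ (2 * min \<alpha> d - 1))"
      using I vt(3) by (simp only: of_real_divide)
    also have "(1 / real b ^ (2 * min \<alpha> d - 1)) ^ i / real b ^ (2 * min \<alpha> d - 1) = u" by (simp add: u_def)
    finally show ?thesis .
  qed
  have f1: "cmem \<tau>1 y = cmem \<tau> y" if "y \<noteq> ''t''" for y using that by (simp add: \<tau>1_def)
  have "ceval ?e \<tau>1 = of_real ((real b - 1 - u * (real b ^ (2 * min \<alpha> d) - 1)) / (real b ^ \<alpha> * (real b ^ (2 * min \<alpha> d) - real b)))"
    using t1 f1 vt by (simp del: of_real_mult of_real_power) (simp add: u_def)
  also have "(real b - 1 - u * (real b ^ (2 * min \<alpha> d) - 1)) / (real b ^ \<alpha> * (real b ^ (2 * min \<alpha> d) - real b)) = chiL b \<alpha> d (Suc i)"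
    by (simp only: chiL_def u_def)
  finally have e: "ceval ?e \<tau>1 = of_real (chiL b \<alpha> d (Suc i))" .
  have "run ?b \<tau> = run (CSet ''chi'' (nv ''k'' \<^bold>+ Num 1) ?e) \<tau>1" by (simp only: run.simps(4) \<tau>1_def)
  moreover have "nmem \<tau>1 ''k'' 0 = i" using nk by (simp add: \<tau>1_def)
  ultimately have c: "cmem (run ?b \<tau>) ''chi'' = (cmem \<tau> ''chi'')(Suc i := of_real (chiL b \<alpha> d (Suc i)))"
    "cmem (run ?b \<tau>) ''t'' 0 = of_real u"
    using e t1 f1[of "''chi''"] by (simp_all del: ceval.simps)
  have "Suc i < K" using i m_le_N K_bounds(4) N_bounds(1) by linarith
  then have "ok K ?b \<tau> 38" by (intro ok_straight) (use nk K_bounds in auto)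
  moreover have "\<forall>k\<in>{1..Suc i}. cmem (run ?b \<tau>) ''chi'' k = of_real (chiL b \<alpha> d k)"
    using I c(1) by (auto simp: le_Suc_eq simp del: run.simps)
  ultimately show "ok K ?b \<tau> 38 \<and> cmem (run ?b \<tau>) ''t'' 0 = of_real ((1 / real b ^ (2 * min \<alpha> d - 1)) ^ Suc i)
      \<and> (\<forall>k\<in>{1..Suc i}. cmem (run ?b \<tau>) ''chi'' k = of_real (chiL b \<alpha> d k))"
    using c(2) unfolding u_def by (intro conjI)
qed (use v K_bounds in auto)

abbreviation "deg_loop \<equiv> for_all ''i'' (nv ''N'')
      (Cond (nv ''i'' \<^bold>< nv ''b'')
        (NSet ''Deg'' (nv ''i'') (Num 0))
        (NSet ''Deg'' (nv ''i'') (NCell ''Deg'' (nv ''i'' \<^bold>/ nv ''b'') \<^bold>+ Num 1)))"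

lemma run_deg_loop:
  fixes \<sigma> :: state
  assumes v: "nmem \<sigma> ''N'' 0 = N" "nmem \<sigma> ''b'' 0 = b"
  shows "(\<forall>i<N. nmem (run deg_loop \<sigma>) ''Deg'' i = Polynomial.degree (np i)) \<and> ok K deg_loop \<sigma> (5 + 40 * N)"
proof (rule for_all_const[where I = "\<lambda>i \<tau>. \<forall>j<i. nmem \<tau> ''Deg'' j = Polynomial.degree (np j)" and t = 36])
  fix i and \<tau> :: state
  let ?b = "Cond (nv ''i'' \<^bold>< nv ''b'')
        (NSet ''Deg'' (nv ''i'') (Num 0))
        (NSet ''Deg'' (nv ''i'') (NCell ''Deg'' (nv ''i'' \<^bold>/ nv ''b'') \<^bold>+ Num 1))"
  assume i: "i < N" and I: "\<forall>j<i. nmem \<tau> ''Deg'' j = Polynomial.degree (np j)" and ni: "nmem \<tau> ''i'' 0 = i"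
    and fn: "\<And>y. y \<notin> nwr deg_loop \<Longrightarrow> nmem \<tau> y = nmem \<sigma> y"
  have vb: "nmem \<tau> ''b'' 0 = b" using v fn by simp
  have "nmem (run ?b \<tau>) ''Deg'' = (nmem \<tau> ''Deg'')(i := Polynomial.degree (np i))"
  proof (cases "i < b")
    case True
    then show ?thesis using vb ni degree_nat_poly[of i, where 'b = 'b] by (simp add: b)
  next
    case False
    then have "i div b < i" using b2 by simp
    then have "nmem \<tau> ''Deg'' (i div b) = Polynomial.degree (np (i div b))" using I by blast
    then show ?thesis using False vb ni degree_nat_poly[of i, where 'b = 'b] by (simp add: b)
  qed
  moreover have "ok K ?b \<tau> 36" by (rule ok_straight) (use i ni vb K_bounds in auto)
  ultimately show "ok K ?b \<tau> 36 \<and> (\<forall>j<Suc i. nmem (run ?b \<tau>) ''Deg'' j = Polynomial.degree (np j))"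
    using I by (auto simp: less_Suc_eq simp del: run.simps)
qed (use v K_bounds in auto)

end

lemma writes_comp_omega: "nwr comp_omega = {''mn'', ''k'', ''i'', ''Deg''}"
  "cwr comp_omega = {''B2'', ''B1'', ''den'', ''t'', ''chi'', ''om''}" "silent comp_omega"
  by (auto simp: comp_omega_def)

context machine_mod
begin

definition omega :: "nat \<Rightarrow> nat \<Rightarrow> 'b mod_ring poly \<Rightarrow> nat \<Rightarrow> real" where
  "omega \<alpha> d g i = chi b \<alpha> d (v_quot m (g ^ i mod P) P)"

lemma run_comp_omega:
  fixes \<sigma> :: state and \<alpha> d :: nat
  assumes t: "tables \<sigma>" and v: "nmem \<sigma> ''alpha'' 0 = \<alpha>" "nmem \<sigma> ''d'' 0 = d" "cmem \<sigma> ''b'' 0 = of_real (real b)"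
    and mn: "1 \<le> \<alpha>" "1 \<le> d" and g: "g \<in> R_set m" and G: "\<forall>i<M. nmem \<sigma> ''G'' i = enc (g ^ i mod P)"
  shows "(\<forall>i<M. cmem (run comp_omega \<sigma>) ''om'' i = of_real (omega \<alpha> d g i))
    \<and> ok K comp_omega \<sigma> (200 + 40 * \<alpha> + 200 * N)"
proof -
  let ?c1 = "Cond (nv ''alpha'' \<^bold>< nv ''d'') (nlet ''mn'' (nv ''alpha'')) (nlet ''mn'' (nv ''d''))"
    and ?c2 = "clet ''B2'' (OfN (Num 1))"
    and ?c3 = "for_all ''k'' (Num 2 \<^bold>* nv ''mn'') (clet ''B2'' (cv ''B2'' \<boxtimes> cv ''b''))"
    and ?c4 = "clet ''B1'' (cv ''B2'' \<div> cv ''b'')"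
    and ?c5 = "clet ''den'' (cv ''B2'' \<boxminus> cv ''b'')"
    and ?c6 = "for_all ''k'' (nv ''alpha'') (clet ''den'' (cv ''den'' \<boxtimes> cv ''b''))"
    and ?c7 = "clet ''t'' (OfN (Num 1))" and ?c8 = chi_loop and ?c9 = deg_loop
    and ?c10 = "for_all ''i'' (nv ''M'')
      (CSet ''om'' (nv ''i'') (CCell ''chi'' (nv ''m'' \<^bold>- NCell ''Deg'' (NCell ''G'' (nv ''i'')))))"
  define \<sigma>1 where "\<sigma>1 = run ?c1 \<sigma>"
  define \<sigma>2 where "\<sigma>2 = run ?c2 \<sigma>1"
  define \<sigma>3 where "\<sigma>3 = run ?c3 \<sigma>2"
  define \<sigma>4 where "\<sigma>4 = run ?c4 \<sigma>3"
  define \<sigma>5 where "\<sigma>5 = run ?c5 \<sigma>4"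
  define \<sigma>6 where "\<sigma>6 = run ?c6 \<sigma>5"
  define \<sigma>7 where "\<sigma>7 = run ?c7 \<sigma>6"
  define \<sigma>8 where "\<sigma>8 = run ?c8 \<sigma>7"
  define \<sigma>9 where "\<sigma>9 = run ?c9 \<sigma>8"
  define \<sigma>10 where "\<sigma>10 = run ?c10 \<sigma>9"
  define \<mu> where "\<mu> = min \<alpha> d"
  have mu: "1 \<le> \<mu>" "\<mu> \<le> \<alpha>" using mn by (simp_all add: \<mu>_def)
  have v2: "nmem \<sigma>2 ''mn'' 0 = \<mu>" "cmem \<sigma>2 ''B2'' 0 = 1" "cmem \<sigma>2 ''b'' 0 = of_real (real b)"
    "\<And>y. y \<noteq> ''mn'' \<Longrightarrow> nmem \<sigma>2 y = nmem \<sigma> y"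
    using v by (auto simp: \<sigma>2_def \<sigma>1_def \<mu>_def)
  have L3: "cmem \<sigma>3 ''B2'' 0 = cmem \<sigma>2 ''B2'' 0 * of_real (real b) ^ (2 * \<mu>)
      \<and> ok K ?c3 \<sigma>2 (1 + ncost (Num 2 \<^bold>* nv ''mn'') + 2 * \<mu> * (4 + ccost (cv ''B2'' \<boxtimes> cv ''b'')))"
    unfolding \<sigma>3_def by (rule run_cpower_loop) (use v2 K_bounds in auto)
  have B3: "cmem \<sigma>3 ''B2'' 0 = of_real (real b ^ (2 * \<mu>))" using L3 v2 by simp
  have b3: "cmem \<sigma>3 ''b'' = cmem \<sigma>2 ''b''" unfolding \<sigma>3_def by (rule cmem_run) simp
  have n3: "nmem \<sigma>3 y = nmem \<sigma> y" if "y \<notin> {''mn'', ''k''}" for y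
  proof -
    have "nmem \<sigma>3 y = nmem \<sigma>2 y" unfolding \<sigma>3_def by (rule nmem_run) (use that in auto)
    then show ?thesis using v2(4)[of y] that by simp
  qed
  have c5: "nmem \<sigma>5 = nmem \<sigma>3" "cmem \<sigma>5 ''b'' 0 = of_real (real b)" "cmem \<sigma>5 ''B2'' 0 = of_real (real b ^ (2 * \<mu>))"
    "cmem \<sigma>5 ''den'' 0 = of_real (real b ^ (2 * \<mu>) - real b)"
    using B3 b3 v2(3) by (simp_all add: \<sigma>5_def \<sigma>4_def)
  have B1: "cmem \<sigma>5 ''B1'' 0 = of_real (real b ^ (2 * \<mu> - 1))"
  proof -
    have "cmem \<sigma>5 ''B1'' 0 = of_real (real b ^ (2 * \<mu>) / real b)"
      using B3 b3 v2(3) by (simp add: \<sigma>5_def \<sigma>4_def)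
    also have "real b ^ (2 * \<mu>) / real b = real b ^ (2 * \<mu> - 1)"
      using mu b_pos by (simp add: power_diff)
    finally show ?thesis .
  qed
  have L6: "cmem \<sigma>6 ''den'' 0 = cmem \<sigma>5 ''den'' 0 * of_real (real b) ^ \<alpha>
      \<and> ok K ?c6 \<sigma>5 (1 + ncost (nv ''alpha'') + \<alpha> * (4 + ccost (cv ''den'' \<boxtimes> cv ''b'')))"
    unfolding \<sigma>6_def by (rule run_cpower_loop) (use v c5 n3 K_bounds in auto)
  have den6: "cmem \<sigma>6 ''den'' 0 = of_real (real b ^ \<alpha> * (real b ^ (2 * \<mu>) - real b))"
    using L6 c5 by (simp add: mult.commute)
  have c6: "cmem \<sigma>6 y = cmem \<sigma>5 y" if "y \<noteq> ''den''" for y unfolding \<sigma>6_def by (rule cmem_run) (use that in auto)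
  have n6: "nmem \<sigma>6 y = nmem \<sigma> y" if "y \<notin> {''mn'', ''k''}" for y
  proof -
    have "nmem \<sigma>6 y = nmem \<sigma>5 y" unfolding \<sigma>6_def by (rule nmem_run) (use that in auto)
    then show ?thesis using n3[OF that] c5(1) by simp
  qed
  have c7: "nmem \<sigma>7 = nmem \<sigma>6" "cmem \<sigma>7 ''t'' 0 = 1" "\<And>y. y \<noteq> ''t'' \<Longrightarrow> cmem \<sigma>7 y = cmem \<sigma>6 y"
    by (simp_all add: \<sigma>7_def)
  have L8: "(cmem \<sigma>8 ''t'' 0 = of_real ((1 / real b ^ (2 * min \<alpha> d - 1)) ^ m)
      \<and> (\<forall>k\<in>{1..m}. cmem \<sigma>8 ''chi'' k = of_real (chiL b \<alpha> d k))) \<and> ok K ?c8 \<sigma>7 (5 + 40 * m)"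
    unfolding \<sigma>8_def
    by (rule run_chi_loop) (use tablesD(2)[OF t] n6 c7 c6 c5 B1 den6 in \<open>simp_all add: \<mu>_def del: of_real_mult of_real_power\<close>)
  have n8: "nmem \<sigma>8 y = nmem \<sigma> y" if "y \<notin> {''mn'', ''k''}" for y
  proof -
    have "nmem \<sigma>8 y = nmem \<sigma>7 y" unfolding \<sigma>8_def by (rule nmem_run) (use that in auto)
    then show ?thesis using n6[OF that] c7(1) by simp
  qed
  have L9: "(\<forall>i<N. nmem \<sigma>9 ''Deg'' i = Polynomial.degree (np i)) \<and> ok K ?c9 \<sigma>8 (5 + 40 * N)"
    unfolding \<sigma>9_def by (rule run_deg_loop) (use tablesD[OF t] n8 in simp_all)
  have c9: "cmem \<sigma>9 ''chi'' = cmem \<sigma>8 ''chi''" unfolding \<sigma>9_def by (rule cmem_run) simp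
  have n9: "nmem \<sigma>9 y = nmem \<sigma> y" if "y \<notin> {''mn'', ''k'', ''i'', ''Deg''}" for y
  proof -
    have "nmem \<sigma>9 y = nmem \<sigma>8 y" unfolding \<sigma>9_def by (rule nmem_run) (use that in auto)
    then show ?thesis using n8[of y] that by simp
  qed
  have MN: "M < N" using N_bounds(1) by (simp add: M)
  have L10: "(\<forall>i. cmem \<sigma>10 ''om'' i = (if i < M then of_real (omega \<alpha> d g i) else cmem \<sigma>9 ''om'' i))
      \<and> ok K ?c10 \<sigma>9 (1 + ncost (nv ''M'') + M * (5 + ccost (CCell ''chi'' (nv ''m'' \<^bold>- NCell ''Deg'' (NCell ''G'' (nv ''i''))))))"
    unfolding \<sigma>10_def
  proof (rule run_cset_loop)
    fix i and \<tau> :: state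
    assume *: "i < M" "nmem \<tau> ''i'' 0 = i" "\<And>y. y \<noteq> ''i'' \<Longrightarrow> nmem \<tau> y = nmem \<sigma>9 y" "\<And>y. y \<noteq> ''om'' \<Longrightarrow> cmem \<tau> y = cmem \<sigma>9 y"
    have h: "g ^ i mod P \<in> R_set m" by (rule Q.pow_R_set[OF g])
    have dl: "Polynomial.degree (g ^ i mod P) < m" by (rule deg_mod)
    have nd: "\<not> P dvd g ^ i mod P" by (rule Q.R_set_not_dvd[OF h])
    have "nmem \<tau> ''G'' i = enc (g ^ i mod P)" "nmem \<tau> ''m'' 0 = m"
      using G n9 *(1) *(3)[of "''G''"] *(3)[of "''m''"] tablesD(2)[OF t] by simp_all
    moreover have "nmem \<tau> ''Deg'' (enc (g ^ i mod P)) = Polynomial.degree (g ^ i mod P)"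
      using *(3)[of "''Deg''"] L9 enc_mod_less[of "g ^ i"] by simp
    moreover have "cmem \<tau> ''chi'' (m - Polynomial.degree (g ^ i mod P)) = of_real (chiL b \<alpha> d (m - Polynomial.degree (g ^ i mod P)))"
    proof -
      have "m - Polynomial.degree (g ^ i mod P) \<in> {1..m}" using dl by auto
      then show ?thesis using L8 *(4)[of "''chi''"] c9 by simp
    qed
    moreover have "chiL b \<alpha> d (m - Polynomial.degree (g ^ i mod P)) = omega \<alpha> d g i"
      unfolding omega_def using chi_v_quot[OF P_deg _ nd, of \<alpha> d] m mn by (simp add: b)
    ultimately show "ceval (CCell ''chi'' (nv ''m'' \<^bold>- NCell ''Deg'' (NCell ''G'' (nv ''i'')))) \<tau> = of_real (omega \<alpha> d g i)"
      using *(2) by simp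
  qed (use tablesD(4)[OF t] n9 MN K_bounds in auto)
  have run_eq: "run comp_omega \<sigma> = \<sigma>10"
    by (simp only: comp_omega_def run.simps(4) \<sigma>10_def \<sigma>9_def \<sigma>8_def \<sigma>7_def \<sigma>6_def \<sigma>5_def \<sigma>4_def \<sigma>3_def \<sigma>2_def \<sigma>1_def)
  have st: "ok K (clet x e) \<tau> (2 + ccost e)" for x e \<tau> using K_bounds by (intro ok_straight) simp_all
  have "ok K ?c1 \<sigma> 20" by (rule ok_straight) (use K_bounds in auto)
  then have "ok K comp_omega \<sigma> (20 + ((2 + ccost (OfN (Num 1)))
    + ((1 + ncost (Num 2 \<^bold>* nv ''mn'') + 2 * \<mu> * (4 + ccost (cv ''B2'' \<boxtimes> cv ''b'')))
    + ((2 + ccost (cv ''B2'' \<div> cv ''b'')) + ((2 + ccost (cv ''B2'' \<boxminus> cv ''b''))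
    + ((1 + ncost (nv ''alpha'') + \<alpha> * (4 + ccost (cv ''den'' \<boxtimes> cv ''b'')))
    + ((2 + ccost (OfN (Num 1))) + ((5 + 40 * m) + ((5 + 40 * N)
    + (1 + ncost (nv ''M'') + M * (5 + ccost (CCell ''chi'' (nv ''m'' \<^bold>- NCell ''Deg'' (NCell ''G'' (nv ''i'')))))))))))))))"
    unfolding comp_omega_def
    by (intro ok_Seq st) (use L3 L6 L8 L9 L10 in \<open>simp_all only: \<sigma>9_def \<sigma>8_def \<sigma>7_def \<sigma>6_def \<sigma>5_def \<sigma>4_def \<sigma>3_def \<sigma>2_def \<sigma>1_def\<close>)
  moreover note m_le_N
  ultimately have "ok K comp_omega \<sigma> (200 + 40 * \<alpha> + 200 * N)" using mu MN by (elim ok_mono) simp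
  then show ?thesis unfolding run_eq using L10 by simp
qed

end

section \<open>The circulant product\<close>

lemma dft_cong: "(\<And>k. k < n \<Longrightarrow> x k = y k) \<Longrightarrow> dft sg n x j = dft sg n y j"
  unfolding dft_def by (intro sum.cong) auto

lemma nwr_fft: "nwr (fft tw) = {''n'', ''st'', ''r'', ''half'', ''k'', ''q''}"
  "cwr (fft tw) = {''w'', ''x'', ''y'', ''Y'', ''X''}" "silent (fft tw)"
  by (auto simp: fft_def)

context machine
begin

lemma M_bounds: "0 < M" "M < N" "4 * M < K" "Suc M = N"
  using N_bounds(1) K_bounds(4) by (auto simp: M)

text \<open>The number of stages is of order \<open>b * m\<close>: the crude estimate
  \<open>b \<le> 2 ^ b\<close> turns \<open>4 * N \<le> b ^ (m + 2)\<close> into a bound on the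
  exponent of 2.\<close>

lemma log_length:
  assumes "2 ^ t < 4 * M"
  shows "t + 1 \<le> 3 * (b * m)" "2 ^ t < 4 * N"
proof -
  show *: "2 ^ t < 4 * N" using assms M_bounds(2) by linarith
  have "(2::nat) ^ t < 4 * N" using * by simp
  also have "\<dots> \<le> b * (b * N)"
    using mult_le_mono[OF b2 b2] by (simp add: mult.assoc[symmetric])
  also have "\<dots> = b ^ (m + 2)" by (simp only: b_pow_m2)
  also have "\<dots> \<le> (2 ^ b) ^ (m + 2)" by (intro power_mono) (simp_all add: less_imp_le)
  also have "\<dots> = 2 ^ (b * (m + 2))" by (simp only: power_mult)
  finally have "t < b * (m + 2)" by simp
  moreover have "b * (m + 2) \<le> b * (3 * m)" using m by (intro mult_le_mono2) simp
  ultimately show "t + 1 \<le> 3 * (b * m)" by simp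
qed

lemma fft_cost:
  assumes "2 ^ t < 4 * M"
  shows "200 * (t + 1) * 2 ^ t \<le> 2400 * (b * m * N)" "2 ^ t \<le> 4 * (b * m * N)" "N \<le> b * m * N" "1 \<le> b * m * N"
proof -
  have "(t + 1) * 2 ^ t \<le> 3 * (b * m) * (4 * N)"
    using log_length[OF assms] by (intro mult_le_mono) simp_all
  moreover have "3 * (b * m) * (4 * N) = 12 * (b * m * N)" by simp
  ultimately have "(t + 1) * 2 ^ t \<le> 12 * (b * m * N)" by linarith
  then have "200 * ((t + 1) * 2 ^ t) \<le> 200 * (12 * (b * m * N))" by (rule mult_le_mono2)
  then show "200 * (t + 1) * 2 ^ t \<le> 2400 * (b * m * N)" by linarith
  have "1 \<le> b * m" using b2 m by simp
  then show N: "N \<le> b * m * N" by simp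
  then show "2 ^ t \<le> 4 * (b * m * N)" "1 \<le> b * m * N" using log_length[OF assms] N_bounds(1) by linarith+
qed

definition padded :: "(nat \<Rightarrow> real) \<Rightarrow> nat \<Rightarrow> complex" where
  "padded y k = (if k < M then of_real (y k) else 0)"

text \<open>The lower bound \<open>2 * M\<close> on the length excludes wrapping around, the upper
  bound \<open>4 * M\<close> controls the cost.\<close>

definition fft_ready :: "(nat \<Rightarrow> real) \<Rightarrow> nat \<Rightarrow> state \<Rightarrow> bool" where
  "fft_ready y t \<tau> \<longleftrightarrow> nmem \<tau> ''Len'' 0 = 2 ^ t \<and> 2 * M \<le> 2 ^ t \<and> 2 ^ t < 4 * M
     \<and> (\<forall>i<2 ^ t. cmem \<tau> ''F'' i = dft 1 (2 ^ t) (padded y) i)"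

abbreviation "zero_X \<equiv> for_all ''i'' (nv ''Len'') (CSet ''X'' (nv ''i'') (OfN (Num 0)))"

abbreviation "length_loop \<equiv> For ''i'' (Num 2 \<^bold>* nv ''M'') (nv ''Len'' \<^bold>< Num 2 \<^bold>* nv ''M'')
      (nlet ''Len'' (Num 2 \<^bold>* nv ''Len''))"

lemma run_length_loop:
  fixes \<sigma> :: state
  assumes v: "nmem \<sigma> ''M'' 0 = M" "nmem \<sigma> ''Len'' 0 = 1"
  shows "(\<exists>t. nmem (run length_loop \<sigma>) ''Len'' 0 = 2 ^ t \<and> 2 * M \<le> 2 ^ t \<and> 2 ^ t < 4 * M)
    \<and> ok K length_loop \<sigma> (60 * N)"
proof -
  have "\<exists>A. ((\<exists>t. nmem (run length_loop \<sigma>) ''Len'' 0 = 2 ^ t \<and> 2 * M \<le> 2 ^ t \<and> 2 ^ t < 4 * M) \<and> A \<le> 20 * (2 * M) + 10)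
     \<and> ok K length_loop \<sigma> (1 + ncost (Num 2 \<^bold>* nv ''M'') + A)"
  proof (rule For_rule[where n = "2 * M" and I = "\<lambda>i A \<tau>. nmem \<tau> ''Len'' 0 = 2 ^ i \<and> 2 ^ i < 4 * M \<and> A \<le> 20 * i"
        and J = "\<lambda>A \<tau>. (\<exists>t. nmem \<tau> ''Len'' 0 = 2 ^ t \<and> 2 * M \<le> 2 ^ t \<and> 2 ^ t < 4 * M) \<and> A \<le> 20 * (2 * M) + 10"])
    fix i A and \<tau> :: state
    assume I: "nmem \<tau> ''Len'' 0 = 2 ^ i \<and> 2 ^ i < 4 * M \<and> A \<le> 20 * i"
      and fn: "\<And>y. y \<notin> nwr length_loop \<Longrightarrow> nmem \<tau> y = nmem \<sigma> y"
      and g: "beval (nv ''Len'' \<^bold>< Num 2 \<^bold>* nv ''M'') \<tau>"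
    have "nmem \<tau> ''M'' 0 = M" using v fn by simp
    with g I have "2 ^ i < 2 * M" by simp
    then show "\<exists>t. ok K (nlet ''Len'' (Num 2 \<^bold>* nv ''Len'')) \<tau> t
        \<and> nmem (run (nlet ''Len'' (Num 2 \<^bold>* nv ''Len'')) \<tau>) ''Len'' 0 = 2 ^ Suc i \<and> 2 ^ Suc i < 4 * M
        \<and> A + (1 + bcost (nv ''Len'' \<^bold>< Num 2 \<^bold>* nv ''M'') + t) \<le> 20 * Suc i"
      using I K_bounds by (intro exI[of _ 8]) (auto intro!: ok_straight)
  next
    fix i A and \<tau> :: state
    assume i: "i < 2 * M" and I: "nmem \<tau> ''Len'' 0 = 2 ^ i \<and> 2 ^ i < 4 * M \<and> A \<le> 20 * i"
      and fn: "\<And>y. y \<notin> nwr length_loop \<Longrightarrow> nmem \<tau> y = nmem \<sigma> y"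
      and g: "\<not> beval (nv ''Len'' \<^bold>< Num 2 \<^bold>* nv ''M'') \<tau>"
    have "nmem \<tau> ''M'' 0 = M" using v fn by simp
    with g I have "2 * M \<le> 2 ^ i" by simp
    then show "(\<exists>t. nmem \<tau> ''Len'' 0 = 2 ^ t \<and> 2 * M \<le> 2 ^ t \<and> 2 ^ t < 4 * M)
        \<and> A + (1 + bcost (nv ''Len'' \<^bold>< Num 2 \<^bold>* nv ''M'')) \<le> 20 * (2 * M) + 10"
      using I i by auto
  next
    fix A and \<tau> :: state
    assume "nmem \<tau> ''Len'' 0 = 2 ^ (2 * M) \<and> 2 ^ (2 * M) < 4 * M \<and> A \<le> 20 * (2 * M)"
    then show "(\<exists>t. nmem \<tau> ''Len'' 0 = 2 ^ t \<and> 2 * M \<le> 2 ^ t \<and> 2 ^ t < 4 * M) \<and> A \<le> 20 * (2 * M) + 10"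
      using less_exp[of "2 * M"] by (auto intro!: exI[of _ "2 * M"])
  qed (use v K_bounds M_bounds in auto)
  then obtain A where A: "((\<exists>t. nmem (run length_loop \<sigma>) ''Len'' 0 = 2 ^ t \<and> 2 * M \<le> 2 ^ t \<and> 2 ^ t < 4 * M)
      \<and> A \<le> 20 * (2 * M) + 10) \<and> ok K length_loop \<sigma> (1 + ncost (Num 2 \<^bold>* nv ''M'') + A)" ..
  have "1 + ncost (Num 2 \<^bold>* nv ''M'') + A \<le> 60 * N" using A M_bounds by simp
  then have "ok K length_loop \<sigma> (60 * N)" by (rule ok_mono[OF conjunct2[OF A]])
  then show ?thesis using A by (intro conjI) (rule conjunct1[OF conjunct1])
qed

lemma run_prepare_fft:
  fixes \<sigma> :: state
  assumes v: "nmem \<sigma> ''M'' 0 = M" and om: "\<forall>i<M. cmem \<sigma> ''om'' i = of_real (y i)"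
  shows "(\<exists>t. fft_ready y t (run prepare_fft \<sigma>)) \<and> ok K prepare_fft \<sigma> (3000 * (b * m * N))"
proof -
  let ?c1 = "nlet ''Len'' (Num 1)" and ?c2 = length_loop and ?c3 = zero_X
    and ?c4 = "for_all ''i'' (nv ''M'') (CSet ''X'' (nv ''i'') (CCell ''om'' (nv ''i'')))"
    and ?c5 = "forward_fft" and ?c6 = "for_all ''i'' (nv ''Len'') (CSet ''F'' (nv ''i'') (CCell ''X'' (nv ''i'')))"
  define \<sigma>1 where "\<sigma>1 = run ?c1 \<sigma>"
  define \<sigma>2 where "\<sigma>2 = run ?c2 \<sigma>1"
  define \<sigma>3 where "\<sigma>3 = run ?c3 \<sigma>2"
  define \<sigma>4 where "\<sigma>4 = run ?c4 \<sigma>3"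
  define \<sigma>5 where "\<sigma>5 = run ?c5 \<sigma>4"
  define \<sigma>6 where "\<sigma>6 = run ?c6 \<sigma>5"
  have v1: "nmem \<sigma>1 ''M'' 0 = M" "nmem \<sigma>1 ''Len'' 0 = 1" "cmem \<sigma>1 = cmem \<sigma>" using v by (simp_all add: \<sigma>1_def)
  note L2 = run_length_loop[OF v1(1,2), folded \<sigma>2_def]
  obtain t where t: "nmem \<sigma>2 ''Len'' 0 = 2 ^ t" "2 * M \<le> 2 ^ t" "2 ^ t < 4 * M" using L2 by auto
  define T W where "T = 200 * (t + 1) * 2 ^ t" and "W = b * m * N"
  have tK: "2 ^ t < K" using t M_bounds by linarith
  have v2: "nmem \<sigma>2 ''M'' = nmem \<sigma>1 ''M''" "cmem \<sigma>2 ''om'' = cmem \<sigma>1 ''om''"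
    unfolding \<sigma>2_def by (rule nmem_run cmem_run; simp)+
  have L3: "(\<forall>i. cmem \<sigma>3 ''X'' i = (if i < 2 ^ t then 0 else cmem \<sigma>2 ''X'' i))
      \<and> ok K ?c3 \<sigma>2 (1 + ncost (nv ''Len'') + 2 ^ t * (5 + ccost (OfN (Num 0))))"
    unfolding \<sigma>3_def by (rule run_cset_loop) (use t tK K_bounds in auto)
  have v3: "nmem \<sigma>3 ''M'' = nmem \<sigma>2 ''M''" "nmem \<sigma>3 ''Len'' = nmem \<sigma>2 ''Len''" "cmem \<sigma>3 ''om'' = cmem \<sigma>2 ''om''"
    unfolding \<sigma>3_def by (rule nmem_run cmem_run; simp)+
  have L4: "(\<forall>i. cmem \<sigma>4 ''X'' i = (if i < M then of_real (y i) else cmem \<sigma>3 ''X'' i))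
      \<and> ok K ?c4 \<sigma>3 (1 + ncost (nv ''M'') + M * (5 + ccost (CCell ''om'' (nv ''i''))))"
    unfolding \<sigma>4_def by (rule run_cset_loop) (use v1 v2 v3 om M_bounds in auto)
  have X4: "cmem \<sigma>4 ''X'' i = padded y i" if "i < 2 ^ t" for i
    using L3 L4 that by (simp add: padded_def)
  have v4: "nmem \<sigma>4 ''Len'' = nmem \<sigma>3 ''Len''"
    unfolding \<sigma>4_def by (rule nmem_run) simp
  have Len4: "nmem \<sigma>4 ''Len'' 0 = 2 ^ t" using v4 v3 t by simp
  have L5: "\<forall>i<2 ^ t. cmem \<sigma>5 ''X'' i = dft 1 (2 ^ t) (cmem \<sigma>4 ''X'') i" "ok K ?c5 \<sigma>4 T"
    unfolding \<sigma>5_def forward_fft_def T_def using run_fft[OF Len4 twiddle_forward _ tK] by simp_all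
  have v5: "nmem \<sigma>5 ''Len'' = nmem \<sigma>4 ''Len''"
    unfolding \<sigma>5_def forward_fft_def by (rule nmem_run) (simp add: nwr_fft)
  have L6: "(\<forall>i. cmem \<sigma>6 ''F'' i = (if i < 2 ^ t then cmem \<sigma>5 ''X'' i else cmem \<sigma>5 ''F'' i))
      \<and> ok K ?c6 \<sigma>5 (1 + ncost (nv ''Len'') + 2 ^ t * (5 + ccost (CCell ''X'' (nv ''i''))))"
    unfolding \<sigma>6_def by (rule run_cset_loop) (use Len4 v5 tK in auto)
  have v6: "nmem \<sigma>6 ''Len'' = nmem \<sigma>5 ''Len''"
    unfolding \<sigma>6_def by (rule nmem_run) simp
  have "dft 1 (2 ^ t) (cmem \<sigma>4 ''X'') i = dft 1 (2 ^ t) (padded y) i" for i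
    by (rule dft_cong) (rule X4)
  then have "fft_ready y t \<sigma>6"
    using L5(1) L6 Len4 v5 v6 t by (simp add: fft_ready_def)
  moreover have run_eq: "run prepare_fft \<sigma> = \<sigma>6"
    by (simp only: prepare_fft_def run.simps(4) \<sigma>6_def \<sigma>5_def \<sigma>4_def \<sigma>3_def \<sigma>2_def \<sigma>1_def)
  moreover have "ok K prepare_fft \<sigma> (3000 * (b * m * N))"
  proof -
    have "ok K ?c1 \<sigma> 5" by (rule ok_straight) (use K_bounds in auto)
    then have "ok K prepare_fft \<sigma> (5 + (60 * N + ((1 + ncost (nv ''Len'') + 2 ^ t * (5 + ccost (OfN (Num 0))))
       + ((1 + ncost (nv ''M'') + M * (5 + ccost (CCell ''om'' (nv ''i''))))
       + (T + (1 + ncost (nv ''Len'') + 2 ^ t * (5 + ccost (CCell ''X'' (nv ''i'')))))))))"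
      unfolding prepare_fft_def
      by (intro ok_Seq) (use L2 L3 L4 L5(2) L6 in \<open>simp_all only: \<sigma>5_def \<sigma>4_def \<sigma>3_def \<sigma>2_def \<sigma>1_def\<close>)
    moreover note fft_cost[OF t(3), folded T_def W_def] M_bounds(2)
    ultimately show ?thesis unfolding W_def[symmetric] by (elim ok_mono) simp
  qed
  ultimately show ?thesis by auto
qed

text \<open>Cyclic convolution modulo \<open>M\<close>; \<open>i + (M - a)\<close> represents
  \<open>i - a\<close> without leaving the natural numbers.\<close>

definition conv :: "(nat \<Rightarrow> real) \<Rightarrow> (nat \<Rightarrow> real) \<Rightarrow> nat \<Rightarrow> real" where
  "conv x y i = (\<Sum>a<M. x a * y ((i + (M - a)) mod M))"

abbreviation "argmin_loop \<equiv> for_all ''i'' (nv ''M'')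
      (Cond (CLess (CCell ''X'' (nv ''i'')) (CCell ''X'' (nv ''i0''))) (nlet ''i0'' (nv ''i'')) skip)"

lemma run_argmin_loop:
  fixes \<sigma> :: state
  assumes v: "nmem \<sigma> ''M'' 0 = M" "nmem \<sigma> ''i0'' 0 = 0" and X: "\<forall>i<M. cmem \<sigma> ''X'' i = of_real (x i)"
  shows "(nmem (run argmin_loop \<sigma>) ''i0'' 0 < M \<and> (\<forall>i<M. x (nmem (run argmin_loop \<sigma>) ''i0'' 0) \<le> x i))
    \<and> ok K argmin_loop \<sigma> (5 + 30 * M)"
proof (rule for_all_const[where I = "\<lambda>k \<tau>. nmem \<tau> ''i0'' 0 < M \<and> (\<forall>i<k. x (nmem \<tau> ''i0'' 0) \<le> x i)" and t = 28])
  fix k and \<tau> :: state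
  let ?b = "Cond (CLess (CCell ''X'' (nv ''i'')) (CCell ''X'' (nv ''i0''))) (nlet ''i0'' (nv ''i'')) skip"
  assume k: "k < M" and I: "nmem \<tau> ''i0'' 0 < M \<and> (\<forall>i<k. x (nmem \<tau> ''i0'' 0) \<le> x i)" and nk: "nmem \<tau> ''i'' 0 = k"
    and fc: "\<And>y. y \<notin> cwr ?b \<Longrightarrow> cmem \<tau> y = cmem \<sigma> y"
  have "cmem \<tau> ''X'' = cmem \<sigma> ''X''" using fc by simp
  then have "beval (CLess (CCell ''X'' (nv ''i'')) (CCell ''X'' (nv ''i0''))) \<tau> \<longleftrightarrow> x k < x (nmem \<tau> ''i0'' 0)"
    using X I k nk by simp
  then have "nmem (run ?b \<tau>) ''i0'' 0 = (if x k < x (nmem \<tau> ''i0'' 0) then k else nmem \<tau> ''i0'' 0)"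
    using nk by (simp del: beval.simps)
  moreover have "ok K ?b \<tau> 28" by (rule ok_straight) (use K_bounds in auto)
  ultimately show "ok K ?b \<tau> 28 \<and> nmem (run ?b \<tau>) ''i0'' 0 < M \<and> (\<forall>i<Suc k. x (nmem (run ?b \<tau>) ''i0'' 0) \<le> x i)"
    using I k by (force simp: less_Suc_eq simp del: run.simps)
qed (use v K_bounds M_bounds in auto)

lemma nwr_choose_next: "nwr choose_next = {''i'', ''n'', ''st'', ''r'', ''half'', ''k'', ''q'', ''i0'', ''tmp''}"
  "cwr choose_next = {''X'', ''w'', ''x'', ''y'', ''Y''}" "silent choose_next"
  by (auto simp: choose_next_def forward_fft_def inverse_fft_def nwr_fft)

lemma run_choose_next:
  fixes \<sigma> :: state
  assumes v: "nmem \<sigma> ''M'' 0 = M" and F: "fft_ready y t \<sigma>"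
    and e: "\<forall>i<M. cmem \<sigma> ''eta1'' i * cmem \<sigma> ''eta2'' i = of_real (x i)"
  defines "i0 \<equiv> nmem (run choose_next \<sigma>) ''i0'' 0"
  shows "i0 < M" "\<forall>i<M. conv x y i0 \<le> conv x y i" "ok K choose_next \<sigma> (6000 * (b * m * N))"
proof -
  let ?c1 = zero_X
    and ?c2 = "for_all ''i'' (nv ''M'') (CSet ''X'' (nv ''i'') (CCell ''eta1'' (nv ''i'') \<boxtimes> CCell ''eta2'' (nv ''i'')))"
    and ?c3 = forward_fft
    and ?c4 = "for_all ''i'' (nv ''Len'') (CSet ''X'' (nv ''i'') (CCell ''X'' (nv ''i'') \<boxtimes> CCell ''F'' (nv ''i'')))"
    and ?c5 = "fft (Root (nv ''n'' \<^bold>- nv ''k'') (nv ''n''))"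
    and ?c6 = "for_all ''q'' (nv ''Len'') (CSet ''X'' (nv ''q'') (CCell ''X'' (nv ''q'') \<div> OfN (nv ''Len'')))"
    and ?c7 = "for_all ''i'' (nv ''M'') (CSet ''X'' (nv ''i'') (CCell ''X'' (nv ''i'') \<boxplus> CCell ''X'' (nv ''i'' \<^bold>+ nv ''M'')))"
    and ?c8 = "nlet ''i0'' (Num 0)" and ?c9 = argmin_loop
  define T W where "T = 200 * (t + 1) * 2 ^ t" and "W = b * m * N"
  define \<sigma>1 where "\<sigma>1 = run ?c1 \<sigma>"
  define \<sigma>2 where "\<sigma>2 = run ?c2 \<sigma>1"
  define \<sigma>3 where "\<sigma>3 = run ?c3 \<sigma>2"
  define \<sigma>4 where "\<sigma>4 = run ?c4 \<sigma>3"
  define \<sigma>5 where "\<sigma>5 = run ?c5 \<sigma>4"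
  define \<sigma>6 where "\<sigma>6 = run ?c6 \<sigma>5"
  define \<sigma>7 where "\<sigma>7 = run ?c7 \<sigma>6"
  define \<sigma>8 where "\<sigma>8 = run ?c8 \<sigma>7"
  define \<sigma>9 where "\<sigma>9 = run ?c9 \<sigma>8"
  have t: "nmem \<sigma> ''Len'' 0 = 2 ^ t" "2 * M \<le> 2 ^ t" "2 ^ t < 4 * M"
    and F': "\<And>i. i < 2 ^ t \<Longrightarrow> cmem \<sigma> ''F'' i = dft 1 (2 ^ t) (padded y) i"
    using F by (auto simp: fft_ready_def)
  have tK: "2 ^ t < K" using t M_bounds by linarith
  let ?fix = "\<lambda>\<tau>::state. nmem \<tau> ''M'' = nmem \<sigma> ''M'' \<and> nmem \<tau> ''Len'' = nmem \<sigma> ''Len'' \<and> cmem \<tau> ''F'' = cmem \<sigma> ''F''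
     \<and> cmem \<tau> ''eta1'' = cmem \<sigma> ''eta1'' \<and> cmem \<tau> ''eta2'' = cmem \<sigma> ''eta2''"
  have step: "?fix (run c \<tau>)" if "?fix \<tau>" "{''M'', ''Len''} \<inter> nwr c = {}" "{''F'', ''eta1'', ''eta2''} \<inter> cwr c = {}" for c \<tau>
    using that by (auto simp: nmem_run cmem_run)
  have f1: "?fix \<sigma>1" unfolding \<sigma>1_def by (rule step) auto
  have f2: "?fix \<sigma>2" unfolding \<sigma>2_def by (rule step[OF f1]) auto
  have f3: "?fix \<sigma>3" unfolding \<sigma>3_def by (rule step[OF f2]) (auto simp: forward_fft_def nwr_fft)
  have f4: "?fix \<sigma>4" unfolding \<sigma>4_def by (rule step[OF f3]) auto
  have f5: "?fix \<sigma>5" unfolding \<sigma>5_def by (rule step[OF f4]) (auto simp: nwr_fft)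
  have f6: "?fix \<sigma>6" unfolding \<sigma>6_def by (rule step[OF f5]) auto
  have f7: "?fix \<sigma>7" unfolding \<sigma>7_def by (rule step[OF f6]) auto
  have f8: "?fix \<sigma>8" unfolding \<sigma>8_def by (rule step[OF f7]) auto
  have L1: "(\<forall>i. cmem \<sigma>1 ''X'' i = (if i < 2 ^ t then 0 else cmem \<sigma> ''X'' i))
      \<and> ok K ?c1 \<sigma> (1 + ncost (nv ''Len'') + 2 ^ t * (5 + ccost (OfN (Num 0))))"
    unfolding \<sigma>1_def by (rule run_cset_loop) (use t tK K_bounds in auto)
  have L2: "(\<forall>i. cmem \<sigma>2 ''X'' i = (if i < M then of_real (x i) else cmem \<sigma>1 ''X'' i))
      \<and> ok K ?c2 \<sigma>1 (1 + ncost (nv ''M'') + M * (5 + ccost (CCell ''eta1'' (nv ''i'') \<boxtimes> CCell ''eta2'' (nv ''i''))))"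
    unfolding \<sigma>2_def by (rule run_cset_loop) (use v f1 e M_bounds in auto)
  have X2: "cmem \<sigma>2 ''X'' i = padded x i" if "i < 2 ^ t" for i
    using L1 L2 that by (simp add: padded_def)
  have Len2: "nmem \<sigma>2 ''Len'' 0 = 2 ^ t" "nmem \<sigma>4 ''Len'' 0 = 2 ^ t" using f2 f4 t by auto
  have L3: "\<forall>i<2 ^ t. cmem \<sigma>3 ''X'' i = dft 1 (2 ^ t) (cmem \<sigma>2 ''X'') i" "ok K ?c3 \<sigma>2 T"
    unfolding \<sigma>3_def forward_fft_def T_def using run_fft[OF Len2(1) twiddle_forward _ tK] by simp_all
  have X3: "cmem \<sigma>3 ''X'' i = dft 1 (2 ^ t) (padded x) i" if "i < 2 ^ t" for i
  proof -
    have "dft 1 (2 ^ t) (cmem \<sigma>2 ''X'') i = dft 1 (2 ^ t) (padded x) i" by (rule dft_cong) (rule X2)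
    then show ?thesis using L3(1) that by simp
  qed
  have L4: "(\<forall>i. cmem \<sigma>4 ''X'' i = (if i < 2 ^ t then cmem \<sigma>3 ''X'' i * cmem \<sigma> ''F'' i else cmem \<sigma>3 ''X'' i))
      \<and> ok K ?c4 \<sigma>3 (1 + ncost (nv ''Len'') + 2 ^ t * (5 + ccost (CCell ''X'' (nv ''i'') \<boxtimes> CCell ''F'' (nv ''i''))))"
    unfolding \<sigma>4_def by (rule run_cset_loop) (use t f3 tK in auto)
  have X4: "cmem \<sigma>4 ''X'' i = dft 1 (2 ^ t) (padded x) i * dft 1 (2 ^ t) (padded y) i" if "i < 2 ^ t" for i
    using L4 that X3[OF that] F'[OF that] by simp
  have L5: "\<forall>i<2 ^ t. cmem \<sigma>5 ''X'' i = dft (-1) (2 ^ t) (cmem \<sigma>4 ''X'') i" "ok K ?c5 \<sigma>4 T"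
    unfolding \<sigma>5_def T_def using run_fft[OF Len2(2) twiddle_inverse _ tK] by simp_all
  define z where "z j = dft (-1) (2 ^ t) (\<lambda>k. dft 1 (2 ^ t) (padded x) k * dft 1 (2 ^ t) (padded y) k) j / of_nat (2 ^ t)" for j
  have X5: "cmem \<sigma>5 ''X'' i / of_nat (2 ^ t) = z i" if "i < 2 ^ t" for i
  proof -
    have "dft (-1) (2 ^ t) (cmem \<sigma>4 ''X'') i = dft (-1) (2 ^ t) (\<lambda>k. dft 1 (2 ^ t) (padded x) k * dft 1 (2 ^ t) (padded y) k) i"
      by (rule dft_cong) (rule X4)
    then show ?thesis using L5(1) that by (simp only: z_def)
  qed
  have L6: "(\<forall>i. cmem \<sigma>6 ''X'' i = (if i < 2 ^ t then z i else cmem \<sigma>5 ''X'' i))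
      \<and> ok K ?c6 \<sigma>5 (1 + ncost (nv ''Len'') + 2 ^ t * (5 + ccost (CCell ''X'' (nv ''q'') \<div> OfN (nv ''Len''))))"
    unfolding \<sigma>6_def
  proof (rule run_cset_loop)
    fix i and \<tau> :: state
    assume "i < 2 ^ t" "nmem \<tau> ''q'' 0 = i" "\<And>y. y \<noteq> ''q'' \<Longrightarrow> nmem \<tau> y = nmem \<sigma>5 y" "\<And>k. i \<le> k \<Longrightarrow> cmem \<tau> ''X'' k = cmem \<sigma>5 ''X'' k"
    then show "ceval (CCell ''X'' (nv ''q'') \<div> OfN (nv ''Len'')) \<tau> = z i"
      using X5[of i] f5 t(1) by simp
  qed (use t f5 tK in auto)
  have L7: "(\<forall>i. cmem \<sigma>7 ''X'' i = (if i < M then of_real (conv x y i) else cmem \<sigma>6 ''X'' i))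
      \<and> ok K ?c7 \<sigma>6 (1 + ncost (nv ''M'') + M * (5 + ccost (CCell ''X'' (nv ''i'') \<boxplus> CCell ''X'' (nv ''i'' \<^bold>+ nv ''M''))))"
    unfolding \<sigma>7_def
  proof (rule run_cset_loop)
    fix i and \<tau> :: state
    assume *: "i < M" "nmem \<tau> ''i'' 0 = i" "\<And>y. y \<noteq> ''i'' \<Longrightarrow> nmem \<tau> y = nmem \<sigma>6 y" "\<And>k. i \<le> k \<Longrightarrow> cmem \<tau> ''X'' k = cmem \<sigma>6 ''X'' k"
    have "nmem \<tau> ''M'' 0 = M" using *(3)[of "''M''"] f6 v by simp
    moreover have "i + M < 2 ^ t" "i < 2 ^ t" using * t(2) by linarith+
    ultimately have "ceval (CCell ''X'' (nv ''i'') \<boxplus> CCell ''X'' (nv ''i'' \<^bold>+ nv ''M'')) \<tau> = z i + z (i + M)"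
      using * L6 by simp
    also have "\<dots> = (\<Sum>a<M. padded x a * padded y ((i + (M - a)) mod M))"
      unfolding z_def by (rule folded_convolution) (use M_bounds t * in \<open>auto simp: padded_def\<close>)
    also have "\<dots> = of_real (conv x y i)"
      unfolding conv_def of_real_sum using M_bounds by (intro sum.cong) (auto simp: padded_def)
    finally show "ceval (CCell ''X'' (nv ''i'') \<boxplus> CCell ''X'' (nv ''i'' \<^bold>+ nv ''M'')) \<tau> = of_real (conv x y i)" .
  qed (use v f6 M_bounds in auto)
  have L9: "(nmem \<sigma>9 ''i0'' 0 < M \<and> (\<forall>i<M. conv x y (nmem \<sigma>9 ''i0'' 0) \<le> conv x y i)) \<and> ok K ?c9 \<sigma>8 (5 + 30 * M)"
    unfolding \<sigma>9_def by (rule run_argmin_loop) (use v f8 L7 in \<open>auto simp: \<sigma>8_def\<close>)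
  have run_eq: "run choose_next \<sigma> = \<sigma>9"
    by (simp only: choose_next_def inverse_fft_def run.simps(4) \<sigma>9_def \<sigma>8_def \<sigma>7_def \<sigma>6_def \<sigma>5_def \<sigma>4_def \<sigma>3_def \<sigma>2_def \<sigma>1_def)
  show "i0 < M" "\<forall>i<M. conv x y i0 \<le> conv x y i" using L9 by (simp_all add: i0_def run_eq)
  have o8: "ok K ?c8 \<sigma>7 5" by (rule ok_straight) (use K_bounds in auto)
  have o56: "ok K inverse_fft \<sigma>4 (T + (1 + ncost (nv ''Len'') + 2 ^ t * (5 + ccost (CCell ''X'' (nv ''q'') \<div> OfN (nv ''Len'')))))"
    unfolding inverse_fft_def by (rule ok_Seq) (use L5(2) L6 in \<open>simp_all only: \<sigma>5_def\<close>)
  have r56: "\<sigma>6 = run inverse_fft \<sigma>4" by (simp only: inverse_fft_def run.simps(4) \<sigma>6_def \<sigma>5_def)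
  have "ok K choose_next \<sigma> ((1 + ncost (nv ''Len'') + 2 ^ t * (5 + ccost (OfN (Num 0))))
    + ((1 + ncost (nv ''M'') + M * (5 + ccost (CCell ''eta1'' (nv ''i'') \<boxtimes> CCell ''eta2'' (nv ''i''))))
    + (T
    + ((1 + ncost (nv ''Len'') + 2 ^ t * (5 + ccost (CCell ''X'' (nv ''i'') \<boxtimes> CCell ''F'' (nv ''i''))))
    + ((T + (1 + ncost (nv ''Len'') + 2 ^ t * (5 + ccost (CCell ''X'' (nv ''q'') \<div> OfN (nv ''Len'')))))
    + ((1 + ncost (nv ''M'') + M * (5 + ccost (CCell ''X'' (nv ''i'') \<boxplus> CCell ''X'' (nv ''i'' \<^bold>+ nv ''M''))))
    + (5 + (5 + 30 * M))))))))"
    unfolding choose_next_def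
    by (intro ok_Seq) (use L1 L2 L3(2) L4 o56 L7 o8 L9 in \<open>simp_all only: r56 \<sigma>8_def \<sigma>7_def \<sigma>4_def \<sigma>3_def \<sigma>2_def \<sigma>1_def\<close>)
  moreover note fft_cost[OF t(3), folded T_def W_def] M_bounds(2)
  ultimately show "ok K choose_next \<sigma> (6000 * (b * m * N))" unfolding W_def[symmetric] by (elim ok_mono) simp
qed

end

section \<open>The construction\<close>

context machine
begin

abbreviation "update_eta2 \<equiv> for_all ''n'' (nv ''M'')
          (CSet ''eta2'' (nv ''n'')
            (CCell ''eta2'' (nv ''n'') \<boxtimes>
             (OfN (Num 1) \<boxplus> CCell ''om'' ((nv ''i0'' \<^bold>+ (nv ''M'' \<^bold>- nv ''n'')) \<^bold>% nv ''M''))))"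

abbreviation "update_eta1 \<equiv> for_all ''n'' (nv ''M'')
        (CSet ''eta1'' (nv ''n'')
          (CCell ''eta1'' (nv ''n'') \<boxtimes>
           (OfN (Num 1) \<boxminus> cv ''t'' \<boxplus> cv ''t'' \<boxtimes> CCell ''eta2'' (nv ''n''))))"

abbreviation "choose_step \<equiv> Cond (Num 0 \<^bold>< nv ''j'' \<^bold>+ nv ''l'') choose_next (nlet ''i0'' (Num 0))"

definition component :: com where
  "component = (choose_step ;; Out (NCell ''G'' (nv ''i0'')) ;; update_eta2)"

definition block :: com where
  "block = (for_all ''n'' (nv ''M'') (CSet ''eta2'' (nv ''n'') (OfN (Num 1))) ;;
     for_all ''l'' (nv ''d'') component ;;
     clet ''t'' (Weight (nv ''j'' \<^bold>+ Num 1) \<boxtimes> cv ''Dt'') ;;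
     update_eta1)"

lemma main_loop_altdef:
  "main_loop = (for_all ''n'' (nv ''M'') (CSet ''eta1'' (nv ''n'') (OfN (Num 1))) ;; for_all ''j'' (nv ''s'') block)"
  by (simp add: main_loop_def block_def component_def)

lemma writes_component: "nwr component = {''i'', ''n'', ''st'', ''r'', ''half'', ''k'', ''q'', ''i0'', ''tmp''}"
  "cwr component = {''X'', ''w'', ''x'', ''y'', ''Y'', ''eta2''}"
  by (auto simp: component_def nwr_choose_next)

lemma writes_block: "nwr block = {''i'', ''n'', ''st'', ''r'', ''half'', ''k'', ''q'', ''i0'', ''tmp'', ''l''}"
  "cwr block = {''X'', ''w'', ''x'', ''y'', ''Y'', ''eta2'', ''eta1'', ''t''}"
  by (auto simp: block_def writes_component)

end

locale construction = machine_mod ty b m h H N M K P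
  for ty :: "'b::prime_card itself" and b m h H N M K P +
  fixes g :: "'b mod_ring poly" and \<alpha> s d :: nat and \<gamma> :: "nat \<Rightarrow> real" and t :: nat
  assumes g: "g \<in> R_set m" "Q.ord_of g = M" and \<alpha>: "1 \<le> \<alpha>" and d: "1 \<le> d"
begin

abbreviation y :: "nat \<Rightarrow> real" where "y \<equiv> omega \<alpha> d g"

text \<open>Everything the main loop reads but never writes, bundled so that a single frame argument
  transports it through all rounds.\<close>

definition env :: "state \<Rightarrow> bool" where
  "env \<tau> \<longleftrightarrow> nmem \<tau> ''M'' 0 = M \<and> nmem \<tau> ''d'' 0 = d \<and> nmem \<tau> ''s'' 0 = s
     \<and> (\<forall>i<M. nmem \<tau> ''G'' i = enc (g ^ i mod P)) \<and> (\<forall>i<M. cmem \<tau> ''om'' i = of_real (y i))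
     \<and> fft_ready y t \<tau> \<and> cmem \<tau> ''Dt'' 0 = of_real (D_tilde b \<alpha> d) \<and> weights \<tau> = \<gamma>"

lemma envD:
  assumes "env \<tau>"
  shows "nmem \<tau> ''M'' 0 = M" "nmem \<tau> ''d'' 0 = d" "nmem \<tau> ''s'' 0 = s"
    "\<And>i. i < M \<Longrightarrow> nmem \<tau> ''G'' i = enc (g ^ i mod P)" "\<And>i. i < M \<Longrightarrow> cmem \<tau> ''om'' i = of_real (y i)"
    "fft_ready y t \<tau>" "cmem \<tau> ''Dt'' 0 = of_real (D_tilde b \<alpha> d)" "weights \<tau> = \<gamma>"
  using assms by (simp_all add: env_def)

abbreviation "env_n \<equiv> {''M'', ''d'', ''s'', ''G'', ''Len''}"
abbreviation "env_c \<equiv> {''om'', ''F'', ''Dt''}"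

lemma env_cong:
  assumes "env \<sigma>" "\<And>z. z \<in> env_n \<Longrightarrow> nmem \<tau> z = nmem \<sigma> z" "\<And>z. z \<in> env_c \<Longrightarrow> cmem \<tau> z = cmem \<sigma> z" "weights \<tau> = weights \<sigma>"
  shows "env \<tau>"
  using assms by (simp add: env_def fft_ready_def)

lemma env_run: "env \<sigma> \<Longrightarrow> env_n \<inter> nwr c = {} \<Longrightarrow> env_c \<inter> cwr c = {} \<Longrightarrow> env (run c \<sigma>)"
  by (erule env_cong) (auto intro!: nmem_run cmem_run)

lemma pow_mod_periodic: "i mod int M = j mod int M \<Longrightarrow> pow_mod m P g i = pow_mod m P g j"
  by (simp only: pow_mod_def Q.M_def[symmetric])

lemma pow_mod_nat: "k < M \<Longrightarrow> pow_mod m P g (int k) = g ^ k mod P"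
  by (rule Q.pow_mod_cong[OF g]) simp

lemma pow_mod_diff: "a < M \<Longrightarrow> pow_mod m P g (int i - int a) = g ^ ((i + (M - a)) mod M) mod P"
proof (rule Q.pow_mod_cong[OF g])
  assume "a < M"
  then have "int ((i + (M - a)) mod M) = (int i - int a + int M) mod int M"
    by (simp add: of_nat_mod of_nat_diff algebra_simps)
  then show "int ((i + (M - a)) mod M) mod int M = (int i - int a) mod int M" by simp
qed

abbreviation hp :: "nat \<Rightarrow> 'b mod_ring poly" where "hp n \<equiv> pow_mod m P g (- int n)"

text \<open>The modulus at the head of the list shifts positions by one, so that component
  \<open>i\<close> is found at index \<open>i\<close>, exactly as in the output.\<close>

definition qf :: "nat list \<Rightarrow> nat \<Rightarrow> 'b mod_ring poly" where "qf rs i = np ((enc P # rs) ! i)"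

definition factor :: "nat list \<Rightarrow> nat \<Rightarrow> nat \<Rightarrow> real" where
  "factor rs n i = chi b \<alpha> d (v_quot m (hp n * qf rs i) P)"

text \<open>The two stored factors of \<eta>, at the polynomial \<open>hp n\<close>, expressed
  through the output so far: \<open>E1\<close> after \<open>j\<close> complete coordinates, and the
  following \<open>E2\<close> after \<open>l\<close> components of the next one.\<close>

definition E1 :: "nat list \<Rightarrow> nat \<Rightarrow> nat \<Rightarrow> real" where
  "E1 rs j n = (\<Prod>j'=1..j. 1 - \<gamma> j' * D_tilde b \<alpha> d
     + \<gamma> j' * D_tilde b \<alpha> d * (\<Prod>l=1..d. 1 + factor rs n (d * (j' - 1) + l)))"

definition E2 :: "nat list \<Rightarrow> nat \<Rightarrow> nat \<Rightarrow> nat \<Rightarrow> real" where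
  "E2 rs j l n = (\<Prod>l'=1..l. 1 + factor rs n (d * j + l'))"

text \<open>Position \<open>i\<close> of \<open>rs\<close> is component \<open>i + 1\<close>. The
  first component is prescribed as the zeroth power and takes no part in the minimisation; exponents
  are kept below \<open>M\<close>, as in the program.\<close>

definition good :: "nat list \<Rightarrow> bool" where
  "good rs \<longleftrightarrow> (\<forall>i<length rs. \<exists>i0<M. rs ! i = enc (g ^ i0 mod P) \<and> (i = 0 \<longrightarrow> i0 = 0)
     \<and> (0 < i \<longrightarrow> (\<forall>k<M. c_vec m \<alpha> d \<gamma> P g (qf rs) (Suc i) i0 \<le> c_vec m \<alpha> d \<gamma> P g (qf rs) (Suc i) k)))"

lemma qf_append: "1 \<le> i \<Longrightarrow> i \<le> length rs \<Longrightarrow> qf (rs @ [x]) i = qf rs i"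
  by (cases i) (simp_all add: qf_def nth_append)

lemma qf_last: "qf (rs @ [x]) (Suc (length rs)) = np x"
  by (simp add: qf_def)

text \<open>Minimality of earlier choices is not disturbed by components appended later.\<close>

lemma c_vec_append:
  assumes "r \<le> Suc (length rs)"
  shows "c_vec m \<alpha> d \<gamma> P g (qf (rs @ [x])) r i = c_vec m \<alpha> d \<gamma> P g (qf rs) r i"
proof -
  have "eta m \<alpha> d \<gamma> P (qf (rs @ [x])) r h = eta m \<alpha> d \<gamma> P (qf rs) r h" for h
    by (rule eta_cong) (use assms d in \<open>auto intro!: qf_append\<close>)
  then show ?thesis by (simp only: c_vec_def)
qed

lemma factor_append: "1 \<le> i \<Longrightarrow> i \<le> length rs \<Longrightarrow> factor (rs @ [x]) n i = factor rs n i"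
  by (simp add: factor_def qf_append)

lemma E1_append:
  assumes "d * j \<le> length rs"
  shows "E1 (rs @ [x]) j n = E1 rs j n"
proof -
  have "(\<Prod>l=1..d. 1 + factor (rs @ [x]) n (d * (j' - 1) + l)) = (\<Prod>l=1..d. 1 + factor rs n (d * (j' - 1) + l))"
    if j': "j' \<in> {1..j}" for j'
  proof (intro prod.cong[OF refl])
    fix l assume l: "l \<in> {1..d}"
    have "d * (j' - 1) + d \<le> d * j" using block_end_le[of j' j d] j' by auto
    then have "d * (j' - 1) + l \<le> length rs" using l assms by auto
    then show "1 + factor (rs @ [x]) n (d * (j' - 1) + l) = 1 + factor rs n (d * (j' - 1) + l)"
      using l by (subst factor_append) auto
  qed
  then show ?thesis unfolding E1_def by (intro prod.cong[OF refl]) (simp only:)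
qed

lemma E2_append:
  assumes "d * j + l \<le> length rs"
  shows "E2 (rs @ [x]) j l n = E2 rs j l n"
  unfolding E2_def using assms by (intro prod.cong) (auto simp: factor_append)

text \<open>Since both polynomials are powers of \<open>g\<close>, their product is found by adding
  exponents: updating \<eta> takes a cyclic reading of the stored first column and no polynomial
  arithmetic.\<close>

lemma factor_eq:
  assumes n: "n < M" and i0: "i0 < M" and q: "qf rs i = g ^ i0 mod P"
  shows "factor rs n i = y ((i0 + (M - n)) mod M)"
proof -
  have "hp n * (g ^ i0 mod P) mod P = g ^ ((i0 + (M - n)) mod M) mod P"
    using Q.pow_mod_add[OF g, of "- int n" "int i0"] pow_mod_diff[OF n, of i0] pow_mod_nat[OF i0] by simp
  then have "hp n * (g ^ i0 mod P) mod P = g ^ ((i0 + (M - n)) mod M) mod P mod P" by simp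
  from v_quot_cong[OF Q.p_nz this] show ?thesis by (simp only: factor_def q omega_def)
qed

lemma E2_Suc:
  assumes "n < M" "i0 < M" "length rs = d * j + l"
  shows "E2 (rs @ [enc (g ^ i0 mod P)]) j (Suc l) n = E2 rs j l n * (1 + y ((i0 + (M - n)) mod M))"
proof -
  let ?rs = "rs @ [enc (g ^ i0 mod P)]"
  have "E2 ?rs j (Suc l) n = E2 ?rs j l n * (1 + factor ?rs n (d * j + Suc l))" by (simp add: E2_def)
  moreover have "E2 ?rs j l n = E2 rs j l n" by (rule E2_append) (simp add: assms)
  moreover have "factor ?rs n (d * j + Suc l) = y ((i0 + (M - n)) mod M)"
    using qf_last[of rs] by (intro factor_eq assms(1,2)) (simp add: assms(3))
  ultimately show ?thesis by simp
qed

lemma E1_Suc: "E1 rs (Suc j) n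
   = E1 rs j n * (1 - \<gamma> (Suc j) * D_tilde b \<alpha> d + \<gamma> (Suc j) * D_tilde b \<alpha> d * E2 rs j d n)"
  by (simp add: E1_def E2_def)

lemma E1_E2: "l < d \<Longrightarrow> E1 rs j n * E2 rs j l n = eta m \<alpha> d \<gamma> P (qf rs) (d * j + Suc l) (hp n)"
  unfolding E1_def E2_def factor_def using eta_split[of d "d * j + Suc l" j l m \<alpha> \<gamma> P "qf rs" "hp n"] d by (simp add: b)

text \<open>The matrix is indexed from 1 to \<open>M\<close>, the arrays from 0 to
  \<open>M - 1\<close>; by periodicity of the powers the term at \<open>M\<close> is the term at
  0.\<close>

lemma conv_eq_c_vec: "conv (\<lambda>a. eta m \<alpha> d \<gamma> P q r (hp a)) y i = c_vec m \<alpha> d \<gamma> P g q r i"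
proof -
  define f where "f = (\<lambda>n. chi b \<alpha> d (v_quot m (pow_mod m P g (int i - int n)) P) * eta m \<alpha> d \<gamma> P q r (hp n))"
  have M: "M = CARD('b) ^ m - 1" by (rule Q.M_def)
  have "c_vec m \<alpha> d \<gamma> P g q r i = sum f {1..M}" unfolding c_vec_def f_def M b ..
  also have "{1..M} = insert M {1..<M}" using M_bounds(1) by auto
  also have "sum f (insert M {1..<M}) = f M + sum f {1..<M}" by (subst sum.insert) auto
  also have "f M = f 0"
    using pow_mod_periodic[of "int i - int M" "int i"] pow_mod_periodic[of "- int M" 0] by (simp add: f_def)
  also have "f 0 + sum f {1..<M} = sum f (insert 0 {1..<M})" by (subst sum.insert) auto
  also have "insert 0 {1..<M} = {..<M}" using M_bounds(1) by auto
  also have "sum f {..<M} = conv (\<lambda>a. eta m \<alpha> d \<gamma> P q r (hp a)) y i"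
    unfolding conv_def f_def by (intro sum.cong[OF refl]) (simp add: pow_mod_diff omega_def)
  finally show ?thesis by simp
qed

definition inv_rs :: "nat list \<Rightarrow> nat \<Rightarrow> state \<Rightarrow> bool" where
  "inv_rs rs j \<tau> \<longleftrightarrow> results \<tau> = enc P # rs \<and> good rs \<and> (\<forall>n<M. cmem \<tau> ''eta1'' n = of_real (E1 rs j n))"

definition inv2 :: "nat \<Rightarrow> nat \<Rightarrow> state \<Rightarrow> bool" where
  "inv2 j l \<tau> \<longleftrightarrow> (\<exists>rs. inv_rs rs j \<tau> \<and> length rs = d * j + l \<and> (\<forall>n<M. cmem \<tau> ''eta2'' n = of_real (E2 rs j l n)))"

definition inv1 :: "nat \<Rightarrow> state \<Rightarrow> bool" where
  "inv1 j \<tau> \<longleftrightarrow> (\<exists>rs. inv_rs rs j \<tau> \<and> length rs = d * j)"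

lemma good_append:
  assumes "good rs" "i0 < M" "rs = [] \<Longrightarrow> i0 = 0"
    and "rs \<noteq> [] \<Longrightarrow> \<forall>k<M. c_vec m \<alpha> d \<gamma> P g (qf rs) (Suc (length rs)) i0 \<le> c_vec m \<alpha> d \<gamma> P g (qf rs) (Suc (length rs)) k"
  shows "good (rs @ [enc (g ^ i0 mod P)])"
  unfolding good_def
proof (intro allI impI)
  let ?rs = "rs @ [enc (g ^ i0 mod P)]"
  fix i assume i: "i < length ?rs"
  have c: "c_vec m \<alpha> d \<gamma> P g (qf ?rs) (Suc i) k = c_vec m \<alpha> d \<gamma> P g (qf rs) (Suc i) k" for k
    by (rule c_vec_append) (use i in simp)
  show "\<exists>i0<M. ?rs ! i = enc (g ^ i0 mod P) \<and> (i = 0 \<longrightarrow> i0 = 0)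
     \<and> (0 < i \<longrightarrow> (\<forall>k<M. c_vec m \<alpha> d \<gamma> P g (qf ?rs) (Suc i) i0 \<le> c_vec m \<alpha> d \<gamma> P g (qf ?rs) (Suc i) k))"
  proof (cases "i < length rs")
    case True
    then show ?thesis using assms(1) unfolding good_def c by (simp add: nth_append)
  next
    case False
    then have "i = length rs" using i by simp
    then show ?thesis unfolding c using assms(2-4) by (intro exI[of _ i0]) auto
  qed
qed

lemma run_component:
  fixes \<tau> :: state
  assumes e: "env \<tau>" and v: "nmem \<tau> ''j'' 0 = j" "nmem \<tau> ''l'' 0 = l" and l: "l < d" and I: "inv2 j l \<tau>"
  shows "ok K component \<tau> (6050 * (b * m * N)) \<and> inv2 j (Suc l) (run component \<tau>)"
proof -
  let ?c1 = choose_step and ?c2 = "Out (NCell ''G'' (nv ''i0''))" and ?c3 = update_eta2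
  obtain rs where rs: "results \<tau> = enc P # rs" "good rs" "\<forall>n<M. cmem \<tau> ''eta1'' n = of_real (E1 rs j n)"
      "length rs = d * j + l" "\<forall>n<M. cmem \<tau> ''eta2'' n = of_real (E2 rs j l n)"
    using I by (auto simp: inv2_def inv_rs_def)
  define W where "W = b * m * N"
  define \<tau>1 where "\<tau>1 = run ?c1 \<tau>"
  define \<tau>2 where "\<tau>2 = run ?c2 \<tau>1"
  define \<tau>3 where "\<tau>3 = run ?c3 \<tau>2"
  define i0 where "i0 = nmem \<tau>1 ''i0'' 0"
  have e1: "env \<tau>1" unfolding \<tau>1_def by (rule env_run[OF e]) (auto simp: nwr_choose_next)
  have f1: "cmem \<tau>1 ''eta1'' = cmem \<tau> ''eta1''" "cmem \<tau>1 ''eta2'' = cmem \<tau> ''eta2''"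
    unfolding \<tau>1_def by (rule cmem_run; simp add: nwr_choose_next)+
  have r1: "results \<tau>1 = enc P # rs" unfolding \<tau>1_def rs(1)[symmetric] by (rule results_run) (simp add: nwr_choose_next)
  have "1 \<le> b * m" using b2 m by simp
  then have NW: "N \<le> W" by (simp add: W_def)
  have C: "i0 < M \<and> (rs = [] \<longrightarrow> i0 = 0) \<and> (rs \<noteq> [] \<longrightarrow> (\<forall>k<M. c_vec m \<alpha> d \<gamma> P g (qf rs) (Suc (length rs)) i0
      \<le> c_vec m \<alpha> d \<gamma> P g (qf rs) (Suc (length rs)) k)) \<and> ok K ?c1 \<tau> (20 + 6000 * W)"
  proof (cases "j = 0 \<and> l = 0")
    \<comment> \<open>The very first component: no choice is made, and \<open>i0 = 0\<close> outputs
      the zeroth power, that is, the polynomial 1.\<close>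
    case True
    then have "beval (Num 0 \<^bold>< nv ''j'' \<^bold>+ nv ''l'') \<tau> = False" using v by simp
    moreover have "i0 = 0" using True v by (simp add: i0_def \<tau>1_def)
    moreover have "rs = []" using rs(4) True by simp
    moreover have "ok K ?c1 \<tau> (1 + bcost (Num 0 \<^bold>< nv ''j'' \<^bold>+ nv ''l'') + (0 + 3))"
      by (rule ok_Cond) (use True v K_bounds in \<open>auto intro!: ok_straight\<close>)
    then have "ok K ?c1 \<tau> (20 + 6000 * W)" by (rule ok_mono) simp
    ultimately show ?thesis using M_bounds(1) by simp
  next
    case False
    then have B: "beval (Num 0 \<^bold>< nv ''j'' \<^bold>+ nv ''l'') \<tau>" using v by auto
    have i0_eq: "i0 = nmem (run choose_next \<tau>) ''i0'' 0" using B by (simp add: i0_def \<tau>1_def)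
    have x: "\<forall>i<M. cmem \<tau> ''eta1'' i * cmem \<tau> ''eta2'' i
        = of_real (eta m \<alpha> d \<gamma> P (qf rs) (d * j + Suc l) (hp i))"
      using rs(3,5) unfolding E1_E2[OF l, symmetric] by simp
    note R = run_choose_next[OF envD(1)[OF e] envD(6)[OF e] x, folded i0_eq W_def, unfolded conv_eq_c_vec]
    have "ok K ?c1 \<tau> (1 + bcost (Num 0 \<^bold>< nv ''j'' \<^bold>+ nv ''l'') + (6000 * W + 0))"
      by (rule ok_Cond) (use B R(3) in auto)
    then have "ok K ?c1 \<tau> (20 + 6000 * W)" by (rule ok_mono) simp
    moreover have "rs \<noteq> []" using rs(4) False d by auto
    moreover have "d * j + Suc l = Suc (length rs)" by (simp add: rs(4))
    ultimately show ?thesis using R(1,2) by simp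
  qed
  define rs' where "rs' = rs @ [enc (g ^ i0 mod P)]"
  have good: "good rs'" unfolding rs'_def by (rule good_append) (use rs(2) C in auto)
  have e2: "env \<tau>2" unfolding \<tau>2_def by (rule env_run[OF e1]) auto
  have r2: "results \<tau>2 = enc P # rs'" "nmem \<tau>2 = nmem \<tau>1" "cmem \<tau>2 = cmem \<tau>1"
    using r1 envD(4)[OF e1, of i0] C by (simp_all add: \<tau>2_def rs'_def i0_def tick_def)
  have L3: "(\<forall>n. cmem \<tau>3 ''eta2'' n = (if n < M then of_real (E2 rs' j (Suc l) n) else cmem \<tau>2 ''eta2'' n))
      \<and> ok K ?c3 \<tau>2 (1 + ncost (nv ''M'') + M * (5 + ccost (CCell ''eta2'' (nv ''n'') \<boxtimes>
             (OfN (Num 1) \<boxplus> CCell ''om'' ((nv ''i0'' \<^bold>+ (nv ''M'' \<^bold>- nv ''n'')) \<^bold>% nv ''M'')))))"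
    unfolding \<tau>3_def
  proof (rule run_cset_loop)
    fix n and \<rho> :: state
    assume n: "n < M" and nn: "nmem \<rho> ''n'' 0 = n" and fn: "\<And>z. z \<noteq> ''n'' \<Longrightarrow> nmem \<rho> z = nmem \<tau>2 z"
      and fc: "\<And>z. z \<noteq> ''eta2'' \<Longrightarrow> cmem \<rho> z = cmem \<tau>2 z" and X: "\<And>k. n \<le> k \<Longrightarrow> cmem \<rho> ''eta2'' k = cmem \<tau>2 ''eta2'' k"
    have "nmem \<rho> ''M'' 0 = M" "nmem \<rho> ''i0'' 0 = i0"
      using fn[of "''M''"] fn[of "''i0''"] envD(1)[OF e2] r2(2) by (simp_all add: i0_def)
    moreover have "(i0 + (M - n)) mod M < M" using M_bounds(1) by simp
    then have "cmem \<rho> ''om'' ((i0 + (M - n)) mod M) = of_real (y ((i0 + (M - n)) mod M))"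
      using fc[of "''om''"] envD(5)[OF e2] by simp
    moreover have "cmem \<rho> ''eta2'' n = of_real (E2 rs j l n)" using X[of n] r2(3) f1(2) rs(5) n by simp
    moreover have "E2 rs' j (Suc l) n = E2 rs j l n * (1 + y ((i0 + (M - n)) mod M))"
      unfolding rs'_def using C by (intro E2_Suc[OF n _ rs(4)]) simp
    ultimately show "ceval (CCell ''eta2'' (nv ''n'') \<boxtimes>
             (OfN (Num 1) \<boxplus> CCell ''om'' ((nv ''i0'' \<^bold>+ (nv ''M'' \<^bold>- nv ''n'')) \<^bold>% nv ''M''))) \<rho> = of_real (E2 rs' j (Suc l) n)"
      using nn by simp
  qed (use envD(1)[OF e2] M_bounds in auto)
  have f3: "results \<tau>3 = results \<tau>2" unfolding \<tau>3_def by (rule results_run) simp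
  have g3: "cmem \<tau>3 ''eta1'' = cmem \<tau>2 ''eta1''" unfolding \<tau>3_def by (rule cmem_run) simp
  have run_eq: "run component \<tau> = \<tau>3" by (simp only: component_def run.simps(4) \<tau>3_def \<tau>2_def \<tau>1_def)
  have E1': "E1 rs' j n = E1 rs j n" for n unfolding rs'_def by (rule E1_append) (simp add: rs(4))
  have "inv2 j (Suc l) \<tau>3"
    unfolding inv2_def inv_rs_def
    by (rule exI[of _ rs']) (use f3 g3 r2 good L3 f1 rs(3,4) E1' in \<open>simp add: rs'_def\<close>)
  moreover have "ok K component \<tau> ((20 + 6000 * W) + ((1 + ncost (NCell ''G'' (nv ''i0''))) + (1 + ncost (nv ''M'') + M * (5 + ccost (CCell ''eta2'' (nv ''n'') \<boxtimes>
             (OfN (Num 1) \<boxplus> CCell ''om'' ((nv ''i0'' \<^bold>+ (nv ''M'' \<^bold>- nv ''n'')) \<^bold>% nv ''M'')))))))"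
    unfolding component_def
    by (intro ok_Seq ok_Out) (use C L3 in \<open>simp_all only: \<tau>2_def \<tau>1_def\<close>)
  then have "ok K component \<tau> (6050 * W)" by (rule ok_mono) (use NW M_bounds N_bounds(1) in simp)
  ultimately show ?thesis unfolding run_eq W_def by (intro conjI)
qed

lemma run_block:
  fixes \<tau> :: state
  assumes e: "env \<tau>" and v: "nmem \<tau> ''j'' 0 = j" and I: "inv1 j \<tau>"
  shows "ok K block \<tau> (6200 * (d * (b * m * N))) \<and> inv1 (Suc j) (run block \<tau>)"
proof -
  let ?c1 = "for_all ''n'' (nv ''M'') (CSet ''eta2'' (nv ''n'') (OfN (Num 1)))" and ?c2 = "for_all ''l'' (nv ''d'') component"
    and ?c3 = "clet ''t'' (Weight (nv ''j'' \<^bold>+ Num 1) \<boxtimes> cv ''Dt'')" and ?c4 = update_eta1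
  obtain rs0 where rs0: "results \<tau> = enc P # rs0" "good rs0" "\<forall>n<M. cmem \<tau> ''eta1'' n = of_real (E1 rs0 j n)"
      "length rs0 = d * j"
    using I by (auto simp: inv1_def inv_rs_def)
  define W where "W = b * m * N"
  have "1 \<le> b * m" using b2 m by simp
  then have NW: "N \<le> W" by (simp add: W_def)
  have dW: "W \<le> d * W" using d by simp
  define V where "V = d * W"
  have V: "N \<le> V" using NW dW by (simp only: V_def)
  define \<tau>1 where "\<tau>1 = run ?c1 \<tau>"
  define \<tau>2 where "\<tau>2 = run ?c2 \<tau>1"
  define \<tau>3 where "\<tau>3 = run ?c3 \<tau>2"
  define \<tau>4 where "\<tau>4 = run ?c4 \<tau>3"
  have L1: "(\<forall>n. cmem \<tau>1 ''eta2'' n = (if n < M then 1 else cmem \<tau> ''eta2'' n))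
      \<and> ok K ?c1 \<tau> (1 + ncost (nv ''M'') + M * (5 + ccost (OfN (Num 1))))"
    unfolding \<tau>1_def by (rule run_cset_loop) (use envD(1)[OF e] M_bounds in auto)
  have e1: "env \<tau>1" unfolding \<tau>1_def by (rule env_run[OF e]) auto
  have f1: "cmem \<tau>1 ''eta1'' = cmem \<tau> ''eta1''" "nmem \<tau>1 ''j'' = nmem \<tau> ''j''" "results \<tau>1 = results \<tau>"
    unfolding \<tau>1_def by (rule cmem_run nmem_run results_run; simp)+
  have I1: "inv2 j 0 \<tau>1"
    unfolding inv2_def inv_rs_def by (rule exI[of _ rs0]) (use f1 rs0 L1 in \<open>simp add: E2_def\<close>)
  have L2: "inv2 j d \<tau>2 \<and> ok K ?c2 \<tau>1 (10 + 6060 * (d * W))"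
    unfolding \<tau>2_def
  proof (rule for_all_const[where I = "\<lambda>l. inv2 j l" and t = "6050 * W"])
    fix l and \<rho> :: state
    assume l: "l < d" and I: "inv2 j l \<rho>" and nl: "nmem \<rho> ''l'' 0 = l"
      and fn: "\<And>y. y \<notin> nwr ?c2 \<Longrightarrow> nmem \<rho> y = nmem \<tau>1 y" and fc: "\<And>y. y \<notin> cwr component \<Longrightarrow> cmem \<rho> y = cmem \<tau>1 y"
      and w: "weights \<rho> = weights \<tau>1"
    have "env \<rho>" by (rule env_cong[OF e1 fn fc w]) (auto simp: writes_component)
    moreover have "nmem \<rho> ''j'' 0 = j" using fn[of "''j''"] f1 v by (simp add: writes_component)
    ultimately show "ok K component \<rho> (6050 * W) \<and> inv2 j (Suc l) (run component \<rho>)"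
      unfolding W_def using nl l I by (intro run_component)
  next
    have "d * (2 + 6050 * W) = 2 * d + 6050 * (d * W)" by (simp add: distrib_left)
    moreover have "d \<le> d * W" using NW N_bounds(1) by simp
    ultimately show "1 + ncost (nv ''d'') + d * (2 + 6050 * W) \<le> 10 + 6060 * (d * W)" unfolding ncost.simps by linarith
  qed (use I1 envD(2)[OF e1] K_bounds in \<open>auto simp: inv2_def inv_rs_def\<close>)
  obtain rs where rs: "results \<tau>2 = enc P # rs" "good rs" "\<forall>n<M. cmem \<tau>2 ''eta1'' n = of_real (E1 rs j n)"
      "length rs = d * j + d" "\<forall>n<M. cmem \<tau>2 ''eta2'' n = of_real (E2 rs j d n)"
    using L2 by (auto simp: inv2_def inv_rs_def)
  have e2: "env \<tau>2" unfolding \<tau>2_def by (rule env_run[OF e1]) (auto simp: writes_component)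
  have j2: "nmem \<tau>2 ''j'' 0 = j"
  proof -
    have "nmem \<tau>2 ''j'' = nmem \<tau>1 ''j''" unfolding \<tau>2_def by (rule nmem_run) (simp add: writes_component)
    then show ?thesis using f1 v by simp
  qed
  have e3: "env \<tau>3" unfolding \<tau>3_def by (rule env_run[OF e2]) auto
  have f3: "cmem \<tau>3 ''t'' 0 = of_real (\<gamma> (Suc j) * D_tilde b \<alpha> d)" "results \<tau>3 = results \<tau>2"
      "cmem \<tau>3 ''eta1'' = cmem \<tau>2 ''eta1''" "cmem \<tau>3 ''eta2'' = cmem \<tau>2 ''eta2''"
    using envD(7,8)[OF e2] j2 by (simp_all add: \<tau>3_def)
  have L4: "(\<forall>n. cmem \<tau>4 ''eta1'' n = (if n < M then of_real (E1 rs (Suc j) n) else cmem \<tau>3 ''eta1'' n))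
      \<and> ok K ?c4 \<tau>3 (1 + ncost (nv ''M'') + M * (5 + ccost (CCell ''eta1'' (nv ''n'') \<boxtimes>
           (OfN (Num 1) \<boxminus> cv ''t'' \<boxplus> cv ''t'' \<boxtimes> CCell ''eta2'' (nv ''n'')))))"
    unfolding \<tau>4_def
  proof (rule run_cset_loop)
    fix n and \<rho> :: state
    assume n: "n < M" and nn: "nmem \<rho> ''n'' 0 = n"
      and fc: "\<And>z. z \<noteq> ''eta1'' \<Longrightarrow> cmem \<rho> z = cmem \<tau>3 z" and X: "\<And>k. n \<le> k \<Longrightarrow> cmem \<rho> ''eta1'' k = cmem \<tau>3 ''eta1'' k"
    have "cmem \<rho> ''eta2'' n = of_real (E2 rs j d n)" "cmem \<rho> ''t'' 0 = of_real (\<gamma> (Suc j) * D_tilde b \<alpha> d)"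
        "cmem \<rho> ''eta1'' n = of_real (E1 rs j n)"
      using fc[of "''eta2''"] fc[of "''t''"] X[of n] f3 rs(3,5) n by simp_all
    then show "ceval (CCell ''eta1'' (nv ''n'') \<boxtimes>
           (OfN (Num 1) \<boxminus> cv ''t'' \<boxplus> cv ''t'' \<boxtimes> CCell ''eta2'' (nv ''n''))) \<rho> = of_real (E1 rs (Suc j) n)"
      using nn by (simp add: E1_Suc)
  qed (use envD(1)[OF e3] M_bounds in auto)
  have f4: "results \<tau>4 = results \<tau>3" unfolding \<tau>4_def by (rule results_run) simp
  have run_eq: "run block \<tau> = \<tau>4" by (simp only: block_def run.simps(4) \<tau>4_def \<tau>3_def \<tau>2_def \<tau>1_def)
  have "inv1 (Suc j) \<tau>4"
    unfolding inv1_def inv_rs_def by (rule exI[of _ rs]) (use f4 f3 rs L4 in simp)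
  moreover have "ok K ?c3 \<tau>2 20" by (rule ok_straight) (use K_bounds in auto)
  then have "ok K block \<tau> ((1 + ncost (nv ''M'') + M * (5 + ccost (OfN (Num 1)))) + ((10 + 6060 * (d * W))
     + (20 + (1 + ncost (nv ''M'') + M * (5 + ccost (CCell ''eta1'' (nv ''n'') \<boxtimes>
           (OfN (Num 1) \<boxminus> cv ''t'' \<boxplus> cv ''t'' \<boxtimes> CCell ''eta2'' (nv ''n''))))))))"
    unfolding block_def
    by (intro ok_Seq) (use L1 L2 L4 in \<open>simp_all only: \<tau>3_def \<tau>2_def \<tau>1_def\<close>)
  then have "ok K block \<tau> (6200 * (d * W))" by (rule ok_mono) (use V M_bounds N_bounds(1) in \<open>simp add: V_def[symmetric]\<close>)
  ultimately show ?thesis unfolding run_eq W_def by (intro conjI)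
qed

lemma run_main_loop:
  fixes \<sigma> :: state
  assumes e: "env \<sigma>" and r: "results \<sigma> = [enc P]" and s: "1 \<le> s"
  shows "(\<exists>rs. results (run main_loop \<sigma>) = enc P # rs \<and> length rs = d * s \<and> good rs)
    \<and> ok K main_loop \<sigma> (6300 * (s * (d * (b * m * N))))"
proof -
  let ?c1 = "for_all ''n'' (nv ''M'') (CSet ''eta1'' (nv ''n'') (OfN (Num 1)))" and ?c2 = "for_all ''j'' (nv ''s'') block"
  define W where "W = b * m * N"
  have "1 \<le> b * m" using b2 m by simp
  then have NW: "N \<le> W" by (simp add: W_def)
  have dW: "W \<le> d * W" using d by simp
  have sW: "d * W \<le> s * (d * W)" using s by simp
  define V where "V = s * (d * W)"
  have V: "N \<le> V" using NW dW sW by (simp only: V_def)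
  define \<tau>1 where "\<tau>1 = run ?c1 \<sigma>"
  have L1: "(\<forall>n. cmem \<tau>1 ''eta1'' n = (if n < M then 1 else cmem \<sigma> ''eta1'' n))
      \<and> ok K ?c1 \<sigma> (1 + ncost (nv ''M'') + M * (5 + ccost (OfN (Num 1))))"
    unfolding \<tau>1_def by (rule run_cset_loop) (use envD(1)[OF e] M_bounds in auto)
  have e1: "env \<tau>1" unfolding \<tau>1_def by (rule env_run[OF e]) auto
  have f1: "results \<tau>1 = results \<sigma>" unfolding \<tau>1_def by (rule results_run) simp
  have I1: "inv1 0 \<tau>1"
    unfolding inv1_def inv_rs_def by (rule exI[of _ "[]"]) (use f1 r L1 in \<open>simp add: E1_def good_def\<close>)
  have L2: "inv1 s (run ?c2 \<tau>1) \<and> ok K ?c2 \<tau>1 (10 + 6202 * (s * (d * W)))"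
  proof (rule for_all_const[where I = inv1 and t = "6200 * (d * W)"])
    fix j and \<rho> :: state
    assume j: "j < s" and I: "inv1 j \<rho>" and nj: "nmem \<rho> ''j'' 0 = j"
      and fn: "\<And>y. y \<notin> nwr ?c2 \<Longrightarrow> nmem \<rho> y = nmem \<tau>1 y" and fc: "\<And>y. y \<notin> cwr block \<Longrightarrow> cmem \<rho> y = cmem \<tau>1 y"
      and w: "weights \<rho> = weights \<tau>1"
    have "env \<rho>" by (rule env_cong[OF e1 fn fc w]) (auto simp: writes_block)
    then show "ok K block \<rho> (6200 * (d * W)) \<and> inv1 (Suc j) (run block \<rho>)"
      unfolding W_def using nj I by (intro run_block)
  next
    have "s * (2 + 6200 * (d * W)) = 2 * s + 6200 * (s * (d * W))" by (simp add: distrib_left)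
    moreover have "s \<le> s * (d * W)" using dW NW N_bounds(1) by simp
    ultimately show "1 + ncost (nv ''s'') + s * (2 + 6200 * (d * W)) \<le> 10 + 6202 * (s * (d * W))" unfolding ncost.simps by linarith
  qed (use I1 envD(3)[OF e1] K_bounds in \<open>auto simp: inv1_def inv_rs_def\<close>)
  have run_eq: "run main_loop \<sigma> = run ?c2 \<tau>1" by (simp only: main_loop_altdef run.simps(4) \<tau>1_def)
  have "ok K main_loop \<sigma> ((1 + ncost (nv ''M'') + M * (5 + ccost (OfN (Num 1)))) + (10 + 6202 * (s * (d * W))))"
    unfolding main_loop_altdef by (intro ok_Seq) (use L1 L2 in \<open>simp_all only: \<tau>1_def\<close>)
  then have "ok K main_loop \<sigma> (6300 * (s * (d * W)))"
    by (rule ok_mono) (use V M_bounds N_bounds(1) in \<open>simp add: V_def[symmetric]\<close>)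
  then show ?thesis using L2 unfolding run_eq W_def by (auto simp: inv1_def inv_rs_def)
qed

lemma c_vec_M: "c_vec m \<alpha> d \<gamma> P g q r M = c_vec m \<alpha> d \<gamma> P g q r 0"
  unfolding c_vec_def by (intro sum.cong[OF refl] arg_cong2[where f = "(*)"] arg_cong[where f = "\<lambda>x. chi _ _ _ (v_quot _ x _)"] pow_mod_periodic) simp_all

lemma good_fast_choice:
  assumes rs: "good rs" "length rs = d * s" and s: "1 \<le> s"
  shows "qf rs 1 = 1"
    and "\<And>r. r \<in> {2..d * s} \<Longrightarrow> \<exists>i0. is_arg_min (c_vec m \<alpha> d \<gamma> P g (qf rs) r) (\<lambda>i. i \<in> {1..M}) i0
        \<and> qf rs r = pow_mod m P g (int i0)"
proof -
  have "0 < length rs" using rs(2) s d by simp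
  then obtain i0 where "i0 < M" "rs ! 0 = enc (g ^ i0 mod P)" "i0 = 0" using rs(1) unfolding good_def by blast
  then have "qf rs 1 = 1 mod P" by (simp add: qf_def)
  also have "\<dots> = 1" by (rule Q.mod_less) (rule Q.one_R_set)
  finally show "qf rs 1 = 1" .
next
  fix r assume r: "r \<in> {2..d * s}"
  let ?c = "c_vec m \<alpha> d \<gamma> P g (qf rs) r"
  have "r - 1 < length rs" "0 < r - 1" "Suc (r - 1) = r" using r rs(2) by auto
  then obtain i0 where i0: "i0 < M" "rs ! (r - 1) = enc (g ^ i0 mod P)" "\<forall>k<M. ?c i0 \<le> ?c k"
    using rs(1) unfolding good_def by metis
  \<comment> \<open>Exponent 0 of the array corresponds to the index \<open>M\<close> of the
    matrix.\<close>
  define i1 where "i1 = (if i0 = 0 then M else i0)"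
  have i1: "i1 \<in> {1..M}" "?c i1 = ?c i0" "pow_mod m P g (int i1) = g ^ i0 mod P"
    using i0(1) M_bounds(1) pow_mod_nat[OF i0(1)] pow_mod_periodic[of "int M" 0] by (auto simp: i1_def c_vec_M)
  have "?c i1 \<le> ?c k" if "k \<in> {1..M}" for k
    using i0(3) that M_bounds(1) unfolding i1(2) by (cases "k = M") (auto simp: c_vec_M)
  then have "is_arg_min ?c (\<lambda>i. i \<in> {1..M}) i1" using i1(1) by (auto simp: is_arg_min_linorder)
  moreover have "qf rs r = pow_mod m P g (int i1)"
    using i0(2) r i1(3) by (cases r) (simp_all add: qf_def)
  ultimately show "\<exists>i0. is_arg_min ?c (\<lambda>i. i \<in> {1..M}) i0 \<and> qf rs r = pow_mod m P g (int i0)" by blast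
qed

end

section \<open>The complete program\<close>

lemma nwr_init_tables: "nwr init_tables = {''N'', ''i'', ''M'', ''h'', ''H'', ''k'', ''Add''}"
  "silent init_tables"
  by (auto simp: init_tables_def)

lemma writes_prepare_fft: "nwr prepare_fft = {''Len'', ''i'', ''n'', ''st'', ''r'', ''half'', ''k'', ''q''}"
  "cwr prepare_fft = {''X'', ''w'', ''x'', ''y'', ''Y'', ''F''}" "silent prepare_fft"
  by (auto simp: prepare_fft_def forward_fft_def nwr_fft)

context machine
begin

lemma run_fast_cbc:
  fixes \<gamma> :: "nat \<Rightarrow> real" and s \<alpha> d :: nat
  assumes \<alpha>: "2 \<le> \<alpha>" and d: "1 \<le> d" and s: "1 \<le> s" and \<gamma>: "\<forall>j\<in>{1..s}. \<gamma> j \<ge> 0"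
  defines "\<sigma> \<equiv> start b m s \<alpha> d \<gamma>"
  defines "p \<equiv> np (results (run fast_cbc \<sigma>) ! 0)" and "q \<equiv> \<lambda>j. np (results (run fast_cbc \<sigma>) ! j)"
  shows "length (results (run fast_cbc \<sigma>)) = d * s + 1" "cbc_result m s \<alpha> d (product_weights \<gamma>) p q"
    "fast_choice m s \<alpha> d \<gamma> p q" "ok K fast_cbc \<sigma> (20000 * (b * b * \<alpha> * (d * s * m * N)))"
proof -
  define \<sigma>1 where "\<sigma>1 = run init_tables \<sigma>"
  define \<sigma>2 where "\<sigma>2 = run find_p \<sigma>1"
  define \<sigma>3 where "\<sigma>3 = run (Out (nv ''p'')) \<sigma>2"
  define \<sigma>4 where "\<sigma>4 = run find_g \<sigma>3"
  define \<sigma>5 where "\<sigma>5 = run comp_D \<sigma>4"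
  define \<sigma>6 where "\<sigma>6 = run comp_omega \<sigma>5"
  define \<sigma>7 where "\<sigma>7 = run prepare_fft \<sigma>6"
  have run_eq: "run fast_cbc \<sigma> = run main_loop \<sigma>7"
    by (simp only: fast_cbc_def run.simps(4) \<sigma>1_def \<sigma>2_def \<sigma>3_def \<sigma>4_def \<sigma>5_def \<sigma>6_def \<sigma>7_def)
  have v0: "nmem \<sigma> ''b'' 0 = b" "nmem \<sigma> ''m'' 0 = m" "nmem \<sigma> ''s'' 0 = s" "nmem \<sigma> ''alpha'' 0 = \<alpha>" "nmem \<sigma> ''d'' 0 = d"
    "nmem \<sigma> ''Mark'' = (\<lambda>_. 0)" "nmem \<sigma> ''Seen'' = (\<lambda>_. 0)" "weights \<sigma> = \<gamma>" "results \<sigma> = []"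
    by (simp_all add: \<sigma>_def start_def fun_eq_iff)
  note I = run_init_tables[OF v0(1,2), folded \<sigma>1_def]
  have n1: "nmem \<sigma>1 y = nmem \<sigma> y" if "y \<notin> nwr init_tables" for y unfolding \<sigma>1_def using that by (rule nmem_run)
  have "nmem \<sigma>1 ''Mark'' = (\<lambda>_. 0)" using n1[of "''Mark''"] v0(6) by (simp add: nwr_init_tables)
  note FP = run_find_p[OF I(1) this, folded \<sigma>2_def]
  obtain P :: "'b mod_ring poly" where P: "Factorial_Ring.irreducible P" "Polynomial.degree P = m" "lead_coeff P = 1"
      "nmem \<sigma>2 ''p'' 0 = enc P" "\<forall>c<b. nmem \<sigma>2 ''P'' c = enc (np c * P)"
    using FP(1) by blast
  interpret mm: machine_mod ty b m h H N M K P by unfold_locales (rule P)+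
  have n2: "nmem \<sigma>2 y = nmem \<sigma>1 y" if "y \<notin> nwr find_p" for y unfolding \<sigma>2_def using that by (rule nmem_run)
  have t2: "tables \<sigma>2" unfolding \<sigma>2_def by (rule tables_run[OF I(1)]) (simp add: nwr_find_p)
  have n3: "nmem \<sigma>3 = nmem \<sigma>2" "cmem \<sigma>3 = cmem \<sigma>2" by (simp_all add: \<sigma>3_def tick_def)
  have t3: "tables \<sigma>3" by (rule tables_cong[OF t2]) (simp add: n3)
  have pt: "mm.ptab \<sigma>3" unfolding mm.ptab_def n3 by (rule P(5))
  have "nmem \<sigma>3 ''Seen'' = (\<lambda>_. 0)"
    using n1[of "''Seen''"] n2[of "''Seen''"] v0(7) by (simp add: n3 nwr_init_tables nwr_find_p)
  note FG = mm.run_find_g[OF t3 pt this, folded \<sigma>4_def]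
  obtain g where g: "g \<in> R_set m" "mm.Q.ord_of g = M" "\<forall>i<M. nmem \<sigma>4 ''G'' i = enc (g ^ i mod P)"
    using FG(1) by blast
  have n4: "nmem \<sigma>4 y = nmem \<sigma>3 y" if "y \<notin> nwr find_g" for y unfolding \<sigma>4_def using that by (rule nmem_run)
  have t4: "tables \<sigma>4" unfolding \<sigma>4_def by (rule tables_run[OF t3]) (simp add: mm.nwr_find_g)
  have v4: "nmem \<sigma>4 y = nmem \<sigma> y" if "y \<in> {''alpha'', ''d'', ''s''}" for y
    using that n1[of y] n2[of y] n4[of y] by (auto simp: n3 nwr_init_tables nwr_find_p mm.nwr_find_g)
  have v4': "nmem \<sigma>4 ''b'' 0 = b" "nmem \<sigma>4 ''alpha'' 0 = \<alpha>" "nmem \<sigma>4 ''d'' 0 = d"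
    using tablesD(1)[OF t4] v4 v0 by simp_all
  note CD = run_comp_D[OF b2 \<alpha> K_bounds(3) v4', folded \<sigma>5_def]
  have n5: "nmem \<sigma>5 y = nmem \<sigma>4 y" if "y \<notin> {''k'', ''tmp''}" for y
    unfolding \<sigma>5_def by (rule nmem_run) (use that in \<open>simp add: writes_comp_D\<close>)
  have t5: "tables \<sigma>5" unfolding \<sigma>5_def by (rule tables_run[OF t4]) (simp add: writes_comp_D)
  have CO: "(\<forall>i<M. cmem \<sigma>6 ''om'' i = of_real (mm.omega \<alpha> d g i)) \<and> ok K comp_omega \<sigma>5 (200 + 40 * \<alpha> + 200 * N)"
    unfolding \<sigma>6_def by (rule mm.run_comp_omega[OF t5 _ _ CD(2) _ d g(1)]) (use n5 v4 v0 g(3) \<alpha> in simp_all)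
  have n6: "nmem \<sigma>6 y = nmem \<sigma>5 y" if "y \<notin> nwr comp_omega" for y unfolding \<sigma>6_def using that by (rule nmem_run)
  have c6: "cmem \<sigma>6 ''Dt'' = cmem \<sigma>5 ''Dt''" unfolding \<sigma>6_def by (rule cmem_run) (simp add: writes_comp_omega)
  have M6: "nmem \<sigma>6 ''M'' 0 = M" using n6[of "''M''"] tablesD(4)[OF t5] by (simp add: writes_comp_omega)
  note PF = run_prepare_fft[OF M6 conjunct1[OF CO], folded \<sigma>7_def]
  obtain t where t: "fft_ready (mm.omega \<alpha> d g) t \<sigma>7" using PF by blast
  interpret cn: construction ty b m h H N M K P g \<alpha> s d \<gamma> t
    by unfold_locales (use g \<alpha> d in simp_all)
  have n7: "nmem \<sigma>7 y = nmem \<sigma>6 y" if "y \<notin> nwr prepare_fft" for y unfolding \<sigma>7_def using that by (rule nmem_run)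
  have c7: "cmem \<sigma>7 y = cmem \<sigma>6 y" if "y \<notin> cwr prepare_fft" for y unfolding \<sigma>7_def using that by (rule cmem_run)
  have "cn.env \<sigma>7"
    unfolding cn.env_def
  proof (intro conjI)
    show "nmem \<sigma>7 ''M'' 0 = M" using n7[of "''M''"] M6 by (simp add: writes_prepare_fft)
    have *: "nmem \<sigma>7 y = nmem \<sigma>4 y" if "y \<in> {''d'', ''s'', ''G''}" for y
      using n7[of y] n6[of y] n5[of y] that by (auto simp: writes_prepare_fft writes_comp_omega)
    show "nmem \<sigma>7 ''d'' 0 = d" "nmem \<sigma>7 ''s'' 0 = s" "\<forall>i<M. nmem \<sigma>7 ''G'' i = enc (g ^ i mod P)"
      using * v4 v0 g(3) by simp_all
    show "\<forall>i<M. cmem \<sigma>7 ''om'' i = complex_of_real (mm.omega \<alpha> d g i)"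
      using CO c7[of "''om''"] by (simp add: writes_prepare_fft)
    show "fft_ready (mm.omega \<alpha> d g) t \<sigma>7" by (rule t)
    show "cmem \<sigma>7 ''Dt'' 0 = complex_of_real (D_tilde b \<alpha> d)"
      using c7[of "''Dt''"] c6 CD(1) by (simp add: writes_prepare_fft)
    show "weights \<sigma>7 = \<gamma>"
      by (simp only: \<sigma>7_def \<sigma>6_def \<sigma>5_def \<sigma>4_def \<sigma>3_def \<sigma>2_def \<sigma>1_def weights_run v0(8))
  qed
  moreover have "results \<sigma>7 = [enc P]"
  proof -
    have "results \<sigma>7 = results \<sigma>3" unfolding \<sigma>7_def \<sigma>6_def \<sigma>5_def \<sigma>4_def
      by (simp only: results_run writes_prepare_fft writes_comp_omega writes_comp_D mm.nwr_find_g)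
    moreover have "results \<sigma>2 = results \<sigma>" unfolding \<sigma>2_def \<sigma>1_def
      by (simp only: results_run nwr_find_p nwr_init_tables)
    ultimately show ?thesis using P(4) v0(9) by (simp add: \<sigma>3_def tick_def)
  qed
  ultimately have main: "(\<exists>rs. results (run main_loop \<sigma>7) = enc P # rs \<and> length rs = d * s \<and> cn.good rs)
      \<and> ok K main_loop \<sigma>7 (6300 * (s * (d * (b * m * N))))"
    using s by (rule cn.run_main_loop)
  then obtain rs where rs: "results (run fast_cbc \<sigma>) = enc P # rs" "length rs = d * s" "cn.good rs"
    unfolding run_eq by blast
  have pP: "p = P" and qf: "q = cn.qf rs" by (simp_all add: p_def q_def rs(1) cn.qf_def fun_eq_iff)
  note fc = cn.good_fast_choice[OF rs(3,2) s]
  show "length (results (run fast_cbc \<sigma>)) = d * s + 1" by (simp add: rs)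
  show "cbc_result m s \<alpha> d (product_weights \<gamma>) p q"
    unfolding pP qf by (rule mm.Q.cbc_result_if_fast[OF g(1,2) cn.\<alpha> d \<gamma> fc])
  show "fast_choice m s \<alpha> d \<gamma> p q"
    unfolding pP qf fast_choice_def mm.Q.M_def[symmetric]
    by (rule exI[of _ g]) (use mm.Q.primitive_mod_iff[OF g(1,2)] fc(2) in blast)
  define Y where "Y = b * b * \<alpha> * (d * s * m * N)"
  have pos: "1 \<le> b" "1 \<le> \<alpha>" "1 \<le> d" "1 \<le> s" "1 \<le> m" "1 \<le> N" using b_pos \<alpha> d s m N_bounds(1) by simp_all
  \<comment> \<open>Each phase contributes a product of some of the factors of \<open>Y\<close>, so
    it is bounded by exhibiting the positive cofactor that is missing.\<close>
  have le: "x \<le> Y" if "x * z = Y" "0 < z" for x z :: nat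
    using that by (metis One_nat_def Suc_leI mult_le_mono2 mult.right_neutral)
  have "ok K fast_cbc \<sigma> ((100 + 20 * m + 70 * (H * H)) + (400 * (m * (b * (b * N))) + ((1 + ncost (nv ''p''))
      + (3000 * (m * (b * (b * N))) + ((300 + 150 * \<alpha> + 10 * ((2 * d - 1) * \<alpha>)) + ((200 + 40 * \<alpha> + 200 * N)
      + (3000 * (b * m * N) + 6300 * (s * (d * (b * m * N))))))))))"
    unfolding fast_cbc_def
    by (intro ok_Seq ok_Out)
      (use I(2) FP(2) FG(2) CD(3) CO PF main in \<open>simp_all only: \<sigma>7_def \<sigma>6_def \<sigma>5_def \<sigma>4_def \<sigma>3_def \<sigma>2_def \<sigma>1_def\<close>)
  moreover have "m \<le> Y" by (rule le[of _ "b * b * \<alpha> * (d * s * N)"]) (use pos in \<open>simp_all add: Y_def mult_ac\<close>)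
  moreover have bbN: "b * (b * N) \<le> Y" by (rule le[of _ "\<alpha> * (d * s * m)"]) (use pos in \<open>simp_all add: Y_def mult_ac\<close>)
  moreover have "H * H \<le> Y" using HH_le bbN unfolding b_pow_m2 by linarith
  moreover have "m * (b * (b * N)) \<le> Y" by (rule le[of _ "\<alpha> * (d * s)"]) (use pos in \<open>simp_all add: Y_def mult_ac\<close>)
  moreover have "\<alpha> \<le> Y" by (rule le[of _ "b * b * (d * s * m * N)"]) (use pos in \<open>simp_all add: Y_def mult_ac\<close>)
  moreover have "d * \<alpha> \<le> Y" by (rule le[of _ "b * b * (s * m * N)"]) (use pos in \<open>simp_all add: Y_def mult_ac\<close>)
  moreover have "(2 * d - 1) * \<alpha> \<le> 2 * (d * \<alpha>)" by (simp add: diff_mult_distrib)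
  moreover have "N \<le> Y" by (rule le[of _ "b * b * \<alpha> * (d * s * m)"]) (use pos in \<open>simp_all add: Y_def mult_ac\<close>)
  moreover have "b * m * N \<le> Y" by (rule le[of _ "b * \<alpha> * (d * s)"]) (use pos in \<open>simp_all add: Y_def mult_ac\<close>)
  moreover have "s * (d * (b * m * N)) \<le> Y" by (rule le[of _ "b * \<alpha>"]) (use pos in \<open>simp_all add: Y_def mult_ac\<close>)
  moreover have "ncost (nv ''p'') = 2" by simp
  ultimately show "ok K fast_cbc \<sigma> (20000 * (b * b * \<alpha> * (d * s * m * N)))"
    unfolding Y_def[symmetric] using pos by (elim ok_mono) linarith
qed

end

theorem mainTheorem4:
  fixes \<alpha> :: nat and b :: nat
  assumes "b = CARD('b::prime_card)" and "\<alpha> \<ge> 2"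
  shows "\<exists>C>0. \<forall>m s d :: nat. \<forall>\<gamma> :: nat \<Rightarrow> real.
    m \<ge> 1 \<longrightarrow> s \<ge> 1 \<longrightarrow> d \<ge> 1 \<longrightarrow> (\<forall>j\<in>{1..s}. \<gamma> j \<ge> 0) \<longrightarrow>
    (let N = b ^ m;
         \<sigma> = run fast_cbc (start b m s \<alpha> d \<gamma>);
         p = nat_poly (results \<sigma> ! 0) :: 'b mod_ring poly;
         q = (\<lambda>j. nat_poly (results \<sigma> ! j))
     in length (results \<sigma>) = d * s + 1 \<and>
        cbc_result m s \<alpha> d (product_weights \<gamma>) p q \<and>
        fast_choice m s \<alpha> d \<gamma> p q \<and>
        real (ticks \<sigma>) \<le> C * real (d * s * m * b ^ m) \<and>
        real (ticks \<sigma>) \<le> C * (real (d * s * N) * ln (real N)) \<and>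
        real (cells_used \<sigma>) \<le> C * real N)"
proof -
  have b2: "2 \<le> b" using assms(1) by simp
  define B where "B = 20000 * (b * b * \<alpha>)"
  \<comment> \<open>The number of array names times the quotient \<open>K/N = 4 * b * b\<close>. In
    \<open>C\<close> below, dividing by \<open>ln b\<close> converts the factor \<open>m\<close> of
    the time bound into \<open>ln N = m * ln b\<close>; all three summands depend on
    \<open>b\<close> and \<alpha> at most.\<close>
  define E where "E = (card (nwr fast_cbc) + card (cwr fast_cbc)) * (4 * b * b)"
  define C where "C = real B + real B / ln b + real E"
  have lnb: "0 < ln (real b)" using b2 by simp
  have B: "0 < real B" using b2 assms(2) by (simp add: B_def)
  have C: "real B \<le> C" "real B / ln b \<le> C" "real E \<le> C"
    using B lnb by (simp_all add: C_def)
  have "0 < C" using B C(1) by linarith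
  moreover
  have "length (results \<sigma>) = d * s + 1 \<and> cbc_result m s \<alpha> d (product_weights \<gamma>) p q \<and> fast_choice m s \<alpha> d \<gamma> p q
      \<and> real (ticks \<sigma>) \<le> C * real (d * s * m * b ^ m) \<and> real (ticks \<sigma>) \<le> C * (real (d * s * N) * ln (real N))
      \<and> real (cells_used \<sigma>) \<le> C * real N"
    if m: "m \<ge> 1" and s: "s \<ge> 1" and d: "d \<ge> 1" and \<gamma>: "\<forall>j\<in>{1..s}. \<gamma> j \<ge> 0"
      and N: "N = b ^ m" and \<sigma>: "\<sigma> = run fast_cbc (start b m s \<alpha> d \<gamma>)"
      and p: "p = (nat_poly (results \<sigma> ! 0) :: 'b mod_ring poly)" and q: "q = (\<lambda>j. nat_poly (results \<sigma> ! j))"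
    for m s d :: nat and \<gamma> :: "nat \<Rightarrow> real" and N \<sigma> p q
  proof -
    define K where "K = 4 * b ^ (m + 2)"
    interpret machine "TYPE('b)" b m "m div 2 + 1" "b ^ (m div 2 + 1)" N "N - 1" K
      by unfold_locales (use assms(1) m in \<open>simp_all add: N K_def\<close>)
    note R = run_fast_cbc[OF assms(2) d s \<gamma>, folded \<sigma>, folded p q]
    have R4: "ticks \<sigma> \<le> B * (d * s * m * N)" "nused \<sigma> \<subseteq> nwr fast_cbc \<times> {..<K}" "cused \<sigma> \<subseteq> cwr fast_cbc \<times> {..<K}"
      using R(4) unfolding ok_def \<sigma>[symmetric] by (simp_all add: start_def B_def mult.assoc)
    have T: "real (ticks \<sigma>) \<le> real B * real (d * s * m * N)"
      using R4(1) by (metis of_nat_le_iff of_nat_mult)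
    have "real B * real (d * s * m * N) \<le> C * real (d * s * m * N)"
      by (rule mult_right_mono[OF C(1)]) simp
    then have T1: "real (ticks \<sigma>) \<le> C * real (d * s * m * b ^ m)" using T unfolding N by linarith
    have "ln (real N) = real m * ln (real b)" using b2 by (simp add: N ln_realpow)
    then have "real B * real (d * s * m * N) = real B / ln b * (real (d * s * N) * ln (real N))"
      using lnb by simp
    also have "\<dots> \<le> C * (real (d * s * N) * ln (real N))"
      using N_bounds(1) by (intro mult_right_mono[OF C(2)]) simp
    finally have T2: "real (ticks \<sigma>) \<le> C * (real (d * s * N) * ln (real N))" using T by linarith
    have "card (nused \<sigma>) \<le> card (nwr fast_cbc) * K" "card (cused \<sigma>) \<le> card (cwr fast_cbc) * K"
      using card_mono[OF _ R4(2)] card_mono[OF _ R4(3)] by (simp_all add: finite_nwr finite_cwr card_cartesian_product)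
    then have "cells_used \<sigma> \<le> (card (nwr fast_cbc) + card (cwr fast_cbc)) * K"
      by (simp add: cells_used_def distrib_right)
    also have "\<dots> = E * N" by (simp add: E_def K_def N mult_ac)
    finally have "real (cells_used \<sigma>) \<le> real E * real N" by (metis of_nat_le_iff of_nat_mult)
    also have "\<dots> \<le> C * real N" by (rule mult_right_mono[OF C(3)]) simp
    finally show ?thesis using R(1-3) T1 T2 by simp
  qed
  ultimately show ?thesis unfolding Let_def by (intro exI[of _ C]) simp
qed

end
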